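(* Let $\alpha>0$, $\beta\ge 0$, $0<p\le 1$, $1\le s<\infty$ and $m>\alpha-1$. For a double indexed sequence of complex numbers $c=\{c_k^j : k\ge 0,\ 1\le j\le d_k\}$ the following conditions are equivalent: 1. $c\in M_H(B^{p,1}_\alpha, H^s_\beta)$. 2. The function $g(x)=\sum_{k\ge 0} r^k\sum_{j=1}^{d_k} c_k^j Y_j^{(k)}(x')$, $x=rx'$, is harmonic in $\mathbb B$ and $$N_s(g)=\sup_{0\le\rho<1}\ \sup_{y'\in\mathbb S}\ (1-\rho)^{m+1-\alpha+\beta}\left(\int_{\mathbb S}|\Lambda_{m+1}(g\ast P_{x'})(\rho y')|^s\,dx'\right)^{1/s}<\infty .$$
   Context: Let $n\ge 2$, let $\mathbb B$ be the open unit ball of $\mathbb R^n$, $\mathbb S=\partial\mathbb B$, and write $x=rx'$ with $r=|x|$, $x'\in\mathbb S$. $dx'$ is the rotation-invariant surface measure on $\mathbb S$ (fixed normalization). $h(\mathbb B)$ is the space of (complex-valued) harmonic functions on $\mathbb B$. For each $k\ge0$ let $Y^{(k)}_j$, $1\le j\le d_k$, be real-valued spherical harmonics of order $k$ ($d_k$ is the dimension of the space of spherical harmonics of order $k$), chosen so that the whole family $\{Y_j^{(k)}\}_{k\ge 0,\,1\le j\le d_k}$ is an orthonormal basis of $L^2(\mathbb S,dx')$; this basis is fixed. Every $f\in h(\mathbb B)$ has an expansion $f(rx')=\sum_{k\ge0} r^k\sum_{j=1}^{d_k} b_k^j(f)Y_j^{(k)}(x')$. For $y'\in\mathbb S$ the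 Poisson kernel is $P_{y'}(rx')=\sum_{k\ge0} r^k\sum_{j=1}^{d_k}Y_j^{(k)}(y')Y_j^{(k)}(x')$. For $f,g\in h(\mathbb B)$ the convolution is $(f\ast g)(rx')=\sum_{k\ge 0}\sum_{j=1}^{d_k} r^k b_k^j(f)b_k^j(g)Y_j^{(k)}(x')$, which is harmonic in $\mathbb B$. For a double indexed sequence $c$ and $f\in h(\mathbb B)$, $(c\ast f)(rx')=\sum_{k\ge 0}\sum_{j=1}^{d_k} r^k c_k^j b_k^j(f)Y_j^{(k)}(x')$, if the series converges in $\mathbb B$. For $t>0$ the fractional derivative of $f\in h(\mathbb B)$ of order $t$ is $$(\Lambda_t f)(rx')=\sum_{k\ge 0} r^k\frac{\Gamma(k+n/2+t)}{\Gamma(k+n/2)\Gamma(t)}\sum_{j=1}^{d_k}b_k^j(f)Y_j^{(k)}(x').$$ In $\Lambda_{m+1}(g\ast P_{x'})(\rho y')$ the operator acts on the harmonic function $g\ast P_{x'}$ ($x'$ fixed), and the result is evaluated at $\rho y'$. For subspaces $X,Y\subset h(\mathbb B)$, $M_H(X,Y)$ is the set of all double indexed sequences $c$ such that $c\ast f\in Y$ for every $f\in X$ (multipliers from $X$ to $Y$). $M_q(f,r)=\left(\int_{\mathbb S}|f(rx')|^q dx'\right)^{1/q}$ for $0<q<\infty$. For $0<p<\infty$, $\alpha>0$, $B^{p,1}_\alpha$ is the space of $f\in h(\mathbb B)$ with $\left(\int_0^1 M_1(f,r)^p(1-r^2)^{\alpha p-1}r^{n-1}dr\right)^{1/p}<\infty$.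 For $0<s<\infty$, $\beta\ge0$, $H^s_\beta$ is the space of $f\in h(\mathbb B)$ with $\sup_{0\le r<1}M_s(f,r)(1-r)^\beta<\infty$. *)

theory Defs
  imports "HOL-Analysis.Analysis" "HOL-Library.Function_Algebras"
begin

section \<open>Harmonic functions\<close>

text \<open>
  \<open>f\<close> is twice continuously differentiable on the open set \<open>S\<close> and its Laplacian vanishes there.
  \<open>D x\<close> is the derivative of \<open>f\<close> at \<open>x\<close>; \<open>D2 i x\<close> is the derivative at \<open>x\<close> of the \<open>i\<close>-th partial derivative.
\<close>
definition harmonic_on :: "('a::euclidean_space \<Rightarrow> 'b::real_normed_vector) \<Rightarrow> 'a set \<Rightarrow> bool" where
  "harmonic_on f S \<longleftrightarrow> open S \<and>
     (\<exists>D D2.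
        (\<forall>x\<in>S. (f has_derivative D x) (at x)) \<and>
        (\<forall>i\<in>Basis. \<forall>x\<in>S. ((\<lambda>y. D y i) has_derivative D2 i x) (at x)) \<and>
        (\<forall>i\<in>Basis. \<forall>j\<in>Basis. continuous_on S (\<lambda>x. D2 i x j)) \<and>
        (\<forall>x\<in>S. (\<Sum>i\<in>Basis. D2 i x i) = 0))"

text \<open>Only the values on the open unit ball are relevant; elements are not normalised outside it.\<close>
definition harmonic_ball :: "('a::euclidean_space \<Rightarrow> complex) set" where
  "harmonic_ball = {f. harmonic_on f (ball 0 1)}"


section \<open>Surface measure on the unit sphere\<close>

text \<open>
  \<open>\<sigma>(A) = n \<cdot> vol {t x | 0 < t < 1, x \<in> A}\<close>. This is the unnormalised surface measure; the theorem
  allows an arbitrary positive multiple of it.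
\<close>
definition surface_measure :: "'a::euclidean_space measure" where
  "surface_measure =
     scale_measure (of_nat DIM('a))
       (distr (restrict_space lborel (ball 0 1 - {0})) (restrict_space borel (sphere 0 1)) sgn)"

lemma space_surface_measure: "space (surface_measure :: 'a::euclidean_space measure) = sphere 0 1"
  by (simp add: surface_measure_def space_scale_measure space_restrict_space)

lemma emeasure_surface_measure:
  fixes A :: "'a::euclidean_space set"
  assumes "A \<in> sets (restrict_space borel (sphere 0 1))"
  shows "emeasure surface_measure A =
           of_nat DIM('a) * emeasure lborel {x \<in> ball 0 1 - {0}. sgn x \<in> A}"
proof -
  let ?B = "ball 0 1 - {0::'a}"
  have "(sgn :: 'a \<Rightarrow> 'a) \<in> borel_measurable lborel"
    unfolding sgn_div_norm[abs_def] by measurable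
  then have "(sgn :: 'a \<Rightarrow> 'a) \<in> borel_measurable (restrict_space lborel ?B)"
    by (rule measurable_restrict_space1)
  then have m: "(sgn :: 'a \<Rightarrow> 'a) \<in> measurable (restrict_space lborel ?B) (restrict_space borel (sphere 0 1))"
    by (intro measurable_restrict_space2) (auto simp: space_restrict_space norm_sgn)
  have "sgn -` A \<inter> space (restrict_space lborel ?B) = {x \<in> ?B. sgn x \<in> A}"
    by (auto simp: space_restrict_space)
  then show ?thesis
    unfolding surface_measure_def emeasure_scale_measure emeasure_distr[OF m assms]
    by (subst emeasure_restrict_space) auto
qed


section \<open>Spherical harmonics\<close>

text \<open>Functions on the sphere are represented by functions on the whole space that vanish off it.\<close>
definition spherical_harmonics :: "nat \<Rightarrow> ('a::euclidean_space \<Rightarrow> real) set" where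
  "spherical_harmonics k =
     {(\<lambda>x. if x \<in> sphere 0 1 then q x else 0) | q.
        real_polynomial_function q \<and> (\<forall>t x. q (t *\<^sub>R x) = t ^ k * q x) \<and> harmonic_on q UNIV}"

interpretation real_fun: vector_space "\<lambda>(c::real) (f :: 'a \<Rightarrow> real) x. c * f x"
  by standard (auto simp: algebra_simps)

definition sph_dim :: "'a::euclidean_space itself \<Rightarrow> nat \<Rightarrow> nat" where
  "sph_dim _ k = real_fun.dim (spherical_harmonics k :: ('a \<Rightarrow> real) set)"

text \<open>
  The last conjunct says that the linear span of the family is dense in the complex space
  \<open>L\<^sup>2(\<sigma>)\<close>.
\<close>
definition spherical_harmonic_basis ::
  "'a::euclidean_space measure \<Rightarrow> (nat \<Rightarrow> nat \<Rightarrow> 'a \<Rightarrow> real) \<Rightarrow> bool" where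
  "spherical_harmonic_basis \<sigma> Y \<longleftrightarrow>
     (\<forall>k. \<forall>j\<in>{1..sph_dim TYPE('a) k}. Y k j \<in> spherical_harmonics k) \<and>
     (\<forall>k. \<forall>j\<in>{1..sph_dim TYPE('a) k}. \<forall>l. \<forall>i\<in>{1..sph_dim TYPE('a) l}.
        integrable \<sigma> (\<lambda>x. Y k j x * Y l i x) \<and>
        (\<integral>x. Y k j x * Y l i x \<partial>\<sigma>) = (if k = l \<and> j = i then 1 else 0)) \<and>
     (\<forall>f :: 'a \<Rightarrow> complex.
        f \<in> borel_measurable \<sigma> \<and> integrable \<sigma> (\<lambda>x. (cmod (f x))\<^sup>2) \<longrightarrow>
        (\<forall>\<epsilon>>0. \<exists>K a.
           (\<integral>\<^sup>+x. ennreal ((cmod (f x - (\<Sum>k\<le>K. \<Sum>j=1..sph_dim TYPE('a) k.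
              a k j * of_real (Y k j x))))\<^sup>2) \<partial>\<sigma>) < ennreal \<epsilon>))"


section \<open>Expansions in spherical harmonics\<close>

text \<open>
  The point \<open>x'\<close> in \<open>x = r x'\<close>. At the origin the choice is immaterial: \<open>r ^ k = 0\<close> for \<open>k > 0\<close>
  and spherical harmonics of order 0 are constant on the sphere.
\<close>
definition direction :: "'a::euclidean_space \<Rightarrow> 'a" where
  "direction x = (if x = 0 then SOME e. e \<in> sphere 0 1 else sgn x)"

definition sph_term ::
  "(nat \<Rightarrow> nat \<Rightarrow> 'a::euclidean_space \<Rightarrow> real) \<Rightarrow> (nat \<Rightarrow> nat \<Rightarrow> complex) \<Rightarrow> 'a \<Rightarrow> nat \<Rightarrow> complex" where
  "sph_term Y a x k =
     of_real (norm x ^ k) * (\<Sum>j=1..sph_dim TYPE('a) k. a k j * of_real (Y k j (direction x)))"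

definition sph_series ::
  "(nat \<Rightarrow> nat \<Rightarrow> 'a::euclidean_space \<Rightarrow> real) \<Rightarrow> (nat \<Rightarrow> nat \<Rightarrow> complex) \<Rightarrow> 'a \<Rightarrow> complex" where
  "sph_series Y a x = (\<Sum>k. sph_term Y a x k)"

definition sph_convergent ::
  "(nat \<Rightarrow> nat \<Rightarrow> 'a::euclidean_space \<Rightarrow> real) \<Rightarrow> (nat \<Rightarrow> nat \<Rightarrow> complex) \<Rightarrow> bool" where
  "sph_convergent Y a \<longleftrightarrow> (\<forall>x\<in>ball 0 1. summable (sph_term Y a x))"

text \<open>
  The coefficients \<open>b\<^sub>k\<^sup>j(f)\<close>; they are set to 0 outside the index range \<open>1 \<le> j \<le> d\<^sub>k\<close> so that the
  expansion determines them.
\<close>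
definition sph_coeff ::
  "(nat \<Rightarrow> nat \<Rightarrow> 'a::euclidean_space \<Rightarrow> real) \<Rightarrow> ('a \<Rightarrow> complex) \<Rightarrow> nat \<Rightarrow> nat \<Rightarrow> complex" where
  "sph_coeff Y f =
     (THE b. (\<forall>k j. j \<notin> {1..sph_dim TYPE('a) k} \<longrightarrow> b k j = 0) \<and>
             (\<forall>x\<in>ball 0 1. sph_term Y b x sums f x))"

definition poisson_kernel ::
  "(nat \<Rightarrow> nat \<Rightarrow> 'a::euclidean_space \<Rightarrow> real) \<Rightarrow> 'a \<Rightarrow> 'a \<Rightarrow> complex" where
  "poisson_kernel Y y = sph_series Y (\<lambda>k j. of_real (Y k j y))"

definition harm_conv ::
  "(nat \<Rightarrow> nat \<Rightarrow> 'a::euclidean_space \<Rightarrow> real) \<Rightarrow> ('a \<Rightarrow> complex) \<Rightarrow> ('a \<Rightarrow> complex) \<Rightarrow> 'a \<Rightarrow> complex" where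
  "harm_conv Y f g = sph_series Y (\<lambda>k j. sph_coeff Y f k j * sph_coeff Y g k j)"

definition frac_deriv ::
  "(nat \<Rightarrow> nat \<Rightarrow> 'a::euclidean_space \<Rightarrow> real) \<Rightarrow> real \<Rightarrow> ('a \<Rightarrow> complex) \<Rightarrow> 'a \<Rightarrow> complex" where
  "frac_deriv Y t f =
     sph_series Y (\<lambda>k j.
       of_real (Gamma (real k + real DIM('a) / 2 + t) / (Gamma (real k + real DIM('a) / 2) * Gamma t))
         * sph_coeff Y f k j)"

text \<open>Values \<open>c k j\<close> with \<open>j\<close> outside \<open>{1..d\<^sub>k}\<close> are irrelevant.\<close>
definition multipliers ::
  "(nat \<Rightarrow> nat \<Rightarrow> 'a::euclidean_space \<Rightarrow> real) \<Rightarrow> ('a \<Rightarrow> complex) set \<Rightarrow> ('a \<Rightarrow> complex) set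
     \<Rightarrow> (nat \<Rightarrow> nat \<Rightarrow> complex) set" where
  "multipliers Y V W =
     {c. \<forall>f\<in>V. sph_convergent Y (\<lambda>k j. c k j * sph_coeff Y f k j) \<and>
               sph_series Y (\<lambda>k j. c k j * sph_coeff Y f k j) \<in> W}"


section \<open>Integral means and function spaces\<close>

text \<open>Positive real powers of extended nonnegative reals.\<close>
definition ennpow :: "ennreal \<Rightarrow> real \<Rightarrow> ennreal" where
  "ennpow x a = (if x = \<infinity> then \<infinity> else ennreal (enn2real x powr a))"

definition lq_norm :: "'a measure \<Rightarrow> real \<Rightarrow> ('a \<Rightarrow> complex) \<Rightarrow> ennreal" where
  "lq_norm \<sigma> q u = ennpow (\<integral>\<^sup>+x. ennreal (cmod (u x) powr q) \<partial>\<sigma>) (1 / q)"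

definition integral_mean ::
  "'a::euclidean_space measure \<Rightarrow> real \<Rightarrow> ('a \<Rightarrow> complex) \<Rightarrow> real \<Rightarrow> ennreal" where
  "integral_mean \<sigma> q f r = lq_norm \<sigma> q (\<lambda>x. f (r *\<^sub>R x))"

definition B1_space :: "'a::euclidean_space measure \<Rightarrow> real \<Rightarrow> real \<Rightarrow> ('a \<Rightarrow> complex) set" where
  "B1_space \<sigma> p \<alpha> =
     {f \<in> harmonic_ball.
        ennpow (\<integral>\<^sup>+r\<in>{0<..<1}. ennpow (integral_mean \<sigma> 1 f r) p *
                 ennreal ((1 - r\<^sup>2) powr (\<alpha> * p - 1) * r ^ (DIM('a) - 1)) \<partial>lborel) (1 / p) < \<infinity>}"

definition H_space :: "'a::euclidean_space measure \<Rightarrow> real \<Rightarrow> real \<Rightarrow> ('a \<Rightarrow> complex) set" where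
  "H_space \<sigma> s \<beta> =
     {f \<in> harmonic_ball.
        (SUP r\<in>{0..<1}. integral_mean \<sigma> s f r * ennreal ((1 - r) powr \<beta>)) < \<infinity>}"

definition N_norm ::
  "'a::euclidean_space measure \<Rightarrow> (nat \<Rightarrow> nat \<Rightarrow> 'a \<Rightarrow> real) \<Rightarrow> real \<Rightarrow> real \<Rightarrow> real \<Rightarrow> real
     \<Rightarrow> ('a \<Rightarrow> complex) \<Rightarrow> ennreal" where
  "N_norm \<sigma> Y \<alpha> \<beta> m s g =
     (SUP \<rho>\<in>{0..<1}. SUP y\<in>sphere 0 1.
        ennreal ((1 - \<rho>) powr (m + 1 - \<alpha> + \<beta>)) *
        lq_norm \<sigma> s (\<lambda>x. frac_deriv Y (m + 1) (harm_conv Y g (poisson_kernel Y x)) (\<rho> *\<^sub>R y)))"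

end

theory Submission
  imports Defs
begin

text \<open>
  A coefficient family of subexponential growth defines a harmonic function \<open>F a\<close> on the ball, and conversely: a harmonic
  function agrees with the series of its moments because its Poisson integrals do.
  Write \<open>K(u, x, y)\<close> for the kernel \<open>\<Lambda>\<^sub>t (g * P\<^sub>x)(u y)\<close> with \<open>t = m + 1\<close>. The Gamma quotient in \<open>\<Lambda>\<^sub>t\<close> is the reciprocal of
  a Beta value, so \<open>(c * f)(\<rho> x)\<close> is the integral over \<open>\<tau>\<close> of
  \<open>\<tau>\<close> to the power \<open>n/2 - 1\<close> times \<open>1 - \<tau>\<close> to the power \<open>t - 1\<close> times the spherical convolution of
  \<open>K(\<surd>(\<rho> \<tau>), x, y)\<close> with \<open>f(\<surd>(\<rho> \<tau>) y)\<close>. Minkowski's inequality together with the pointwise bound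
  \<open>M\<^sub>1(f, r) \<le> C (1 - r)\<close> to the power \<open>-\<alpha>\<close>, which reduces exponents \<open>p \<le> 1\<close> to \<open>p = 1\<close>, gives sufficiency.
  For necessity the multiplier is bounded by a gliding hump argument and is then tested on dilated fractional derivatives
  of the Poisson kernel, whose \<open>L\<^sup>1\<close> means at radius \<open>r\<close> are of order \<open>1 - r\<close> to the power \<open>-t\<close>.
\<close>

section \<open>Surface measure and polar coordinates\<close>

text \<open>The proof takes from the basis only homogeneity, harmonicity, orthonormality and density
  in L2, so the size of the sup norms and of the dimensions has to be produced: Bessel's inequality
  for the explicit Poisson kernel shows that both grow more slowly than every geometric sequence of
  ratio above 1. The resulting class of coefficient families is closed under products, so
  convolutions and multipliers are handled as families, with convergence automatic. Radii are split
  by square roots throughout: spherical convolution multiplies radii, and placing both factors at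
  the same radius costs only a constant, because 1 - r \<le> 2 (1 - sqrt r). Two obstacles shape
  necessity. A multiplier is an arbitrary family, so its own growth has to be established before any
  kernel can be formed. And for p < 1 the domain is only quasi-normed; what rescues uniform
  boundedness is that the p-th power of the quasi-norm is countably subadditive, which keeps
  p-summable combinations of unit ball elements under control.\<close>

lemma direction_in_sphere [simp]: "direction (x :: 'a::euclidean_space) \<in> sphere 0 1"
proof -
  have "\<exists>e::'a. e \<in> sphere 0 1"
    using norm_Basis SOME_Basis by (auto intro!: exI[of _ "SOME b. b \<in> Basis"])
  then have "(SOME e::'a. e \<in> sphere 0 1) \<in> sphere 0 1" by (rule someI_ex)
  then show ?thesis by (auto simp: direction_def norm_sgn)
qed

lemma norm_direction [simp]: "norm (direction x) = 1"
  using direction_in_sphere[of x] by simp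

lemma scaleR_norm_direction [simp]: "norm x *\<^sub>R direction x = x"
  by (auto simp: direction_def sgn_div_norm)

lemma borel_measurable_direction [measurable]:
  "direction \<in> borel_measurable (borel :: 'a::euclidean_space measure)"
  unfolding direction_def[abs_def] sgn_div_norm by measurable

lemma emeasure_lborel_scale:
  fixes A :: "'a::euclidean_space set"
  assumes "A \<in> sets borel" "b > 0"
  shows "emeasure lborel A = ennreal (b ^ DIM('a)) * emeasure lborel {x. b *\<^sub>R x \<in> A}"
proof -
  have "emeasure lborel A = emeasure (density (distr lborel borel (\<lambda>x::'a. 0 + b *\<^sub>R x)) (\<lambda>_. ennreal (\<bar>b\<bar>^DIM('a)))) A"
    by (subst lborel_affine[of b 0]) (use assms in auto)
  also have "\<dots> = ennreal (b ^ DIM('a)) * emeasure lborel {x. b *\<^sub>R x \<in> A}"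
    using assms by (subst emeasure_density_const) (auto simp: emeasure_distr vimage_def)
  finally show ?thesis .
qed

lemma null_sets_sphere: "sphere (c :: 'a::euclidean_space) r \<in> null_sets lborel"
  using negligible_sphere[of c r] by (auto simp: null_sets_completion_iff negligible_iff_null_sets)

section \<open>Polar coordinates for positive multiples of the surface measure\<close>

locale sphere_measure =
  fixes \<sigma> :: "'a::euclidean_space measure" and \<kappa> :: real
  assumes kappa_pos: "\<kappa> > 0" and sigma_eq: "\<sigma> = scale_measure (ennreal \<kappa>) surface_measure"
begin

abbreviation "S \<equiv> sphere (0::'a) 1"

lemma space_sigma [simp]: "space \<sigma> = S"
  by (simp add: sigma_eq space_scale_measure space_surface_measure)

lemma sets_sigma [measurable_cong]: "sets \<sigma> = sets (restrict_space borel S)"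
  by (simp add: sigma_eq surface_measure_def)

lemma emeasure_sigma:
  assumes "A \<in> sets \<sigma>"
  shows "emeasure \<sigma> A = ennreal (\<kappa> * DIM('a)) * emeasure lborel {x \<in> ball 0 1 - {0}. sgn x \<in> A}"
  using assms kappa_pos
  by (simp add: sigma_eq emeasure_surface_measure[OF assms[unfolded sets_sigma]] ennreal_mult'
      ennreal_of_nat_eq_real_of_nat mult.assoc)

lemma sets_cone [measurable]:
  assumes "A \<in> sets \<sigma>"
  shows "{x \<in> ball 0 b - {0}. sgn x \<in> A} \<in> sets borel" "{x. direction x \<in> A} \<in> sets borel"
proof -
  have A: "A \<in> sets borel" "A \<subseteq> S"
    using assms by (auto simp: sets_sigma sets_restrict_space_iff)
  have "(sgn :: 'a \<Rightarrow> 'a) \<in> borel_measurable borel"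
    unfolding sgn_div_norm[abs_def] by measurable
  then show "{x \<in> ball 0 b - {0}. sgn x \<in> A} \<in> sets borel"
    using A(1) by measurable
  show "{x. direction x \<in> A} \<in> sets borel"
    using A(1) by measurable
qed

lemma direction_measurable_sigma [measurable]: "direction \<in> measurable borel \<sigma>"
  by (subst measurable_cong_sets[OF refl sets_sigma])
     (rule measurable_restrict_space2, auto intro: borel_measurable_direction simp del: mem_sphere)

lemma emeasure_lborel_ball_finite: "emeasure lborel (ball (0::'a) b) < \<infinity>"
  by (rule emeasure_bounded_finite) auto

lemma emeasure_cone_finite:  "emeasure lborel {x \<in> ball 0 b - {0}. sgn x \<in> (A::'a set)} < \<infinity>"
  by (rule order.strict_trans1[OF emeasure_mono emeasure_lborel_ball_finite]) auto

sublocale finite_measure \<sigma>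
proof
  have "S \<in> sets \<sigma>"
    using sets.top[of \<sigma>] by simp
  then show "emeasure \<sigma> (space \<sigma>) \<noteq> \<infinity>"
    using emeasure_cone_finite[of 1 "space \<sigma>"]
    by (subst emeasure_sigma) (auto simp: ennreal_mult_eq_top_iff)
qed

lemma emeasure_cone:
  assumes "B \<in> sets \<sigma>" "b > 0"
  shows "emeasure lborel {x \<in> ball 0 b - {0}. sgn x \<in> B}
      = ennreal (b ^ DIM('a)) * emeasure lborel {x \<in> ball 0 1 - {0}. sgn x \<in> B}"
proof -
  have "{x. b *\<^sub>R x \<in> {x \<in> ball 0 b - {0}. sgn x \<in> B}} = {x \<in> ball 0 1 - {0}. sgn x \<in> B}"
    using assms by (auto simp: sgn_scaleR)
  then show ?thesis
    by (subst emeasure_lborel_scale[OF sets_cone(1)[OF assms(1)] assms(2)]) simp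
qed

text \<open>Lebesgue measure on the punctured ball, scaled by \<kappa> and written in polar
  coordinates. \<open>direction\<close> replaces \<open>sgn\<close> because the map has to land in
  the sphere even at the origin in order to be measurable into
  \<open>borel \<Otimes>\<^sub>M \<sigma>\<close>.\<close>

definition cone_measure :: "(real \<times> 'a) measure" where
  "cone_measure = distr (density lborel (\<lambda>x. ennreal \<kappa> * indicator (ball 0 1 - {0}) x)) (borel \<Otimes>\<^sub>M \<sigma>)
      (\<lambda>x. (norm x, direction x))"

lemma measurable_cone_map [measurable]: "(\<lambda>x. (norm x, direction x)) \<in> measurable borel (borel \<Otimes>\<^sub>M \<sigma>)"
  by measurable

lemma emeasure_cone_measure:
  assumes "A \<in> sets borel" "B \<in> sets \<sigma>"
  shows "emeasure cone_measure (A \<times> B)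
     = ennreal \<kappa> * emeasure lborel {x \<in> ball 0 1 - {0}. norm x \<in> A \<and> sgn x \<in> B}"
proof -
  have AB: "A \<times> B \<in> sets (borel \<Otimes>\<^sub>M \<sigma>)" using assms by auto
  have m: "(\<lambda>x. (norm x, direction x)) \<in> measurable lborel (borel \<Otimes>\<^sub>M \<sigma>)"
    by measurable
  have s: "(\<lambda>x. (norm x, direction x)) -` (A \<times> B) \<in> sets (lborel :: 'a measure)"
    using measurable_sets[OF m AB] by simp
  have "emeasure cone_measure (A \<times> B) = (\<integral>\<^sup>+x. ennreal \<kappa> * indicator {x \<in> ball 0 1 - {0}. norm x \<in> A \<and> sgn x \<in> B} x \<partial>lborel)"
  proof -
    have o [measurable]: "(ball 0 1 - {0} :: 'a set) \<in> sets borel" by (intro borel_open open_Diff) auto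
    have "emeasure cone_measure (A \<times> B) = emeasure (density lborel (\<lambda>x. ennreal \<kappa> * indicator (ball 0 1 - {0}) x))
        ((\<lambda>x. (norm x, direction x)) -` (A \<times> B) \<inter> UNIV)"
      unfolding cone_measure_def by (subst emeasure_distr[OF _ AB]) (use m in \<open>auto simp: space_density\<close>)
    also have "\<dots> = (\<integral>\<^sup>+x. (ennreal \<kappa> * indicator (ball 0 1 - {0}) x) * indicator ((\<lambda>x. (norm x, direction x)) -` (A \<times> B) \<inter> UNIV) x \<partial>lborel)"
      by (rule emeasure_density) (measurable, use s in auto)
    also have "\<dots> = (\<integral>\<^sup>+x. ennreal \<kappa> * indicator {x \<in> ball 0 1 - {0}. norm x \<in> A \<and> sgn x \<in> B} x \<partial>lborel)"
      by (intro nn_integral_cong) (auto simp: indicator_def direction_def)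
    finally show ?thesis .
  qed
  also have "\<dots> = ennreal \<kappa> * emeasure lborel {x \<in> ball 0 1 - {0}. norm x \<in> A \<and> sgn x \<in> B}"
  proof -
    have "{x \<in> ball 0 1 - {0}. norm x \<in> A \<and> sgn x \<in> B} = {x \<in> ball 0 1 - {0}. sgn x \<in> B} \<inter> norm -` A"
      by auto
    moreover have "norm -` A \<inter> space borel \<in> sets (borel :: 'a measure)"
      using assms(1) by measurable
    ultimately show ?thesis
      using sets_cone(1)[OF assms(2), of 1] by (subst nn_integral_cmult_indicator) auto
  qed
  finally show ?thesis .
qed

definition radial_measure :: "real measure" where
  "radial_measure = density lborel (\<lambda>r. ennreal (r ^ (DIM('a) - 1)) * indicator {0<..<1} r)"

lemma sets_radial [measurable_cong, simp]: "sets radial_measure = sets borel"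
  by (simp add: radial_measure_def)

lemma emeasure_radial:
  assumes "0 \<le> a" "a \<le> 1"
  shows "emeasure radial_measure {a<..} = ennreal ((1 - a ^ DIM('a)) / DIM('a))"
proof -
  have "emeasure radial_measure {a<..} = (\<integral>\<^sup>+r. ennreal (r ^ (DIM('a) - 1)) * indicator {a..1} r \<partial>lborel)"
    unfolding radial_measure_def
    apply (subst emeasure_density, measurable)
    apply (intro nn_integral_cong_AE)
    using AE_lborel_singleton[of a] AE_lborel_singleton[of 1]
    apply eventually_elim
    using assms by (auto simp: indicator_def)
  also have "\<dots> = ennreal (1 ^ DIM('a) / DIM('a) - a ^ DIM('a) / DIM('a))"
    by (rule nn_integral_FTC_Icc[of _ a 1 "\<lambda>r. r ^ DIM('a) / DIM('a)"])
       (use assms in \<open>auto intro!: derivative_eq_intros simp: field_simps\<close>)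
  finally show ?thesis by (simp add: diff_divide_distrib)
qed

lemma emeasure_radial_lessThan: "a < 0 \<Longrightarrow> emeasure radial_measure {a<..} = emeasure radial_measure {0<..}"
  unfolding radial_measure_def
  by (simp add: emeasure_density, intro nn_integral_cong) (auto simp: indicator_def)

lemma emeasure_radial_gt: "a > 1 \<Longrightarrow> emeasure radial_measure {a<..} = 0"
  unfolding radial_measure_def
  by (simp add: emeasure_density, rule nn_integral_0_iff_AE[THEN iffD2]) (auto simp: indicator_def)

lemma emeasure_radial_finite: "emeasure radial_measure {a<..} < \<infinity>"
  using emeasure_radial[of a] emeasure_radial_lessThan[of a] emeasure_radial[of 0] emeasure_radial_gt[of a]
  by (cases "a < 0"; cases "a > 1") auto

sublocale radial: finite_measure radial_measure
proof
  have "emeasure radial_measure (space radial_measure) = emeasure radial_measure {-1<..}"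
    unfolding radial_measure_def
    by (simp add: emeasure_density, intro nn_integral_cong) (auto simp: indicator_def)
  then show "emeasure radial_measure (space radial_measure) \<noteq> \<infinity>"
    using emeasure_radial_finite[of "-1"] by simp
qed

text \<open>For fixed \<open>B\<close> both sides are finite measures in the radial set, so it
  suffices to compare half-lines. There the scaling law of Lebesgue measure gives the cone of radius
  a the mass a^n times that of the unit cone, and the density r^(n-1) integrates to (1 - a^n) / n;
  the factor n in \<open>surface_measure\<close> cancels the denominator.\<close>

lemma cone_measure_eq: "radial_measure \<Otimes>\<^sub>M \<sigma> = cone_measure"
proof (rule pair_measure_eqI)
  show "sigma_finite_measure radial_measure" "sigma_finite_measure \<sigma>" by unfold_locales
  show "sets (radial_measure \<Otimes>\<^sub>M \<sigma>) = sets cone_measure"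
    unfolding cone_measure_def sets_distr by (intro sets_pair_measure_cong) auto
  fix A B assume A': "A \<in> sets radial_measure" and B: "B \<in> sets \<sigma>"
  have A: "A \<in> sets borel" using A' by simp
  define v where "v = measure lborel {x \<in> ball 0 1 - {0}. sgn x \<in> B}"
  have v: "emeasure lborel {x \<in> ball 0 1 - {0}. sgn x \<in> B} = ennreal v"
    unfolding v_def using emeasure_cone_finite[of 1 B] by (intro emeasure_eq_ennreal_measure) auto
  have v0: "v \<ge> 0" by (simp add: v_def)
  let ?M = "density radial_measure (\<lambda>_. emeasure \<sigma> B)"
  let ?C = "\<lambda>A. {x \<in> ball 0 1 - {0}. norm x \<in> A \<and> sgn x \<in> B}"
  have C: "?C A \<in> sets borel" if "A \<in> sets borel" for A
  proof -
    have "?C A = {x \<in> ball 0 1 - {0}. sgn x \<in> B} \<inter> norm -` A" by auto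
    moreover have "norm -` A \<inter> space borel \<in> sets (borel :: 'a measure)"
      using that by measurable
    ultimately show ?thesis using sets_cone(1)[OF B, of 1] by auto
  qed
  let ?N = "distr (density lborel (\<lambda>x. ennreal \<kappa> * indicator {x \<in> ball 0 1 - {0}. sgn x \<in> B} x)) borel norm"
  have N: "emeasure ?N A = ennreal \<kappa> * emeasure lborel (?C A)" if "A \<in> sets borel" for A
  proof -
    have nm: "(norm -` A) \<inter> space borel \<in> sets (borel :: 'a measure)"
      using that by measurable
    then have nm': "(norm -` A) \<in> sets (borel :: 'a measure)" by simp
    have "emeasure ?N A = (\<integral>\<^sup>+x. ennreal \<kappa> * indicator {x \<in> ball 0 1 - {0}. sgn x \<in> B} x * indicator (norm -` A) x \<partial>lborel)"
      using that sets_cone(1)[OF B, of 1] nm' by (simp add: emeasure_distr emeasure_density)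
    also have "\<dots> = (\<integral>\<^sup>+x. ennreal \<kappa> * indicator (?C A) x \<partial>lborel)"
      by (intro nn_integral_cong) (auto simp: indicator_def)
    also have "\<dots> = ennreal \<kappa> * emeasure lborel (?C A)"
      using C[OF that] by (subst nn_integral_cmult_indicator) auto
    finally show ?thesis .
  qed
  have sB: "emeasure \<sigma> B = ennreal (\<kappa> * DIM('a) * v)"
    unfolding emeasure_sigma[OF B] v using kappa_pos v0 by (simp add: ennreal_mult'[symmetric])
  have eq: "emeasure ?M {a<..} = emeasure ?N {a<..}" for a
  proof -
    have *: "emeasure ?M {a<..} = emeasure ?N {a<..}" if a: "0 \<le> a" "a \<le> 1" for a
    proof -
      have split: "?C {a<..} \<union> ?C {..a} = {x \<in> ball 0 1 - {0}. sgn x \<in> B}"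
        by auto
      \<comment> \<open>The inner part of the cone is measured in place of the outer one: up to a
        null sphere it is a dilate of the full cone.\<close>
      have "emeasure lborel (?C {..a}) = ennreal (a ^ DIM('a) * v)"
      proof (cases "a = 0")
        case True
        then have e: "?C {..a} = {}" by auto
        show ?thesis unfolding e using True by (simp add: zero_power)
      next
        case False
        then have a0: "a > 0" using a by simp
        have "emeasure lborel (?C {..a}) = emeasure lborel {x \<in> ball 0 a - {0}. sgn x \<in> B}"
        proof (rule emeasure_eq_AE)
          have "AE x in lborel. x \<notin> sphere (0::'a) a"
            by (rule AE_not_in[OF null_sets_sphere])
          moreover have "AE x in lborel. x \<notin> sphere (0::'a) 1"
            by (rule AE_not_in[OF null_sets_sphere])
          ultimately show "AE x in lborel. (x \<in> ?C {..a}) = (x \<in> {x \<in> ball 0 a - {0}. sgn x \<in> B})"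
          proof eventually_elim
            case (elim x)
            then have "norm x \<noteq> a" "norm x \<noteq> 1" by simp_all
            then have "norm x < 1 \<and> norm x \<le> a \<longleftrightarrow> norm x < a"
              using a by linarith
            then show ?case by (simp add: conj_ac) blast
          qed
        next
          show "?C {..a} \<in> sets lborel" "{x \<in> ball 0 a - {0}. sgn x \<in> B} \<in> sets lborel"
            unfolding sets_lborel by (rule C, simp) (rule sets_cone(1)[OF B])
        qed
        also have "\<dots> = ennreal (a ^ DIM('a) * v)"
          unfolding emeasure_cone[OF B a0] v using a by (simp add: ennreal_mult')
        finally show ?thesis .
      qed
      then have "emeasure lborel (?C {a<..}) + ennreal (a ^ DIM('a) * v) = emeasure lborel (?C {a<..} \<union> ?C {..a})"
      proof -
        assume "emeasure lborel (?C {..a}) = ennreal (a ^ DIM('a) * v)"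
        moreover have "emeasure lborel (?C {a<..}) + emeasure lborel (?C {..a}) = emeasure lborel (?C {a<..} \<union> ?C {..a})"
        proof (rule plus_emeasure)
          show "?C {a<..} \<in> sets lborel" "?C {..a} \<in> sets lborel"
            unfolding sets_lborel by (rule C, simp)+
        qed auto
        ultimately show ?thesis by simp
      qed
      also have "\<dots> = ennreal v"
        by (simp only: split v)
      finally have "emeasure lborel (?C {a<..}) = ennreal (v - a ^ DIM('a) * v)"
        using v0 a ennreal_add_diff_cancel_right[of "ennreal (a ^ DIM('a) * v)" "emeasure lborel (?C {a<..})"]
        by (simp only: ennreal_minus ennreal_neq_top mult_nonneg_nonneg zero_le_power not_False_eq_True)
      then have N': "emeasure ?N {a<..} = ennreal (\<kappa> * (v - a ^ DIM('a) * v))"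
        using kappa_pos by (simp only: N[OF greaterThan_borel] ennreal_mult' less_imp_le)
      have p: "(1 - a ^ DIM('a)) / DIM('a) \<ge> 0"
        using a by (simp add: power_le_one)
      have "emeasure ?M {a<..} = ennreal (\<kappa> * DIM('a) * v * ((1 - a ^ DIM('a)) / DIM('a)))"
        using a p by (simp only: emeasure_density_const sets_radial greaterThan_borel emeasure_radial sB ennreal_mult'')
      also have "\<kappa> * DIM('a) * v * ((1 - a ^ DIM('a)) / DIM('a)) = \<kappa> * (v - a ^ DIM('a) * v)"
        by (simp add: field_simps)
      finally show ?thesis unfolding N' .
    qed
    consider "a < 0" | "0 \<le> a" "a \<le> 1" | "a > 1" by linarith
    then show ?thesis
    proof cases
      case 1
      have "a < norm x" for x :: 'a using 1 norm_ge_zero[of x] by linarith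
      then have "?C {a<..} = ?C {0<..}" by simp
      then show ?thesis
        using *[of 0]
        by (simp only: N[OF greaterThan_borel] emeasure_density_const sets_radial greaterThan_borel emeasure_radial_lessThan[OF 1]
            order_refl zero_le_one)
    next
      case 3
      then have "?C {a<..} = {}" by auto
      then show ?thesis
        by (simp only: N[OF greaterThan_borel] emeasure_density_const sets_radial greaterThan_borel emeasure_radial_gt[OF 3]
            emeasure_empty mult_zero_right)
    qed (use * in auto)
  qed
  have "?M = ?N"
  proof (rule measure_eqI_lessThan)
    show "emeasure ?M {x<..} < \<infinity>" for x
      unfolding emeasure_density_const[of "{x<..}" radial_measure, unfolded sets_radial, OF greaterThan_borel] sB
      using emeasure_radial_finite[of x] by (simp add: ennreal_mult_less_top)
    show "sets ?M = sets borel" "sets ?N = sets borel"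
      by (simp_all only: sets_density sets_distr sets_radial)
  qed (rule eq)
  then have "emeasure ?M A = emeasure ?N A" by (rule arg_cong)
  then show "emeasure radial_measure A * emeasure \<sigma> B = emeasure cone_measure (A \<times> B)"
    unfolding N[OF A] emeasure_cone_measure[OF A B] emeasure_density_const[OF A'] by (simp add: mult.commute)
qed

text \<open>Only vanishing is transferred from the ball to the iterated integral: the one
  application is to a divergence with integral zero, and the factor \<kappa> then
  disappears.\<close>

lemma integral_polar:
  fixes g :: "'a \<Rightarrow> 'b::{banach, second_countable_topology}"
  assumes g [measurable]: "g \<in> borel_measurable borel" and int: "integrable lborel (\<lambda>x. indicator (ball 0 1 - {0}) x *\<^sub>R g x)"
  shows "(\<integral>x. indicator (ball 0 1 - {0}) x *\<^sub>R g x \<partial>lborel) = 0 \<Longrightarrow>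
     (\<integral>r. (r ^ (DIM('a) - 1) * indicator {0<..<1} r) *\<^sub>R (\<integral>x. g (r *\<^sub>R x) \<partial>\<sigma>) \<partial>lborel) = 0"
proof -
  assume z: "(\<integral>x. indicator (ball 0 1 - {0}) x *\<^sub>R g x \<partial>lborel) = 0"
  have o [measurable]: "(ball 0 1 - {0} :: 'a set) \<in> sets borel" by (intro borel_open open_Diff) auto
  have id: "(\<lambda>x. x) \<in> measurable \<sigma> borel"
    by (subst measurable_cong_sets[OF sets_sigma refl]) (rule measurable_restrict_space1, simp)
  have h [measurable]: "(\<lambda>z. g (fst z *\<^sub>R snd z)) \<in> borel_measurable (borel \<Otimes>\<^sub>M \<sigma>)"
    using measurable_compose[OF measurable_snd id] by measurable
  have h' [measurable]: "(\<lambda>z. g (fst z *\<^sub>R snd z)) \<in> borel_measurable (radial_measure \<Otimes>\<^sub>M \<sigma>)"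
    using measurable_compose[OF measurable_snd id] by measurable
  let ?D = "density lborel (\<lambda>x. ennreal (\<kappa> * indicator (ball 0 1 - {0}) x))"
  have D: "density lborel (\<lambda>x. ennreal \<kappa> * indicator (ball 0 1 - {0}) x) = ?D"
    using kappa_pos by (intro density_cong) (auto simp: indicator_def)
  have iD: "integrable ?D g"
    using kappa_pos int by (subst integrable_density) (auto simp: scaleR_scaleR[symmetric] simp del: scaleR_scaleR)
  have iC: "integrable cone_measure (\<lambda>z. g (fst z *\<^sub>R snd z))"
    unfolding cone_measure_def D using iD by (subst integrable_distr_eq[OF _ h]) auto
  have "0 = \<kappa> *\<^sub>R (\<integral>x. indicator (ball 0 1 - {0}) x *\<^sub>R g x \<partial>lborel)"
    using z by simp
  also have "\<dots> = (\<integral>x. (\<kappa> * indicator (ball 0 1 - {0}) x) *\<^sub>R g x \<partial>lborel)"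
    by (subst integral_scaleR_right[symmetric]) (auto simp: scaleR_scaleR[symmetric] simp del: scaleR_scaleR)
  also have "\<dots> = (\<integral>x. g x \<partial>?D)"
    using kappa_pos by (subst integral_density) auto
  also have "\<dots> = (\<integral>z. g (fst z *\<^sub>R snd z) \<partial>cone_measure)"
    unfolding cone_measure_def D by (subst integral_distr[OF _ h]) auto
  also have "\<dots> = (\<integral>r. \<integral>x. g (r *\<^sub>R x) \<partial>\<sigma> \<partial>radial_measure)"
  proof -
    interpret pair_sigma_finite radial_measure \<sigma> ..
    show ?thesis using integral_fst'[of "\<lambda>z. g (fst z *\<^sub>R snd z)"] iC by (simp add: cone_measure_eq)
  qed
  also have "\<dots> = (\<integral>r. (r ^ (DIM('a) - 1) * indicator {0<..<1} r) *\<^sub>R (\<integral>x. g (r *\<^sub>R x) \<partial>\<sigma>) \<partial>lborel)"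
  proof -
    have m [measurable]: "(\<lambda>r. \<integral>x. g (r *\<^sub>R x) \<partial>\<sigma>) \<in> borel_measurable borel"
      using borel_measurable_lebesgue_integral[of "\<lambda>r x. g (r *\<^sub>R x)" borel] h by (simp add: case_prod_beta')
    have "radial_measure = density lborel (\<lambda>r. ennreal (r ^ (DIM('a) - 1) * indicator {0<..<1} r))"
      unfolding radial_measure_def by (intro density_cong) (auto simp: indicator_def)
    then show ?thesis
      by (simp, subst integral_density) (auto simp: indicator_def)
  qed
  finally show "(\<integral>r. (r ^ (DIM('a) - 1) * indicator {0<..<1} r) *\<^sub>R (\<integral>x. g (r *\<^sub>R x) \<partial>\<sigma>) \<partial>lborel) = 0"
    by simp
qed

lemma continuous_on_sphere_measurable:
  assumes "continuous_on S h"
  shows "h \<in> borel_measurable \<sigma>"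
  by (subst measurable_cong_sets[OF sets_sigma refl]) (rule borel_measurable_continuous_on_restrict[OF assms])

lemma continuous_on_sphere_integrable:
  fixes h :: "'a \<Rightarrow> 'b::{banach, second_countable_topology}"
  assumes "continuous_on S h"
  shows "integrable \<sigma> h"
proof -
  have "compact (h ` S)" using assms by (intro compact_continuous_image) auto
  then obtain B where "\<forall>x\<in>S. norm (h x) \<le> B"
    using compact_imp_bounded bounded_iff by (metis (no_types, lifting) imageI)
  then show ?thesis
    by (intro integrable_const_bound[of _ B]) (auto simp: continuous_on_sphere_measurable assms AE_I2)
qed

lemma measurable_joint:
  fixes h :: "'a \<times> 'a \<Rightarrow> 'b::topological_space"
  assumes "continuous_on (S \<times> S) h"
  shows "h \<in> borel_measurable (\<sigma> \<Otimes>\<^sub>M \<sigma>)"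
proof -
  have id: "(\<lambda>x. x) \<in> measurable \<sigma> borel"
    by (subst measurable_cong_sets[OF sets_sigma refl]) (rule measurable_restrict_space1, simp)
  have "(\<lambda>z. (fst z, snd z)) \<in> measurable (\<sigma> \<Otimes>\<^sub>M \<sigma>) (borel \<Otimes>\<^sub>M borel)"
    using measurable_compose[OF measurable_snd id] measurable_compose[OF measurable_fst id] by measurable
  then have "(\<lambda>z. z) \<in> measurable (\<sigma> \<Otimes>\<^sub>M \<sigma>) (restrict_space borel (S \<times> S))"
    by (intro measurable_restrict_space2) (auto simp: space_pair_measure borel_prod)
  from measurable_compose[OF this borel_measurable_continuous_on_restrict[OF assms]] show ?thesis .
qed

text \<open>If \<open>h\<close> were positive somewhere, its set of positivity would be a
  \<sigma>-null relatively open set; but the cone over that set is open, nonempty and of Lebesgue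
  measure zero, which is impossible.\<close>

lemma continuous_nonneg_integral_0:
  fixes h :: "'a \<Rightarrow> real"
  assumes cont: "continuous_on S h" and nn: "\<And>x. x \<in> S \<Longrightarrow> h x \<ge> 0" and z: "(\<integral>x. h x \<partial>\<sigma>) = 0" and x: "x \<in> S"
  shows "h x = 0"
proof (rule ccontr)
  assume "h x \<noteq> 0"
  then have hx: "h x > 0" using nn[OF x] by simp
  have AE: "AE x in \<sigma>. h x = 0"
    using z nn by (subst (asm) integral_nonneg_eq_0_iff_AE) (auto intro: continuous_on_sphere_integrable cont AE_I2)
  obtain U where U: "open U" "U \<inter> S = {y \<in> S. h y > 0}"
    using continuous_on_open_invariant[THEN iffD1, OF cont, rule_format, of "{0<..}"]
    by (auto simp: vimage_def Int_def)
  have US: "U \<inter> S \<in> sets \<sigma>" using U(1) by (auto simp: sets_sigma sets_restrict_space)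
  have "AE x in \<sigma>. x \<notin> U \<inter> S" using AE by eventually_elim (use U in auto)
  then have "emeasure \<sigma> (U \<inter> S) = 0"
    using US by (simp add: AE_iff_measurable[OF US] AE_iff_null_sets null_setsD1)
  then have 0: "emeasure lborel {x \<in> ball 0 1 - {0}. sgn x \<in> U \<inter> S} = 0"
    using kappa_pos by (simp add: emeasure_sigma[OF US])
  have "{x \<in> ball 0 1 - {0}. sgn x \<in> U \<inter> S} = (ball 0 1 - {0}) \<inter> sgn -` U"
    by (auto simp: norm_sgn)
  moreover have "open ((ball 0 1 - {0::'a}) \<inter> sgn -` U)"
    by (rule continuous_open_preimage) (auto intro!: continuous_intros open_Diff U simp: sgn_div_norm)
  ultimately have op: "open {x \<in> ball 0 1 - {0}. sgn x \<in> U \<inter> S}" by simp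
  have "(1/2) *\<^sub>R x \<in> {x \<in> ball 0 1 - {0}. sgn x \<in> U \<inter> S}"
    using x hx U(2) by (auto simp: sgn_scaleR sgn_div_norm)
  then have "{x \<in> ball 0 1 - {0}. sgn x \<in> U \<inter> S} \<noteq> {}" by blast
  then have "\<not> negligible {x \<in> ball 0 1 - {0}. sgn x \<in> U \<inter> S}"
    using open_not_negligible[OF op] by simp
  then show False using 0 op
    by (simp add: negligible_iff_null_sets null_sets_completion_iff null_sets_def)
qed

end

text \<open>Difference quotients in the direction \<open>e\<close> have integral zero by translation
  invariance, and they converge to the derivative under an integrable majorant, since the derivative
  is bounded near the support.\<close>

lemma integral_partial_0:
  fixes w :: "'a::euclidean_space \<Rightarrow> 'b::{banach, second_countable_topology}"
  assumes D: "\<And>x. (w has_derivative D x) (at x)" and cont: "continuous_on UNIV (\<lambda>x. D x e)"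
    and supp: "\<And>x. norm x \<ge> 1 \<Longrightarrow> w x = 0"
  shows "(\<integral>x. D x e \<partial>lborel) = 0" "integrable lborel (\<lambda>x. D x e)"
proof -
  have wc: "continuous_on A w" for A
    using D by (meson continuous_at_imp_continuous_on has_derivative_continuous)
  have [measurable]: "w \<in> borel_measurable borel" "(\<lambda>x. D x e) \<in> borel_measurable borel"
    using wc cont by (auto intro: borel_measurable_continuous_onI)
  \<comment> \<open>A shift moves a point by at most \<open>norm e\<close>, so the quotients vanish
    beyond radius 1 + L, and every segment that starts within that radius stays within 1 + 2 L,
    where \<open>B\<close> bounds the derivative.\<close>
  define L where "L = norm e + 1"
  have L: "L > 0" by (simp add: L_def add_nonneg_pos)
  have "compact ((\<lambda>x. D x e) ` cball 0 (1 + 2 * L))"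
    by (intro compact_continuous_image continuous_on_subset[OF cont]) auto
  then obtain B where B: "\<And>x. norm x \<le> 1 + 2 * L \<Longrightarrow> norm (D x e) \<le> B"
    using compact_imp_bounded bounded_iff by (metis (no_types, lifting) imageI mem_cball_0)
  have Bpos: "B \<ge> 0" using B[of 0] L norm_ge_zero[of "D 0 e"] by (smt (verit) norm_zero)
  define d where "d n x = real (Suc n) *\<^sub>R (w (x + (1 / real (Suc n)) *\<^sub>R e) - w x)" for n x
  have d0: "d n x = 0" if "norm x > 1 + L" for n x
  proof -
    have "norm ((1 / real (Suc n)) *\<^sub>R e) \<le> norm e"
      by (simp add: divide_le_eq mult_le_cancel_left1 algebra_simps)
    then have "norm (x + (1 / real (Suc n)) *\<^sub>R e) \<ge> 1"
      using that norm_triangle_ineq4[of "x + (1 / real (Suc n)) *\<^sub>R e" "(1 / real (Suc n)) *\<^sub>R e"] by (simp add: L_def)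
    then show ?thesis using that supp L by (simp add: d_def)
  qed
  have lim: "(\<lambda>n. d n x) \<longlonglongrightarrow> D x e" for x
  proof -
    have "((\<lambda>t. w (x + t *\<^sub>R e)) has_vector_derivative D x e) (at 0)"
    proof -
      have 1: "((\<lambda>t. x + t *\<^sub>R e) has_derivative (\<lambda>t. t *\<^sub>R e)) (at (0::real))"
        by (auto intro!: derivative_eq_intros)
      have "((\<lambda>t. w (x + t *\<^sub>R e)) has_derivative (\<lambda>t. D x (t *\<^sub>R e))) (at (0::real))"
        using has_derivative_compose[OF 1, of w "D x"] D[of x] by simp
      moreover have "(\<lambda>t. D x (t *\<^sub>R e)) = (\<lambda>t. t *\<^sub>R D x e)"
        using has_derivative_linear[OF D[of x]] by (auto simp: linear_cmul)
      ultimately show ?thesis by (simp add: has_vector_derivative_def)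
    qed
    then have "((\<lambda>t. (w (x + t *\<^sub>R e) - w x) /\<^sub>R t) \<longlongrightarrow> D x e) (at 0)"
    proof -
      assume "((\<lambda>t. w (x + t *\<^sub>R e)) has_vector_derivative D x e) (at 0)"
      then have l: "((\<lambda>t. norm (w (x + t *\<^sub>R e) - w x - t *\<^sub>R D x e) / norm t) \<longlongrightarrow> 0) (at 0)"
        by (simp add: has_vector_derivative_def has_derivative_iff_norm)
      have "norm (w (x + t *\<^sub>R e) - w x - t *\<^sub>R D x e) / norm t = dist ((w (x + t *\<^sub>R e) - w x) /\<^sub>R t) (D x e)"
        if "t \<noteq> 0" for t
      proof -
        have "(w (x + t *\<^sub>R e) - w x) /\<^sub>R t - D x e = (w (x + t *\<^sub>R e) - w x - t *\<^sub>R D x e) /\<^sub>R t"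
          using that by (simp add: scaleR_diff_right)
        then show ?thesis by (simp add: dist_norm divide_inverse mult.commute)
      qed
      then show ?thesis
        unfolding tendsto_dist_iff[of _ "D x e"]
        by (intro Lim_transform_eventually[OF l]) (simp add: eventually_at_filter)
    qed
    then have "((\<lambda>n. (w (x + (1 / real (Suc n)) *\<^sub>R e) - w x) /\<^sub>R (1 / real (Suc n))) \<longlonglongrightarrow> D x e)"
      by (rule filterlim_compose) (use LIMSEQ_Suc[OF lim_1_over_n[where 'a=real]] in \<open>auto simp: filterlim_at\<close>)
    then show ?thesis by (simp add: d_def divide_inverse)
  qed
  have bnd: "norm (d n x) \<le> B * indicator (cball 0 (1 + L)) x" for n x
  proof (cases "norm x \<le> 1 + L")
    case False
    then show ?thesis using d0[of x n] by simp
  next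
    case True
    define h where "h = 1 / real (Suc n)"
    have h: "h > 0" "h \<le> 1" by (auto simp: h_def)
    have "norm ((\<lambda>t. w (x + t *\<^sub>R e)) h - (\<lambda>t. w (x + t *\<^sub>R e)) 0) \<le> B * norm (h - 0)"
    proof (rule differentiable_bound[of "{0..h}" _ "\<lambda>t s. D (x + t *\<^sub>R e) (s *\<^sub>R e)"])
      fix t assume t: "t \<in> {0..h}"
      have 1: "((\<lambda>t. x + t *\<^sub>R e) has_derivative (\<lambda>t. t *\<^sub>R e)) (at t)"
        by (auto intro!: derivative_eq_intros)
      have "((\<lambda>t. w (x + t *\<^sub>R e)) has_derivative (\<lambda>s. D (x + t *\<^sub>R e) (s *\<^sub>R e))) (at t)"
        using has_derivative_compose[OF 1 D] by simp
      then show "((\<lambda>t. w (x + t *\<^sub>R e)) has_derivative (\<lambda>s. D (x + t *\<^sub>R e) (s *\<^sub>R e))) (at t within {0..h})"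
        by (rule has_derivative_at_withinI)
      have "norm (x + t *\<^sub>R e) \<le> norm x + t * norm e"
        using norm_triangle_ineq[of x "t *\<^sub>R e"] t by simp
      also have "\<dots> \<le> norm x + 1 * norm e" using t h by (intro add_left_mono mult_right_mono) auto
      finally have "norm (D (x + t *\<^sub>R e) e) \<le> B" using True by (intro B) (simp add: L_def)
      moreover have "D (x + t *\<^sub>R e) (s *\<^sub>R e) = s *\<^sub>R D (x + t *\<^sub>R e) e" for s
        using has_derivative_linear[OF D] by (simp add: linear_cmul)
      ultimately show "onorm (\<lambda>s. D (x + t *\<^sub>R e) (s *\<^sub>R e)) \<le> B"
        by (intro onorm_le) (simp add: mult.commute[of B] mult_left_mono)
    qed (use h in auto)
    then have "norm (w (x + h *\<^sub>R e) - w x) \<le> B * h" using h by simp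
    then have "norm (w (x + h *\<^sub>R e) - w x) / h \<le> B" using h by (simp only: pos_divide_le_eq)
    moreover have "norm (d n x) = norm (w (x + h *\<^sub>R e) - w x) / h"
      by (simp add: d_def h_def mult.commute)
    ultimately show ?thesis using True by simp
  qed
  have ib: "integrable lborel (\<lambda>x. B * indicator (cball (0::'a) (1 + L)) x)"
    by (intro integrable_mult_right integrable_real_indicator emeasure_bounded_finite) auto
  have dm: "d n \<in> borel_measurable lborel" for n
    unfolding d_def[abs_def] by measurable
  have dc: "(\<lambda>n. \<integral>x. d n x \<partial>lborel) \<longlonglongrightarrow> (\<integral>x. D x e \<partial>lborel)"
    by (rule integral_dominated_convergence[OF _ _ ib]) (use lim bnd dm in auto)
  show "integrable lborel (\<lambda>x. D x e)"
    by (rule integrable_dominated_convergence[OF _ _ ib, of _ d]) (use lim bnd dm in auto)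
  have "compact (w ` cball 0 1)" by (intro compact_continuous_image wc) auto
  then obtain C where C: "\<And>x. norm x \<le> 1 \<Longrightarrow> norm (w x) \<le> C"
    using compact_imp_bounded bounded_iff by (metis (no_types, lifting) imageI mem_cball_0)
  have wi: "integrable lborel w"
  proof (rule Bochner_Integration.integrable_bound)
    show "integrable lborel (\<lambda>x. C * indicator (cball (0::'a) 1) x)"
      by (intro integrable_mult_right integrable_real_indicator emeasure_bounded_finite) auto
    have "norm (w x) \<le> norm (C * indicator (cball 0 1) x)" for x
      using C[of x] supp[of x] by (cases "norm x \<le> 1") auto
    then show "AE x in lborel. norm (w x) \<le> norm (C * indicator (cball 0 1) x)" by simp
  qed auto
  have "(\<integral>x. d n x \<partial>lborel) = 0" for n
  proof -
    let ?c = "(1 / real (Suc n)) *\<^sub>R e"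
    have tr: "integrable lborel (\<lambda>x. w (?c + x))" "(\<integral>x. w (?c + x) \<partial>lborel) = (\<integral>x. w x \<partial>lborel)"
    proof -
      have "integrable (distr lborel borel ((+) ?c)) w" using wi by (simp add: lborel_distr_plus)
      then show "integrable lborel (\<lambda>x. w (?c + x))" by (subst (asm) integrable_distr_eq) auto
      have "(\<integral>x. w x \<partial>lborel) = (\<integral>x. w x \<partial>distr lborel borel ((+) ?c))" by (simp add: lborel_distr_plus)
      also have "\<dots> = (\<integral>x. w (?c + x) \<partial>lborel)" by (subst integral_distr) auto
      finally show "(\<integral>x. w (?c + x) \<partial>lborel) = (\<integral>x. w x \<partial>lborel)" ..
    qed
    show ?thesis
      unfolding d_def using tr wi by (simp add: add.commute)
  qed
  then have "(\<lambda>n. 0) \<longlonglongrightarrow> (\<integral>x. D x e \<partial>lborel)" using dc by simp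
  then show "(\<integral>x. D x e \<partial>lborel) = 0" by (simp add: LIMSEQ_const_iff)
qed

section \<open>Moments of harmonic functions\<close>

lemma linear_eq_sum_Basis:
  fixes f :: "'a::euclidean_space \<Rightarrow> 'b::real_vector"
  assumes "linear f"
  shows "f h = (\<Sum>i\<in>Basis. (h \<bullet> i) *\<^sub>R f i)"
proof -
  have "f (\<Sum>i\<in>Basis. (h \<bullet> i) *\<^sub>R i) = (\<Sum>i\<in>Basis. f ((h \<bullet> i) *\<^sub>R i))"
    by (rule linear_sum[OF assms])
  then show ?thesis
    by (simp add: euclidean_representation linear_cmul[OF assms])
qed

lemma norm_linear_le_Basis:
  fixes f :: "'a::euclidean_space \<Rightarrow> 'b::real_normed_vector"
  assumes "linear f" "\<And>i. i \<in> Basis \<Longrightarrow> norm (f i) \<le> e"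
  shows "norm (f h) \<le> real DIM('a) * e * norm h"
proof -
  have "norm (f h) \<le> (\<Sum>i\<in>Basis. norm ((h \<bullet> i) *\<^sub>R f i))"
    unfolding linear_eq_sum_Basis[OF assms(1), of h] by (rule norm_sum)
  also have "\<dots> \<le> (\<Sum>i\<in>(Basis::'a set). norm h * e)"
    by (intro sum_mono) (auto intro!: mult_mono simp: Basis_le_norm assms(2))
  finally show ?thesis by (simp add: algebra_simps)
qed

section \<open>Continuity and differentiation of integrals over the sphere\<close>

context sphere_measure
begin

text \<open>Compactness of the sphere makes joint continuity uniform in the integration variable,
  and the total mass is finite.\<close>

lemma continuous_on_integral_sphere:
  fixes K :: "'c::topological_space \<Rightarrow> 'a \<Rightarrow> 'b::{banach, second_countable_topology}"
  assumes K: "continuous_on (U \<times> S) (\<lambda>(x, y). K x y)"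
  shows "continuous_on U (\<lambda>x. \<integral>y. K x y \<partial>\<sigma>)"
proof -
  have c: "continuous_on S (K x)" if "x \<in> U" for x
    using continuous_on_compose2[OF K, of S "\<lambda>y. (x, y)"] that by (auto simp: continuous_on_Pair)
  show ?thesis
    unfolding continuous_on_def tendsto_iff
  proof safe
    fix x e assume x: "x \<in> U" and e: "(0::real) < e"
    \<comment> \<open>The summand 1 keeps the denominator away from zero.\<close>
    define e' where "e' = e / (measure \<sigma> S + 1)"
    have e': "e' > 0" using e by (simp add: e'_def add_nonneg_pos)
    obtain X where X: "x \<in> X" "open X" "\<And>z. z \<in> X \<inter> U \<Longrightarrow> \<forall>t\<in>S. dist (K z t) (K x t) \<le> e'"
      using continuous_on_prod_compactE[OF K compact_sphere x e'] by (metis case_prod_conv)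
    show "\<forall>\<^sub>F z in at x within U. dist (\<integral>y. K z y \<partial>\<sigma>) (\<integral>y. K x y \<partial>\<sigma>) < e"
      unfolding eventually_at_topological
    proof (intro exI conjI ballI impI)
      fix z assume z: "z \<in> X" "z \<noteq> x" "z \<in> U"
      have "(\<integral>y. K z y \<partial>\<sigma>) - (\<integral>y. K x y \<partial>\<sigma>) = (\<integral>y. K z y - K x y \<partial>\<sigma>)"
        by (subst Bochner_Integration.integral_diff) (use c x z in \<open>auto intro: continuous_on_sphere_integrable\<close>)
      then have "dist (\<integral>y. K z y \<partial>\<sigma>) (\<integral>y. K x y \<partial>\<sigma>) = norm (\<integral>y. K z y - K x y \<partial>\<sigma>)"
        by (simp add: dist_norm)
      also have "\<dots> \<le> (\<integral>y. e' \<partial>\<sigma>)"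
        using X(3)[of z] z c x
        by (intro Bochner_Integration.integral_norm_bound_integral)
           (auto intro!: continuous_on_sphere_integrable continuous_intros simp: dist_norm)
      also have "\<dots> = e' * measure \<sigma> S" by simp
      also have "\<dots> < e' * (measure \<sigma> S + 1)" using e' by simp
      also have "\<dots> = e"
      proof -
        have "measure \<sigma> S + 1 \<noteq> 0" using measure_nonneg[of \<sigma> S] by linarith
        then show ?thesis by (simp add: e'_def)
      qed
      finally show "dist (\<integral>y. K z y \<partial>\<sigma>) (\<integral>y. K x y \<partial>\<sigma>) < e" .
    qed (use X in auto)
  qed
qed

text \<open>Joint continuity is demanded only along basis vectors, which is the form in which
  \<open>harmonic_on\<close> supplies derivatives. Uniform closeness of \<open>DK x y\<close> to
  \<open>DK x0 y\<close> over the sphere bounds the linearisation error uniformly in y, and that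
  bound can be integrated.\<close>

lemma has_derivative_integral_sphere:
  fixes K :: "'c::euclidean_space \<Rightarrow> 'a \<Rightarrow> 'b::{banach, second_countable_topology}"
  assumes U: "open U" "x0 \<in> U"
    and D: "\<And>x y. x \<in> U \<Longrightarrow> y \<in> S \<Longrightarrow> ((\<lambda>x. K x y) has_derivative DK x y) (at x)"
    and contK: "\<And>x. x \<in> U \<Longrightarrow> continuous_on S (K x)"
    and contD: "\<And>i. i \<in> Basis \<Longrightarrow> continuous_on (U \<times> S) (\<lambda>(x, y). DK x y i)"
  shows "((\<lambda>x. \<integral>y. K x y \<partial>\<sigma>) has_derivative (\<lambda>h. \<integral>y. DK x0 y h \<partial>\<sigma>)) (at x0)"
  unfolding has_derivative_at_alt
proof (intro conjI allI impI)
  have lin: "linear (DK x y)" if "x \<in> U" "y \<in> S" for x y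
    using D[OF that] has_derivative_linear by blast
  have ci: "continuous_on S (\<lambda>y. DK x0 y i)" if "i \<in> Basis" for i
    using continuous_on_compose2[OF contD[OF that], of S "\<lambda>y. (x0, y)"] U by (auto simp: continuous_on_Pair)
  have c: "continuous_on S (\<lambda>y. DK x0 y h)" for h
  proof -
    have "continuous_on S (\<lambda>y. \<Sum>i\<in>Basis. (h \<bullet> i) *\<^sub>R DK x0 y i)"
      by (intro continuous_intros ci)
    then show ?thesis
      by (rule continuous_on_eq) (use linear_eq_sum_Basis[OF lin[OF U(2)], of _ h] in auto)
  qed
  have "linear (\<lambda>h. \<integral>y. DK x0 y h \<partial>\<sigma>)"
  proof (rule linearI)
    fix h k
    have "(\<integral>y. DK x0 y (h + k) \<partial>\<sigma>) = (\<integral>y. DK x0 y h + DK x0 y k \<partial>\<sigma>)"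
      by (rule Bochner_Integration.integral_cong) (auto simp: linear_add[OF lin[OF U(2)]])
    also have "\<dots> = (\<integral>y. DK x0 y h \<partial>\<sigma>) + (\<integral>y. DK x0 y k \<partial>\<sigma>)"
      by (rule Bochner_Integration.integral_add) (auto intro: continuous_on_sphere_integrable c)
    finally show "(\<integral>y. DK x0 y (h + k) \<partial>\<sigma>) = (\<integral>y. DK x0 y h \<partial>\<sigma>) + (\<integral>y. DK x0 y k \<partial>\<sigma>)" .
  next
    fix a h
    have "(\<integral>y. DK x0 y (a *\<^sub>R h) \<partial>\<sigma>) = (\<integral>y. a *\<^sub>R DK x0 y h \<partial>\<sigma>)"
      by (rule Bochner_Integration.integral_cong) (auto simp: linear_cmul[OF lin[OF U(2)]])
    then show "(\<integral>y. DK x0 y (a *\<^sub>R h) \<partial>\<sigma>) = a *\<^sub>R (\<integral>y. DK x0 y h \<partial>\<sigma>)" by simp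
  qed
  then show "bounded_linear (\<lambda>h. \<integral>y. DK x0 y h \<partial>\<sigma>)"
    by (simp add: linear_conv_bounded_linear)
  fix e :: real assume e: "e > 0"
  \<comment> \<open>The dimension pays for the passage from basis vectors to the operator norm, the
    area for the integration.\<close>
  define e' where "e' = e / (DIM('c) * (measure \<sigma> S + 1))"
  have e': "e' > 0" using e by (simp add: e'_def add_nonneg_pos)
  have "\<exists>X. x0 \<in> X \<and> open X \<and> (\<forall>x\<in>X \<inter> U. \<forall>y\<in>S. dist (DK x y i) (DK x0 y i) \<le> e')" if "i \<in> Basis" for i
    using continuous_on_prod_compactE[OF contD[OF that] compact_sphere U(2) e'] by (metis case_prod_conv)
  then obtain X where X: "\<And>i. i \<in> Basis \<Longrightarrow> x0 \<in> X i \<and> open (X i) \<and> (\<forall>x\<in>X i \<inter> U. \<forall>y\<in>S. dist (DK x y i) (DK x0 y i) \<le> e')"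
    by metis
  have "open (U \<inter> (\<Inter>i\<in>Basis. X i))" "x0 \<in> U \<inter> (\<Inter>i\<in>Basis. X i)"
    using X U by (intro open_Int open_INT; simp) (use X U in simp)
  from openE[OF this] obtain d where d: "d > 0" "ball x0 d \<subseteq> U \<inter> (\<Inter>i\<in>Basis. X i)"
    by metis
  show "\<exists>d>0. \<forall>x. norm (x - x0) < d \<longrightarrow>
      norm ((\<integral>y. K x y \<partial>\<sigma>) - (\<integral>y. K x0 y \<partial>\<sigma>) - (\<integral>y. DK x0 y (x - x0) \<partial>\<sigma>)) \<le> e * norm (x - x0)"
  proof (intro exI conjI allI impI, rule d)
    fix x assume xd: "norm (x - x0) < d"
    then have xU: "x \<in> U" using d by (auto simp: dist_norm norm_minus_commute)
    have bnd: "norm (K x y - K x0 y - DK x0 y (x - x0)) \<le> norm (x - x0) * (DIM('c) * e')" if y: "y \<in> S" for y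
    proof (rule differentiable_bound_linearization[where S = "ball x0 d"])
      fix z assume z: "z \<in> ball x0 d"
      then have zU: "z \<in> U" using d by auto
      show "((\<lambda>x. K x y) has_derivative DK z y) (at z within ball x0 d)"
        using D[OF zU y] by (rule has_derivative_at_withinI)
      have l: "linear (DK z y - DK x0 y)"
        using lin[OF zU y] lin[OF U(2) y] unfolding fun_diff_def by (rule linear_compose_sub)
      have "norm ((DK z y - DK x0 y) h) \<le> DIM('c) * e' * norm h" for h

      proof (rule norm_linear_le_Basis[OF l])
        fix i :: 'c assume i: "i \<in> Basis"
        then have "z \<in> X i \<inter> U" using z d by blast
        then show "norm ((DK z y - DK x0 y) i) \<le> e'" using X[OF i] y by (simp add: dist_norm)
      qed
      then show "onorm (DK z y - DK x0 y) \<le> DIM('c) * e'" by (intro onorm_le) auto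
    next
      fix t :: real assume t: "t \<in> {0..1}"
      have "norm (t *\<^sub>R (x - x0)) \<le> 1 * norm (x - x0)"
        using t by (simp add: mult_left_le_one_le)
      then show "x0 + t *\<^sub>R (x - x0) \<in> ball x0 d" using xd by (simp add: dist_norm)
    qed (use d in auto)
    have i: "integrable \<sigma> (K x)" "integrable \<sigma> (K x0)" "integrable \<sigma> (\<lambda>y. DK x0 y (x - x0))"
      by (intro continuous_on_sphere_integrable contK xU U c)+
    then have "(\<integral>y. K x y \<partial>\<sigma>) - (\<integral>y. K x0 y \<partial>\<sigma>) - (\<integral>y. DK x0 y (x - x0) \<partial>\<sigma>)
      = (\<integral>y. K x y - K x0 y - DK x0 y (x - x0) \<partial>\<sigma>)"
      by simp
    also have "norm \<dots> \<le> (\<integral>y. norm (x - x0) * (DIM('c) * e') \<partial>\<sigma>)"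
      using bnd i by (intro Bochner_Integration.integral_norm_bound_integral) simp_all
    also have "\<dots> = norm (x - x0) * (DIM('c) * e' * measure \<sigma> S)" by simp
    also have "\<dots> \<le> norm (x - x0) * e"
    proof (intro mult_left_mono)
      have "DIM('c) * e' * measure \<sigma> S \<le> DIM('c) * e' * (measure \<sigma> S + 1)"
        using e' by (intro mult_left_mono) auto
      also have "\<dots> = e"
      proof -
        have "measure \<sigma> S + 1 \<noteq> 0" using measure_nonneg[of \<sigma> S] by linarith
        then show ?thesis by (simp add: e'_def)
      qed
      finally show "DIM('c) * e' * measure \<sigma> S \<le> e" .
    qed simp
    finally show "norm ((\<integral>y. K x y \<partial>\<sigma>) - (\<integral>y. K x0 y \<partial>\<sigma>) - (\<integral>y. DK x0 y (x - x0) \<partial>\<sigma>)) \<le> e * norm (x - x0)"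
      by (simp only: mult.commute)
  qed
qed

end

text \<open>The square of the positive part is continuously differentiable, the positive part itself
  is not. This is why the cutoff in Green's identity is squared.\<close>

lemma has_real_derivative_max_sq: "((\<lambda>t. (max 0 t)\<^sup>2) has_real_derivative 2 * max 0 t) (at t)"
proof -
  consider "t > 0" | "t < 0" | "t = 0" by linarith
  then show ?thesis
  proof cases
    case 1
    have "((\<lambda>t. t\<^sup>2) has_real_derivative 2 * max 0 t) (at t)"
      using 1 by (auto intro!: derivative_eq_intros)
    then show ?thesis
      by (rule DERIV_cong_ev[THEN iffD1, OF refl _ refl, rotated])
         (use eventually_nhds_in_open[of "{0<..}" t] 1 in \<open>auto elim!: eventually_mono\<close>)
  next
    case 2
    have "((\<lambda>t. 0) has_real_derivative 2 * max 0 t) (at t)"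
      using 2 by auto
    then show ?thesis
      by (rule DERIV_cong_ev[THEN iffD1, OF refl _ refl, rotated])
         (use eventually_nhds_in_open[of "{..<0}" t] 2 in \<open>auto elim!: eventually_mono\<close>)
  next
    case 3
    have "((\<lambda>h. (max 0 h)\<^sup>2 / h) \<longlongrightarrow> 0) (at (0::real))"
    proof (rule Lim_null_comparison)
      show "\<forall>\<^sub>F h in at 0. norm ((max 0 h)\<^sup>2 / h) \<le> \<bar>h::real\<bar>"
        by (intro always_eventually allI) (auto simp: max_def power2_eq_square)
    qed (auto intro!: tendsto_eq_intros)
    then show ?thesis using 3 by (simp add: DERIV_def)
  qed
qed

text \<open>Euler's identity: differentiate q(t x) = t^k q(x) at t = 1 in both ways.\<close>

lemma homogeneous_euler:
  fixes q :: "'a::euclidean_space \<Rightarrow> real"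
  assumes "(q has_derivative E) (at x)" "\<And>t x. q (t *\<^sub>R x) = t ^ k * q x"
  shows "E x = k * q x"
proof -
  have 1: "((\<lambda>t. t *\<^sub>R x) has_derivative (\<lambda>t. t *\<^sub>R x)) (at (1::real))"
    by (auto intro!: derivative_eq_intros)
  have "((\<lambda>t. q (t *\<^sub>R x)) has_derivative (\<lambda>t. E (t *\<^sub>R x))) (at 1)"
    using has_derivative_compose[OF 1, of q E] assms(1) by simp
  moreover have "((\<lambda>t. q (t *\<^sub>R x)) has_derivative (\<lambda>t. real k * q x * t)) (at 1)"
    unfolding assms(2) by (auto intro!: derivative_eq_intros simp: field_simps)
  ultimately have "(\<lambda>t. E (t *\<^sub>R x)) = (\<lambda>t. real k * q x * t)"
    using has_derivative_unique by blast
  from fun_cong[OF this, of 1] show ?thesis by simp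
qed

text \<open>The weight vanishes at the upper limit, so the first derivative in R produces no
  boundary term and is 2 R times the integral of \<open>u\<close> over [0, R]. Hence that integral
  vanishes for every R, and the second derivative gives \<open>u = 0\<close>.\<close>

lemma continuous_zero_of_integral_zero:
  fixes u :: "real \<Rightarrow> 'b::banach"
  assumes u: "continuous_on {0..<1} u"
    and z: "\<And>R. 0 < R \<Longrightarrow> R < 1 \<Longrightarrow> integral {0..R} (\<lambda>r. (R\<^sup>2 - r\<^sup>2) *\<^sub>R u r) = 0"
    and r: "0 < r" "r < 1"
  shows "u r = 0"
proof -
  \<comment> \<open>An endpoint strictly between \<open>r\<close> and 1: \<open>u\<close> is
    continuous on the compact interval up to it, and \<open>r\<close> is interior.\<close>
  define b where "b = (r + 1) / 2"
  have b: "r < b" "b < 1" "0 < b" using r by (auto simp: b_def)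
  have ub: "continuous_on {0..b} u" using u by (rule continuous_on_subset) (use b in auto)
  have ub2: "continuous_on {0..b} (\<lambda>r. r\<^sup>2 *\<^sub>R u r)" by (intro continuous_intros ub)
  have dU: "((\<lambda>R. integral {0..R} u) has_vector_derivative u x) (at x)" if "0 < x" "x < b" for x
    using integral_has_vector_derivative[OF ub, of x] that by (simp only: at_within_Icc_at atLeastAtMost_iff less_imp_le)
  have dU2: "((\<lambda>R. integral {0..R} (\<lambda>r. r\<^sup>2 *\<^sub>R u r)) has_vector_derivative x\<^sup>2 *\<^sub>R u x) (at x)" if "0 < x" "x < b" for x
    using integral_has_vector_derivative[OF ub2, of x] that by (simp only: at_within_Icc_at atLeastAtMost_iff less_imp_le)
  have eq: "R\<^sup>2 *\<^sub>R integral {0..R} u - integral {0..R} (\<lambda>r. r\<^sup>2 *\<^sub>R u r) = 0" if "0 < R" "R < b" for R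
  proof -
    have "u integrable_on {0..R}" "(\<lambda>r. r\<^sup>2 *\<^sub>R u r) integrable_on {0..R}"
      using continuous_on_subset[OF ub] continuous_on_subset[OF ub2] that
      by (auto intro!: integrable_continuous_real)
    moreover have "(\<lambda>r. (R\<^sup>2 - r\<^sup>2) *\<^sub>R u r) = (\<lambda>r. R\<^sup>2 *\<^sub>R u r - r\<^sup>2 *\<^sub>R u r)"
      by (simp add: scaleR_diff_left)
    ultimately show ?thesis
      using z[of R] that b by (simp add: integral_diff integral_cmul)
  qed
  have U0: "integral {0..x} u = 0" if x: "0 < x" "x < b" for x
  proof -
    have "((\<lambda>R. R\<^sup>2 *\<^sub>R integral {0..R} u - integral {0..R} (\<lambda>r. r\<^sup>2 *\<^sub>R u r)) has_vector_derivative
        (x\<^sup>2 *\<^sub>R u x + (2 * x) *\<^sub>R integral {0..x} u - x\<^sup>2 *\<^sub>R u x)) (at x)"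
      by (intro has_vector_derivative_diff has_vector_derivative_scaleR dU dU2 x)
         (auto intro!: derivative_eq_intros)
    moreover have "((\<lambda>R. R\<^sup>2 *\<^sub>R integral {0..R} u - integral {0..R} (\<lambda>r. r\<^sup>2 *\<^sub>R u r)) has_vector_derivative 0) (at x)"
      by (rule has_vector_derivative_transform_within_open[of "\<lambda>_. 0" _ _ "{0<..<b}"])
         (use x eq in auto)
    ultimately have "x\<^sup>2 *\<^sub>R u x + (2 * x) *\<^sub>R integral {0..x} u - x\<^sup>2 *\<^sub>R u x = 0"
      using vector_derivative_unique_at by blast
    then show ?thesis using x by simp
  qed
  have "((\<lambda>R. integral {0..R} u) has_vector_derivative 0) (at r)"
    by (rule has_vector_derivative_transform_within_open[of "\<lambda>_. 0" _ _ "{0<..<b}"])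
       (use r b U0 in auto)
  then show ?thesis using dU[of r] r b vector_derivative_unique_at by blast
qed

lemma harmonic_onE:
  assumes "harmonic_on f S"
  obtains D D2 where "open S" "\<forall>x\<in>S. (f has_derivative D x) (at x)"
    "\<forall>i\<in>Basis. \<forall>x\<in>S. ((\<lambda>y. D y i) has_derivative D2 i x) (at x)"
    "\<forall>i\<in>Basis. \<forall>j\<in>Basis. continuous_on S (\<lambda>x. D2 i x j)"
    "\<forall>x\<in>S. (\<Sum>i\<in>Basis. D2 i x i) = 0"
  using assms unfolding harmonic_on_def by blast

section \<open>Green's identity for the ball and the moment formula\<close>

context sphere_measure
begin

text \<open>\<open>w i\<close> is the i-th component of the cut-off field and \<open>Dw i x\<close>
  its derivative. In the divergence the products of first derivatives cancel and the second-order
  terms vanish by harmonicity of both functions. Only the gradient of the cutoff survives, paired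
  with the field, and this contribution is -4 \<open>g\<close>.\<close>

lemma green_ball:
  fixes f :: "'a \<Rightarrow> 'b::{banach, second_countable_topology}" and q :: "'a \<Rightarrow> real"
  assumes f1: "\<And>x. x \<in> ball 0 1 \<Longrightarrow> (f has_derivative D x) (at x)"
    and f2: "\<And>i x. i \<in> Basis \<Longrightarrow> x \<in> ball 0 1 \<Longrightarrow> ((\<lambda>y. D y i) has_derivative D2 i x) (at x)"
    and f3: "\<And>i j. i \<in> Basis \<Longrightarrow> j \<in> Basis \<Longrightarrow> continuous_on (ball 0 1) (\<lambda>x. D2 i x j)"
    and f4: "\<And>x. x \<in> ball 0 1 \<Longrightarrow> (\<Sum>i\<in>Basis. D2 i x i) = 0"
    and q1: "\<And>x. (q has_derivative E x) (at x)"
    and q2: "\<And>i x. i \<in> Basis \<Longrightarrow> ((\<lambda>y. E y i) has_derivative E2 i x) (at x)"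
    and q3: "\<And>i j. i \<in> Basis \<Longrightarrow> j \<in> Basis \<Longrightarrow> continuous_on UNIV (\<lambda>x. E2 i x j)"
    and q4: "\<And>x. (\<Sum>i\<in>Basis. E2 i x i) = 0"
    and R: "0 < R" "R < 1"
    and g: "\<And>x. g x = (if x \<in> ball 0 1 then max 0 (R\<^sup>2 - x \<bullet> x) *\<^sub>R (E x x *\<^sub>R f x - q x *\<^sub>R D x x) else 0)"
  shows "integrable lborel g" "(\<integral>x. g x \<partial>lborel) = 0"
proof -
  define w where "w i x = (if x \<in> ball 0 1 then (max 0 (R\<^sup>2 - x \<bullet> x))\<^sup>2 *\<^sub>R (E x i *\<^sub>R f x - q x *\<^sub>R D x i) else 0)" for i x
  define Dw where "Dw i x h = (if x \<in> ball 0 1 then (max 0 (R\<^sup>2 - x \<bullet> x))\<^sup>2 *\<^sub>R (E x i *\<^sub>R D x h + E2 i x h *\<^sub>R f x - (q x *\<^sub>R D2 i x h + E x h *\<^sub>R D x i))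
      + (-4 * max 0 (R\<^sup>2 - x \<bullet> x) * (x \<bullet> h)) *\<^sub>R (E x i *\<^sub>R f x - q x *\<^sub>R D x i) else 0)" for i x h
  have cut0: "max 0 (R\<^sup>2 - x \<bullet> x) = 0" if "norm x > R" for x :: 'a
    using that R power_strict_mono[of R "norm x" 2] by (simp add: dot_square_norm)
  \<comment> \<open>Two open sets cover the space: on the unit ball the formula for the field is
    differentiable, and beyond radius R the cutoff makes everything zero. The overlap needs R <
    1.\<close>
  have Rball: "norm x < 1 \<or> norm x > R" for x :: 'a using R by linarith
  have cut: "((\<lambda>x. (max 0 (R\<^sup>2 - x \<bullet> x))\<^sup>2) has_derivative (\<lambda>h. -4 * max 0 (R\<^sup>2 - x \<bullet> x) * (x \<bullet> h))) (at x)" for x :: 'a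
  proof -
    have 1: "((\<lambda>x. R\<^sup>2 - x \<bullet> x) has_derivative (\<lambda>h. - (2 * (x \<bullet> h)))) (at x)"
      by (auto intro!: derivative_eq_intros simp: inner_commute)
    have "((\<lambda>t. (max 0 t)\<^sup>2) has_derivative (\<lambda>h. 2 * max 0 (R\<^sup>2 - x \<bullet> x) * h)) (at (R\<^sup>2 - x \<bullet> x))"
      using has_real_derivative_max_sq[of "R\<^sup>2 - x \<bullet> x"] by (simp add: has_field_derivative_def)
    from has_derivative_compose[OF 1 this] show ?thesis
      by (simp add: mult_ac)
  qed
  have der: "(w i has_derivative Dw i x) (at x)" if i: "i \<in> Basis" for i x
  proof (cases "norm x < 1")
    case True
    then have x: "x \<in> ball 0 1" by simp
    have "((\<lambda>x. (max 0 (R\<^sup>2 - x \<bullet> x))\<^sup>2 *\<^sub>R (E x i *\<^sub>R f x - q x *\<^sub>R D x i)) has_derivative Dw i x) (at x)"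
      by (rule has_derivative_eq_rhs, (rule has_derivative_scaleR has_derivative_diff cut q1 q2[OF i] f1[OF x] f2[OF i x])+)
         (use x in \<open>simp add: Dw_def fun_eq_iff\<close>)
    then show ?thesis
      by (rule has_derivative_transform_within_open[where s = "ball 0 1"]) (use x in \<open>auto simp: w_def\<close>)
  next
    case False
    then have nx: "norm x > R" using R by linarith
    have "((\<lambda>_. 0) has_derivative Dw i x) (at x)"
      using False by (simp add: Dw_def[abs_def])
    then show ?thesis
      by (rule has_derivative_transform_within_open[where s = "{x. norm x > R}"])
         (use nx cut0 in \<open>auto simp: w_def intro!: open_Collect_less continuous_intros\<close>)
  qed
  have fc: "continuous_on (ball 0 1) f"
    using f1 by (meson continuous_at_imp_continuous_on has_derivative_continuous)
  have Dc: "continuous_on (ball 0 1) (\<lambda>x. D x i)" if "i \<in> Basis" for i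
    using f2[OF that] by (meson continuous_at_imp_continuous_on has_derivative_continuous)
  have qc: "continuous_on A q" for A
    using q1 by (meson continuous_at_imp_continuous_on has_derivative_continuous)
  have Ec: "continuous_on A (\<lambda>x. E x i)" if "i \<in> Basis" for i A
    using q2[OF that] by (meson continuous_at_imp_continuous_on has_derivative_continuous)
  have cont: "continuous_on UNIV (\<lambda>x. Dw i x i)" if i: "i \<in> Basis" for i
  proof -
    have A: "continuous_on (ball 0 1) (\<lambda>x. Dw i x i)"
    proof (rule continuous_on_eq)
      show "continuous_on (ball 0 1) (\<lambda>x. (max 0 (R\<^sup>2 - x \<bullet> x))\<^sup>2 *\<^sub>R (E x i *\<^sub>R D x i + E2 i x i *\<^sub>R f x - (q x *\<^sub>R D2 i x i + E x i *\<^sub>R D x i))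
      + (-4 * max 0 (R\<^sup>2 - x \<bullet> x) * (x \<bullet> i)) *\<^sub>R (E x i *\<^sub>R f x - q x *\<^sub>R D x i))"
        by (intro continuous_intros fc Dc i qc Ec f3 continuous_on_subset[OF q3]) auto
    qed (simp add: Dw_def)
    have B: "continuous_on {x. norm x > R} (\<lambda>x. Dw i x i)"
      by (rule continuous_on_eq[where f = "\<lambda>_. 0"]) (auto simp: Dw_def cut0)
    have "continuous_on (ball 0 1 \<union> {x. norm x > R}) (\<lambda>x. Dw i x i)"
      by (rule continuous_on_open_Un[OF _ _ A B]) (auto intro!: open_Collect_less continuous_intros)
    moreover have "ball 0 1 \<union> {x. norm x > R} = (UNIV :: 'a set)" by (simp add: set_eq_iff Rball)
    ultimately show ?thesis by simp
  qed
  have supp: "w i x = 0" if "norm x \<ge> 1" for i x using that by (simp add: w_def)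
  have lin: "linear (D x)" if "x \<in> ball 0 1" for x using f1[OF that] has_derivative_linear by blast
  have linE: "linear (E x)" for x using q1 has_derivative_linear by blast
  have sum: "(\<Sum>i\<in>Basis. Dw i x i) = (-4) *\<^sub>R g x" for x
  proof (cases "x \<in> ball 0 1")
    case True
    define m where "m = max 0 (R\<^sup>2 - x \<bullet> x)"
    have 1: "Dw i x i = m\<^sup>2 *\<^sub>R (E2 i x i *\<^sub>R f x - q x *\<^sub>R D2 i x i)
      + (-4 * m) *\<^sub>R ((x \<bullet> i) *\<^sub>R (E x i *\<^sub>R f x) - (x \<bullet> i) *\<^sub>R (q x *\<^sub>R D x i))" for i
    proof -
      have "Dw i x i = m\<^sup>2 *\<^sub>R (E x i *\<^sub>R D x i + E2 i x i *\<^sub>R f x - (q x *\<^sub>R D2 i x i + E x i *\<^sub>R D x i))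
          + (-4 * m * (x \<bullet> i)) *\<^sub>R (E x i *\<^sub>R f x - q x *\<^sub>R D x i)"
        by (simp only: Dw_def m_def if_P[OF True])
      also have "\<dots> = m\<^sup>2 *\<^sub>R (E2 i x i *\<^sub>R f x - q x *\<^sub>R D2 i x i)
          + (-4 * m) *\<^sub>R ((x \<bullet> i) *\<^sub>R (E x i *\<^sub>R f x - q x *\<^sub>R D x i))"
        by (simp only: add.commute[of "E x i *\<^sub>R D x i"] add_diff_cancel_right scaleR_scaleR)
      finally show ?thesis by (simp only: scaleR_diff_right)
    qed
    have 2: "(\<Sum>i\<in>Basis. E2 i x i *\<^sub>R f x - q x *\<^sub>R D2 i x i) = (\<Sum>i\<in>Basis. E2 i x i) *\<^sub>R f x - q x *\<^sub>R (\<Sum>i\<in>Basis. D2 i x i)"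
      by (simp only: sum_subtractf scaleR_sum_left scaleR_sum_right)
    have 3: "(\<Sum>i\<in>Basis. (x \<bullet> i) *\<^sub>R (E x i *\<^sub>R f x) - (x \<bullet> i) *\<^sub>R (q x *\<^sub>R D x i))
       = (\<Sum>i\<in>Basis. (x \<bullet> i) *\<^sub>R E x i) *\<^sub>R f x - q x *\<^sub>R (\<Sum>i\<in>Basis. (x \<bullet> i) *\<^sub>R D x i)"
      by (simp only: sum_subtractf scaleR_sum_left scaleR_sum_right scaleR_scaleR real_scaleR_def mult.commute[of "q x"])
    have "(\<Sum>i\<in>Basis. Dw i x i) = m\<^sup>2 *\<^sub>R ((\<Sum>i\<in>Basis. E2 i x i) *\<^sub>R f x - q x *\<^sub>R (\<Sum>i\<in>Basis. D2 i x i))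
      + (-4 * m) *\<^sub>R ((\<Sum>i\<in>Basis. (x \<bullet> i) *\<^sub>R E x i) *\<^sub>R f x - q x *\<^sub>R (\<Sum>i\<in>Basis. (x \<bullet> i) *\<^sub>R D x i))"
      unfolding 1 sum.distrib scaleR_sum_right[symmetric] 2 3 ..
    also have "\<dots> = (-4 * m) *\<^sub>R (E x x *\<^sub>R f x - q x *\<^sub>R D x x)"
      using True by (simp only: q4 f4 linear_eq_sum_Basis[OF lin, of x x, symmetric] linear_eq_sum_Basis[OF linE, of x x, symmetric]) simp
    finally show ?thesis using True by (simp add: g m_def)
  qed (simp add: Dw_def g)
  note ip = integral_partial_0[OF der cont supp]
  have "(\<integral>x. (\<Sum>i\<in>Basis. Dw i x i) \<partial>lborel) = (\<Sum>i\<in>Basis. \<integral>x. Dw i x i \<partial>lborel)"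
    by (rule Bochner_Integration.integral_sum) (rule ip(2))
  also have "\<dots> = 0" by (intro sum.neutral ballI ip(1))
  finally have z: "(\<integral>x. (-4) *\<^sub>R g x \<partial>lborel) = 0" unfolding sum .
  then show "(\<integral>x. g x \<partial>lborel) = 0" by (subst (asm) integral_scaleR_right) simp
  have "integrable lborel (\<lambda>x. \<Sum>i\<in>Basis. Dw i x i)"
    by (rule Bochner_Integration.integrable_sum) (rule ip(2))
  then have "integrable lborel (\<lambda>x. (-1/4) *\<^sub>R ((-4) *\<^sub>R g x))"
    unfolding sum by (rule integrable_scaleR_right[rotated])
  then show "integrable lborel g" by simp
qed

text \<open>
  Green's identity on spheres without a divergence theorem: the field
  \<open>((R\<^sup>2 - |x|\<^sup>2)\<^sub>+)\<^sup>2 (f \<nabla>q - q \<nabla>f)\<close> is continuously differentiable with compact support, so the integral of its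
  divergence vanishes. In polar coordinates, two differentiations in \<open>R\<close> turn this into \<open>r \<Phi>'(r) = k \<Phi>(r)\<close> for
  the moment \<open>\<Phi>\<close>.
\<close>
theorem harmonic_moment:
  fixes f :: "'a \<Rightarrow> 'b::euclidean_space" and q :: "'a \<Rightarrow> real"
  assumes f: "harmonic_on f (ball 0 1)" and q: "harmonic_on q UNIV" and hom: "\<And>t x. q (t *\<^sub>R x) = t ^ k * q x"
  shows "\<exists>c. \<forall>r\<in>{0..<1}. (\<integral>x. q x *\<^sub>R f (r *\<^sub>R x) \<partial>\<sigma>) = r ^ k *\<^sub>R c"
proof -
  obtain D D2 where "open (ball (0::'a) 1)" and f1: "\<forall>x\<in>ball 0 1. (f has_derivative D x) (at x)"
    and f2: "\<forall>i\<in>Basis. \<forall>x\<in>ball 0 1. ((\<lambda>y. D y i) has_derivative D2 i x) (at x)"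
    and f3: "\<forall>i\<in>Basis. \<forall>j\<in>Basis. continuous_on (ball 0 1) (\<lambda>x. D2 i x j)"
    and f4: "\<forall>x\<in>ball 0 1. (\<Sum>i\<in>Basis. D2 i x i) = 0"
    by (rule harmonic_onE[OF f]) (rule that, assumption+)
  note f1 = f1[rule_format] and f2 = f2[rule_format] and f3 = f3[rule_format] and f4 = f4[rule_format]
  obtain E E2 where "open (UNIV::'a set)" and q1: "\<forall>x\<in>UNIV. (q has_derivative E x) (at x)"
    and q2: "\<forall>i\<in>Basis. \<forall>x\<in>UNIV. ((\<lambda>y. E y i) has_derivative E2 i x) (at x)"
    and q3: "\<forall>i\<in>Basis. \<forall>j\<in>Basis. continuous_on UNIV (\<lambda>x. E2 i x j)"
    and q4: "\<forall>x\<in>UNIV. (\<Sum>i\<in>Basis. E2 i x i) = 0"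
    by (rule harmonic_onE[OF q]) (rule that, assumption+)
  note q1 = q1[rule_format, OF UNIV_I] and q2 = q2[rule_format, OF _ UNIV_I] and q3 = q3[rule_format] and q4 = q4[rule_format, OF UNIV_I]
  have fc: "continuous_on (ball 0 1) f"
    using f1 by (meson continuous_at_imp_continuous_on has_derivative_continuous)
  have Dc: "continuous_on (ball 0 1) (\<lambda>x. D x i)" if "i \<in> Basis" for i
    using f2[OF that] by (meson continuous_at_imp_continuous_on has_derivative_continuous)
  have qc: "continuous_on A q" for A
    using q1 by (meson continuous_at_imp_continuous_on has_derivative_continuous)
  have lin: "linear (D x)" if "x \<in> ball 0 1" for x using f1[OF that] has_derivative_linear by blast
  \<comment> \<open>The interval extends to both sides of 0, because the value of the moment at r =
    0 is recovered at the end by continuity.\<close>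
  define U where "U = {-1<..<1::real}"
  have inball: "r *\<^sub>R x \<in> ball 0 1" if "r \<in> U" "x \<in> S" for r and x :: 'a
    using that by (auto simp: U_def)
  have c1: "continuous_on (U \<times> S) (\<lambda>(r, x). q x *\<^sub>R f (r *\<^sub>R x))"
    unfolding case_prod_beta'
    by (intro continuous_intros continuous_on_compose2[OF qc] continuous_on_compose2[OF fc]) (use inball in auto)
  have c2: "continuous_on (U \<times> S) (\<lambda>(r, x). q x *\<^sub>R D (r *\<^sub>R x) x)"
  proof -
    have "continuous_on (U \<times> S) (\<lambda>z. q (snd z) *\<^sub>R (\<Sum>i\<in>Basis. (snd z \<bullet> i) *\<^sub>R D (fst z *\<^sub>R snd z) i))"
      by (intro continuous_intros continuous_on_compose2[OF qc] continuous_on_compose2[OF Dc]) (use inball in auto)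
    then show ?thesis
      by (rule continuous_on_eq) (use linear_eq_sum_Basis[OF lin[OF inball], symmetric] in auto)
  qed
  have i1: "integrable \<sigma> (\<lambda>x. q x *\<^sub>R f (r *\<^sub>R x))" and i2: "integrable \<sigma> (\<lambda>x. q x *\<^sub>R D (r *\<^sub>R x) x)" if "r \<in> U" for r
    using continuous_on_compose2[OF c1, of S "\<lambda>y. (r, y)"] continuous_on_compose2[OF c2, of S "\<lambda>y. (r, y)"] that
    by (auto simp: continuous_on_Pair intro!: continuous_on_sphere_integrable)
  define \<Phi> where "\<Phi> r = (\<integral>x. q x *\<^sub>R f (r *\<^sub>R x) \<partial>\<sigma>)" for r
  define \<Phi>' where "\<Phi>' r = (\<integral>x. q x *\<^sub>R D (r *\<^sub>R x) x \<partial>\<sigma>)" for r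
  have \<Phi>c: "continuous_on U \<Phi>" unfolding \<Phi>_def by (rule continuous_on_integral_sphere[OF c1])
  have \<Phi>'c: "continuous_on U \<Phi>'" unfolding \<Phi>'_def by (rule continuous_on_integral_sphere[OF c2])
  have d\<Phi>: "(\<Phi> has_vector_derivative \<Phi>' r) (at r)" if r: "r \<in> U" for r
  proof -
    have "(\<Phi> has_derivative (\<lambda>h. \<integral>x. q x *\<^sub>R D (r *\<^sub>R x) (h *\<^sub>R x) \<partial>\<sigma>)) (at r)"
      unfolding \<Phi>_def
    proof (rule has_derivative_integral_sphere[where U = U and DK = "\<lambda>r x h. q x *\<^sub>R D (r *\<^sub>R x) (h *\<^sub>R x)"])
      show "open U" by (simp add: U_def)
      fix r :: real and x :: 'a assume rx: "r \<in> U" "x \<in> S"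
      have 1: "((\<lambda>r. r *\<^sub>R x) has_derivative (\<lambda>h. h *\<^sub>R x)) (at r)" by (auto intro!: derivative_eq_intros)
      have "((\<lambda>r. f (r *\<^sub>R x)) has_derivative (\<lambda>h. D (r *\<^sub>R x) (h *\<^sub>R x))) (at r)"
        by (rule has_derivative_compose[OF 1 f1]) (rule inball[OF rx])
      then show "((\<lambda>r. q x *\<^sub>R f (r *\<^sub>R x)) has_derivative (\<lambda>h. q x *\<^sub>R D (r *\<^sub>R x) (h *\<^sub>R x))) (at r)"
        by (rule has_derivative_scaleR_right)
    next
      fix r assume "r \<in> U"
      then show "continuous_on S (\<lambda>x. q x *\<^sub>R f (r *\<^sub>R x))"
        using continuous_on_compose2[OF c1, of S "\<lambda>y. (r, y)"] by (auto simp: continuous_on_Pair)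
    next
      fix i :: real assume "i \<in> Basis"
      then show "continuous_on (U \<times> S) (\<lambda>(r, x). q x *\<^sub>R D (r *\<^sub>R x) (i *\<^sub>R x))"
        using c2 by simp
    qed (rule r)
    moreover have "(\<integral>x. q x *\<^sub>R D (r *\<^sub>R x) (h *\<^sub>R x) \<partial>\<sigma>) = h *\<^sub>R \<Phi>' r" for h
    proof -
      have "(\<integral>x. q x *\<^sub>R D (r *\<^sub>R x) (h *\<^sub>R x) \<partial>\<sigma>) = (\<integral>x. h *\<^sub>R (q x *\<^sub>R D (r *\<^sub>R x) x) \<partial>\<sigma>)"
        using linear_cmul[OF lin[OF inball[OF r]]] by (intro Bochner_Integration.integral_cong) (auto simp: mult.commute)
      also have "\<dots> = h *\<^sub>R \<Phi>' r"
        unfolding \<Phi>'_def by (rule Bochner_Integration.integral_scaleR_right)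
      finally show ?thesis .
    qed
    ultimately show ?thesis by (simp add: has_vector_derivative_def)
  qed
  \<comment> \<open>Radial density r^(n-1), homogeneity factor r^k of \<open>q\<close>, and the
    bracket that has to vanish.\<close>
  define u where "u r = (r ^ (DIM('a) - 1) * r ^ k) *\<^sub>R (k *\<^sub>R \<Phi> r - r *\<^sub>R \<Phi>' r)" for r
  have uc: "continuous_on {0..<1} u"
    unfolding u_def
    by (intro continuous_intros continuous_on_subset[OF \<Phi>c] continuous_on_subset[OF \<Phi>'c]) (auto simp: U_def)
  have zero: "integral {0..R} (\<lambda>r. (R\<^sup>2 - r\<^sup>2) *\<^sub>R u r) = 0" if R: "0 < R" "R < 1" for R
  proof -
    define g where "g x = (if x \<in> ball 0 1 then max 0 (R\<^sup>2 - x \<bullet> x) *\<^sub>R (E x x *\<^sub>R f x - q x *\<^sub>R D x x) else 0)" for x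
    have sub: "{0..R} \<subseteq> {0..<1}" using R by auto
    note gb = green_ball[OF f1 f2 f3 f4 q1 q2 q3 q4 R g_def]
    have gm: "g \<in> borel_measurable borel" using gb(1) by auto
    have "AE x in lborel. indicator (ball 0 1 - {0}) x *\<^sub>R g x = g x"
      using AE_lborel_singleton[of 0] by eventually_elim (auto simp: indicator_def g_def)
    moreover have "(ball 0 1 - {0} :: 'a set) \<in> sets borel" by (intro borel_open open_Diff) auto
    then have "(\<lambda>x. indicator (ball 0 1 - {0}) x *\<^sub>R g x) \<in> borel_measurable lborel"
      using gm by measurable
    ultimately have gi: "integrable lborel (\<lambda>x. indicator (ball 0 1 - {0}) x *\<^sub>R g x)"
      "(\<integral>x. indicator (ball 0 1 - {0}) x *\<^sub>R g x \<partial>lborel) = 0"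
      using gb gm integrable_cong_AE[of "\<lambda>x. indicator (ball 0 1 - {0}) x *\<^sub>R g x" lborel g]
        integral_cong_AE[of "\<lambda>x. indicator (ball 0 1 - {0}) x *\<^sub>R g x" lborel g] by simp_all
    have "0 = (\<integral>r. (r ^ (DIM('a) - 1) * indicator {0<..<1} r) *\<^sub>R (\<integral>x. g (r *\<^sub>R x) \<partial>\<sigma>) \<partial>lborel)"
      using integral_polar[OF gm gi] by simp
    also have "\<dots> = (\<integral>r. indicator {0..R} r *\<^sub>R ((R\<^sup>2 - r\<^sup>2) *\<^sub>R u r) \<partial>lborel)"
    proof -
      have eq: "(r ^ (DIM('a) - 1) * indicator {0<..<1} r) *\<^sub>R (\<integral>x. g (r *\<^sub>R x) \<partial>\<sigma>) = indicator {0..R} r *\<^sub>R ((R\<^sup>2 - r\<^sup>2) *\<^sub>R u r)"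
        if r0: "r \<noteq> 0" for r
      proof (cases "0 < r \<and> r < 1")
        case True
        then have rU: "r \<in> U" by (simp add: U_def)
        have "(\<integral>x. g (r *\<^sub>R x) \<partial>\<sigma>) = (\<integral>x. (max 0 (R\<^sup>2 - r\<^sup>2) * r ^ k) *\<^sub>R (k *\<^sub>R (q x *\<^sub>R f (r *\<^sub>R x)) - r *\<^sub>R (q x *\<^sub>R D (r *\<^sub>R x) x)) \<partial>\<sigma>)"
        proof (rule Bochner_Integration.integral_cong[OF refl])
          fix x assume "x \<in> space \<sigma>"
          then have x: "x \<in> S" by simp
          have e: "E (r *\<^sub>R x) (r *\<^sub>R x) = k * (r ^ k * q x)"
            using homogeneous_euler[OF q1 hom, of "r *\<^sub>R x"] by (simp add: hom)
          have xx: "(r *\<^sub>R x) \<bullet> (r *\<^sub>R x) = r\<^sup>2" using x by (simp add: dot_square_norm power2_eq_square)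
          show "g (r *\<^sub>R x) = (max 0 (R\<^sup>2 - r\<^sup>2) * r ^ k) *\<^sub>R (k *\<^sub>R (q x *\<^sub>R f (r *\<^sub>R x)) - r *\<^sub>R (q x *\<^sub>R D (r *\<^sub>R x) x))"
            unfolding g_def e xx hom
            using inball[OF rU x] linear_cmul[OF lin[OF inball[OF rU x]], of r x]
            by (simp add: scaleR_diff_right algebra_simps)
        qed
        also have "\<dots> = (max 0 (R\<^sup>2 - r\<^sup>2) * r ^ k) *\<^sub>R (k *\<^sub>R \<Phi> r - r *\<^sub>R \<Phi>' r)"
        proof -
          have "(\<integral>x. k *\<^sub>R (q x *\<^sub>R f (r *\<^sub>R x)) - r *\<^sub>R (q x *\<^sub>R D (r *\<^sub>R x) x) \<partial>\<sigma>)
            = (\<integral>x. k *\<^sub>R (q x *\<^sub>R f (r *\<^sub>R x)) \<partial>\<sigma>) - (\<integral>x. r *\<^sub>R (q x *\<^sub>R D (r *\<^sub>R x) x) \<partial>\<sigma>)"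
            by (intro Bochner_Integration.integral_diff integrable_scaleR_right i1 i2 rU)
          also have "(\<integral>x. k *\<^sub>R (q x *\<^sub>R f (r *\<^sub>R x)) \<partial>\<sigma>) = k *\<^sub>R \<Phi> r"
            unfolding \<Phi>_def by (rule Bochner_Integration.integral_scaleR_right)
          also have "(\<integral>x. r *\<^sub>R (q x *\<^sub>R D (r *\<^sub>R x) x) \<partial>\<sigma>) = r *\<^sub>R \<Phi>' r"
            unfolding \<Phi>'_def by (rule Bochner_Integration.integral_scaleR_right)
          finally have *: "(\<integral>x. k *\<^sub>R (q x *\<^sub>R f (r *\<^sub>R x)) - r *\<^sub>R (q x *\<^sub>R D (r *\<^sub>R x) x) \<partial>\<sigma>) = k *\<^sub>R \<Phi> r - r *\<^sub>R \<Phi>' r" .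
          show ?thesis
            unfolding *[symmetric]
            by (rule Bochner_Integration.integral_scaleR_right)
        qed
        finally have *: "(\<integral>x. g (r *\<^sub>R x) \<partial>\<sigma>) = (max 0 (R\<^sup>2 - r\<^sup>2) * r ^ k) *\<^sub>R (k *\<^sub>R \<Phi> r - r *\<^sub>R \<Phi>' r)" .
        show ?thesis
        proof (cases "r \<le> R")
          case True
          then have "R\<^sup>2 - r\<^sup>2 \<ge> 0" using \<open>0 < r \<and> r < 1\<close> by (simp add: power_mono)
          then show ?thesis
            unfolding * using \<open>0 < r \<and> r < 1\<close> True by (simp add: u_def mult_ac)
        next
          case False
          then have "R\<^sup>2 - r\<^sup>2 \<le> 0" using R by (simp add: power_mono)
          then show ?thesis
            unfolding * using False by simp
        qed
      next
        case False
        then show ?thesis using r0 R by (auto simp: indicator_def)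
      qed
      have um: "(\<lambda>r. indicator {0..R} r *\<^sub>R ((R\<^sup>2 - r\<^sup>2) *\<^sub>R u r)) \<in> borel_measurable borel"
        by (rule borel_measurable_continuous_on_indicator)
           (auto intro!: continuous_intros continuous_on_subset[OF uc sub])
      have sw: "(\<lambda>r. (r ^ (DIM('a) - 1) * indicator {0<..<1} r) *\<^sub>R (\<integral>x. g (r *\<^sub>R x) \<partial>\<sigma>))
           = (\<lambda>r. if r = 0 then (0 ^ (DIM('a) - 1) * indicator {0<..<1} (0::real)) *\<^sub>R (\<integral>x. g (0 *\<^sub>R x) \<partial>\<sigma>) else indicator {0..R} r *\<^sub>R ((R\<^sup>2 - r\<^sup>2) *\<^sub>R u r))"
        using eq by auto
      show ?thesis
      proof (rule integral_cong_AE)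
        show "(\<lambda>r. (r ^ (DIM('a) - 1) * indicator {0<..<1} r) *\<^sub>R (\<integral>x. g (r *\<^sub>R x) \<partial>\<sigma>)) \<in> borel_measurable lborel"
          unfolding sw using um by (intro measurable_If) auto
        show "AE r in lborel. (r ^ (DIM('a) - 1) * indicator {0<..<1} r) *\<^sub>R (\<integral>x. g (r *\<^sub>R x) \<partial>\<sigma>) = indicator {0..R} r *\<^sub>R ((R\<^sup>2 - r\<^sup>2) *\<^sub>R u r)"
          using AE_lborel_singleton[of "0::real"] by eventually_elim (rule eq)
      qed (use um in simp)
    qed
    also have "\<dots> = integral {0..R} (\<lambda>r. (R\<^sup>2 - r\<^sup>2) *\<^sub>R u r)"
    proof -
      have "set_integrable lborel {0..R} (\<lambda>r. (R\<^sup>2 - r\<^sup>2) *\<^sub>R u r)"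
        by (rule borel_integrable_atLeastAtMost')
           (auto intro!: continuous_intros continuous_on_subset[OF uc sub])
      from set_borel_integral_eq_integral(2)[OF this] show ?thesis
        by (simp add: set_lebesgue_integral_def)
    qed
    finally show ?thesis by simp
  qed
  have ode: "k *\<^sub>R \<Phi> r = r *\<^sub>R \<Phi>' r" if r: "0 < r" "r < 1" for r
    using continuous_zero_of_integral_zero[OF uc zero r] r by (simp add: u_def)
  \<comment> \<open>\<open>ode\<close> is Euler's differential equation; the integrating factor
    r^(-k) shows that the quotient is constant.\<close>
  obtain c where c: "\<And>r. r \<in> {0<..<1} \<Longrightarrow> inverse (r ^ k) *\<^sub>R \<Phi> r = c"
  proof (rule has_vector_derivative_zero_constant[of "{0<..<1::real}" "\<lambda>r. inverse (r ^ k) *\<^sub>R \<Phi> r"])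
    fix r :: real assume r: "r \<in> {0<..<1}"
    then have rU: "r \<in> U" by (simp add: U_def)
    have 1: "((\<lambda>r. inverse (r ^ k)) has_real_derivative (- (k / r) * inverse (r ^ k))) (at r)"
    proof -
      have "((\<lambda>r. inverse (r ^ k)) has_real_derivative - (inverse (r ^ k) * (k * r ^ (k - Suc 0)) * inverse (r ^ k))) (at r)"
        by (rule DERIV_inverse') (use r DERIV_pow[of k r] in auto)
      moreover have "k * r ^ (k - Suc 0) = k / r * r ^ k" using r by (cases k) auto
      ultimately show ?thesis using r by (simp add: field_simps)
    qed
    have "((\<lambda>r. inverse (r ^ k) *\<^sub>R \<Phi> r) has_vector_derivative
       (inverse (r ^ k) *\<^sub>R \<Phi>' r + (- (k / r) * inverse (r ^ k)) *\<^sub>R \<Phi> r)) (at r)"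
      by (rule has_vector_derivative_scaleR[OF 1 d\<Phi>[OF rU]])
    moreover have "(- (k / r) * inverse (r ^ k)) *\<^sub>R \<Phi> r = - (inverse (r ^ k) *\<^sub>R \<Phi>' r)"
    proof -
      have "(- (k / r) * inverse (r ^ k)) *\<^sub>R \<Phi> r = (- (inverse (r ^ k) / r)) *\<^sub>R (k *\<^sub>R \<Phi> r)"
        by simp
      also have "\<dots> = - (inverse (r ^ k) *\<^sub>R \<Phi>' r)"
        using r by (subst ode) auto
      finally show ?thesis .
    qed
    ultimately show "((\<lambda>r. inverse (r ^ k) *\<^sub>R \<Phi> r) has_vector_derivative 0) (at r within {0<..<1})"
      by (simp add: has_vector_derivative_at_within)
  qed auto
  have pos: "\<Phi> r = r ^ k *\<^sub>R c" if r: "0 < r" "r < 1" for r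
  proof -
    have "\<Phi> r = r ^ k *\<^sub>R (inverse (r ^ k) *\<^sub>R \<Phi> r)" using r by simp
    also have "\<dots> = r ^ k *\<^sub>R c" using c[of r] r by simp
    finally show ?thesis .
  qed
  have "(\<Phi> \<longlongrightarrow> \<Phi> 0) (at_right 0)"
    using \<Phi>c by (auto simp: U_def continuous_on_eq_continuous_at isCont_def filterlim_at_split)
  moreover have "((\<lambda>r. r ^ k *\<^sub>R c) \<longlongrightarrow> 0 ^ k *\<^sub>R c) (at_right (0::real))"
    by (intro tendsto_intros)
  then have "(\<Phi> \<longlongrightarrow> 0 ^ k *\<^sub>R c) (at_right 0)"
    by (rule Lim_transform_eventually)
       (use eventually_at_right_real[of 0 "1::real"] pos in \<open>auto elim!: eventually_mono\<close>)
  ultimately have "\<Phi> 0 = 0 ^ k *\<^sub>R c"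
    by (rule tendsto_unique[rotated]) simp
  then have "\<Phi> r = r ^ k *\<^sub>R c" if "0 \<le> r" "r < 1" for r
    using pos[of r] that by (cases "r = 0") auto
  then show ?thesis
    by (intro exI[of _ c]) (simp add: \<Phi>_def)
qed

end

section \<open>The Poisson kernel\<close>

text \<open>The classical kernel (1 - |x|^2) / |x - y|^n, normalised to the value 1 at the origin.
  It becomes the series \<open>poisson_kernel\<close> after division by the total mass of \<sigma>.
  The power is taken of the squared distance, which is differentiable away from the pole.\<close>

definition poisson_fun :: "'a::euclidean_space \<Rightarrow> 'a \<Rightarrow> real" where
  "poisson_fun y x = (1 - x \<bullet> x) * ((x - y) \<bullet> (x - y)) powr (- real DIM('a) / 2)"

definition poisson_fun' :: "'a::euclidean_space \<Rightarrow> 'a \<Rightarrow> 'a \<Rightarrow> real" where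
  "poisson_fun' y x h = -2 * (x \<bullet> h) * ((x - y) \<bullet> (x - y)) powr (- real DIM('a) / 2)
     - real DIM('a) * (1 - x \<bullet> x) * ((x - y) \<bullet> (x - y)) powr (- real DIM('a) / 2 - 1) * ((x - y) \<bullet> h)"

definition poisson_fun'' :: "'a::euclidean_space \<Rightarrow> 'a \<Rightarrow> 'a \<Rightarrow> 'a \<Rightarrow> real" where
  "poisson_fun'' y i x h = -2 * (h \<bullet> i) * ((x - y) \<bullet> (x - y)) powr (- real DIM('a) / 2)
     + 2 * real DIM('a) * (x \<bullet> i) * ((x - y) \<bullet> (x - y)) powr (- real DIM('a) / 2 - 1) * ((x - y) \<bullet> h)
     + 2 * real DIM('a) * (x \<bullet> h) * ((x - y) \<bullet> (x - y)) powr (- real DIM('a) / 2 - 1) * ((x - y) \<bullet> i)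
     + real DIM('a) * (real DIM('a) + 2) * (1 - x \<bullet> x) * ((x - y) \<bullet> (x - y)) powr (- real DIM('a) / 2 - 2) * ((x - y) \<bullet> h) * ((x - y) \<bullet> i)
     - real DIM('a) * (1 - x \<bullet> x) * ((x - y) \<bullet> (x - y)) powr (- real DIM('a) / 2 - 1) * (h \<bullet> i)"

lemma powr_inner_has_derivative:
  fixes y :: "'a::euclidean_space"
  assumes "x \<noteq> y"
  shows "((\<lambda>x. ((x - y) \<bullet> (x - y)) powr a) has_derivative
     (\<lambda>h. 2 * a * ((x - y) \<bullet> (x - y)) powr (a - 1) * ((x - y) \<bullet> h))) (at x)"
proof -
  have 1: "((\<lambda>x. (x - y) \<bullet> (x - y)) has_derivative (\<lambda>h. 2 * ((x - y) \<bullet> h))) (at x)"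
    by (auto intro!: derivative_eq_intros simp: inner_commute)
  have pos: "(x - y) \<bullet> (x - y) > 0" using assms by simp
  have "((\<lambda>t. t powr a) has_derivative (\<lambda>h. (a * ((x - y) \<bullet> (x - y)) powr (a - 1)) * h)) (at ((x - y) \<bullet> (x - y)))"
    using has_real_derivative_powr[OF pos, of a] by (simp add: has_field_derivative_def)
  then have "((\<lambda>x. (\<lambda>t. t powr a) ((x - y) \<bullet> (x - y))) has_derivative
      (\<lambda>h. (\<lambda>h. (a * ((x - y) \<bullet> (x - y)) powr (a - 1)) * h) (2 * ((x - y) \<bullet> h)))) (at x)"
    by (rule has_derivative_compose[OF 1])
  moreover have "(\<lambda>h. (\<lambda>h. (a * ((x - y) \<bullet> (x - y)) powr (a - 1)) * h) (2 * ((x - y) \<bullet> h)))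
     = (\<lambda>h. 2 * a * ((x - y) \<bullet> (x - y)) powr (a - 1) * ((x - y) \<bullet> h))"
    by (rule ext) (simp only: ac_simps)
  ultimately show ?thesis by metis
qed

lemma poisson_fun_has_derivative:
  fixes y :: "'a::euclidean_space"
  assumes "x \<noteq> y"
  shows "(poisson_fun y has_derivative poisson_fun' y x) (at x)"
proof -
  have "((\<lambda>x. 1 - x \<bullet> x) has_derivative (\<lambda>h. - (2 * (x \<bullet> h)))) (at x)"
    by (auto intro!: derivative_eq_intros simp: inner_commute)
  from has_derivative_mult[OF this powr_inner_has_derivative[OF assms, of "- real DIM('a) / 2"]] show ?thesis
    unfolding poisson_fun_def[abs_def]
    by (rule has_derivative_eq_rhs) (simp add: poisson_fun'_def fun_eq_iff algebra_simps)
qed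

lemma poisson_fun'_has_derivative:
  fixes y :: "'a::euclidean_space"
  assumes "x \<noteq> y"
  shows "((\<lambda>x. poisson_fun' y x i) has_derivative poisson_fun'' y i x) (at x)"
proof -
  have 1: "((\<lambda>x. 1 - x \<bullet> x) has_derivative (\<lambda>h. - (2 * (x \<bullet> h)))) (at x)"
    by (auto intro!: derivative_eq_intros simp: inner_commute)
  have 2: "((\<lambda>x. -2 * (x \<bullet> i)) has_derivative (\<lambda>h. -2 * (h \<bullet> i))) (at x)"
    by (auto intro!: derivative_eq_intros)
  have 3: "((\<lambda>x. (x - y) \<bullet> i) has_derivative (\<lambda>h. h \<bullet> i)) (at x)"
    by (auto intro!: derivative_eq_intros)
  note p = powr_inner_has_derivative[OF assms]
  show ?thesis
    unfolding poisson_fun'_def[abs_def]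
    by (rule has_derivative_eq_rhs, rule has_derivative_diff, rule has_derivative_mult[OF 2 p], rule has_derivative_mult[OF _ 3],
        rule has_derivative_mult[OF _ p], rule has_derivative_mult[OF has_derivative_const 1])
       (simp add: poisson_fun''_def fun_eq_iff algebra_simps)
qed

text \<open>Written with the single power \<open>P\<close>, the sum over the basis collapses to 2 n
  P (- u + 2 x . (x - y) + 1 - |x|^2), and the bracket is 1 - |y|^2 = 0.\<close>

lemma poisson_fun''_laplace:
  fixes y :: "'a::euclidean_space"
  assumes y: "norm y = 1" and x: "x \<noteq> y"
  shows "(\<Sum>i\<in>Basis. poisson_fun'' y i x i) = 0"
proof -
  define u where "u = (x - y) \<bullet> (x - y)"
  define n where "n = real DIM('a)"
  define P where "P = u powr (- n / 2 - 1)"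
  have u: "u > 0" using x by (simp add: u_def)
  have P: "P = u powr (- n / 2) / u" unfolding P_def powr_diff using u by simp
  then have p0: "u powr (- n / 2) = u * P" using u by simp
  have "u powr (- n / 2 - 2) = u powr (- n / 2) / u\<^sup>2" unfolding powr_diff using u by simp
  then have p2: "u powr (- n / 2 - 2) = P / u" using u by (simp add: P power2_eq_square)
  have t: "poisson_fun'' y i x i = -2 * u * P + 4 * n * P * ((x \<bullet> i) * ((x - y) \<bullet> i))
     + n * (n + 2) * (1 - x \<bullet> x) * (P / u) * (((x - y) \<bullet> i) * ((x - y) \<bullet> i)) - n * (1 - x \<bullet> x) * P"
    if "i \<in> Basis" for i
    using that unfolding poisson_fun''_def u_def[symmetric] n_def[symmetric] p0 p2 P_def[symmetric]
    by (simp add: algebra_simps)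
  have "(\<Sum>i\<in>Basis. poisson_fun'' y i x i) = (\<Sum>i\<in>Basis. -2 * u * P + 4 * n * P * ((x \<bullet> i) * ((x - y) \<bullet> i))
     + n * (n + 2) * (1 - x \<bullet> x) * (P / u) * (((x - y) \<bullet> i) * ((x - y) \<bullet> i)) - n * (1 - x \<bullet> x) * P)"
    by (rule sum.cong[OF refl t])
  also have "\<dots> = n * (-2 * u * P) + 4 * n * P * (x \<bullet> (x - y)) + n * (n + 2) * (1 - x \<bullet> x) * (P / u) * u - n * (n * (1 - x \<bullet> x) * P)"
  proof -
    have s: "(\<Sum>i\<in>Basis. (x \<bullet> i) * ((x - y) \<bullet> i)) = x \<bullet> (x - y)" "(\<Sum>i\<in>Basis. ((x - y) \<bullet> i) * ((x - y) \<bullet> i)) = u"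
      unfolding u_def by (rule euclidean_inner[symmetric])+
    have "(\<Sum>i\<in>(Basis::'a set). A + B * f i + C * g i - D) = n * A + B * (\<Sum>i\<in>Basis. f i) + C * (\<Sum>i\<in>Basis. g i) - n * D"
      for A B C D :: real and f g
      by (simp add: sum.distrib sum_subtractf sum_distrib_left n_def)
    from this[of "-2 * u * P" "4 * n * P" "\<lambda>i. (x \<bullet> i) * ((x - y) \<bullet> i)" "n * (n + 2) * (1 - x \<bullet> x) * (P / u)"
        "\<lambda>i. ((x - y) \<bullet> i) * ((x - y) \<bullet> i)" "n * (1 - x \<bullet> x) * P"]
    show ?thesis unfolding s .
  qed
  also have "\<dots> = 2 * n * P * (- u + 2 * (x \<bullet> (x - y)) + (1 - x \<bullet> x))"
    using u by (simp add: field_simps)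
  also have "- u + 2 * (x \<bullet> (x - y)) + (1 - x \<bullet> x) = 0"
  proof -
    have "y \<bullet> y = 1" using y by (simp add: dot_square_norm)
    then show ?thesis by (simp add: u_def inner_diff_left inner_diff_right inner_commute)
  qed
  finally show ?thesis by simp
qed

lemma continuous_on_poisson [continuous_intros]:
  fixes f g :: "'c::topological_space \<Rightarrow> 'a::euclidean_space"
  assumes "continuous_on A f" "continuous_on A g" "\<And>z. z \<in> A \<Longrightarrow> f z \<noteq> g z"
  shows "continuous_on A (\<lambda>z. poisson_fun (g z) (f z))"
    "continuous_on A (\<lambda>z. poisson_fun' (g z) (f z) i)"
    "continuous_on A (\<lambda>z. poisson_fun'' (g z) j (f z) i)"
  unfolding poisson_fun_def poisson_fun'_def poisson_fun''_def
  using assms by (auto intro!: continuous_intros)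

lemma harmonic_on_poisson_fun:
  fixes y :: "'a::euclidean_space"
  assumes y: "norm y = 1"
  shows "harmonic_on (poisson_fun y) (ball 0 1)"
  unfolding harmonic_on_def
proof (intro conjI exI[of _ "poisson_fun' y"] exI[of _ "poisson_fun'' y"] ballI)
  have ne: "x \<noteq> y" if "x \<in> ball 0 1" for x using y that by auto
  fix x i j assume x: "x \<in> ball (0::'a) 1"
  show "(poisson_fun y has_derivative poisson_fun' y x) (at x)"
    by (rule poisson_fun_has_derivative[OF ne[OF x]])
  show "((\<lambda>x. poisson_fun' y x i) has_derivative poisson_fun'' y i x) (at x)"
    by (rule poisson_fun'_has_derivative[OF ne[OF x]])
  show "(\<Sum>i\<in>Basis. poisson_fun'' y i x i) = 0"
    by (rule poisson_fun''_laplace[OF y ne[OF x]])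
next
  fix i j
  show "continuous_on (ball 0 1) (\<lambda>x. poisson_fun'' y i x j)"
    using y by (intro continuous_intros) auto
qed simp

lemma harmonic_on_const: "harmonic_on (\<lambda>_::'a::euclidean_space. c::'b::real_normed_vector) UNIV"
  unfolding harmonic_on_def
  by (intro conjI exI[of _ "\<lambda>_ _. 0"] exI[of _ "\<lambda>_ _ _. 0"]) auto

lemma inner_diff_radial:
  fixes x y :: "'a::euclidean_space"
  assumes "norm x = 1" "norm y = 1"
  shows "(r *\<^sub>R x - y) \<bullet> (r *\<^sub>R x - y) = 1 - 2 * r * (x \<bullet> y) + r\<^sup>2"
proof -
  have "x \<bullet> x = 1" "y \<bullet> y = 1" using assms by (simp_all add: dot_square_norm)
  then show ?thesis by (simp add: inner_diff_left inner_diff_right inner_commute power2_eq_square)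
qed

text \<open>For unit vectors the squared distance depends only on \<open>r\<close> and on the inner
  product \<open>x \<bullet> y\<close>.\<close>

lemma poisson_fun_sym:
  fixes x y :: "'a::euclidean_space"
  assumes "norm x = 1" "norm y = 1"
  shows "poisson_fun y (r *\<^sub>R x) = poisson_fun x (r *\<^sub>R y)"
proof -
  have "x \<bullet> x = 1" "y \<bullet> y = 1" using assms by (simp_all add: dot_square_norm)
  then show ?thesis
    unfolding poisson_fun_def inner_diff_radial[OF assms] inner_diff_radial[OF assms(2,1)] by (simp add: inner_commute)
qed

lemma norm_diff_radial_ge:
  fixes x y :: "'a::euclidean_space"
  assumes "norm x = 1" "norm y = 1" "0 \<le> r" "r < 1"
  shows "1 - r \<le> sqrt ((r *\<^sub>R x - y) \<bullet> (r *\<^sub>R x - y))"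
proof -
  have "norm y - norm (r *\<^sub>R x) \<le> norm (r *\<^sub>R x - y)"
    using norm_triangle_ineq2[of y "r *\<^sub>R x"] by (simp add: norm_minus_commute)
  then show ?thesis using assms by (simp add: norm_eq_sqrt_inner[symmetric])
qed

lemma poisson_fun_nonneg: "norm x \<le> 1 \<Longrightarrow> poisson_fun y x \<ge> 0"
  unfolding poisson_fun_def by (intro mult_nonneg_nonneg) (auto simp: dot_square_norm power_le_one)

lemma poisson_fun_zero [simp]: "norm y = 1 \<Longrightarrow> poisson_fun y 0 = 1"
  by (simp add: poisson_fun_def dot_square_norm)

text \<open>Moving x to r x shifts it by 1 - r \<le> \<delta> / 2, so at least half of the distance
  to the pole remains; the numerator 1 - r^2 then forces decay as r tends to 1.\<close>

lemma poisson_fun_far: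
  fixes x y :: "'a::euclidean_space"
  assumes "norm x = 1" "norm y = 1" "0 \<le> r" "r < 1" "\<delta> \<le> norm (x - y)" "1 - r \<le> \<delta> / 2" "\<delta> > 0"
  shows "poisson_fun y (r *\<^sub>R x) \<le> (1 - r\<^sup>2) * (\<delta> / 2)\<^sup>2 powr (- real DIM('a) / 2)"
proof -
  have "norm (x - y) \<le> norm (x - r *\<^sub>R x) + norm (r *\<^sub>R x - y)"
    using norm_triangle_ineq[of "x - r *\<^sub>R x" "r *\<^sub>R x - y"] by simp
  also have "norm (x - r *\<^sub>R x) = 1 - r"
  proof -
    have "x - r *\<^sub>R x = (1 - r) *\<^sub>R x" by (simp add: scaleR_diff_left)
    then show ?thesis using assms by simp
  qed
  finally have "\<delta> / 2 \<le> norm (r *\<^sub>R x - y)" using assms by linarith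
  then have "(\<delta> / 2)\<^sup>2 \<le> (r *\<^sub>R x - y) \<bullet> (r *\<^sub>R x - y)"
    using assms by (metis dot_square_norm divide_nonneg_nonneg less_imp_le power_mono zero_le_numeral)
  then have "((r *\<^sub>R x - y) \<bullet> (r *\<^sub>R x - y)) powr (- real DIM('a) / 2) \<le> (\<delta> / 2)\<^sup>2 powr (- real DIM('a) / 2)"
    using assms by (intro powr_mono2') auto
  moreover have "1 - r\<^sup>2 \<ge> 0" using assms by (simp add: power_le_one)
  ultimately show ?thesis
    using assms unfolding poisson_fun_def by (simp add: dot_square_norm power2_eq_square mult_left_mono)
qed

text \<open>A radial derivative costs one factor 1 / (1 - r), since |r x - y| \<ge> 1 - r. In the
  constant, the dimension stems from the power and 2 from the numerator of the kernel. This is the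
  source of all bounds for kernels of fractional derivatives.\<close>

lemma poisson_fun'_radial:
  fixes x y :: "'a::euclidean_space"
  assumes "norm x = 1" "norm y = 1" "0 \<le> r" "r < 1"
  shows "\<bar>poisson_fun' y (r *\<^sub>R x) x\<bar> \<le> (real DIM('a) + 2) / (1 - r) * poisson_fun y (r *\<^sub>R x)"
proof -
  define u where "u = (r *\<^sub>R x - y) \<bullet> (r *\<^sub>R x - y)"
  define n where "n = real DIM('a)"
  define p where "p = u powr (- n / 2)"
  have su: "1 - r \<le> sqrt u" unfolding u_def by (rule norm_diff_radial_ge[OF assms])
  have su0: "sqrt u > 0" using su assms by linarith
  have u: "u > 0" using su0 by simp
  have uu: "u = sqrt u * sqrt u" using u by simp
  have p: "p \<ge> 0" by (simp add: p_def)
  have p1: "u powr (- n / 2 - 1) = p / u" using u by (simp add: p_def powr_diff)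
  have r2: "1 - r * r = (1 - r) * (1 + r)" by (simp add: algebra_simps)
  have P: "poisson_fun y (r *\<^sub>R x) = (1 - r * r) * p"
    using assms by (simp add: poisson_fun_def u_def p_def n_def dot_square_norm power2_eq_square)
  have "poisson_fun' y (r *\<^sub>R x) x = -2 * r * p - n * (1 - r * r) * (p / u) * ((r *\<^sub>R x - y) \<bullet> x)"
    unfolding poisson_fun'_def u_def[symmetric] n_def[symmetric] p1 p_def[symmetric]
    using assms by (simp add: dot_square_norm power2_eq_square)
  also have "\<bar>\<dots>\<bar> \<le> 2 * r * p + n * (1 - r * r) * (p / u) * \<bar>(r *\<^sub>R x - y) \<bullet> x\<bar>"
  proof -
    have "\<bar>-2 * r * p - n * (1 - r * r) * (p / u) * ((r *\<^sub>R x - y) \<bullet> x)\<bar>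
       \<le> \<bar>-2 * r * p\<bar> + \<bar>n * (1 - r * r) * (p / u) * ((r *\<^sub>R x - y) \<bullet> x)\<bar>"
      by (rule abs_triangle_ineq4)
    also have "\<bar>n * (1 - r * r) * (p / u) * ((r *\<^sub>R x - y) \<bullet> x)\<bar> = n * (1 - r * r) * (p / u) * \<bar>(r *\<^sub>R x - y) \<bullet> x\<bar>"
      using u p assms by (simp add: abs_mult n_def r2)
    also have "\<bar>-2 * r * p\<bar> = 2 * r * p" using p assms by (simp add: abs_mult)
    finally show ?thesis .
  qed
  also have "\<dots> \<le> 2 * r * p + n * (1 - r * r) * (p / u) * sqrt u"
  proof -
    have "\<bar>(r *\<^sub>R x - y) \<bullet> x\<bar> \<le> sqrt u"
      using Cauchy_Schwarz_ineq2[of "r *\<^sub>R x - y" x] assms by (simp add: u_def norm_eq_sqrt_inner)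
    then show ?thesis
      using u p assms by (intro add_left_mono mult_left_mono) (auto simp: n_def r2)
  qed
  also have "n * (1 - r * r) * (p / u) * sqrt u = n * (1 - r * r) * p / sqrt u"
    using u by (subst (1) uu) (simp add: field_simps)
  also have "\<dots> \<le> n * (1 - r * r) * p / (1 - r)"
    using su p assms by (intro divide_left_mono mult_pos_pos su0) (auto simp: n_def r2)
  also have "2 * r * p \<le> 2 * (1 - r * r) * p / (1 - r)"
  proof -
    have "2 * (1 - r * r) * p / (1 - r) = 2 * (1 + r) * p" using assms by (simp add: r2)
    moreover have "2 * r * p \<le> 2 * (1 + r) * p" using p by (intro mult_right_mono) auto
    ultimately show ?thesis by simp
  qed
  finally show ?thesis
    by (simp add: P n_def[symmetric] add_divide_distrib algebra_simps)
qed

section \<open>Poisson integrals and the approximate identity\<close>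

context sphere_measure
begin

abbreviation "area \<equiv> measure \<sigma> S"

lemma harmonic_on_poisson_integral:
  fixes g :: "'a \<Rightarrow> 'b::{banach, second_countable_topology}"
  assumes g: "continuous_on S g"
  shows "harmonic_on (\<lambda>x. \<integral>y. poisson_fun y x *\<^sub>R g y \<partial>\<sigma>) (ball 0 1)"
  unfolding harmonic_on_def
proof (intro conjI exI[of _ "\<lambda>x h. \<integral>y. poisson_fun' y x h *\<^sub>R g y \<partial>\<sigma>"]
    exI[of _ "\<lambda>i x h. \<integral>y. poisson_fun'' y i x h *\<^sub>R g y \<partial>\<sigma>"] ballI)
  have ne: "x \<noteq> y" if "x \<in> ball 0 1" "y \<in> S" for x y using that by auto
  have gc: "continuous_on (A \<times> S) (\<lambda>z. g (snd z))" for A :: "'a set"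
    by (rule continuous_on_compose2[OF g]) (auto intro!: continuous_intros)
  have K: "continuous_on (ball 0 1 \<times> S) (\<lambda>(x, y). poisson_fun' y x i *\<^sub>R g y)"
    "continuous_on (ball 0 1 \<times> S) (\<lambda>(x, y). poisson_fun'' y j x i *\<^sub>R g y)" for i j
    unfolding case_prod_beta' using ne by (auto intro!: continuous_intros gc)
  fix x :: 'a assume x: "x \<in> ball 0 1"
  have c: "continuous_on S (\<lambda>y. poisson_fun y x *\<^sub>R g y)" "continuous_on S (\<lambda>y. poisson_fun' y x i *\<^sub>R g y)"
     "continuous_on S (\<lambda>y. poisson_fun'' y j x i *\<^sub>R g y)"
    if "x \<in> ball 0 1" for x i j
    using ne that by (auto intro!: continuous_intros g)
  show "((\<lambda>x. \<integral>y. poisson_fun y x *\<^sub>R g y \<partial>\<sigma>) has_derivative (\<lambda>h. \<integral>y. poisson_fun' y x h *\<^sub>R g y \<partial>\<sigma>)) (at x)"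
    by (rule has_derivative_integral_sphere[where U = "ball 0 1"])
       (use x ne in \<open>auto intro!: c K has_derivative_scaleR_left poisson_fun_has_derivative simp del: mem_ball mem_sphere\<close>)
  show "((\<lambda>x. \<integral>y. poisson_fun' y x i *\<^sub>R g y \<partial>\<sigma>) has_derivative (\<lambda>h. \<integral>y. poisson_fun'' y i x h *\<^sub>R g y \<partial>\<sigma>)) (at x)" for i
    by (rule has_derivative_integral_sphere[where U = "ball 0 1"])
       (use x ne in \<open>auto intro!: c K has_derivative_scaleR_left poisson_fun'_has_derivative simp del: mem_ball mem_sphere\<close>)
  have "(\<Sum>i\<in>Basis. \<integral>y. poisson_fun'' y i x i *\<^sub>R g y \<partial>\<sigma>) = (\<integral>y. (\<Sum>i\<in>Basis. poisson_fun'' y i x i *\<^sub>R g y) \<partial>\<sigma>)"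
    by (rule Bochner_Integration.integral_sum[symmetric]) (intro continuous_on_sphere_integrable c x)
  also have "\<dots> = (\<integral>y. 0 \<partial>\<sigma>)"
    by (rule Bochner_Integration.integral_cong)
       (use ne x poisson_fun''_laplace in \<open>auto simp: scaleR_sum_left[symmetric]\<close>)
  finally show "(\<Sum>i\<in>Basis. \<integral>y. poisson_fun'' y i x i *\<^sub>R g y \<partial>\<sigma>) = 0" by simp
next
  have ne: "x \<noteq> y" if "x \<in> ball 0 1" "y \<in> S" for x y using that by auto
  have gc: "continuous_on (A \<times> S) (\<lambda>z. g (snd z))" for A :: "'a set"
    by (rule continuous_on_compose2[OF g]) (auto intro!: continuous_intros)
  fix i j :: 'a
  show "continuous_on (ball 0 1) (\<lambda>x. \<integral>y. poisson_fun'' y i x j *\<^sub>R g y \<partial>\<sigma>)"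
    by (rule continuous_on_integral_sphere)
       (unfold case_prod_beta', use ne in \<open>auto intro!: continuous_intros gc\<close>)
qed simp

lemma continuous_on_poisson_sphere:
  assumes "y \<in> S" "0 \<le> r" "r < 1"
  shows "continuous_on S (\<lambda>x. poisson_fun y (r *\<^sub>R x))"
proof (intro continuous_intros)
  fix z assume "z \<in> S"
  then have "norm (r *\<^sub>R z) < norm y" using assms by simp
  then show "r *\<^sub>R z \<noteq> y" by blast
qed

text \<open>The moment against the constant 1, of degree 0, does not depend on r, and at r = 0 the
  kernel is identically 1.\<close>

lemma poisson_mass:
  assumes y: "y \<in> S" and r: "0 \<le> r" "r < 1"
  shows "(\<integral>x. poisson_fun y (r *\<^sub>R x) \<partial>\<sigma>) = area"
proof -
  have h: "harmonic_on (poisson_fun y) (ball 0 1)" using y by (intro harmonic_on_poisson_fun) auto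
  have hom: "(\<lambda>_. 1 :: real) (t *\<^sub>R x) = t ^ 0 * (\<lambda>_. 1) (x::'a)" for t x by simp
  obtain c where c: "\<forall>r\<in>{0..<1}. (\<integral>x. 1 *\<^sub>R poisson_fun y (r *\<^sub>R x) \<partial>\<sigma>) = r ^ 0 *\<^sub>R c"
    using harmonic_moment[OF h harmonic_on_const hom] by blast
  show ?thesis using bspec[OF c, of 0] bspec[OF c, of r] r y by simp
qed

text \<open>\<open>harmonic_moment\<close>, applied to the kernel itself, gives r^k c with an
  unknown c; letting r tend to 1, where the kernel concentrates at y, identifies c as
  \<open>area * q y\<close>.\<close>

lemma poisson_reproduces:
  assumes y: "y \<in> S" and r: "0 \<le> r" "r < 1"
    and q: "harmonic_on q UNIV" and hom: "\<And>t x. q (t *\<^sub>R x) = t ^ k * q x"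
  shows "(\<integral>x. q x * poisson_fun y (r *\<^sub>R x) \<partial>\<sigma>) = r ^ k * (area * q y)"
proof -
  have h: "harmonic_on (poisson_fun y) (ball 0 1)" using y by (intro harmonic_on_poisson_fun) auto
  obtain c where c': "\<forall>r\<in>{0..<1}. (\<integral>x. q x *\<^sub>R poisson_fun y (r *\<^sub>R x) \<partial>\<sigma>) = r ^ k *\<^sub>R c"
    using harmonic_moment[OF h q hom] by blast
  have c: "(\<integral>x. q x * poisson_fun y (r *\<^sub>R x) \<partial>\<sigma>) = r ^ k * c" if "0 \<le> r" "r < 1" for r
    using c' that by simp
  have qc: "continuous_on A q" for A
  proof -
    obtain E where "\<And>x. (q has_derivative E x) (at x)"
      using q unfolding harmonic_on_def by auto
    then show ?thesis by (meson continuous_at_imp_continuous_on has_derivative_continuous)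
  qed
  have "compact (q ` S)" by (intro compact_continuous_image qc) auto
  then obtain B where B: "\<And>x. x \<in> S \<Longrightarrow> \<bar>q x\<bar> \<le> B"
    using compact_imp_bounded bounded_iff by (metis imageI real_norm_def)
  have B0: "B \<ge> 0" using B[OF y] by linarith
  have key: "\<bar>c - area * q y\<bar> \<le> \<epsilon> * area" if e: "\<epsilon> > 0" for \<epsilon>
  proof -
    obtain \<delta> where d: "\<delta> > 0" "\<And>x. x \<in> S \<Longrightarrow> dist x y < \<delta> \<Longrightarrow> dist (q x) (q y) < \<epsilon>"
      using qc[of S] y e unfolding continuous_on_iff by metis
    define C where "C = (\<delta> / 2)\<^sup>2 powr (- real DIM('a) / 2)"
    have C: "C \<ge> 0" by (simp add: C_def)
    \<comment> \<open>Near y the continuity of \<open>q\<close> leaves \<epsilon> times the mass of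
      the kernel; away from y the kernel is at most (1 - r^2) C.\<close>
    have bnd: "\<bar>r ^ k * c - area * q y\<bar> \<le> (\<epsilon> + 2 * B * ((1 - r\<^sup>2) * C)) * area" if r: "0 \<le> r" "r < 1" "1 - r \<le> \<delta> / 2" for r
    proof -
      note pc = continuous_on_poisson_sphere[OF y r(1,2)]
      have r2: "1 - r\<^sup>2 \<ge> 0" using r by (simp add: power_le_one)
      have "r ^ k * c - area * q y = (\<integral>x. q x * poisson_fun y (r *\<^sub>R x) - q y * poisson_fun y (r *\<^sub>R x) \<partial>\<sigma>)"
        by (subst Bochner_Integration.integral_diff)
           (use c[OF r(1,2)] poisson_mass[OF y r(1,2)] in \<open>auto intro!: continuous_on_sphere_integrable continuous_intros qc pc simp: mult.commute\<close>)
      also have "\<bar>\<dots>\<bar> \<le> (\<integral>x. \<epsilon> * poisson_fun y (r *\<^sub>R x) + 2 * B * ((1 - r\<^sup>2) * C) \<partial>\<sigma>)"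
        unfolding real_norm_def[symmetric]
      proof (rule Bochner_Integration.integral_norm_bound_integral)
        fix x assume "x \<in> space \<sigma>"
        then have x: "x \<in> S" by simp
        have p0: "poisson_fun y (r *\<^sub>R x) \<ge> 0" using x r by (intro poisson_fun_nonneg) auto
        have "norm (q x * poisson_fun y (r *\<^sub>R x) - q y * poisson_fun y (r *\<^sub>R x)) = \<bar>q x - q y\<bar> * poisson_fun y (r *\<^sub>R x)"
          using p0 by (simp add: left_diff_distrib[symmetric] abs_mult)
        also have "\<dots> \<le> \<epsilon> * poisson_fun y (r *\<^sub>R x) + 2 * B * ((1 - r\<^sup>2) * C)"
        proof (cases "dist x y < \<delta>")
          case True
          have "\<bar>q x - q y\<bar> * poisson_fun y (r *\<^sub>R x) \<le> \<epsilon> * poisson_fun y (r *\<^sub>R x)"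
            using d(2)[OF x True] p0 by (intro mult_right_mono) (auto simp: dist_real_def)
          moreover have "0 \<le> 2 * B * ((1 - r\<^sup>2) * C)" using B0 r2 C by simp
          ultimately show ?thesis by linarith
        next
          case False
          have "poisson_fun y (r *\<^sub>R x) \<le> (1 - r\<^sup>2) * C"
            unfolding C_def by (rule poisson_fun_far) (use x y r False d(1) in \<open>auto simp: dist_norm\<close>)
          moreover have "\<bar>q x - q y\<bar> \<le> 2 * B" using B[OF x] B[OF y] by linarith
          ultimately have "\<bar>q x - q y\<bar> * poisson_fun y (r *\<^sub>R x) \<le> 2 * B * ((1 - r\<^sup>2) * C)"
            using p0 by (intro mult_mono) auto
          moreover have "0 \<le> \<epsilon> * poisson_fun y (r *\<^sub>R x)" using e p0 by simp
          ultimately show ?thesis by linarith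
        qed
        finally show "norm (q x * poisson_fun y (r *\<^sub>R x) - q y * poisson_fun y (r *\<^sub>R x))
            \<le> \<epsilon> * poisson_fun y (r *\<^sub>R x) + 2 * B * ((1 - r\<^sup>2) * C)" .
      qed (auto intro!: continuous_on_sphere_integrable continuous_intros qc pc)
      also have "\<dots> = (\<epsilon> + 2 * B * ((1 - r\<^sup>2) * C)) * area"
      proof -
        have "integrable \<sigma> (\<lambda>x. \<epsilon> * poisson_fun y (r *\<^sub>R x))"
          by (intro continuous_on_sphere_integrable continuous_intros pc)
        then show ?thesis
          using poisson_mass[OF y r(1,2)] by (subst Bochner_Integration.integral_add) (auto simp: algebra_simps)
      qed
      finally show ?thesis .
    qed
    have l1: "((\<lambda>r. \<bar>r ^ k * c - area * q y\<bar>) \<longlongrightarrow> \<bar>1 ^ k * c - area * q y\<bar>) (at_left (1::real))"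
      by (intro tendsto_intros)
    have l2: "((\<lambda>r. (\<epsilon> + 2 * B * ((1 - r\<^sup>2) * C)) * area) \<longlongrightarrow> (\<epsilon> + 2 * B * ((1 - 1\<^sup>2) * C)) * area) (at_left (1::real))"
      by (intro tendsto_intros)
    have "\<forall>\<^sub>F r in at_left 1. r \<in> {max 0 (1 - \<delta> / 2)<..<1}"
      using d(1) by (intro eventually_at_left_real) auto
    then have "\<forall>\<^sub>F r in at_left 1. \<bar>r ^ k * c - area * q y\<bar> \<le> (\<epsilon> + 2 * B * ((1 - r\<^sup>2) * C)) * area"
      by eventually_elim (rule bnd, auto)
    from tendsto_le[OF _ l2 l1 this] show ?thesis by simp
  qed
  have "\<bar>c - area * q y\<bar> \<le> 0 + \<epsilon>" if "\<epsilon> > 0" for \<epsilon>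
  proof -
    have t: "area + 1 > 0" by (simp add: add_nonneg_pos)
    have "\<bar>c - area * q y\<bar> \<le> \<epsilon> / (area + 1) * area" by (rule key) (use that t in simp)
    also have "\<dots> \<le> \<epsilon> / (area + 1) * (area + 1)" using that t by (intro mult_left_mono) auto
    also have "\<dots> = \<epsilon>" using t by simp
    finally show ?thesis by simp
  qed
  then have "c = area * q y" using field_le_epsilon[of "\<bar>c - area * q y\<bar>" 0] by fastforce
  then show ?thesis using c[OF r] by simp
qed

end

section \<open>Expansions in spherical harmonics\<close>

text \<open>Once the coefficients below m are known to vanish, division by r^m and r tending to 0
  from the right isolate the m-th one.\<close>

lemma powser_zero_on_reals:
  fixes a :: "nat \<Rightarrow> complex"
  assumes "\<And>r::real. 0 < r \<Longrightarrow> r < 1 \<Longrightarrow> (\<lambda>k. a k * of_real r ^ k) sums 0"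
  shows "a m = 0"
proof (induction m rule: less_induct)
  case (less m)
  define b where "b n = a (n + m)" for n
  have sb: "(\<lambda>n. b n * of_real r ^ n) sums 0" if r: "0 < r" "r < 1" for r :: real
  proof -
    have "(\<lambda>n. a (n + m) * of_real r ^ (n + m)) sums (0 - (\<Sum>i<m. a i * of_real r ^ i))"
      by (rule sums_split_initial_segment[OF assms[OF r]])
    moreover have "(\<Sum>i<m. a i * of_real r ^ i) = 0" using less by simp
    ultimately have "(\<lambda>n. (b n * of_real r ^ n) * of_real r ^ m) sums (0 * of_real r ^ m)"
      by (simp add: b_def power_add mult_ac)
    then show ?thesis using r by (subst (asm) sums_mult2_iff) auto
  qed
  have "summable (\<lambda>n. b n * z ^ n)" if "norm z < 1 / 2" for z
    by (rule powser_inside[OF sums_summable[OF sb[of "1/2"]]]) (use that in auto)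
  then have "(\<lambda>n. b n * z ^ n) sums (\<Sum>n. b n * z ^ n)" if "norm z < 1 / 2" for z
    using that by (simp add: summable_sums)
  then have "((\<lambda>z. \<Sum>n. b n * z ^ n) \<longlongrightarrow> b 0) (at 0)"
    by (intro powser_limit_0[of "1/2"]) auto
  moreover have "filterlim (complex_of_real) (at 0) (at_right 0)"
    by (auto simp: filterlim_at eventually_at_filter intro!: tendsto_eq_intros)
  ultimately have "((\<lambda>r. \<Sum>n. b n * complex_of_real r ^ n) \<longlongrightarrow> b 0) (at_right 0)"
    by (rule filterlim_compose)
  moreover have "\<forall>\<^sub>F r in at_right 0. (\<Sum>n. b n * complex_of_real r ^ n) = 0"
  proof (rule eventually_mono)
    show "\<forall>\<^sub>F r in at_right 0. r \<in> {0<..<1::real}" by (rule eventually_at_right_real) simp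
    fix r :: real assume "r \<in> {0<..<1}"
    then show "(\<Sum>n. b n * complex_of_real r ^ n) = 0" using sums_unique[OF sb[of r]] by simp
  qed
  ultimately have "((\<lambda>_. 0) \<longlongrightarrow> b 0) (at_right (0::real))"
    by (rule Lim_transform_eventually)
  then have "b 0 = 0" by (simp add: tendsto_const_iff)
  then show ?case by (simp add: b_def)
qed

text \<open>\<open>harmonic_on\<close> asks for one choice of derivatives on the whole set.
  \<open>frechet_derivative\<close> makes the choice canonical, so that the local ones agree where
  they overlap.\<close>

lemma harmonic_on_local:
  assumes "open S" "\<And>x. x \<in> S \<Longrightarrow> \<exists>T. x \<in> T \<and> T \<subseteq> S \<and> harmonic_on f T"
  shows "harmonic_on f S"
proof -
  define D where "D x = frechet_derivative f (at x)" for x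
  define D2 where "D2 i x = frechet_derivative (\<lambda>y. D y i) (at x)" for i x
  have loc: "open T \<and> (\<forall>x\<in>T. (f has_derivative D x) (at x)) \<and>
      (\<forall>i\<in>Basis. \<forall>x\<in>T. ((\<lambda>y. D y i) has_derivative D2 i x) (at x)) \<and>
      (\<forall>i\<in>Basis. \<forall>j\<in>Basis. continuous_on T (\<lambda>x. D2 i x j)) \<and> (\<forall>x\<in>T. (\<Sum>i\<in>Basis. D2 i x i) = 0)"
    if T: "harmonic_on f T" for T
  proof -
    obtain E E2 where h: "open T" and E: "\<forall>x\<in>T. (f has_derivative E x) (at x)"
      and E2: "\<forall>i\<in>Basis. \<forall>x\<in>T. ((\<lambda>y. E y i) has_derivative E2 i x) (at x)"
      and c: "\<forall>i\<in>Basis. \<forall>j\<in>Basis. continuous_on T (\<lambda>x. E2 i x j)"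
      and s: "\<forall>x\<in>T. (\<Sum>i\<in>Basis. E2 i x i) = 0"
      by (rule harmonic_onE[OF T]) (rule that, assumption+)
    have D: "D x = E x" if "x \<in> T" for x
      using frechet_derivative_at[of f "E x" x] E that by (simp add: D_def)
    have dD: "((\<lambda>y. D y i) has_derivative E2 i x) (at x)" if "x \<in> T" "i \<in> Basis" for x i
      by (rule has_derivative_transform_within_open[of "\<lambda>y. E y i" _ _ _ T]) (use that E2 h D in auto)
    have D2: "D2 i x = E2 i x" if "x \<in> T" "i \<in> Basis" for x i
      using frechet_derivative_at[OF dD[OF that]] by (simp add: D2_def)
    have "continuous_on T (\<lambda>x. D2 i x j)" if "i \<in> Basis" "j \<in> Basis" for i j
      using c that by (subst continuous_on_cong[OF refl, of _ _ "\<lambda>x. E2 i x j"]) (auto simp: D2)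
    then show ?thesis using h E dD s by (auto simp: D D2)
  qed
  show ?thesis
    unfolding harmonic_on_def
  proof (intro conjI exI[of _ D] exI[of _ D2] ballI)
    show "open S" by fact
    fix x assume x: "x \<in> S"
    obtain T where T: "x \<in> T" "harmonic_on f T" using assms(2)[OF x] by blast
    from loc[OF T(2)] T(1) show "(f has_derivative D x) (at x)"
      "\<And>i. i \<in> Basis \<Longrightarrow> ((\<lambda>y. D y i) has_derivative D2 i x) (at x)" "(\<Sum>i\<in>Basis. D2 i x i) = 0"
      by auto
  next
    fix i j :: 'a assume ij: "i \<in> Basis" "j \<in> Basis"
    have "isCont (\<lambda>x. D2 i x j) x" if x: "x \<in> S" for x
    proof -
      obtain T where T: "x \<in> T" "harmonic_on f T" using assms(2)[OF x] by blast
      from loc[OF T(2)] have "open T" "continuous_on T (\<lambda>x. D2 i x j)" using ij by auto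
      then show ?thesis using T(1) by (simp add: continuous_on_eq_continuous_at)
    qed
    then show "continuous_on S (\<lambda>x. D2 i x j)" by (simp add: continuous_at_imp_continuous_on)
  qed
qed

lemma harmonic_on_dilation:
  fixes f :: "'a::euclidean_space \<Rightarrow> 'b::real_normed_vector"
  assumes f: "harmonic_on f (ball 0 1)" and s: "s > 0"
  shows "harmonic_on (\<lambda>x. f (inverse s *\<^sub>R x)) (ball 0 s)"
proof -
  define r where "r = inverse s"
  have r: "r > 0" using s by (simp add: r_def)
  have sc: "r *\<^sub>R x \<in> ball 0 1" if "x \<in> ball 0 s" for x :: 'a
    using that s by (simp add: r_def field_simps)
  obtain D D2 where h: "\<forall>x\<in>ball 0 1. (f has_derivative D x) (at x)"
    "\<forall>i\<in>Basis. \<forall>x\<in>ball 0 1. ((\<lambda>y. D y i) has_derivative D2 i x) (at x)"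
    "\<forall>i\<in>Basis. \<forall>j\<in>Basis. continuous_on (ball 0 1) (\<lambda>x. D2 i x j)"
    "\<forall>x\<in>ball 0 1. (\<Sum>i\<in>Basis. D2 i x i) = 0"
    by (rule harmonic_onE[OF f]) (rule that, assumption+)
  have lin: "linear (D (r *\<^sub>R x))" if "x \<in> ball 0 s" for x
    using h(1) sc[OF that] has_derivative_linear by blast
  have lin2: "linear (D2 i (r *\<^sub>R x))" if "x \<in> ball 0 s" "i \<in> Basis" for x i
    using h(2) sc[OF that(1)] that(2) has_derivative_linear by blast
  have 1: "((\<lambda>x. r *\<^sub>R x) has_derivative (\<lambda>h. r *\<^sub>R h)) (at x)" for x :: 'a
    by (auto intro!: derivative_eq_intros)
  show ?thesis
    unfolding harmonic_on_def r_def[symmetric]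
  proof (intro conjI exI[of _ "\<lambda>x h. r *\<^sub>R D (r *\<^sub>R x) h"] exI[of _ "\<lambda>i x h. r *\<^sub>R r *\<^sub>R D2 i (r *\<^sub>R x) h"] ballI)
    fix x :: 'a assume x: "x \<in> ball 0 s"
    have "((\<lambda>x. f (r *\<^sub>R x)) has_derivative (\<lambda>h. D (r *\<^sub>R x) (r *\<^sub>R h))) (at x)"
      by (rule has_derivative_compose[OF 1]) (use h(1) sc[OF x] in blast)
    then show "((\<lambda>x. f (r *\<^sub>R x)) has_derivative (\<lambda>h. r *\<^sub>R D (r *\<^sub>R x) h)) (at x)"
      by (simp only: linear_cmul[OF lin[OF x]])
    fix i :: 'a assume i: "i \<in> Basis"
    have "((\<lambda>x. D (r *\<^sub>R x) i) has_derivative (\<lambda>h. D2 i (r *\<^sub>R x) (r *\<^sub>R h))) (at x)"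
      by (rule has_derivative_compose[OF 1]) (use h(2) sc[OF x] i in blast)
    then have "((\<lambda>x. r *\<^sub>R D (r *\<^sub>R x) i) has_derivative (\<lambda>h. r *\<^sub>R D2 i (r *\<^sub>R x) (r *\<^sub>R h))) (at x)"
      by (rule has_derivative_scaleR_right)
    then show "((\<lambda>x. r *\<^sub>R D (r *\<^sub>R x) i) has_derivative (\<lambda>h. r *\<^sub>R r *\<^sub>R D2 i (r *\<^sub>R x) h)) (at x)"
      by (simp only: linear_cmul[OF lin2[OF x i]])
  next
    fix x :: 'a assume x: "x \<in> ball 0 s"
    have "(\<Sum>i\<in>Basis. r *\<^sub>R r *\<^sub>R D2 i (r *\<^sub>R x) i) = r *\<^sub>R r *\<^sub>R (\<Sum>i\<in>Basis. D2 i (r *\<^sub>R x) i)"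
      by (simp only: scaleR_sum_right)
    also have "\<dots> = 0" using h(4) sc[OF x] by simp
    finally show "(\<Sum>i\<in>Basis. r *\<^sub>R r *\<^sub>R D2 i (r *\<^sub>R x) i) = 0" .
  next
    fix i j :: 'a assume ij: "i \<in> Basis" "j \<in> Basis"
    then have "continuous_on (ball 0 1) (\<lambda>x. D2 i x j)" using h(3) by blast
    then have "continuous_on (ball 0 s) (\<lambda>x. D2 i (r *\<^sub>R x) j)"
      by (rule continuous_on_compose2) (use sc in \<open>auto intro!: continuous_intros simp del: mem_ball\<close>)
    then show "continuous_on (ball 0 s) (\<lambda>x. r *\<^sub>R r *\<^sub>R D2 i (r *\<^sub>R x) j)"
      by (intro continuous_intros)
  qed simp
qed

section \<open>Size of spherical harmonics and coefficient families of subexponential growth\<close>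

locale sph_basis = sphere_measure \<sigma> \<kappa> for \<sigma> :: "'a::euclidean_space measure" and \<kappa> +
  fixes Y :: "nat \<Rightarrow> nat \<Rightarrow> 'a \<Rightarrow> real"
  assumes basis: "spherical_harmonic_basis \<sigma> Y"
begin

text \<open>The homogeneous harmonic polynomial behind \<open>Y k j\<close>. The basis functions
  vanish off the sphere, so the polynomial has to be rebuilt by homogeneity.\<close>

definition solid :: "nat \<Rightarrow> nat \<Rightarrow> 'a \<Rightarrow> real" where
  "solid k j x = norm x ^ k * Y k j (direction x)"

lemma solid:
  assumes j: "j \<in> {1..sph_dim TYPE('a) k}"
  shows "harmonic_on (solid k j) UNIV" "solid k j (t *\<^sub>R x) = t ^ k * solid k j x" "x \<in> S \<Longrightarrow> solid k j x = Y k j x"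
proof -
  have "Y k j \<in> spherical_harmonics k"
    using basis j by (auto simp: spherical_harmonic_basis_def)
  then obtain q where q: "Y k j = (\<lambda>x. if x \<in> sphere 0 1 then q x else 0)" "\<And>t x. q (t *\<^sub>R x) = t ^ k * q x" "harmonic_on q UNIV"
    by (auto simp: spherical_harmonics_def)
  have "solid k j = q"
  proof
    fix x
    have "solid k j x = norm x ^ k * q (direction x)" by (simp add: solid_def q(1))
    also have "\<dots> = q (norm x *\<^sub>R direction x)" by (simp only: q(2))
    finally have "solid k j x = q (norm x *\<^sub>R direction x)" .
    then show "solid k j x = q x" by simp
  qed
  then show "harmonic_on (solid k j) UNIV" "solid k j (t *\<^sub>R x) = t ^ k * solid k j x" "x \<in> S \<Longrightarrow> solid k j x = Y k j x"
    using q by auto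
qed

lemma continuous_on_solid: "j \<in> {1..sph_dim TYPE('a) k} \<Longrightarrow> continuous_on A (solid k j)"
  using solid(1)[of j k] unfolding harmonic_on_def
  by (meson UNIV_I continuous_at_imp_continuous_on has_derivative_continuous)

lemma continuous_on_Y: "j \<in> {1..sph_dim TYPE('a) k} \<Longrightarrow> continuous_on S (Y k j)"
  using continuous_on_solid[of j k S] solid(3)[of j k] by (metis (no_types, lifting) continuous_on_eq)

lemma Y_orthonormal:
  assumes "j \<in> {1..sph_dim TYPE('a) k}" "i \<in> {1..sph_dim TYPE('a) l}"
  shows "(\<integral>x. Y k j x * Y l i x \<partial>\<sigma>) = (if k = l \<and> j = i then 1 else 0)"
proof -
  have "\<forall>k. \<forall>j\<in>{1..sph_dim TYPE('a) k}. \<forall>l. \<forall>i\<in>{1..sph_dim TYPE('a) l}. integrable \<sigma> (\<lambda>x. Y k j x * Y l i x) \<and> (\<integral>x. Y k j x * Y l i x \<partial>\<sigma>) = (if k = l \<and> j = i then 1 else 0)"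
    using basis unfolding spherical_harmonic_basis_def by (elim conjE)
  then show ?thesis using assms by blast
qed

lemma Y_poisson:
  assumes "j \<in> {1..sph_dim TYPE('a) k}" "y \<in> S" "0 \<le> r" "r < 1"
  shows "(\<integral>x. Y k j x * poisson_fun y (r *\<^sub>R x) \<partial>\<sigma>) = r ^ k * (area * Y k j y)"
proof -
  have "(\<integral>x. Y k j x * poisson_fun y (r *\<^sub>R x) \<partial>\<sigma>) = (\<integral>x. solid k j x * poisson_fun y (r *\<^sub>R x) \<partial>\<sigma>)"
    by (rule Bochner_Integration.integral_cong) (auto simp: solid(3)[OF assms(1)])
  also have "\<dots> = r ^ k * (area * solid k j y)"
    by (rule poisson_reproduces) (use assms solid in auto)
  finally show ?thesis using solid(3)[OF assms(1,2)] by simp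
qed

lemma S_nonempty: "\<exists>x. x \<in> S"
  using direction_in_sphere by blast

lemma area_pos: "area > 0"
proof -
  obtain x where x: "x \<in> S" using S_nonempty by blast
  have "(\<integral>x. 1 \<partial>\<sigma>) \<noteq> (0::real)"
    using continuous_nonneg_integral_0[of "\<lambda>_. 1", OF _ _ _ x] by fastforce
  then show ?thesis using measure_nonneg[of \<sigma> S] by (auto simp: less_le)
qed

lemma poisson_upper:
  fixes x y :: 'a
  assumes "x \<in> S" "y \<in> S" "0 \<le> r" "r < 1"
  shows "poisson_fun y (r *\<^sub>R x) \<le> (1 - r)\<^sup>2 powr (- real DIM('a) / 2)"
proof -
  have "1 - r \<le> sqrt ((r *\<^sub>R x - y) \<bullet> (r *\<^sub>R x - y))" using assms by (intro norm_diff_radial_ge) auto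
  then have "(1 - r)\<^sup>2 \<le> (sqrt ((r *\<^sub>R x - y) \<bullet> (r *\<^sub>R x - y)))\<^sup>2" using assms by (intro power_mono) auto
  then have "(1 - r)\<^sup>2 \<le> (r *\<^sub>R x - y) \<bullet> (r *\<^sub>R x - y)" by simp
  then have "((r *\<^sub>R x - y) \<bullet> (r *\<^sub>R x - y)) powr (- real DIM('a) / 2) \<le> (1 - r)\<^sup>2 powr (- real DIM('a) / 2)"
    using assms by (intro powr_mono2') auto
  moreover have "1 - (r *\<^sub>R x) \<bullet> (r *\<^sub>R x) \<le> 1" "1 - (r *\<^sub>R x) \<bullet> (r *\<^sub>R x) \<ge> 0"
    using assms by (simp_all add: dot_square_norm power_le_one)
  ultimately show ?thesis
    unfolding poisson_fun_def using mult_mono[of "1 - (r *\<^sub>R x) \<bullet> (r *\<^sub>R x)" 1] by fastforce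
qed

text \<open>Bessel's inequality in degree k for the Poisson kernel with pole y, whose coefficients
  are r^k area Y(y) and whose sup norm is crudely bounded. It takes the place of the addition
  theorem and yields the growth of the basis functions and of the dimensions.\<close>

lemma bessel_poisson:
  assumes y: "y \<in> S" and r: "0 < r" "r < 1"
  shows "(\<Sum>j\<in>{1..sph_dim TYPE('a) k}. (Y k j y)\<^sup>2) * (r ^ k * area)\<^sup>2 \<le> ((1 - r)\<^sup>2 powr (- real DIM('a) / 2))\<^sup>2 * area"
proof -
  define A where "A = r ^ k * area"
  define Z where "Z x = (\<Sum>j\<in>{1..sph_dim TYPE('a) k}. Y k j y * Y k j x)" for x
  define p where "p x = poisson_fun y (r *\<^sub>R x)" for x
  have Zc: "continuous_on S Z" unfolding Z_def by (intro continuous_intros continuous_on_Y)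
  have pc: "continuous_on S p" unfolding p_def by (rule continuous_on_poisson_sphere) (use y r in auto)
  have pZ: "(\<integral>x. p x * Z x \<partial>\<sigma>) = A * (\<Sum>j\<in>{1..sph_dim TYPE('a) k}. (Y k j y)\<^sup>2)"
  proof -
    have "(\<integral>x. p x * Z x \<partial>\<sigma>) = (\<integral>x. (\<Sum>j\<in>{1..sph_dim TYPE('a) k}. Y k j y * (Y k j x * p x)) \<partial>\<sigma>)"
      by (simp add: Z_def sum_distrib_left mult_ac)
    also have "\<dots> = (\<Sum>j\<in>{1..sph_dim TYPE('a) k}. \<integral>x. Y k j y * (Y k j x * p x) \<partial>\<sigma>)"
      by (rule Bochner_Integration.integral_sum) (intro continuous_on_sphere_integrable continuous_intros continuous_on_Y pc)
    also have "\<dots> = (\<Sum>j\<in>{1..sph_dim TYPE('a) k}. Y k j y * (r ^ k * (area * Y k j y)))"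
      using Y_poisson y r by (intro sum.cong refl) (simp add: p_def)
    finally show ?thesis by (simp add: A_def sum_distrib_left power2_eq_square mult_ac)
  qed
  have ZZ: "(\<integral>x. Z x * Z x \<partial>\<sigma>) = (\<Sum>j\<in>{1..sph_dim TYPE('a) k}. (Y k j y)\<^sup>2)"
  proof -
    have "(\<integral>x. Z x * Z x \<partial>\<sigma>) = (\<integral>x. (\<Sum>j\<in>{1..sph_dim TYPE('a) k}. \<Sum>i\<in>{1..sph_dim TYPE('a) k}. (Y k j y * Y k i y) * (Y k j x * Y k i x)) \<partial>\<sigma>)"
      by (simp add: Z_def sum_product mult_ac)
    also have "\<dots> = (\<Sum>j\<in>{1..sph_dim TYPE('a) k}. \<integral>x. (\<Sum>i\<in>{1..sph_dim TYPE('a) k}. (Y k j y * Y k i y) * (Y k j x * Y k i x)) \<partial>\<sigma>)"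
      by (rule Bochner_Integration.integral_sum) (intro continuous_on_sphere_integrable continuous_intros continuous_on_Y)
    also have "\<dots> = (\<Sum>j\<in>{1..sph_dim TYPE('a) k}. \<Sum>i\<in>{1..sph_dim TYPE('a) k}. \<integral>x. (Y k j y * Y k i y) * (Y k j x * Y k i x) \<partial>\<sigma>)"
      by (intro sum.cong refl Bochner_Integration.integral_sum) (intro continuous_on_sphere_integrable continuous_intros continuous_on_Y)
    also have "\<dots> = (\<Sum>j\<in>{1..sph_dim TYPE('a) k}. \<Sum>i\<in>{1..sph_dim TYPE('a) k}. (Y k j y * Y k i y) * (if j = i then 1 else 0))"
      by (intro sum.cong refl) (simp add: Y_orthonormal)
    also have "\<dots> = (\<Sum>j\<in>{1..sph_dim TYPE('a) k}. (Y k j y)\<^sup>2)"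
      by (intro sum.cong refl) (simp add: power2_eq_square if_distrib[of "\<lambda>z. _ * z"] sum.delta cong: if_cong)
    finally show ?thesis .
  qed
  \<comment> \<open>\<open>A * Z\<close> is the orthogonal projection of \<open>p\<close> onto
    degree k.\<close>
  have "0 \<le> (\<integral>x. (p x - A * Z x)\<^sup>2 \<partial>\<sigma>)" by simp
  also have "\<dots> = (\<integral>x. (p x)\<^sup>2 - 2 * A * (p x * Z x) + A\<^sup>2 * (Z x * Z x) \<partial>\<sigma>)"
    by (intro Bochner_Integration.integral_cong refl) (simp add: power2_eq_square algebra_simps)
  also have "\<dots> = (\<integral>x. (p x)\<^sup>2 \<partial>\<sigma>) - 2 * A * (\<integral>x. p x * Z x \<partial>\<sigma>) + A\<^sup>2 * (\<integral>x. Z x * Z x \<partial>\<sigma>)"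
  proof -
    have i: "integrable \<sigma> (\<lambda>x. (p x)\<^sup>2)" "integrable \<sigma> (\<lambda>x. 2 * A * (p x * Z x))" "integrable \<sigma> (\<lambda>x. A\<^sup>2 * (Z x * Z x))"
      by (intro continuous_on_sphere_integrable continuous_intros pc Zc)+
    then show ?thesis by simp
  qed
  also have "\<dots> = (\<integral>x. (p x)\<^sup>2 \<partial>\<sigma>) - A\<^sup>2 * (\<Sum>j\<in>{1..sph_dim TYPE('a) k}. (Y k j y)\<^sup>2)"
    unfolding pZ ZZ by (simp add: power2_eq_square algebra_simps)
  finally have "A\<^sup>2 * (\<Sum>j\<in>{1..sph_dim TYPE('a) k}. (Y k j y)\<^sup>2) \<le> (\<integral>x. (p x)\<^sup>2 \<partial>\<sigma>)" by simp
  also have "\<dots> \<le> (\<integral>x. ((1 - r)\<^sup>2 powr (- real DIM('a) / 2))\<^sup>2 \<partial>\<sigma>)"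
  proof (rule Bochner_Integration.integral_mono)
    fix x assume "x \<in> space \<sigma>"
    then have "x \<in> S" by simp
    then show "(p x)\<^sup>2 \<le> ((1 - r)\<^sup>2 powr (- real DIM('a) / 2))\<^sup>2"
      unfolding p_def using r y poisson_upper[of x y r] by (intro power_mono poisson_fun_nonneg) auto
  qed (auto intro!: continuous_on_sphere_integrable continuous_intros pc)
  finally show ?thesis by (simp add: A_def mult.commute)
qed

text \<open>Boundedness is required for every ratio r < 1 instead of one fixed rate. This makes the
  class closed under products: each factor is given the ratio sqrt r.\<close>

definition growth :: "(nat \<Rightarrow> nat \<Rightarrow> complex) \<Rightarrow> bool" where
  "growth a \<longleftrightarrow> (\<forall>r. 0 < r \<longrightarrow> r < 1 \<longrightarrow> (\<exists>C. \<forall>k. \<forall>j\<in>{1..sph_dim TYPE('a) k}. cmod (a k j) * r ^ k \<le> C))"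

lemma growthD:
  assumes "growth a" "0 < r" "r < 1"
  obtains C where "C \<ge> 0" "\<And>k j. j \<in> {1..sph_dim TYPE('a) k} \<Longrightarrow> cmod (a k j) * r ^ k \<le> C"
proof -
  obtain C where "\<forall>k. \<forall>j\<in>{1..sph_dim TYPE('a) k}. cmod (a k j) * r ^ k \<le> C"
    using assms unfolding growth_def by blast
  then show ?thesis by (intro that[of "max 0 C"]) (auto simp: le_max_iff_disj)
qed

lemma Y_sq_bound:
  assumes r: "0 < r" "r < 1"
  obtains C where "C \<ge> 0" "\<And>k y. y \<in> S \<Longrightarrow> (\<Sum>j\<in>{1..sph_dim TYPE('a) k}. (Y k j y)\<^sup>2) * r ^ k \<le> C"
proof (rule that)
  \<comment> \<open>Bessel's inequality carries the square of s^k.\<close>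
  define s where "s = sqrt r"
  have s: "0 < s" "s < 1" "s\<^sup>2 = r" using r by (auto simp: s_def)
  define B where "B = ((1 - s)\<^sup>2 powr (- real DIM('a) / 2))\<^sup>2 * area / area\<^sup>2"
  show "B \<ge> 0" using area_pos by (simp add: B_def)
  fix k y assume y: "y \<in> S"
  have "(s ^ k * area)\<^sup>2 = r ^ k * area\<^sup>2"
    by (simp add: power_mult_distrib s(3)[symmetric] power_mult[symmetric] mult.commute)
  then show "(\<Sum>j\<in>{1..sph_dim TYPE('a) k}. (Y k j y)\<^sup>2) * r ^ k \<le> B"
    using bessel_poisson[OF y s(1,2), of k] area_pos
    unfolding B_def by (simp add: pos_le_divide_eq mult.assoc)
qed

definition Ysup :: "nat \<Rightarrow> nat \<Rightarrow> real" where
  "Ysup k j = (SUP x\<in>S. \<bar>Y k j x\<bar>)"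

lemma Y_le_Ysup:
  assumes "j \<in> {1..sph_dim TYPE('a) k}" "x \<in> S"
  shows "\<bar>Y k j x\<bar> \<le> Ysup k j"
proof -
  have "compact ((\<lambda>x. \<bar>Y k j x\<bar>) ` S)"
    by (intro compact_continuous_image continuous_intros continuous_on_Y assms) auto
  then have "bdd_above ((\<lambda>x. \<bar>Y k j x\<bar>) ` S)"
    by (intro bounded_imp_bdd_above compact_imp_bounded)
  then show ?thesis unfolding Ysup_def using assms(2) by (rule cSUP_upper[rotated])
qed

lemma Ysup_nonneg: "j \<in> {1..sph_dim TYPE('a) k} \<Longrightarrow> Ysup k j \<ge> 0"
  using Y_le_Ysup[of j k] S_nonempty by (meson abs_ge_zero order_trans)

lemma growth_Ysup: "growth (\<lambda>k j. of_real (Ysup k j))"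
  unfolding growth_def
proof (intro allI impI)
  fix r :: real assume r: "0 < r" "r < 1"
  then have r2: "0 < r\<^sup>2" "r\<^sup>2 < 1" by (auto simp: power_less_one_iff)
  obtain C where C: "C \<ge> 0" "\<And>k y. y \<in> S \<Longrightarrow> (\<Sum>j\<in>{1..sph_dim TYPE('a) k}. (Y k j y)\<^sup>2) * (r\<^sup>2) ^ k \<le> C"
    using Y_sq_bound[OF r2] by blast
  show "\<exists>C. \<forall>k. \<forall>j\<in>{1..sph_dim TYPE('a) k}. cmod (of_real (Ysup k j)) * r ^ k \<le> C"
  proof (intro exI allI ballI)
    fix k j assume j: "j \<in> {1..sph_dim TYPE('a) k}"
    have "\<bar>Y k j x\<bar> \<le> sqrt C / r ^ k" if x: "x \<in> S" for x
    proof -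
      have "(Y k j x)\<^sup>2 \<le> (\<Sum>j\<in>{1..sph_dim TYPE('a) k}. (Y k j x)\<^sup>2)" using j by (intro member_le_sum) auto
      then have "(Y k j x)\<^sup>2 * (r\<^sup>2) ^ k \<le> C" using C(2)[OF x, of k] r
        by (meson mult_right_mono order_trans zero_le_power zero_le_power2)
      then have "(\<bar>Y k j x\<bar> * r ^ k)\<^sup>2 \<le> C" by (simp add: power_mult_distrib power_mult[symmetric] mult.commute)
      then have "\<bar>Y k j x\<bar> * r ^ k \<le> sqrt C" by (rule real_le_rsqrt)
      then show ?thesis using r by (simp add: pos_le_divide_eq)
    qed
    then have "Ysup k j \<le> sqrt C / r ^ k"
      unfolding Ysup_def using S_nonempty by (intro cSUP_least) auto
    then show "cmod (of_real (Ysup k j)) * r ^ k \<le> sqrt C"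
      using r Ysup_nonneg[OF j] by (simp add: pos_le_divide_eq)
  qed
qed

text \<open>Integrating the pointwise bound \<open>Y_sq_bound\<close> over the sphere counts the
  basis functions of degree k, each of norm 1.\<close>

lemma dim_bound:
  assumes r: "0 < r" "r < 1"
  obtains C where "C \<ge> 0" "\<And>k. real (sph_dim TYPE('a) k) * r ^ k \<le> C"
proof -
  obtain C where C: "C \<ge> 0" "\<And>k y. y \<in> S \<Longrightarrow> (\<Sum>j\<in>{1..sph_dim TYPE('a) k}. (Y k j y)\<^sup>2) * r ^ k \<le> C"
    using Y_sq_bound[OF r] by blast
  have "real (sph_dim TYPE('a) k) * r ^ k \<le> C * area" for k
  proof -
    have i: "integrable \<sigma> (\<lambda>y. (Y k j y)\<^sup>2)" if "j \<in> {1..sph_dim TYPE('a) k}" for j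
      by (intro continuous_on_sphere_integrable continuous_intros continuous_on_Y that)
    have "real (sph_dim TYPE('a) k) * r ^ k = (\<Sum>j\<in>{1..sph_dim TYPE('a) k}. \<integral>y. (Y k j y)\<^sup>2 \<partial>\<sigma>) * r ^ k"
      using Y_orthonormal[of _ k _ k] by (simp add: power2_eq_square)
    also have "\<dots> = (\<integral>y. (\<Sum>j\<in>{1..sph_dim TYPE('a) k}. (Y k j y)\<^sup>2) \<partial>\<sigma>) * r ^ k"
      by (subst Bochner_Integration.integral_sum[OF i]) auto
    also have "\<dots> = (\<integral>y. (\<Sum>j\<in>{1..sph_dim TYPE('a) k}. (Y k j y)\<^sup>2) * r ^ k \<partial>\<sigma>)" by simp
    also have "\<dots> \<le> (\<integral>y. C \<partial>\<sigma>)"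
      by (rule Bochner_Integration.integral_mono) (use C i in \<open>auto intro!: integrable_mult_left Bochner_Integration.integrable_sum\<close>)
    finally show ?thesis by (simp add: mult.commute)
  qed
  then show ?thesis using that[of "C * area"] C by simp
qed

lemma growth_mult:
  assumes "growth a" "growth b"
  shows "growth (\<lambda>k j. a k j * b k j)"
  unfolding growth_def
proof (intro allI impI)
  fix r :: real assume r: "0 < r" "r < 1"
  define s where "s = sqrt r"
  have s: "0 < s" "s < 1" "s * s = r" using r by (auto simp: s_def)
  obtain A where A: "A \<ge> 0" "\<And>k j. j \<in> {1..sph_dim TYPE('a) k} \<Longrightarrow> cmod (a k j) * s ^ k \<le> A" using growthD[OF assms(1) s(1,2)] by blast
  obtain B where B: "B \<ge> 0" "\<And>k j. j \<in> {1..sph_dim TYPE('a) k} \<Longrightarrow> cmod (b k j) * s ^ k \<le> B" using growthD[OF assms(2) s(1,2)] by blast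
  have "cmod (a k j * b k j) * r ^ k \<le> A * B" if "j \<in> {1..sph_dim TYPE('a) k}" for k j
  proof -
    have "cmod (a k j * b k j) * r ^ k = (cmod (a k j) * s ^ k) * (cmod (b k j) * s ^ k)"
      by (simp add: norm_mult s(3)[symmetric] power_mult_distrib mult_ac)
    also have "\<dots> \<le> A * B" using A B that s by (intro mult_mono) auto
    finally show ?thesis .
  qed
  then show "\<exists>C. \<forall>k. \<forall>j\<in>{1..sph_dim TYPE('a) k}. cmod (a k j * b k j) * r ^ k \<le> C" by blast
qed

lemma growth_mono:
  assumes "growth b" "\<And>k j. j \<in> {1..sph_dim TYPE('a) k} \<Longrightarrow> cmod (a k j) \<le> cmod (b k j)"
  shows "growth a"
  unfolding growth_def
proof (intro allI impI)
  fix r :: real assume r: "0 < r" "r < 1"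
  obtain B where B: "B \<ge> 0" "\<And>k j. j \<in> {1..sph_dim TYPE('a) k} \<Longrightarrow> cmod (b k j) * r ^ k \<le> B" using growthD[OF assms(1) r] by blast
  have "cmod (a k j) * r ^ k \<le> B" if "j \<in> {1..sph_dim TYPE('a) k}" for k j
    using B(2)[OF that] assms(2)[OF that] r by (meson less_imp_le mult_right_mono order_trans zero_le_power)
  then show "\<exists>C. \<forall>k. \<forall>j\<in>{1..sph_dim TYPE('a) k}. cmod (a k j) * r ^ k \<le> C" by blast
qed

lemma growth_Y: "y \<in> S \<Longrightarrow> growth (\<lambda>k j. of_real (Y k j y))"
  by (rule growth_mono[OF growth_Ysup]) (use Y_le_Ysup in force)

lemma growth_sum:
  assumes a: "growth a" and R: "0 \<le> R" "R < 1"
  obtains C \<rho> where "C \<ge> 0" "0 < \<rho>" "\<rho> < 1" "\<And>k r. 0 \<le> r \<Longrightarrow> r \<le> R \<Longrightarrow> r ^ k * (\<Sum>j\<in>{1..sph_dim TYPE('a) k}. cmod (a k j)) \<le> C * \<rho> ^ k"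
proof -
  \<comment> \<open>Of the three factors t^k one absorbs the coefficients, one the dimension, and
    one is left as geometric majorant. The maximum with 1/2 keeps t positive when R = 0.\<close>
  define t where "t = root 3 (max R (1/2))"
  have "max R (1/2) > 0" "max R (1/2) < 1" using R by (auto simp: max_def)
  then have t: "0 < t" "t < 1" "t ^ 3 = max R (1/2)" by (auto simp: t_def)
  obtain A where A: "A \<ge> 0" "\<And>k j. j \<in> {1..sph_dim TYPE('a) k} \<Longrightarrow> cmod (a k j) * t ^ k \<le> A" using growthD[OF a t(1,2)] by blast
  obtain B where B: "B \<ge> 0" "\<And>k. real (sph_dim TYPE('a) k) * t ^ k \<le> B" using dim_bound[OF t(1,2)] by blast
  have "r ^ k * (\<Sum>j\<in>{1..sph_dim TYPE('a) k}. cmod (a k j)) \<le> (A * B) * t ^ k" if r: "0 \<le> r" "r \<le> R" for k r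
  proof -
    have "r ^ k \<le> (t ^ 3) ^ k" using r t(3) by (intro power_mono) auto
    also have "\<dots> = t ^ k * t ^ k * t ^ k" by (simp only: power3_eq_cube power_mult_distrib)
    finally have "r ^ k * (\<Sum>j\<in>{1..sph_dim TYPE('a) k}. cmod (a k j)) \<le> (t ^ k * t ^ k * t ^ k) * (\<Sum>j\<in>{1..sph_dim TYPE('a) k}. cmod (a k j))"
      by (intro mult_right_mono sum_nonneg) auto
    also have "\<dots> = t ^ k * (t ^ k * (\<Sum>j\<in>{1..sph_dim TYPE('a) k}. cmod (a k j) * t ^ k))"
      by (simp only: sum_distrib_left[symmetric] mult_ac)
    also have "\<dots> \<le> t ^ k * (t ^ k * (\<Sum>j\<in>{1..sph_dim TYPE('a) k}. A))"
      using t A by (intro mult_left_mono sum_mono) auto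
    also have "\<dots> = t ^ k * (A * (real (sph_dim TYPE('a) k) * t ^ k))" by (simp add: mult_ac)
    also have "\<dots> \<le> t ^ k * (A * B)"
      using t A B by (intro mult_left_mono) auto
    finally show ?thesis by (simp add: mult.commute)
  qed
  then show ?thesis using that[of "A * B" t] A B t by auto
qed

section \<open>Sums of expansions, and the expansion of an arbitrary harmonic function\<close>

text \<open>The component of degree k, as a function on the sphere; the series \<open>F a\<close> is
  a power series in the radius with these coefficients.\<close>

definition T :: "(nat \<Rightarrow> nat \<Rightarrow> complex) \<Rightarrow> nat \<Rightarrow> 'a \<Rightarrow> complex" where
  "T a k x = (\<Sum>j\<in>{1..sph_dim TYPE('a) k}. a k j * of_real (Y k j x))"

lemma continuous_on_T: "continuous_on S (T a k)"
  unfolding T_def by (intro continuous_intros continuous_on_Y)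

lemma sph_term_T: "sph_term Y a z k = of_real (norm z ^ k) * T a k (direction z)"
  by (simp add: sph_term_def T_def)

lemma sph_term_solid: "sph_term Y a z k = (\<Sum>j\<in>{1..sph_dim TYPE('a) k}. a k j * of_real (solid k j z))"
  by (simp add: sph_term_def solid_def sum_distrib_left mult_ac)

lemma sph_term_scale: "x \<in> S \<Longrightarrow> sph_term Y a (r *\<^sub>R x) k = of_real (r ^ k) * T a k x"
  unfolding sph_term_solid T_def sum_distrib_left
  by (intro sum.cong refl) (simp add: solid)

lemma T_bound:
  assumes a: "growth a" and R: "0 \<le> R" "R < 1"
  obtains C \<rho> where "C \<ge> 0" "0 < \<rho>" "\<rho> < 1"
    "\<And>k r x. 0 \<le> r \<Longrightarrow> r \<le> R \<Longrightarrow> x \<in> S \<Longrightarrow> r ^ k * cmod (T a k x) \<le> C * \<rho> ^ k"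
proof -
  obtain C \<rho> where C: "C \<ge> 0" "0 < \<rho>" "\<rho> < 1"
    "\<And>k r. 0 \<le> r \<Longrightarrow> r \<le> R \<Longrightarrow> r ^ k * (\<Sum>j\<in>{1..sph_dim TYPE('a) k}. cmod (a k j * of_real (Ysup k j))) \<le> C * \<rho> ^ k"
    using growth_sum[OF growth_mult[OF a growth_Ysup] R] by blast
  have "r ^ k * cmod (T a k x) \<le> C * \<rho> ^ k" if r: "0 \<le> r" "r \<le> R" and x: "x \<in> S" for k r x
  proof -
    have "cmod (T a k x) \<le> (\<Sum>j\<in>{1..sph_dim TYPE('a) k}. cmod (a k j * of_real (Y k j x)))"
      unfolding T_def by (rule norm_sum)
    also have "\<dots> \<le> (\<Sum>j\<in>{1..sph_dim TYPE('a) k}. cmod (a k j * of_real (Ysup k j)))"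
      using Y_le_Ysup[OF _ x] Ysup_nonneg by (intro sum_mono) (auto simp: norm_mult intro!: mult_left_mono)
    finally have "r ^ k * cmod (T a k x) \<le> r ^ k * (\<Sum>j\<in>{1..sph_dim TYPE('a) k}. cmod (a k j * of_real (Ysup k j)))"
      using r by (intro mult_left_mono) auto
    then show ?thesis using C(4)[OF r, of k] by linarith
  qed
  then show ?thesis using that[of C \<rho>] C by blast
qed

abbreviation "F \<equiv> sph_series Y"

lemma summable_T:
  assumes "growth a" "0 \<le> r" "r < 1" "x \<in> S"
  shows "summable (\<lambda>k. cmod (of_real (r ^ k) * T a k x))"
proof -
  obtain C \<rho> where C: "C \<ge> 0" "0 < \<rho>" "\<rho> < 1"
    "\<And>k r' x. 0 \<le> r' \<Longrightarrow> r' \<le> r \<Longrightarrow> x \<in> S \<Longrightarrow> r' ^ k * cmod (T a k x) \<le> C * \<rho> ^ k"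
    using T_bound[OF assms(1-3)] by blast
  show ?thesis
    by (rule summable_comparison_test'[of "\<lambda>k. C * \<rho> ^ k" 0])
       (use C assms in \<open>auto intro!: summable_mult summable_geometric simp: norm_mult norm_power\<close>)
qed

lemma F_sums:
  assumes "growth a" "0 \<le> r" "r < 1" "x \<in> S"
  shows "(\<lambda>k. of_real (r ^ k) * T a k x) sums F a (r *\<^sub>R x)"
  unfolding sph_series_def sph_term_scale[OF assms(4)]
  by (rule summable_sums[OF summable_norm_cancel[OF summable_T[OF assms]]])

lemma sph_term_sums:
  assumes "growth a" "z \<in> ball 0 1"
  shows "sph_term Y a z sums F a z"
proof -
  have "sph_term Y a z = (\<lambda>k. of_real (norm z ^ k) * T a k (direction z))"
    by (rule ext) (rule sph_term_T)
  then show ?thesis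
    using F_sums[OF assms(1), of "norm z" "direction z"] assms(2) by simp
qed

lemma growth_convergent: "growth a \<Longrightarrow> sph_convergent Y a"
  unfolding sph_convergent_def using sph_term_sums sums_summable by blast

lemma continuous_on_F:
  assumes a: "growth a"
  shows "continuous_on (ball 0 1) (F a)"
proof -
  have "continuous_on (cball 0 R) (F a)" if R: "0 \<le> R" "R < 1" for R
  proof -
    obtain C \<rho> where C: "C \<ge> 0" "0 < \<rho>" "\<rho> < 1"
      "\<And>k r x. 0 \<le> r \<Longrightarrow> r \<le> R \<Longrightarrow> x \<in> S \<Longrightarrow> r ^ k * cmod (T a k x) \<le> C * \<rho> ^ k"
      using T_bound[OF a R] by blast
    have "uniform_limit (cball 0 R) (\<lambda>n z. \<Sum>k<n. sph_term Y a z k) (\<lambda>z. \<Sum>k. sph_term Y a z k) sequentially"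
    proof (rule Weierstrass_m_test)
      show "summable (\<lambda>k. C * \<rho> ^ k)" using C by (intro summable_mult summable_geometric) auto
      fix k and z :: 'a assume "z \<in> cball 0 R"
      then show "norm (sph_term Y a z k) \<le> C * \<rho> ^ k"
        unfolding sph_term_T using C(4)[of "norm z" "direction z" k] by (simp add: norm_mult norm_power)
    qed
    then show ?thesis
      unfolding sph_series_def
      by (rule uniform_limit_theorem[rotated])
         (auto intro!: always_eventually continuous_intros continuous_on_solid simp: sph_term_solid)
  qed
  note c = this
  have "isCont (F a) z" if z: "z \<in> ball 0 1" for z
  proof -
    define R where "R = (1 + norm z) / 2"
    have R: "0 \<le> R" "R < 1" "norm z < R" using z by (auto simp: R_def)
    have "continuous_on (ball 0 R) (F a)" by (rule continuous_on_subset[OF c[OF R(1,2)]]) auto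
    then show ?thesis using R by (simp add: continuous_on_eq_continuous_at)
  qed
  then show ?thesis by (simp add: continuous_at_imp_continuous_on)
qed

lemma continuous_on_F_scaled:
  assumes "growth a" "0 \<le> r" "r < 1"
  shows "continuous_on S (\<lambda>x. F a (r *\<^sub>R x))"
  by (rule continuous_on_compose2[OF continuous_on_F[OF assms(1)]]) (use assms in \<open>auto intro!: continuous_intros\<close>)

lemma integral_F_sums:
  assumes a: "growth a" "0 \<le> r" "r < 1" and h: "continuous_on S h"
  shows "(\<lambda>k. of_real (r ^ k) * (\<integral>x. h x * T a k x \<partial>\<sigma>)) sums (\<integral>x. h x * F a (r *\<^sub>R x) \<partial>\<sigma>)"
proof -
  obtain C \<rho> where C: "C \<ge> 0" "0 < \<rho>" "\<rho> < 1"
    "\<And>k r' x. 0 \<le> r' \<Longrightarrow> r' \<le> r \<Longrightarrow> x \<in> S \<Longrightarrow> r' ^ k * cmod (T a k x) \<le> C * \<rho> ^ k"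
    using T_bound[OF assms(1-3)] by blast
  have "compact (h ` S)" by (intro compact_continuous_image h) auto
  then obtain B where B: "\<And>x. x \<in> S \<Longrightarrow> cmod (h x) \<le> B"
    using compact_imp_bounded bounded_iff by (metis imageI)
  have B0: "B \<ge> 0" using B S_nonempty norm_ge_zero order_trans by blast
  have i: "integrable \<sigma> (\<lambda>x. h x * (of_real (r ^ k) * T a k x))" for k
    by (intro continuous_on_sphere_integrable continuous_intros h continuous_on_T)
  have bnd: "norm (h x * (of_real (r ^ k) * T a k x)) \<le> B * (C * \<rho> ^ k)" if "x \<in> S" for x k
    using B[OF that] C(4)[of r x k] that a B0 by (auto simp: norm_mult norm_power intro!: mult_mono)
  have sm: "summable (\<lambda>k. B * (C * \<rho> ^ k))" using C by (intro summable_mult summable_geometric) auto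
  have "(\<lambda>k. \<integral>x. h x * (of_real (r ^ k) * T a k x) \<partial>\<sigma>) sums (\<integral>x. (\<Sum>k. h x * (of_real (r ^ k) * T a k x)) \<partial>\<sigma>)"
  proof (rule sums_integral[OF i])
    show "AE x in \<sigma>. summable (\<lambda>k. norm (h x * (of_real (r ^ k) * T a k x)))"
      by (rule AE_I2) (rule summable_comparison_test'[OF sm, of 0], use bnd in auto)
    have "norm (\<integral>x. norm (h x * (of_real (r ^ k) * T a k x)) \<partial>\<sigma>) \<le> area * (B * (C * \<rho> ^ k))" for k
    proof -
      have "(\<integral>x. norm (h x * (of_real (r ^ k) * T a k x)) \<partial>\<sigma>) \<le> (\<integral>x. B * (C * \<rho> ^ k) \<partial>\<sigma>)"
        by (rule Bochner_Integration.integral_mono) (use bnd i in \<open>auto intro!: integrable_norm\<close>)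
      then show ?thesis by simp
    qed
    then show "summable (\<lambda>k. \<integral>x. norm (h x * (of_real (r ^ k) * T a k x)) \<partial>\<sigma>)"
      by (intro summable_comparison_test'[OF summable_mult[OF sm, of area], of 0]) blast
  qed
  moreover have "(\<integral>x. (\<Sum>k. h x * (of_real (r ^ k) * T a k x)) \<partial>\<sigma>) = (\<integral>x. h x * F a (r *\<^sub>R x) \<partial>\<sigma>)"
    by (rule Bochner_Integration.integral_cong[OF refl])
       (use sums_mult[OF F_sums[OF a], THEN sums_unique] in auto)
  moreover have "(\<integral>x. h x * (of_real (r ^ k) * T a k x) \<partial>\<sigma>) = of_real (r ^ k) * (\<integral>x. h x * T a k x \<partial>\<sigma>)" for k
  proof -
    have "(\<integral>x. h x * (of_real (r ^ k) * T a k x) \<partial>\<sigma>) = (\<integral>x. of_real (r ^ k) * (h x * T a k x) \<partial>\<sigma>)"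
      by (rule Bochner_Integration.integral_cong) (auto simp: mult_ac)
    then show ?thesis by simp
  qed
  ultimately show ?thesis by simp
qed

lemma integral_Y_T:
  assumes j: "j \<in> {1..sph_dim TYPE('a) k}"
  shows "(\<integral>x. of_real (Y k j x) * T a l x \<partial>\<sigma>) = (if k = l then a k j else 0)"
proof -
  have "(\<integral>x. of_real (Y k j x) * T a l x \<partial>\<sigma>) = (\<integral>x. (\<Sum>i\<in>{1..sph_dim TYPE('a) l}. a l i * of_real (Y k j x * Y l i x)) \<partial>\<sigma>)"
    by (simp add: T_def sum_distrib_left mult_ac)
  also have "\<dots> = (\<Sum>i\<in>{1..sph_dim TYPE('a) l}. \<integral>x. a l i * of_real (Y k j x * Y l i x) \<partial>\<sigma>)"
    by (rule Bochner_Integration.integral_sum) (intro continuous_on_sphere_integrable continuous_intros continuous_on_Y j)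
  also have "\<dots> = (\<Sum>i\<in>{1..sph_dim TYPE('a) l}. if k = l \<and> j = i then a k j else 0)"
  proof (intro sum.cong refl)
    fix i assume i: "i \<in> {1..sph_dim TYPE('a) l}"
    have "(\<integral>x. a l i * of_real (Y k j x * Y l i x) \<partial>\<sigma>) = a l i * of_real (\<integral>x. Y k j x * Y l i x \<partial>\<sigma>)"
      by (simp only: integral_mult_right_zero integral_complex_of_real)
    then show "(\<integral>x. a l i * of_real (Y k j x * Y l i x) \<partial>\<sigma>) = (if k = l \<and> j = i then a k j else 0)"
      unfolding Y_orthonormal[OF j i] by auto
  qed
  also have "\<dots> = (if k = l then a k j else 0)"
    using j by (auto simp: sum.delta)
  finally show ?thesis .
qed

lemma F_coeff:
  assumes "growth a" "0 \<le> r" "r < 1" "j \<in> {1..sph_dim TYPE('a) k}"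
  shows "(\<integral>x. of_real (Y k j x) * F a (r *\<^sub>R x) \<partial>\<sigma>) = of_real (r ^ k) * a k j"
proof -
  have "(\<lambda>l. of_real (r ^ l) * (if k = l then a k j else 0)) sums (\<integral>x. of_real (Y k j x) * F a (r *\<^sub>R x) \<partial>\<sigma>)"
    using integral_F_sums[OF assms(1-3), of "\<lambda>x. of_real (Y k j x)"] continuous_on_Y[OF assms(4)]
    by (simp add: integral_Y_T[OF assms(4)] continuous_intros)
  moreover have "(\<lambda>l. of_real (r ^ l) * (if k = l then a k j else 0)) sums (of_real (r ^ k) * a k j)"
    using sums_single[of k "\<lambda>l. of_real (r ^ l) * a k j"] by (simp add: if_distrib[of "\<lambda>z. _ * z"] eq_commute cong: if_cong)
  ultimately show ?thesis using sums_unique2 by blast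
qed

text \<open>In degree k the Poisson integral acts as the scalar r^k area, so on the boundary values
  F(s y) it acts as a dilation. Harmonicity of \<open>F a\<close> and monotonicity of its means both
  come from this identity.\<close>

lemma F_poisson:
  assumes a: "growth a" and r: "0 \<le> r" "r < 1" and s: "0 \<le> s" "s < 1" and x: "x \<in> S"
  shows "(\<integral>y. poisson_fun y (r *\<^sub>R x) *\<^sub>R F a (s *\<^sub>R y) \<partial>\<sigma>) = area *\<^sub>R F a ((r * s) *\<^sub>R x)"
proof -
  have pc: "continuous_on S (\<lambda>y. complex_of_real (poisson_fun x (r *\<^sub>R y)))"
    by (intro continuous_intros continuous_on_poisson_sphere x r)
  have pT: "(\<integral>y. of_real (poisson_fun x (r *\<^sub>R y)) * T a k y \<partial>\<sigma>) = of_real (r ^ k * area) * T a k x" for k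
  proof -
    have "(\<integral>y. of_real (poisson_fun x (r *\<^sub>R y)) * T a k y \<partial>\<sigma>) = (\<integral>y. (\<Sum>j\<in>{1..sph_dim TYPE('a) k}. a k j * of_real (Y k j y * poisson_fun x (r *\<^sub>R y))) \<partial>\<sigma>)"
      by (simp add: T_def sum_distrib_left mult_ac)
    also have "\<dots> = (\<Sum>j\<in>{1..sph_dim TYPE('a) k}. \<integral>y. a k j * of_real (Y k j y * poisson_fun x (r *\<^sub>R y)) \<partial>\<sigma>)"
      by (rule Bochner_Integration.integral_sum)
         (intro continuous_on_sphere_integrable continuous_intros continuous_on_Y continuous_on_poisson_sphere x r)
    also have "\<dots> = (\<Sum>j\<in>{1..sph_dim TYPE('a) k}. a k j * of_real (r ^ k * (area * Y k j x)))"
      by (intro sum.cong refl) (simp only: integral_mult_right_zero integral_complex_of_real Y_poisson x r)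
    finally show ?thesis by (simp add: T_def sum_distrib_left mult_ac)
  qed
  have 1: "(\<lambda>k. of_real (s ^ k) * (of_real (r ^ k * area) * T a k x)) sums (\<integral>y. of_real (poisson_fun x (r *\<^sub>R y)) * F a (s *\<^sub>R y) \<partial>\<sigma>)"
    using integral_F_sums[OF a s pc] unfolding pT .
  have "r * s \<le> 1 * s" using r s by (intro mult_right_mono) auto
  then have rs: "0 \<le> r * s" "r * s < 1" using r s by auto
  have 2: "(\<lambda>k. of_real area * (of_real ((r * s) ^ k) * T a k x)) sums (of_real area * F a ((r * s) *\<^sub>R x))"
    by (intro sums_mult F_sums a x rs)
  have 3: "(\<lambda>k. of_real area * (of_real ((r * s) ^ k) * T a k x)) = (\<lambda>k. of_real (s ^ k) * (of_real (r ^ k * area) * T a k x))"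
    by (simp add: power_mult_distrib mult_ac)
  have "(\<integral>y. of_real (poisson_fun x (r *\<^sub>R y)) * F a (s *\<^sub>R y) \<partial>\<sigma>) = of_real area * F a ((r * s) *\<^sub>R x)"
    by (rule sums_unique2[OF 1 2[unfolded 3]])
  moreover have "(\<integral>y. poisson_fun y (r *\<^sub>R x) *\<^sub>R F a (s *\<^sub>R y) \<partial>\<sigma>) = (\<integral>y. of_real (poisson_fun x (r *\<^sub>R y)) * F a (s *\<^sub>R y) \<partial>\<sigma>)"
    using x by (intro Bochner_Integration.integral_cong refl) (simp add: scaleR_conv_of_real poisson_fun_sym)
  ultimately show ?thesis by (simp add: scaleR_conv_of_real)
qed

lemma harmonic_on_eq:
  assumes "harmonic_on f A" "\<And>x. x \<in> A \<Longrightarrow> f x = g x"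
  shows "harmonic_on g A"
proof -
  obtain D D2 where h: "open A" "\<forall>x\<in>A. (f has_derivative D x) (at x)"
    "\<forall>i\<in>Basis. \<forall>x\<in>A. ((\<lambda>y. D y i) has_derivative D2 i x) (at x)"
    "\<forall>i\<in>Basis. \<forall>j\<in>Basis. continuous_on A (\<lambda>x. D2 i x j)"
    "\<forall>x\<in>A. (\<Sum>i\<in>Basis. D2 i x i) = 0"
    by (rule harmonic_onE[OF assms(1)]) (rule that, assumption+)
  have "(g has_derivative D x) (at x)" if "x \<in> A" for x
    by (rule has_derivative_transform_within_open[of f _ _ _ A]) (use h that assms(2) in auto)
  then show ?thesis using h unfolding harmonic_on_def by blast
qed

text \<open>The series is never differentiated. On the ball of radius s < 1 it is a dilated Poisson
  integral of a continuous function, and harmonicity is local, so that s may depend on the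
  point.\<close>

lemma F_harmonic:
  assumes a: "growth a"
  shows "F a \<in> harmonic_ball"
  unfolding harmonic_ball_def mem_Collect_eq
proof (rule harmonic_on_local)
  fix z :: 'a assume z: "z \<in> ball 0 1"
  define s where "s = (1 + norm z) / 2"
  have s: "0 < s" "s < 1" "norm z < s" using z by (auto simp: s_def add_pos_nonneg)
  define G where "G w = inverse area *\<^sub>R (\<integral>y. poisson_fun y w *\<^sub>R F a (s *\<^sub>R y) \<partial>\<sigma>)" for w
  have G: "G w = F a (s *\<^sub>R w)" if "w \<in> ball 0 1" for w
  proof -
    have "(norm w * s) *\<^sub>R direction w = s *\<^sub>R w"
      by (simp only: mult.commute[of _ s] scaleR_scaleR[symmetric] scaleR_norm_direction)
    then show ?thesis
      using F_poisson[OF a, of "norm w" s "direction w"] that s area_pos by (simp add: G_def)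
  qed
  have "continuous_on S (\<lambda>y. inverse area *\<^sub>R F a (s *\<^sub>R y))"
    using continuous_on_F_scaled[OF a, of s] s by (intro continuous_intros) auto
  from harmonic_on_poisson_integral[OF this] have "harmonic_on G (ball 0 1)"
    by (rule harmonic_on_eq) (simp add: G_def flip: integral_scaleR_right, simp add: mult.commute)
  from harmonic_on_dilation[OF this s(1)] have "harmonic_on (F a) (ball 0 s)"
    by (rule harmonic_on_eq) (use G s in \<open>auto simp: field_simps\<close>)
  then show "\<exists>T. z \<in> T \<and> T \<subseteq> ball 0 1 \<and> harmonic_on (F a) T"
    using s by (intro exI[of _ "ball 0 s"]) auto
qed simp

text \<open>\<open>h\<close> is orthogonal to every finite combination \<open>A\<close> of basis
  functions, so the squared distance from \<open>h\<close> to \<open>A\<close> is at least the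
  squared norm of \<open>h\<close>. Density makes the distance arbitrarily small, and continuity
  turns a zero norm into pointwise vanishing.\<close>

lemma completeness:
  fixes h :: "'a \<Rightarrow> complex"
  assumes h: "continuous_on S h" and z: "\<And>k j. j \<in> {1..sph_dim TYPE('a) k} \<Longrightarrow> (\<integral>x. of_real (Y k j x) * h x \<partial>\<sigma>) = 0" and x: "x \<in> S"
  shows "h x = 0"
proof -
  have hsq: "integrable \<sigma> (\<lambda>x. (cmod (h x))\<^sup>2)"
    by (intro continuous_on_sphere_integrable continuous_intros h)
  have "h \<in> borel_measurable \<sigma>" by (rule continuous_on_sphere_measurable[OF h])
  have "(\<integral>x. (cmod (h x))\<^sup>2 \<partial>\<sigma>) \<le> 0 + \<epsilon>" if e: "\<epsilon> > 0" for \<epsilon>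
  proof -
    have "\<forall>f :: 'a \<Rightarrow> complex. f \<in> borel_measurable \<sigma> \<and> integrable \<sigma> (\<lambda>x. (cmod (f x))\<^sup>2) \<longrightarrow>
        (\<forall>\<epsilon>>0. \<exists>K a. (\<integral>\<^sup>+x. ennreal ((cmod (f x - (\<Sum>k\<le>K. \<Sum>j=1..sph_dim TYPE('a) k.
              a k j * of_real (Y k j x))))\<^sup>2) \<partial>\<sigma>) < ennreal \<epsilon>)"
      using basis unfolding spherical_harmonic_basis_def by (elim conjE)
    then obtain K a where Ka: "(\<integral>\<^sup>+x. ennreal ((cmod (h x - (\<Sum>k\<le>K. T a k x)))\<^sup>2) \<partial>\<sigma>) < ennreal \<epsilon>"
      unfolding T_def using hsq \<open>h \<in> borel_measurable \<sigma>\<close> e by blast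
    define A where "A x = (\<Sum>k\<le>K. T a k x)" for x
    have Ac: "continuous_on S A" unfolding A_def by (intro continuous_intros continuous_on_T)
    have hA: "(\<integral>x. cnj (A x) * h x \<partial>\<sigma>) = 0"
    proof -
      have "(\<integral>x. cnj (A x) * h x \<partial>\<sigma>) = (\<integral>x. (\<Sum>k\<le>K. \<Sum>j\<in>{1..sph_dim TYPE('a) k}. cnj (a k j) * (of_real (Y k j x) * h x)) \<partial>\<sigma>)"
        by (simp add: A_def T_def sum_distrib_right mult.assoc)
      also have "\<dots> = (\<Sum>k\<le>K. \<integral>x. (\<Sum>j\<in>{1..sph_dim TYPE('a) k}. cnj (a k j) * (of_real (Y k j x) * h x)) \<partial>\<sigma>)"
        by (rule Bochner_Integration.integral_sum) (intro continuous_on_sphere_integrable continuous_intros continuous_on_Y h)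
      also have "\<dots> = (\<Sum>k\<le>K. \<Sum>j\<in>{1..sph_dim TYPE('a) k}. \<integral>x. cnj (a k j) * (of_real (Y k j x) * h x) \<partial>\<sigma>)"
        by (intro sum.cong refl Bochner_Integration.integral_sum) (intro continuous_on_sphere_integrable continuous_intros continuous_on_Y h)
      also have "\<dots> = 0" by (simp add: z)
      finally show ?thesis .
    qed
    have i: "integrable \<sigma> (\<lambda>x. (cmod (h x - A x))\<^sup>2)" "integrable \<sigma> (\<lambda>x. (cmod (A x))\<^sup>2)" "integrable \<sigma> (\<lambda>x. cnj (A x) * h x)"
      by (intro continuous_on_sphere_integrable continuous_intros h Ac)+
    have "ennreal (\<integral>x. (cmod (h x - A x))\<^sup>2 \<partial>\<sigma>) = (\<integral>\<^sup>+x. ennreal ((cmod (h x - A x))\<^sup>2) \<partial>\<sigma>)"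
      by (rule nn_integral_eq_integral[symmetric]) (use i in auto)
    also have "\<dots> < ennreal \<epsilon>" using Ka by (simp only: A_def)
    finally have lt: "(\<integral>x. (cmod (h x - A x))\<^sup>2 \<partial>\<sigma>) < \<epsilon>"
      by (subst (asm) ennreal_less_iff) auto
    define R where "R x = Re (cnj (A x) * h x)" for x
    have iR: "integrable \<sigma> R" unfolding R_def by (rule integrable_Re[OF i(3)])
    have "(\<integral>x. R x \<partial>\<sigma>) = 0" unfolding R_def by (subst integral_Re[OF i(3)]) (simp add: hA)
    moreover have "(\<integral>x. (cmod (h x - A x))\<^sup>2 \<partial>\<sigma>) = (\<integral>x. (cmod (h x))\<^sup>2 + (cmod (A x))\<^sup>2 - 2 * R x \<partial>\<sigma>)"
      unfolding R_def cmod_power2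
      by (intro Bochner_Integration.integral_cong refl) (simp add: power2_eq_square algebra_simps)
    moreover have "\<dots> = (\<integral>x. (cmod (h x))\<^sup>2 \<partial>\<sigma>) + (\<integral>x. (cmod (A x))\<^sup>2 \<partial>\<sigma>) - 2 * (\<integral>x. R x \<partial>\<sigma>)"
      using i hsq iR by simp
    moreover have "(\<integral>x. (cmod (A x))\<^sup>2 \<partial>\<sigma>) \<ge> 0" by simp
    ultimately show ?thesis using lt by linarith
  qed
  then have "(\<integral>x. (cmod (h x))\<^sup>2 \<partial>\<sigma>) \<le> 0" by (rule field_le_epsilon)
  moreover have "(\<integral>x. (cmod (h x))\<^sup>2 \<partial>\<sigma>) \<ge> 0" by simp
  ultimately have z0: "(\<integral>x. (cmod (h x))\<^sup>2 \<partial>\<sigma>) = 0" by linarith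
  have "(cmod (h x))\<^sup>2 = 0"
    by (rule continuous_nonneg_integral_0[OF _ _ z0 x]) (auto intro!: continuous_intros h)
  then show ?thesis by simp
qed

text \<open>\<open>harmonic_moment\<close> extracts coefficients that do not depend on the radius.
  Their growth follows from the moment at radius sqrt r together with \<open>growth_Ysup\<close>. At
  each radius the difference of series and function has zero moments, so \<open>completeness\<close>
  applies.\<close>

theorem harmonic_expansion:
  assumes f: "f \<in> harmonic_ball"
  obtains b where "growth b" "\<And>k j. j \<notin> {1..sph_dim TYPE('a) k} \<Longrightarrow> b k j = 0" "\<And>z. z \<in> ball 0 1 \<Longrightarrow> F b z = f z"
proof -
  have fh: "harmonic_on f (ball 0 1)" using f by (simp add: harmonic_ball_def)
  have fc: "continuous_on (ball 0 1) f"
  proof -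
    obtain D where "\<forall>x\<in>ball 0 1. (f has_derivative D x) (at x)"
      using fh unfolding harmonic_on_def by blast
    then show ?thesis by (meson continuous_at_imp_continuous_on has_derivative_continuous)
  qed
  have fcr: "continuous_on S (\<lambda>x. f (r *\<^sub>R x))" if "0 \<le> r" "r < 1" for r
    by (rule continuous_on_compose2[OF fc]) (use that in \<open>auto intro!: continuous_intros\<close>)
  have "\<exists>c. \<forall>r\<in>{0..<1}. (\<integral>x. of_real (Y k j x) * f (r *\<^sub>R x) \<partial>\<sigma>) = of_real (r ^ k) * c" if j: "j \<in> {1..sph_dim TYPE('a) k}" for k j
  proof -
    obtain c where c: "\<forall>r\<in>{0..<1}. (\<integral>x. solid k j x *\<^sub>R f (r *\<^sub>R x) \<partial>\<sigma>) = r ^ k *\<^sub>R c"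
      using harmonic_moment[OF fh solid(1,2)[OF j]] by blast
    have "(\<integral>x. of_real (Y k j x) * f (r *\<^sub>R x) \<partial>\<sigma>) = (\<integral>x. solid k j x *\<^sub>R f (r *\<^sub>R x) \<partial>\<sigma>)" for r
      by (rule Bochner_Integration.integral_cong) (auto simp: solid(3)[OF j] scaleR_conv_of_real)
    then show ?thesis using c by (intro exI[of _ c]) (auto simp: scaleR_conv_of_real)
  qed
  moreover define P where "P k j c \<longleftrightarrow> (\<forall>r\<in>{0..<1}. (\<integral>x. of_real (Y k j x) * f (r *\<^sub>R x) \<partial>\<sigma>) = of_real (r ^ k) * c)" for k j c
  ultimately have "\<forall>k j. \<exists>c. j \<in> {1..sph_dim TYPE('a) k} \<longrightarrow> P k j c" by blast
  then obtain c where "\<forall>k j. j \<in> {1..sph_dim TYPE('a) k} \<longrightarrow> P k j (c k j)" by metis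
  then have c: "(\<integral>x. of_real (Y k j x) * f (r *\<^sub>R x) \<partial>\<sigma>) = of_real (r ^ k) * c k j"
    if "j \<in> {1..sph_dim TYPE('a) k}" "0 \<le> r" "r < 1" for k j r
    using that unfolding P_def by simp
  \<comment> \<open>Zero outside the index range, as the definite description in
    \<open>sph_coeff\<close> demands.\<close>
  define b where "b k j = (if j \<in> {1..sph_dim TYPE('a) k} then c k j else 0)" for k j
  have gb: "growth b"
    unfolding growth_def
  proof (intro allI impI)
    fix r :: real assume r: "0 < r" "r < 1"
    define s where "s = sqrt r"
    have s: "0 < s" "s < 1" "s * s = r" using r by (auto simp: s_def)
    have "compact ((\<lambda>x. f (s *\<^sub>R x)) ` S)" using s by (intro compact_continuous_image fcr) auto
    then obtain B where B: "\<And>x. x \<in> S \<Longrightarrow> cmod (f (s *\<^sub>R x)) \<le> B"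
      using compact_imp_bounded bounded_iff by (metis (no_types, lifting) imageI)
    have B0: "B \<ge> 0" using B S_nonempty norm_ge_zero order_trans by blast
    obtain C where C: "C \<ge> 0" "\<And>k j. j \<in> {1..sph_dim TYPE('a) k} \<Longrightarrow> cmod (of_real (Ysup k j)) * s ^ k \<le> C"
      using growthD[OF growth_Ysup s(1,2)] by blast
    have "cmod (b k j) * r ^ k \<le> C * B * area" if j: "j \<in> {1..sph_dim TYPE('a) k}" for k j
    proof -
      have "s ^ k * cmod (b k j) = cmod (\<integral>x. of_real (Y k j x) * f (s *\<^sub>R x) \<partial>\<sigma>)"
        using c[OF j, of s] s j by (simp add: b_def norm_mult norm_power)
      also have "\<dots> \<le> (\<integral>x. Ysup k j * B \<partial>\<sigma>)"
        using Y_le_Ysup[OF j] B s j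
        by (intro Bochner_Integration.integral_norm_bound_integral)
           (auto intro!: continuous_on_sphere_integrable continuous_intros continuous_on_Y fcr mult_mono Ysup_nonneg simp: norm_mult)
      also have "\<dots> = Ysup k j * B * area" by simp
      finally have "s ^ k * (s ^ k * cmod (b k j)) \<le> s ^ k * (Ysup k j * B * area)"
        using s by (intro mult_left_mono) auto
      also have "\<dots> = (Ysup k j * s ^ k) * (B * area)" by (simp add: mult_ac)
      also have "\<dots> \<le> C * (B * area)" using C(2)[OF j] Ysup_nonneg[OF j] B0 by (intro mult_right_mono) auto
      finally have "s ^ k * (s ^ k * cmod (b k j)) \<le> C * (B * area)" .
      moreover have "r ^ k = s ^ k * s ^ k" using s(3) by (simp add: power_mult_distrib[symmetric])
      ultimately show ?thesis by (simp add: mult_ac)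
    qed
    then show "\<exists>C. \<forall>k. \<forall>j\<in>{1..sph_dim TYPE('a) k}. cmod (b k j) * r ^ k \<le> C" by blast
  qed
  have "F b z = f z" if z: "z \<in> ball 0 1" for z
  proof -
    define r where "r = norm z"
    have r: "0 \<le> r" "r < 1" using z by (auto simp: r_def)
    have "F b (r *\<^sub>R x) - f (r *\<^sub>R x) = 0" if "x \<in> S" for x
    proof (rule completeness[OF _ _ that])
      show "continuous_on S (\<lambda>x. F b (r *\<^sub>R x) - f (r *\<^sub>R x))"
        by (intro continuous_intros continuous_on_F_scaled gb r fcr)
      fix k j assume j: "j \<in> {1..sph_dim TYPE('a) k}"
      have "(\<integral>x. of_real (Y k j x) * (F b (r *\<^sub>R x) - f (r *\<^sub>R x)) \<partial>\<sigma>)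
        = (\<integral>x. of_real (Y k j x) * F b (r *\<^sub>R x) - of_real (Y k j x) * f (r *\<^sub>R x) \<partial>\<sigma>)"
        by (simp add: right_diff_distrib)
      also have "\<dots> = of_real (r ^ k) * b k j - of_real (r ^ k) * c k j"
        by (subst Bochner_Integration.integral_diff)
           (auto intro!: continuous_on_sphere_integrable continuous_intros continuous_on_Y j continuous_on_F_scaled gb r fcr
              simp: F_coeff[OF gb r j] c[OF j r] simp del: of_real_power)
      finally show "(\<integral>x. of_real (Y k j x) * (F b (r *\<^sub>R x) - f (r *\<^sub>R x)) \<partial>\<sigma>) = 0"
        using j by (simp add: b_def)
    qed
    from this[of "direction z"] show ?thesis by (simp add: r_def)
  qed
  then show ?thesis by (rule that[OF gb, rotated]) (auto simp: b_def)
qed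

text \<open>Along each ray the difference is a power series in r that vanishes on (0, 1), so the
  components of every degree agree; orthogonality then separates the coefficients within a
  degree.\<close>

lemma expansion_unique:
  assumes "\<And>z. z \<in> ball 0 1 \<Longrightarrow> sph_term Y a z sums f z" "\<And>z. z \<in> ball 0 1 \<Longrightarrow> sph_term Y b z sums f z" "j \<in> {1..sph_dim TYPE('a) k}"
  shows "a k j = b k j"
proof -
  have "T a k x = T b k x" if x: "x \<in> S" for k x
  proof -
    have "T a k x - T b k x = 0"
    proof (rule powser_zero_on_reals[of "\<lambda>k. T a k x - T b k x"])
      fix r :: real assume r: "0 < r" "r < 1"
      then have "r *\<^sub>R x \<in> ball 0 1" using x by simp
      from sums_diff[OF assms(1)[OF this] assms(2)[OF this]]
      show "(\<lambda>k. (T a k x - T b k x) * of_real r ^ k) sums 0"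
        unfolding sph_term_scale[OF x] by (simp add: algebra_simps)
    qed
    then show ?thesis by simp
  qed
  then have "(\<integral>x. of_real (Y k j x) * T a k x \<partial>\<sigma>) = (\<integral>x. of_real (Y k j x) * T b k x \<partial>\<sigma>)"
    by (intro Bochner_Integration.integral_cong) auto
  then show ?thesis by (simp add: integral_Y_T[OF assms(3)])
qed

text \<open>The definite description has exactly one solution, by \<open>harmonic_expansion\<close>
  and \<open>expansion_unique\<close>; from here on it may be used through these three
  properties.\<close>

lemma sph_coeff:
  assumes f: "f \<in> harmonic_ball"
  shows "growth (sph_coeff Y f)" "\<And>k j. j \<notin> {1..sph_dim TYPE('a) k} \<Longrightarrow> sph_coeff Y f k j = 0" "\<And>z. z \<in> ball 0 1 \<Longrightarrow> F (sph_coeff Y f) z = f z"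
proof -
  obtain b where b: "growth b" "\<And>k j. j \<notin> {1..sph_dim TYPE('a) k} \<Longrightarrow> b k j = 0" "\<And>z. z \<in> ball 0 1 \<Longrightarrow> F b z = f z"
    using harmonic_expansion[OF f] by blast
  have "sph_coeff Y f = b"
    unfolding sph_coeff_def
  proof (rule the_equality)
    show "(\<forall>k j. j \<notin> {1..sph_dim TYPE('a) k} \<longrightarrow> b k j = 0) \<and> (\<forall>x\<in>ball 0 1. sph_term Y b x sums f x)"
      using b sph_term_sums[OF b(1)] by auto
    fix a assume a: "(\<forall>k j. j \<notin> {1..sph_dim TYPE('a) k} \<longrightarrow> a k j = 0) \<and> (\<forall>x\<in>ball 0 1. sph_term Y a x sums f x)"
    show "a = b"
    proof (intro ext)
      fix k j
      show "a k j = b k j"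
      proof (cases "j \<in> {1..sph_dim TYPE('a) k}")
        case True
        have "sph_term Y b z sums f z" if "z \<in> ball 0 1" for z
          using sph_term_sums[OF b(1) that] b(3)[OF that] by simp
        then show ?thesis using a by (intro expansion_unique[of a f b, OF _ _ True]) auto
      next
        case False
        then show ?thesis using a b by simp
      qed
    qed
  qed
  then show "growth (sph_coeff Y f)" "\<And>k j. j \<notin> {1..sph_dim TYPE('a) k} \<Longrightarrow> sph_coeff Y f k j = 0" "\<And>z. z \<in> ball 0 1 \<Longrightarrow> F (sph_coeff Y f) z = f z"
    using b by auto
qed

lemma coeff_unique:
  assumes f: "f \<in> harmonic_ball" and a: "\<And>z. z \<in> ball 0 1 \<Longrightarrow> sph_term Y a z sums f z" and j: "j \<in> {1..sph_dim TYPE('a) k}"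
  shows "sph_coeff Y f k j = a k j"
proof (rule expansion_unique[OF _ a j])
  fix z :: 'a assume "z \<in> ball 0 1"
  then show "sph_term Y (sph_coeff Y f) z sums f z"
    using sph_term_sums[OF sph_coeff(1)[OF f]] sph_coeff(3)[OF f] by metis
qed

lemma coeff_F:
  assumes a: "growth a" and j: "j \<in> {1..sph_dim TYPE('a) k}"
  shows "sph_coeff Y (F a) k j = a k j"
  by (rule coeff_unique[OF F_harmonic[OF a] _ j]) (rule sph_term_sums[OF a])

text \<open>A convergent series with harmonic sum is the expansion of that sum, so its coefficients
  inherit the growth of \<open>sph_coeff\<close>. It is the bridge from families about which only
  convergence is known.\<close>

lemma growth_of_harmonic:
  assumes "sph_convergent Y a" "F a \<in> harmonic_ball"
  shows "growth a"
proof (rule growth_mono[OF sph_coeff(1)[OF assms(2)]])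
  fix k j assume j: "j \<in> {1..sph_dim TYPE('a) k}"
  have "sph_term Y a z sums F a z" if "z \<in> ball 0 1" for z
    using assms(1) that unfolding sph_convergent_def sph_series_def by (simp add: summable_sums)
  from coeff_unique[OF assms(2) this j] show "cmod (a k j) \<le> cmod (sph_coeff Y (F a) k j)" by simp
qed

end

section \<open>Convolution kernels and their integral bounds\<close>

text \<open>Young's inequality for u / \<theta> and 1 with exponents s and its conjugate, multiplied
  back by \<theta>. The right-hand side is linear in u^s, so it can be integrated term by
  term.\<close>

lemma young_powr:
  fixes u :: real
  assumes "u \<ge> 0" "\<theta> > 0" "s \<ge> 1"
  shows "u \<le> u powr s * \<theta> powr (1 - s) / s + (1 - 1 / s) * \<theta>"
proof (cases "u = 0")
  case True
  have "(1 - 1 / s) * \<theta> \<ge> 0" using assms by simp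
  then show ?thesis using True by simp
next
  case False
  then have u: "u > 0" using assms by simp
  have "((u / \<theta>) powr s) powr (1 / s) * 1 powr (1 - 1 / s) \<le> 1 / s * (u / \<theta>) powr s + (1 - 1 / s) * 1"
    using assms u by (intro Youngs_inequality_0) auto
  moreover have "((u / \<theta>) powr s) powr (1 / s) = u / \<theta>"
    using assms u by (simp add: powr_powr)
  ultimately have "u / \<theta> \<le> 1 / s * (u / \<theta>) powr s + (1 - 1 / s)" by simp
  then have "(u / \<theta>) * \<theta> \<le> (1 / s * (u / \<theta>) powr s + (1 - 1 / s)) * \<theta>"
    using assms by (intro mult_right_mono) auto
  moreover have "(u / \<theta>) powr s * \<theta> = u powr s * \<theta> powr (1 - s)"
    using assms u by (simp add: powr_divide powr_diff)
  ultimately show ?thesis using assms by (simp add: distrib_right)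
qed

text \<open>
  Minkowski's integral inequality with a prescribed bound \<open>A \<omega>\<close> for the norms of the slices. Young's inequality with
  parameter \<open>\<theta> = F x / I\<close> replaces duality, so no finiteness of the left-hand side has to be known beforehand.
\<close>
lemma minkowski_integral:
  fixes l :: "'w \<Rightarrow> 'x \<Rightarrow> real"
  assumes M: "sigma_finite_measure M" and N: "sigma_finite_measure N" and s: "s \<ge> 1"
    and l [measurable]: "case_prod l \<in> borel_measurable (M \<Otimes>\<^sub>M N)" and l0: "\<And>\<omega> x. l \<omega> x \<ge> 0"
    and w [measurable]: "w \<in> borel_measurable M" and w0: "\<And>\<omega>. w \<omega> \<ge> 0"
    and A [measurable]: "A \<in> borel_measurable M" and A0: "\<And>\<omega>. \<omega> \<in> space M \<Longrightarrow> w \<omega> > 0 \<Longrightarrow> A \<omega> > 0"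
    and lA: "\<And>\<omega>. \<omega> \<in> space M \<Longrightarrow> w \<omega> > 0 \<Longrightarrow> (\<integral>\<^sup>+x. ennreal (l \<omega> x powr s) \<partial>N) \<le> ennreal (A \<omega> powr s)"
    and I: "(\<integral>\<^sup>+\<omega>. ennreal (A \<omega> * w \<omega>) \<partial>M) \<le> ennreal I" "I > 0"
    and F0: "\<And>x. F x \<ge> 0" and F: "\<And>x. x \<in> space N \<Longrightarrow> ennreal (F x) \<le> (\<integral>\<^sup>+\<omega>. ennreal (l \<omega> x * w \<omega>) \<partial>M)"
  shows "(\<integral>\<^sup>+x. ennreal (F x powr s) \<partial>N) \<le> ennreal (I powr s)"
proof -
  interpret M: sigma_finite_measure M by fact
  interpret N: sigma_finite_measure N by fact
  interpret MN: pair_sigma_finite M N ..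
  \<comment> \<open>Normalised so that integration over x leaves at most
    \<open>A \<omega> * w \<omega>\<close>.\<close>
  define H where "H \<omega> x = (l \<omega> x / A \<omega>) powr s * (A \<omega> * w \<omega>)" for \<omega> x
  have Hm [measurable]: "case_prod H \<in> borel_measurable (M \<Otimes>\<^sub>M N)"
    unfolding H_def case_prod_beta' using l unfolding case_prod_beta' by measurable
  have Hm': "(\<lambda>\<omega>. H \<omega> x) \<in> borel_measurable M" if "x \<in> space N" for x
    using measurable_compose[OF measurable_Pair2'[OF that] Hm] by simp
  have H0: "H \<omega> x \<ge> 0" if "\<omega> \<in> space M" for \<omega> x
    using A0[OF that] w0[of \<omega>] by (cases "w \<omega> = 0") (auto simp: H_def less_le)
  define G where "G x = (\<integral>\<^sup>+\<omega>. ennreal (H \<omega> x) \<partial>M)" for x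
  have key: "ennreal (F x powr s) \<le> ennreal (I powr (s - 1)) * G x" if x: "x \<in> space N" for x
  proof (cases "F x = 0 \<or> G x = top")
    case True
    then show ?thesis using I(2) s by (auto simp: ennreal_mult_eq_top_iff)
  next
    case False
    then have Fx: "F x > 0" using F0[of x] by (simp add: less_le)
    define \<theta> where "\<theta> = F x / I"
    have th: "\<theta> > 0" using Fx I by (simp add: \<theta>_def)
    define c1 c2 where "c1 = \<theta> powr (1 - s) / s" and "c2 = (1 - 1 / s) * \<theta>"
    have c: "c1 \<ge> 0" "c2 \<ge> 0" using s th by (auto simp: c1_def c2_def)
    obtain g where g: "G x = ennreal g" "g \<ge> 0" using False by (cases "G x") auto
    have "ennreal (F x) \<le> (\<integral>\<^sup>+\<omega>. ennreal (l \<omega> x * w \<omega>) \<partial>M)" by (rule F[OF x])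
    also have "\<dots> \<le> (\<integral>\<^sup>+\<omega>. ennreal c1 * ennreal (H \<omega> x) + ennreal c2 * ennreal (A \<omega> * w \<omega>) \<partial>M)"
    proof (rule nn_integral_mono)
      fix \<omega> assume om: "\<omega> \<in> space M"
      show "ennreal (l \<omega> x * w \<omega>) \<le> ennreal c1 * ennreal (H \<omega> x) + ennreal c2 * ennreal (A \<omega> * w \<omega>)"
      proof (cases "w \<omega> = 0")
        case False
        then have w: "w \<omega> > 0" using w0[of \<omega>] by (simp add: less_le)
        have A: "A \<omega> > 0" by (rule A0[OF om w])
        have "l \<omega> x / A \<omega> \<le> (l \<omega> x / A \<omega>) powr s * c1 + c2"
          unfolding c1_def c2_def using young_powr[of "l \<omega> x / A \<omega>" \<theta> s] l0[of \<omega> x] A th s by simp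
        then have "l \<omega> x / A \<omega> * (A \<omega> * w \<omega>) \<le> ((l \<omega> x / A \<omega>) powr s * c1 + c2) * (A \<omega> * w \<omega>)"
          using A w by (intro mult_right_mono) auto
        also have "\<dots> = c1 * H \<omega> x + c2 * (A \<omega> * w \<omega>)"
          by (simp only: H_def distrib_right distrib_left mult_ac)
        also have "l \<omega> x / A \<omega> * (A \<omega> * w \<omega>) = l \<omega> x * w \<omega>" using A by simp
        finally have "l \<omega> x * w \<omega> \<le> c1 * H \<omega> x + c2 * (A \<omega> * w \<omega>)" .
        then have "ennreal (l \<omega> x * w \<omega>) \<le> ennreal (c1 * H \<omega> x + c2 * (A \<omega> * w \<omega>))" by (rule ennreal_leI)
        also have "\<dots> = ennreal c1 * ennreal (H \<omega> x) + ennreal c2 * ennreal (A \<omega> * w \<omega>)"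
          using c H0[OF om, of x] A w by (subst ennreal_plus) (auto simp: ennreal_mult)
        finally show ?thesis .
      qed simp
    qed
    also have "\<dots> = ennreal c1 * G x + ennreal c2 * (\<integral>\<^sup>+\<omega>. ennreal (A \<omega> * w \<omega>) \<partial>M)"
      unfolding G_def using Hm'[OF x] by (subst nn_integral_add) (auto simp: nn_integral_cmult)
    also have "\<dots> \<le> ennreal c1 * ennreal g + ennreal c2 * ennreal I"
      unfolding g by (intro add_left_mono mult_left_mono I) auto
    also have "\<dots> = ennreal (c1 * g + c2 * I)"
      using c g I by (simp add: ennreal_mult)
    finally have "F x \<le> c1 * g + c2 * I"
      using c g I by (subst (asm) ennreal_le_iff) auto
    \<comment> \<open>By the choice of \<theta> this term is the fraction 1 - 1/s of
      \<open>F x\<close>; it can be moved to the left because \<open>F x\<close> is a real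
      number.\<close>
    moreover have "c2 * I = F x - F x / s"
    proof -
      have "\<theta> * I = F x" using I by (simp add: \<theta>_def)
      then have "c2 * I = (1 - 1 / s) * F x" by (simp add: c2_def mult.assoc)
      then show ?thesis by (simp add: left_diff_distrib)
    qed
    ultimately have "F x / s \<le> c1 * g" by simp
    then have "F x \<le> \<theta> powr (1 - s) * g" using s by (simp add: c1_def field_simps)
    then have "F x * \<theta> powr (s - 1) \<le> \<theta> powr (1 - s) * g * \<theta> powr (s - 1)"
      by (intro mult_right_mono) auto
    also have "\<dots> = g" using th by (simp add: powr_add[symmetric] mult.commute mult.left_commute)
    finally have "F x * \<theta> powr (s - 1) * I powr (s - 1) \<le> g * I powr (s - 1)"
      by (intro mult_right_mono) auto
    moreover have "F x * \<theta> powr (s - 1) * I powr (s - 1) = F x powr s"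
    proof -
      have "\<theta> powr (s - 1) * I powr (s - 1) = F x powr (s - 1)"
        using I Fx by (simp add: \<theta>_def powr_divide)
      moreover have "F x * F x powr (s - 1) = F x powr s"
        using Fx by (simp add: powr_diff)
      ultimately show ?thesis by (simp add: mult.assoc)
    qed
    ultimately have "F x powr s \<le> I powr (s - 1) * g" by (simp add: mult.commute)
    then have "ennreal (F x powr s) \<le> ennreal (I powr (s - 1) * g)" by (rule ennreal_leI)
    then show ?thesis using g by (simp add: ennreal_mult)
  qed
  have "(\<integral>\<^sup>+x. ennreal (F x powr s) \<partial>N) \<le> (\<integral>\<^sup>+x. ennreal (I powr (s - 1)) * G x \<partial>N)"
    by (rule nn_integral_mono) (rule key)
  also have "\<dots> = ennreal (I powr (s - 1)) * (\<integral>\<^sup>+x. G x \<partial>N)"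
    unfolding G_def by (rule nn_integral_cmult) (use Hm in measurable)
  also have "(\<integral>\<^sup>+x. G x \<partial>N) = (\<integral>\<^sup>+\<omega>. \<integral>\<^sup>+x. ennreal (H \<omega> x) \<partial>N \<partial>M)"
    unfolding G_def by (rule MN.Fubini') (use Hm in \<open>simp add: case_prod_beta'\<close>)
  also have "\<dots> \<le> (\<integral>\<^sup>+\<omega>. ennreal (A \<omega> * w \<omega>) \<partial>M)"
  proof (rule nn_integral_mono)
    fix \<omega> assume om: "\<omega> \<in> space M"
    show "(\<integral>\<^sup>+x. ennreal (H \<omega> x) \<partial>N) \<le> ennreal (A \<omega> * w \<omega>)"
    proof (cases "w \<omega> = 0")
      case True
      then show ?thesis by (simp add: H_def)
    next
      case False
      then have w: "w \<omega> > 0" using w0[of \<omega>] by (simp add: less_le)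
      have A: "A \<omega> > 0" by (rule A0[OF om w])
      have lm: "(\<lambda>x. l \<omega> x) \<in> borel_measurable N"
        using measurable_compose[OF measurable_Pair1'[OF om] l] by simp
      have "(\<integral>\<^sup>+x. ennreal (H \<omega> x) \<partial>N) = (\<integral>\<^sup>+x. ennreal (A \<omega> powr (- s) * (A \<omega> * w \<omega>)) * ennreal (l \<omega> x powr s) \<partial>N)"
      proof (rule nn_integral_cong)
        fix x
        have "(l \<omega> x / A \<omega>) powr s = A \<omega> powr (- s) * l \<omega> x powr s"
          using powr_divide[of "l \<omega> x" "A \<omega>" s] A l0[of \<omega> x] by (simp add: powr_minus divide_inverse mult.commute)
        then have "H \<omega> x = A \<omega> powr (- s) * (A \<omega> * w \<omega>) * l \<omega> x powr s" by (simp add: H_def mult_ac)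
        then show "ennreal (H \<omega> x) = ennreal (A \<omega> powr (- s) * (A \<omega> * w \<omega>)) * ennreal (l \<omega> x powr s)"
          using A w by (simp add: ennreal_mult)
      qed
      also have "\<dots> = ennreal (A \<omega> powr (- s) * (A \<omega> * w \<omega>)) * (\<integral>\<^sup>+x. ennreal (l \<omega> x powr s) \<partial>N)"
        by (rule nn_integral_cmult) (use lm in measurable)
      also have "\<dots> \<le> ennreal (A \<omega> powr (- s) * (A \<omega> * w \<omega>)) * ennreal (A \<omega> powr s)"
        by (intro mult_left_mono lA om w) auto
      also have "\<dots> = ennreal (A \<omega> * w \<omega>)"
        using A w by (simp add: ennreal_mult'[symmetric] powr_minus)
      finally show ?thesis .
    qed
  qed
  also have "\<dots> \<le> ennreal I" by (rule I)
  finally have "(\<integral>\<^sup>+x. ennreal (F x powr s) \<partial>N) \<le> ennreal (I powr (s - 1)) * ennreal I"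
    by (simp add: mult_left_mono)
  also have "\<dots> = ennreal (I powr s)"
    using I by (simp add: ennreal_mult'[symmetric] powr_diff)
  finally show ?thesis .
qed

lemma nn_integral_powr_from_0:
  assumes "b > 0" "c \<ge> (0::real)"
  shows "(\<integral>\<^sup>+x. ennreal (indicator {0..c} x * x powr (b - 1)) \<partial>lborel) = ennreal (c powr b / b)"
  using nn_integral_has_integral_lebesgue[of "{0..c}" "\<lambda>x. x powr (b - 1)" "c powr b / b"]
    has_integral_powr_from_0[of "b - 1" c] assms by simp

text \<open>In the variable 1 - R, split at \<delta> = 1 - \<rho>. Below \<delta> the first factor
  is at most \<delta>^(-a), and the rest integrates to \<delta>^b / b; above \<delta> the two
  factors merge into the exponent b - a - 1 < -1. The two pieces give the constants 1 / b and 1 / (a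
  - b).\<close>

lemma nn_integral_power_weight_le:
  fixes a b :: real
  assumes "b > 0" "a > b"
  obtains C where "C > 0"
    "\<And>\<rho>. 0 \<le> \<rho> \<Longrightarrow> \<rho> < 1 \<Longrightarrow> (\<integral>\<^sup>+R. ennreal (indicator {0<..<1} R * ((1 - \<rho> * R) powr (- a) * (1 - R) powr (b - 1))) \<partial>lborel)
        \<le> ennreal (C * (1 - \<rho>) powr (b - a))"
proof
  show "1 / b + 1 / (a - b) > 0" using assms by (simp add: add_pos_pos)
  fix \<rho> :: real assume r: "0 \<le> \<rho>" "\<rho> < 1"
  define \<delta> where "\<delta> = 1 - \<rho>"
  have d: "0 < \<delta>" "\<delta> \<le> 1" using r by (auto simp: \<delta>_def)
  have "(\<integral>\<^sup>+R. ennreal (indicator {0<..<1} R * ((1 - \<rho> * R) powr (- a) * (1 - R) powr (b - 1))) \<partial>lborel)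
    = (\<integral>\<^sup>+R. ennreal (indicator {0<..<1} (1 - R) * ((1 - \<rho> * (1 - R)) powr (- a) * R powr (b - 1))) \<partial>lborel)"
    by (subst nn_integral_real_affine[where c = "-1" and t = 1]) auto
  also have "\<dots> \<le> (\<integral>\<^sup>+R. ennreal (\<delta> powr (- a)) * ennreal (indicator {0..\<delta>} R * R powr (b - 1))
      + ennreal (R powr (b - a - 1)) * indicator {\<delta>..1} R \<partial>lborel)"
  proof (rule nn_integral_mono)
    fix R :: real
    consider "R \<le> 0 \<or> R \<ge> 1" | "0 < R" "R \<le> \<delta>" | "\<delta> < R" "R < 1" by linarith
    then show "ennreal (indicator {0<..<1} (1 - R) * ((1 - \<rho> * (1 - R)) powr (- a) * R powr (b - 1)))
      \<le> ennreal (\<delta> powr (- a)) * ennreal (indicator {0..\<delta>} R * R powr (b - 1)) + ennreal (R powr (b - a - 1)) * indicator {\<delta>..1} R"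
    proof cases
      case 1
      then show ?thesis by auto
    next
      case 2
      have "\<rho> * (1 - R) \<le> \<rho> * 1" using 2 r by (intro mult_left_mono) auto
      then have "\<delta> \<le> 1 - \<rho> * (1 - R)" by (simp add: \<delta>_def)
      then have "(1 - \<rho> * (1 - R)) powr (- a) \<le> \<delta> powr (- a)"
        using d assms by (intro powr_mono2') auto
      then have "(1 - \<rho> * (1 - R)) powr (- a) * R powr (b - 1) \<le> \<delta> powr (- a) * R powr (b - 1)"
        by (intro mult_right_mono) auto
      then have "ennreal (indicator {0<..<1} (1 - R) * ((1 - \<rho> * (1 - R)) powr (- a) * R powr (b - 1)))
         \<le> ennreal (\<delta> powr (- a) * (indicator {0..\<delta>} R * R powr (b - 1)))"
        using 2 by (intro ennreal_leI) (auto simp: indicator_def)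
      also have "\<dots> = ennreal (\<delta> powr (- a)) * ennreal (indicator {0..\<delta>} R * R powr (b - 1))"
        by (rule ennreal_mult) auto
      finally show ?thesis by (rule order_trans) simp
    next
      case 3
      have "\<rho> * (1 - R) \<le> 1 * (1 - R)" using 3 r by (intro mult_right_mono) auto
      then have "R \<le> 1 - \<rho> * (1 - R)" by simp
      then have "(1 - \<rho> * (1 - R)) powr (- a) \<le> R powr (- a)"
        using d 3 assms by (intro powr_mono2') auto
      then have "(1 - \<rho> * (1 - R)) powr (- a) * R powr (b - 1) \<le> R powr (- a) * R powr (b - 1)"
        by (intro mult_right_mono) auto
      also have "\<dots> = R powr (b - a - 1)" by (simp add: powr_add[symmetric] algebra_simps)
      finally have "ennreal (indicator {0<..<1} (1 - R) * ((1 - \<rho> * (1 - R)) powr (- a) * R powr (b - 1))) \<le> ennreal (R powr (b - a - 1))"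
        by (intro ennreal_leI) (auto simp: indicator_def)
      then show ?thesis using 3 by simp
    qed
  qed
  also have "\<dots> = ennreal (\<delta> powr (- a)) * ennreal (\<delta> powr b / b) + (\<integral>\<^sup>+R. ennreal (R powr (b - a - 1)) * indicator {\<delta>..1} R \<partial>lborel)"
    using nn_integral_powr_from_0[of b \<delta>] assms d
    by (subst nn_integral_add) (auto simp: nn_integral_cmult)
  also have "(\<integral>\<^sup>+R. ennreal (R powr (b - a - 1)) * indicator {\<delta>..1} R \<partial>lborel) = ennreal (1 powr (b - a) / (b - a) - \<delta> powr (b - a) / (b - a))"
  proof (rule nn_integral_FTC_Icc[of "\<lambda>R. R powr (b - a - 1)" \<delta> 1 "\<lambda>R. R powr (b - a) / (b - a)"])
    fix R :: real assume "R \<in> {\<delta>..1}"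
    then have "((\<lambda>R. R powr (b - a)) has_real_derivative (b - a) * R powr (b - a - 1)) (at R)"
      using d by (intro has_real_derivative_powr) auto
    from DERIV_cdivide[OF this, of "b - a"]
    show "((\<lambda>R. R powr (b - a) / (b - a)) has_real_derivative R powr (b - a - 1)) (at R)"
      using assms by simp
  qed (use d in auto)
  also have "1 powr (b - a) / (b - a) - \<delta> powr (b - a) / (b - a) \<le> \<delta> powr (b - a) / (a - b)"
  proof -
    have "1 powr (b - a) / (b - a) \<le> 0" using assms by (simp add: divide_le_0_iff)
    moreover have "\<delta> powr (b - a) / (a - b) = - (\<delta> powr (b - a) / (b - a))"
      by (metis minus_diff_eq minus_divide_right)
    ultimately show ?thesis by linarith
  qed
  then have "ennreal (\<delta> powr (- a)) * ennreal (\<delta> powr b / b) + ennreal (1 powr (b - a) / (b - a) - \<delta> powr (b - a) / (b - a))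
      \<le> ennreal (\<delta> powr (- a)) * ennreal (\<delta> powr b / b) + ennreal (\<delta> powr (b - a) / (a - b))"
    by (intro add_left_mono ennreal_leI)
  also have "\<dots> = ennreal (\<delta> powr (- a) * (\<delta> powr b / b) + \<delta> powr (b - a) / (a - b))"
    using assms by (subst ennreal_plus) (simp_all add: ennreal_mult'[symmetric])
  also have "\<delta> powr (- a) * (\<delta> powr b / b) + \<delta> powr (b - a) / (a - b) = (1 / b + 1 / (a - b)) * \<delta> powr (b - a)"
    using d assms by (simp add: powr_diff powr_minus field_simps)
  finally show "(\<integral>\<^sup>+R. ennreal (indicator {0<..<1} R * ((1 - \<rho> * R) powr (- a) * (1 - R) powr (b - 1))) \<partial>lborel)
        \<le> ennreal ((1 / b + 1 / (a - b)) * (1 - \<rho>) powr (b - a))" by (simp add: \<delta>_def)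
qed

definition beta_weight :: "real \<Rightarrow> real \<Rightarrow> real \<Rightarrow> real" where
  "beta_weight p q \<tau> = indicator {0<..<1} \<tau> * (\<tau> powr (p - 1) * (1 - \<tau>) powr (q - 1))"

lemma beta_weight_nonneg: "beta_weight p q \<tau> \<ge> 0"
  by (simp add: beta_weight_def)

lemma beta_weight_measurable [measurable]: "beta_weight p q \<in> borel_measurable borel"
  unfolding beta_weight_def[abs_def] by measurable

lemma beta_weight_integral:
  assumes "p > 0" "q > 0"
  shows "has_bochner_integral lborel (beta_weight p q) (Beta p q)"
proof (rule has_bochner_integral_nn_integral)
  have "((\<lambda>t. t powr (p - 1) * (1 - t) powr (q - 1)) has_integral Beta p q) {0<..<1}"
    using has_integral_Beta_real[OF assms] by (simp add: has_integral_Icc_iff_Ioo)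
  from nn_integral_has_integral_lebesgue[OF _ this]
  show "(\<integral>\<^sup>+x. ennreal (beta_weight p q x) \<partial>lborel) = ennreal (Beta p q)"
    by (simp add: beta_weight_def)
  show "0 \<le> Beta p q" using assms by (simp add: Beta_def)
qed (auto simp: beta_weight_nonneg)

section \<open>Kernels of multipliers and the Beta integral\<close>

context sph_basis
begin

lemma measurable_T [measurable]: "T a k \<in> borel_measurable \<sigma>"
  by (rule continuous_on_sphere_measurable[OF continuous_on_T])

lemma F_eq_suminf: "x \<in> S \<Longrightarrow> F a (r *\<^sub>R x) = (\<Sum>k. of_real (r ^ k) * T a k x)"
  by (simp add: sph_series_def sph_term_scale)

lemma measurable_F: "(\<lambda>z. F a (fst z *\<^sub>R snd z)) \<in> borel_measurable (borel \<Otimes>\<^sub>M \<sigma>)"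
proof -
  have "(\<lambda>z. F a (fst z *\<^sub>R snd z)) \<in> borel_measurable (borel \<Otimes>\<^sub>M \<sigma>)
     \<longleftrightarrow> (\<lambda>z. \<Sum>k. of_real (fst z ^ k) * T a k (snd z)) \<in> borel_measurable (borel \<Otimes>\<^sub>M \<sigma>)"
    by (rule measurable_cong) (auto simp: space_pair_measure F_eq_suminf)
  then show ?thesis by simp
qed

text \<open>The integral kernel of the multiplier \<open>a\<close> followed by dilation with ratio
  \<open>r\<close>. With \<open>a = frac_mult t c\<close> it is the function whose s-th means enter
  \<open>N_norm\<close>.\<close>

definition kern :: "(nat \<Rightarrow> nat \<Rightarrow> complex) \<Rightarrow> real \<Rightarrow> 'a \<Rightarrow> 'a \<Rightarrow> complex" where
  "kern a r x y = F (\<lambda>k j. a k j * of_real (Y k j y)) (r *\<^sub>R x)"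

lemma growth_kern: "growth a \<Longrightarrow> y \<in> S \<Longrightarrow> growth (\<lambda>k j. a k j * of_real (Y k j y))"
  by (rule growth_mult[OF _ growth_Y])

lemma T_kern_sym: "T (\<lambda>k j. a k j * of_real (Y k j y)) k x = T (\<lambda>k j. a k j * of_real (Y k j x)) k y"
  by (simp add: T_def mult_ac)

lemma kern_sym: "x \<in> S \<Longrightarrow> y \<in> S \<Longrightarrow> kern a r x y = kern a r y x"
  by (simp add: kern_def F_eq_suminf T_kern_sym[of a y])

lemma measurable_kern: "(\<lambda>z. kern a r (fst z) (snd z)) \<in> borel_measurable (\<sigma> \<Otimes>\<^sub>M \<sigma>)"
proof -
  have Ym: "Y k j \<in> borel_measurable \<sigma>" if "j \<in> {1..sph_dim TYPE('a) k}" for k j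
    by (rule continuous_on_sphere_measurable[OF continuous_on_Y[OF that]])
  have "(\<lambda>z. \<Sum>j\<in>{1..sph_dim TYPE('a) k}. a k j * of_real (Y k j (snd z)) * of_real (Y k j (fst z))) \<in> borel_measurable (\<sigma> \<Otimes>\<^sub>M \<sigma>)" for k
    by (intro borel_measurable_sum) (use Ym in measurable)
  then have "(\<lambda>z. \<Sum>k. complex_of_real (r ^ k) * (\<Sum>j\<in>{1..sph_dim TYPE('a) k}. a k j * of_real (Y k j (snd z)) * of_real (Y k j (fst z))))
      \<in> borel_measurable (\<sigma> \<Otimes>\<^sub>M \<sigma>)" by measurable
  moreover have "(\<lambda>z. kern a r (fst z) (snd z)) \<in> borel_measurable (\<sigma> \<Otimes>\<^sub>M \<sigma>) \<longleftrightarrow>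
     (\<lambda>z. \<Sum>k. complex_of_real (r ^ k) * (\<Sum>j\<in>{1..sph_dim TYPE('a) k}. a k j * of_real (Y k j (snd z)) * of_real (Y k j (fst z))))
      \<in> borel_measurable (\<sigma> \<Otimes>\<^sub>M \<sigma>)"
    by (rule measurable_cong) (auto simp: space_pair_measure kern_def F_eq_suminf T_def)
  ultimately show ?thesis by simp
qed

lemma continuous_on_kern:
  assumes "growth a" "0 \<le> r" "r < 1" "x \<in> S"
  shows "continuous_on S (\<lambda>y. kern a r y x)" "continuous_on S (\<lambda>y. kern a r x y)"
proof -
  show 1: "continuous_on S (\<lambda>y. kern a r y x)"
    unfolding kern_def by (intro continuous_on_F_scaled growth_kern assms)
  show "continuous_on S (\<lambda>y. kern a r x y)"
    by (rule continuous_on_eq[OF 1]) (rule kern_sym[OF _ assms(4)])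
qed

text \<open>The radii multiply, so a given radius can be shared freely between the kernel and the
  function. Termwise integration reduces the claim to the coefficients of the kernel, supplied by
  \<open>F_coeff\<close>.\<close>

lemma kern_action:
  assumes a: "growth a" "0 \<le> r" "r < 1" and b: "growth b" "0 \<le> s" "s < 1" and x: "x \<in> S"
  shows "(\<integral>y. kern a r x y * F b (s *\<^sub>R y) \<partial>\<sigma>) = F (\<lambda>k j. a k j * b k j) ((r * s) *\<^sub>R x)"
proof -
  have kT: "(\<integral>y. kern a r x y * T b k y \<partial>\<sigma>) = of_real (r ^ k) * T (\<lambda>k j. a k j * b k j) k x" for k
  proof -
    have "(\<integral>y. kern a r x y * T b k y \<partial>\<sigma>) = (\<integral>y. (\<Sum>j\<in>{1..sph_dim TYPE('a) k}. b k j * (of_real (Y k j y) * kern a r y x)) \<partial>\<sigma>)"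
      by (rule Bochner_Integration.integral_cong[OF refl]) (simp add: T_def sum_distrib_left mult_ac kern_sym[OF x])
    also have "\<dots> = (\<Sum>j\<in>{1..sph_dim TYPE('a) k}. \<integral>y. b k j * (of_real (Y k j y) * kern a r y x) \<partial>\<sigma>)"
      by (rule Bochner_Integration.integral_sum)
         (intro continuous_on_sphere_integrable continuous_intros continuous_on_Y continuous_on_kern a x)
    also have "\<dots> = (\<Sum>j\<in>{1..sph_dim TYPE('a) k}. b k j * (of_real (r ^ k) * (a k j * of_real (Y k j x))))"
      by (intro sum.cong refl) (simp only: integral_mult_right_zero kern_def F_coeff[OF growth_kern[OF a(1) x] a(2,3)])
    finally show ?thesis by (simp add: T_def sum_distrib_left mult_ac)
  qed
  have 1: "(\<lambda>k. of_real (s ^ k) * (of_real (r ^ k) * T (\<lambda>k j. a k j * b k j) k x)) sums (\<integral>y. kern a r x y * F b (s *\<^sub>R y) \<partial>\<sigma>)"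
    using integral_F_sums[OF b continuous_on_kern(2)[OF a x]] unfolding kT .
  have "r * s \<le> 1 * s" using a b by (intro mult_right_mono) auto
  then have rs: "0 \<le> r * s" "r * s < 1" using a b by auto
  have 2: "(\<lambda>k. of_real ((r * s) ^ k) * T (\<lambda>k j. a k j * b k j) k x) sums F (\<lambda>k j. a k j * b k j) ((r * s) *\<^sub>R x)"
    by (rule F_sums[OF growth_mult[OF a(1) b(1)] rs x])
  have 3: "(\<lambda>k. of_real ((r * s) ^ k) * T (\<lambda>k j. a k j * b k j) k x) = (\<lambda>k. of_real (s ^ k) * (of_real (r ^ k) * T (\<lambda>k j. a k j * b k j) k x))"
    by (simp add: power_mult_distrib mult_ac)
  show ?thesis by (rule sums_unique2[OF 1 2[unfolded 3]])
qed

lemma kern_composition: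
  assumes a: "growth a" "0 \<le> r" "r < 1" and b: "growth b" "0 \<le> s" "s < 1" and xy: "x \<in> S" "y \<in> S"
  shows "(\<integral>z. kern a r x z * kern b s z y \<partial>\<sigma>) = kern (\<lambda>k j. a k j * b k j) (r * s) x y"
  using kern_action[OF a growth_kern[OF b(1) xy(2)] b(2,3) xy(1)] by (simp add: kern_def mult.assoc)

lemma growth_const: "growth (\<lambda>_ _. c)"
  unfolding growth_def
proof (intro allI impI exI ballI)
  fix r :: real and k j :: nat assume "0 < r" "r < 1"
  then have "cmod c * r ^ k \<le> cmod c * 1" by (intro mult_left_mono power_le_one) auto
  then show "cmod c * r ^ k \<le> cmod c" by simp
qed

lemma growth_beta:
  assumes a: "growth a" and pq: "p > 0" "q > 0"
  shows "growth (\<lambda>k j. of_real (Beta (real k + p) q) * a k j)"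
proof (rule growth_mult[OF growth_mono[OF growth_const] a])
  fix k j :: nat
  show "cmod (of_real (Beta (real k + p) q)) \<le> cmod (of_real (Beta p q))"
  proof -
    have "Beta (real k + p) q \<le> Beta p q" using pq by (intro Beta_real_mono) auto
    moreover have "Beta (real k + p) q \<ge> 0" using pq by (simp add: Beta_def)
    ultimately show ?thesis by (simp only: norm_of_real)
  qed
qed

text \<open>Beta(k + p, q) is the k-th moment of the Beta weight, so multiplying the coefficients by
  it averages \<open>F a\<close> over the radii r \<tau>. Only the bound of the modulus is recorded,
  in the form that \<open>minkowski_integral\<close> consumes.\<close>

lemma beta_integral:
  assumes a: "growth a" and pq: "p > 0" "q > 0" and r: "0 \<le> r" "r < 1" and x: "x \<in> S"
  shows "ennreal (cmod (F (\<lambda>k j. of_real (Beta (real k + p) q) * a k j) (r *\<^sub>R x)))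
     \<le> (\<integral>\<^sup>+\<tau>. ennreal (cmod (F a ((r * \<tau>) *\<^sub>R x)) * beta_weight p q \<tau>) \<partial>lborel)"
proof -
  obtain C \<rho> where C: "C \<ge> 0" "0 < \<rho>" "\<rho> < 1"
    "\<And>k r' x. 0 \<le> r' \<Longrightarrow> r' \<le> r \<Longrightarrow> x \<in> S \<Longrightarrow> r' ^ k * cmod (T a k x) \<le> C * \<rho> ^ k"
    using T_bound[OF a r] by blast
  define f where "f k \<tau> = beta_weight (real k + p) q \<tau> *\<^sub>R (of_real (r ^ k) * T a k x)" for k \<tau>
  have hb: "has_bochner_integral lborel (beta_weight (real k + p) q) (Beta (real k + p) q)" for k
    using pq by (intro beta_weight_integral) auto
  have bw: "beta_weight (real k + p) q \<tau> = beta_weight p q \<tau> * \<tau> ^ k" for k \<tau>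
    by (auto simp: beta_weight_def indicator_def powr_realpow[symmetric] powr_add[symmetric] algebra_simps)
  have fi: "integrable lborel (f k)" for k
    unfolding f_def using hb[of k] by (intro integrable_scaleR_left) (auto simp: has_bochner_integral_iff)
  have fI: "(\<integral>\<tau>. f k \<tau> \<partial>lborel) = of_real (r ^ k) * T (\<lambda>k j. of_real (Beta (real k + p) q) * a k j) k x" for k
  proof -
    have "(\<integral>\<tau>. f k \<tau> \<partial>lborel) = Beta (real k + p) q *\<^sub>R (of_real (r ^ k) * T a k x)"
      unfolding f_def using hb[of k] by (subst integral_scaleR_left) (auto simp: has_bochner_integral_iff)
    then show ?thesis by (simp add: T_def scaleR_conv_of_real sum_distrib_left mult_ac)
  qed
  have rt: "0 \<le> r * \<tau>" "r * \<tau> \<le> r" "r * \<tau> < 1" if "0 < \<tau>" "\<tau> < 1" for \<tau>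
    using r that mult_left_mono[of \<tau> 1 r] by auto
  have fs: "f k \<tau> = beta_weight p q \<tau> *\<^sub>R (of_real ((r * \<tau>) ^ k) * T a k x)" for k \<tau>
    by (simp add: f_def bw power_mult_distrib scaleR_conv_of_real mult_ac)
  have S: "summable (\<lambda>k. norm (f k \<tau>))" for \<tau>
  proof (cases "0 < \<tau> \<and> \<tau> < 1")
    case True
    then show ?thesis
      unfolding fs norm_scaleR using summable_T[OF a rt(1,3) x, of \<tau>] by (intro summable_mult) auto
  next
    case False
    then show ?thesis by (auto simp: fs beta_weight_def)
  qed
  have Fsum: "(\<Sum>k. f k \<tau>) = beta_weight p q \<tau> *\<^sub>R F a ((r * \<tau>) *\<^sub>R x)" for \<tau>
  proof (cases "0 < \<tau> \<and> \<tau> < 1")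
    case True
    then show ?thesis
      unfolding fs using sums_unique[OF sums_scaleR_right[OF F_sums[OF a rt(1,3) x, of \<tau>], of "beta_weight p q \<tau>"]] by simp
  next
    case False
    then show ?thesis by (auto simp: fs beta_weight_def)
  qed
  have Sn: "summable (\<lambda>k. \<integral>\<tau>. norm (f k \<tau>) \<partial>lborel)"
  proof (rule summable_comparison_test'[of "\<lambda>k. Beta p q * (C * \<rho> ^ k)" 0])
    show "summable (\<lambda>k. Beta p q * (C * \<rho> ^ k))" using C by (intro summable_mult summable_geometric) auto
    fix k
    have "(\<integral>\<tau>. norm (f k \<tau>) \<partial>lborel) = (\<integral>\<tau>. beta_weight (real k + p) q \<tau> * cmod (of_real (r ^ k) * T a k x) \<partial>lborel)"
      by (simp add: f_def beta_weight_nonneg)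
    also have "\<dots> = Beta (real k + p) q * cmod (of_real (r ^ k) * T a k x)"
    proof -
      have "integral\<^sup>L lborel (beta_weight (real k + p) q) = Beta (real k + p) q"
        using hb[of k] by (simp add: has_bochner_integral_iff)
      then show ?thesis by (simp only: integral_mult_left_zero)
    qed
    also have "\<dots> \<le> Beta p q * (C * \<rho> ^ k)"
      using C(4)[of r x k] r x Beta_real_mono[of p "real k + p" q q] pq C
      by (intro mult_mono) (auto simp: norm_mult norm_power Beta_def)
    finally show "norm (\<integral>\<tau>. norm (f k \<tau>) \<partial>lborel) \<le> Beta p q * (C * \<rho> ^ k)" by simp
  qed
  note si = sums_integral[OF fi _ Sn] and ii = integrable_suminf[OF fi _ Sn]
  have "(\<lambda>k. of_real (r ^ k) * T (\<lambda>k j. of_real (Beta (real k + p) q) * a k j) k x) sums (\<integral>\<tau>. (\<Sum>k. f k \<tau>) \<partial>lborel)"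
    using si S unfolding fI by simp
  then have "F (\<lambda>k j. of_real (Beta (real k + p) q) * a k j) (r *\<^sub>R x) = (\<integral>\<tau>. (\<Sum>k. f k \<tau>) \<partial>lborel)"
    using F_sums[OF growth_beta[OF a pq] r x] sums_unique2 by blast
  also have "ennreal (cmod \<dots>) \<le> (\<integral>\<^sup>+\<tau>. ennreal (norm (\<Sum>k. f k \<tau>)) \<partial>lborel)"
    by (rule integral_norm_bound_ennreal) (use ii S in simp)
  also have "\<dots> = (\<integral>\<^sup>+\<tau>. ennreal (cmod (F a ((r * \<tau>) *\<^sub>R x)) * beta_weight p q \<tau>) \<partial>lborel)"
    by (simp add: Fsum beta_weight_nonneg mult.commute)
  finally show ?thesis .
qed

text \<open>Closed form and series have the same moments, so \<open>completeness\<close> identifies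
  them. The factor 1 / area reflects that the basis is orthonormal for a measure of total mass
  \<open>area\<close>.\<close>

lemma poisson_expansion:
  assumes y: "y \<in> S" and x: "x \<in> S" and r: "0 \<le> r" "r < 1"
  shows "F (\<lambda>k j. of_real (Y k j y)) (r *\<^sub>R x) = of_real (poisson_fun y (r *\<^sub>R x) / area)"
proof -
  let ?h = "\<lambda>x. F (\<lambda>k j. of_real (Y k j y)) (r *\<^sub>R x) - of_real (poisson_fun y (r *\<^sub>R x) / area)"
  note pc = continuous_on_poisson_sphere[OF y r]
  note Fc = continuous_on_F_scaled[OF growth_Y[OF y] r]
  have "?h x = 0"
  proof (rule completeness[OF _ _ x])
    show "continuous_on S ?h"
      by (intro continuous_intros Fc pc) (use area_pos in auto)
    fix k j assume j: "j \<in> {1..sph_dim TYPE('a) k}"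
    have i1: "integrable \<sigma> (\<lambda>x. of_real (Y k j x) * F (\<lambda>k j. of_real (Y k j y)) (r *\<^sub>R x))"
      by (intro continuous_on_sphere_integrable continuous_intros continuous_on_Y j Fc)
    have i2: "integrable \<sigma> (\<lambda>x. complex_of_real (Y k j x * poisson_fun y (r *\<^sub>R x) / area))"
      using area_pos by (intro continuous_on_sphere_integrable continuous_intros continuous_on_Y j pc) auto
    have "(\<integral>x. of_real (Y k j x) * ?h x \<partial>\<sigma>) = (\<integral>x. of_real (Y k j x) * F (\<lambda>k j. of_real (Y k j y)) (r *\<^sub>R x)
        - of_real (Y k j x * poisson_fun y (r *\<^sub>R x) / area) \<partial>\<sigma>)"
      by (simp add: right_diff_distrib)
    also have "\<dots> = of_real (r ^ k) * of_real (Y k j y) - of_real (\<integral>x. Y k j x * poisson_fun y (r *\<^sub>R x) / area \<partial>\<sigma>)"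
      by (simp only: Bochner_Integration.integral_diff[OF i1 i2] F_coeff[OF growth_Y[OF y] r j] integral_complex_of_real)
    also have "(\<integral>x. Y k j x * poisson_fun y (r *\<^sub>R x) / area \<partial>\<sigma>) = r ^ k * Y k j y"
      using Y_poisson[OF j y r] area_pos by simp
    finally show "(\<integral>x. of_real (Y k j x) * ?h x \<partial>\<sigma>) = 0" using area_pos by simp
  qed
  then show ?thesis by simp
qed

section \<open>Radial symbols and the L1 means of their kernels\<close>

definition zonal :: "nat \<Rightarrow> 'a \<Rightarrow> 'a \<Rightarrow> real" where
  "zonal k x y = (\<Sum>j\<in>{1..sph_dim TYPE('a) k}. Y k j y * Y k j x)"

lemma T_zonal: "T (\<lambda>k j. of_real (\<mu> k) * of_real (Y k j y)) k x = of_real (\<mu> k * zonal k x y)"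
  by (simp add: T_def zonal_def sum_distrib_left mult.assoc)

lemma zonal_sums:
  assumes "y \<in> S" "x \<in> S" "0 \<le> r" "r < 1"
  shows "(\<lambda>k. zonal k x y * r ^ k) sums (poisson_fun y (r *\<^sub>R x) / area)"
proof -
  have 1: "(\<lambda>k. of_real (r ^ k) * T (\<lambda>k j. of_real (Y k j y)) k x) sums of_real (poisson_fun y (r *\<^sub>R x) / area)"
    using F_sums[OF growth_Y[OF assms(1)] assms(3,4,2)] unfolding poisson_expansion[OF assms] .
  have eq: "(\<lambda>k. of_real (r ^ k) * T (\<lambda>k j. of_real (Y k j y)) k x) = (\<lambda>k. complex_of_real (zonal k x y * r ^ k))"
    by (rule ext) (use T_zonal[of "\<lambda>_. 1" y _ x] in \<open>simp add: mult.commute\<close>)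
  have "(\<lambda>k. complex_of_real (zonal k x y * r ^ k)) sums of_real (poisson_fun y (r *\<^sub>R x) / area)"
    using 1 unfolding eq .
  then show ?thesis by (simp only: sums_of_real_iff)
qed

text \<open>Multiplication of the coefficients by k is the operator r d/dr, applied here to the
  expansion of the Poisson kernel.\<close>

lemma zonal_derivative_sums:
  assumes y: "y \<in> S" and x: "x \<in> S" and r: "0 \<le> r" "r < 1"
  shows "(\<lambda>k. real k * zonal k x y * r ^ k) sums (r * (poisson_fun' y (r *\<^sub>R x) x / area))"
proof (cases "r = 0")
  case True
  have "(\<lambda>k. real k * zonal k x y * r ^ k) = (\<lambda>_. 0)" using True by (auto simp: fun_eq_iff power_0_left)
  then show ?thesis using True by simp
next
  case False
  then have r0: "0 < r" using r by simp
  define c where "c k = zonal k x y" for k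
  note cs = zonal_sums[OF y x, folded c_def]
  have sm: "summable (\<lambda>k. c k * z ^ k)" if "norm z < 1" for z :: real
  proof (rule powser_inside)
    show "summable (\<lambda>k. c k * ((norm z + 1) / 2) ^ k)"
      using that by (intro sums_summable[OF cs]) auto
  qed (use that in auto)
  have "((\<lambda>z. \<Sum>k. c k * z ^ k) has_field_derivative (\<Sum>k. diffs c k * r ^ k)) (at r)"
    by (rule termdiffs_strong'[of 1]) (use sm r in auto)
  moreover have "((\<lambda>z. \<Sum>k. c k * z ^ k) has_field_derivative (poisson_fun' y (r *\<^sub>R x) x / area)) (at r)"
  proof -
    have ne: "r *\<^sub>R x \<noteq> y"
    proof
      assume "r *\<^sub>R x = y"
      then have "norm (r *\<^sub>R x) = norm y" by simp
      then show False using x y r by simp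
    qed
    have 1: "((\<lambda>r. r *\<^sub>R x) has_derivative (\<lambda>h. h *\<^sub>R x)) (at r)" by (auto intro!: derivative_eq_intros)
    have "((\<lambda>r. poisson_fun y (r *\<^sub>R x)) has_derivative (\<lambda>h. poisson_fun' y (r *\<^sub>R x) (h *\<^sub>R x))) (at r)"
      by (rule has_derivative_compose[OF 1 poisson_fun_has_derivative[OF ne]])
    moreover have "poisson_fun' y (r *\<^sub>R x) (h *\<^sub>R x) = poisson_fun' y (r *\<^sub>R x) x * h" for h
      using linear_cmul[OF has_derivative_linear[OF poisson_fun_has_derivative[OF ne]], of h x] by simp
    ultimately have "((\<lambda>r. poisson_fun y (r *\<^sub>R x)) has_field_derivative poisson_fun' y (r *\<^sub>R x) x) (at r)"
      by (simp add: has_field_derivative_def)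
    then have "((\<lambda>r. poisson_fun y (r *\<^sub>R x) / area) has_field_derivative poisson_fun' y (r *\<^sub>R x) x / area) (at r)"
      by (rule DERIV_cdivide)
    then show ?thesis
    proof (rule has_field_derivative_transform_within_open[of _ _ _ "{0<..<1}"])
      fix z :: real assume "z \<in> {0<..<1}"
      then show "poisson_fun y (z *\<^sub>R x) / area = (\<Sum>k. c k * z ^ k)"
        using sums_unique[OF cs[of z]] by auto
    qed (use r0 r in auto)
  qed
  ultimately have eq: "(\<Sum>k. diffs c k * r ^ k) = poisson_fun' y (r *\<^sub>R x) x / area"
    by (rule DERIV_unique)
  have "summable (\<lambda>k. diffs c k * r ^ k)"
    by (rule termdiff_converges[of _ 1]) (use sm r in auto)
  then have "(\<lambda>k. diffs c k * r ^ k) sums (poisson_fun' y (r *\<^sub>R x) x / area)"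
    unfolding eq[symmetric] by (rule summable_sums)
  then have "(\<lambda>k. r * (diffs c k * r ^ k)) sums (r * (poisson_fun' y (r *\<^sub>R x) x / area))"
    by (rule sums_mult)
  moreover have "r * (diffs c k * r ^ k) = real (Suc k) * c (Suc k) * r ^ Suc k" for k
    by (simp add: diffs_def mult_ac)
  ultimately have "(\<lambda>k. real (Suc k) * c (Suc k) * r ^ Suc k) sums (r * (poisson_fun' y (r *\<^sub>R x) x / area))"
    by simp
  then show ?thesis
    unfolding c_def by (subst (asm) sums_Suc_iff) simp
qed

abbreviation "radial \<mu> \<equiv> (\<lambda>k (j::nat). complex_of_real (\<mu> k))"

text \<open>Bernoulli's inequality for powers of 1 / r bounds k r^k by 1 / (1 / r - 1).\<close>

lemma growth_linear: "growth (radial (\<lambda>k. real k + e))"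
  unfolding growth_def
proof (intro allI impI)
  fix r :: real assume r: "0 < r" "r < 1"
  have x: "1 / r - 1 > 0" using r by simp
  have "real k * r ^ k \<le> 1 / (1 / r - 1)" for k
  proof -
    have "1 + real k * (1 / r - 1) \<le> (1 + (1 / r - 1)) ^ k" using x r by (intro Bernoulli_inequality) auto
    moreover have "r ^ k \<ge> 0" using r by simp
    ultimately have "(1 + real k * (1 / r - 1)) * r ^ k \<le> (1 + (1 / r - 1)) ^ k * r ^ k" by (rule mult_right_mono)
    also have "\<dots> = 1" using r by (simp add: power_one_over)
    finally have "real k * r ^ k * (1 / r - 1) \<le> 1 - r ^ k" by (simp add: algebra_simps)
    also have "\<dots> \<le> 1" using r by simp
    finally show ?thesis using x by (simp add: pos_le_divide_eq)
  qed
  moreover have "\<bar>e\<bar> * r ^ k \<le> \<bar>e\<bar> * 1" for k using r by (intro mult_left_mono power_le_one) auto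
  ultimately have "cmod (complex_of_real (real k + e)) * r ^ k \<le> 1 / (1 / r - 1) + \<bar>e\<bar>" for k
  proof -
    have "cmod (complex_of_real (real k + e)) * r ^ k \<le> (real k + \<bar>e\<bar>) * r ^ k"
      using r unfolding norm_of_real by (intro mult_right_mono) auto
    also have "\<dots> = real k * r ^ k + \<bar>e\<bar> * r ^ k" by (simp add: distrib_right)
    finally show ?thesis using \<open>\<And>k. real k * r ^ k \<le> 1 / (1 / r - 1)\<close>[of k] \<open>\<And>k. \<bar>e\<bar> * r ^ k \<le> \<bar>e\<bar> * 1\<close>[of k] by linarith
  qed
  then show "\<exists>C. \<forall>k. \<forall>j\<in>{1..sph_dim TYPE('a) k}. cmod (complex_of_real (real k + e)) * r ^ k \<le> C" by blast
qed

text \<open>The symbol k + e acts on the Poisson kernel as r d/dr + e, and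
  \<open>poisson_fun'_radial\<close> bounds the result by a multiple of the kernel itself, whose
  mass is known.\<close>

lemma kern_linear_bound:
  assumes y: "y \<in> S" and x: "x \<in> S" and r: "0 \<le> r" "r < 1" and e: "e \<ge> 0"
  shows "cmod (kern (radial (\<lambda>k. real k + e)) r x y) \<le> (real DIM('a) + 2 + e) / (1 - r) * (poisson_fun y (r *\<^sub>R x) / area)"
proof -
  define P where "P = poisson_fun y (r *\<^sub>R x) / area"
  have P0: "P \<ge> 0" unfolding P_def using x r area_pos by (intro divide_nonneg_pos poisson_fun_nonneg) auto
  have "(\<lambda>k. real k * zonal k x y * r ^ k + e * (zonal k x y * r ^ k)) sums (r * (poisson_fun' y (r *\<^sub>R x) x / area) + e * P)"
    unfolding P_def by (intro sums_add sums_mult zonal_derivative_sums zonal_sums assms)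
  then have 1: "(\<lambda>k. complex_of_real (real k * zonal k x y * r ^ k + e * (zonal k x y * r ^ k))) sums of_real (r * (poisson_fun' y (r *\<^sub>R x) x / area) + e * P)"
    by (rule sums_of_real)
  have eq: "(\<lambda>k. complex_of_real (real k * zonal k x y * r ^ k + e * (zonal k x y * r ^ k)))
     = (\<lambda>k. of_real (r ^ k) * T (\<lambda>k j. complex_of_real (real k + e) * of_real (Y k j y)) k x)"
    by (rule ext, unfold T_zonal[of "\<lambda>k. real k + e"]) (simp add: algebra_simps)
  have "kern (radial (\<lambda>k. real k + e)) r x y = of_real (r * (poisson_fun' y (r *\<^sub>R x) x / area) + e * P)"
    unfolding kern_def by (rule sums_unique2[OF F_sums[OF growth_kern[OF growth_linear y] r x] 1[unfolded eq]])
  then have "cmod (kern (radial (\<lambda>k. real k + e)) r x y) = \<bar>r * (poisson_fun' y (r *\<^sub>R x) x / area) + e * P\<bar>"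
    by (simp only: norm_of_real)
  also have "\<dots> \<le> r * (\<bar>poisson_fun' y (r *\<^sub>R x) x\<bar> / area) + e * P"
  proof -
    have "\<bar>r * (poisson_fun' y (r *\<^sub>R x) x / area)\<bar> = r * (\<bar>poisson_fun' y (r *\<^sub>R x) x\<bar> / area)"
      using r area_pos by (simp add: abs_mult)
    moreover have "\<bar>e * P\<bar> = e * P" using e P0 by simp
    ultimately show ?thesis
      using abs_triangle_ineq[of "r * (poisson_fun' y (r *\<^sub>R x) x / area)" "e * P"] by (simp only:)
  qed
  also have "\<dots> \<le> 1 * ((real DIM('a) + 2) / (1 - r) * poisson_fun y (r *\<^sub>R x) / area) + e / (1 - r) * P"
  proof (intro add_mono mult_mono)
    show "\<bar>poisson_fun' y (r *\<^sub>R x) x\<bar> / area \<le> (real DIM('a) + 2) / (1 - r) * poisson_fun y (r *\<^sub>R x) / area"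
      using poisson_fun'_radial[of x y r] x y r area_pos by (intro divide_right_mono) auto
    show "e \<le> e / (1 - r)" using e r by (simp add: pos_le_divide_eq mult_left_le)
  qed (use r P0 e area_pos in auto)
  also have "\<dots> = (real DIM('a) + 2 + e) / (1 - r) * P"
    by (simp add: P_def add_divide_distrib algebra_simps)
  finally show ?thesis unfolding P_def .
qed

text \<open>Stated for the symbol, with one constant for all poles y, because symbols multiply under
  composition of kernels and the orders then add.\<close>

definition L1_order :: "(nat \<Rightarrow> real) \<Rightarrow> real \<Rightarrow> bool" where
  "L1_order \<mu> t \<longleftrightarrow> growth (radial \<mu>) \<and> (\<exists>C>0. \<forall>r\<in>{0..<1}. \<forall>y\<in>S.
      (\<integral>\<^sup>+x. ennreal (cmod (kern (radial \<mu>) r x y)) \<partial>\<sigma>) \<le> ennreal (C * (1 - r) powr (- t)))"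

lemma poisson_nn_mass:
  assumes "y \<in> S" "0 \<le> r" "r < 1"
  shows "(\<integral>\<^sup>+x. ennreal (poisson_fun y (r *\<^sub>R x) / area) \<partial>\<sigma>) = 1"
proof -
  have "(\<integral>\<^sup>+x. ennreal (poisson_fun y (r *\<^sub>R x) / area) \<partial>\<sigma>) = ennreal (\<integral>x. poisson_fun y (r *\<^sub>R x) / area \<partial>\<sigma>)"
    using area_pos assms
    by (intro nn_integral_eq_integral continuous_on_sphere_integrable continuous_intros continuous_on_poisson_sphere)
       (auto intro!: AE_I2 divide_nonneg_pos poisson_fun_nonneg)
  also have "(\<integral>x. poisson_fun y (r *\<^sub>R x) / area \<partial>\<sigma>) = 1"
    using poisson_mass[OF assms] area_pos by simp
  finally show ?thesis by simp
qed

lemma L1_order_linear: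
  assumes e: "e \<ge> 0"
  shows "L1_order (\<lambda>k. real k + e) 1"
  unfolding L1_order_def
proof (intro conjI growth_linear exI[of _ "real DIM('a) + 2 + e"] ballI)
  fix r :: real and y assume r: "r \<in> {0..<1}" and y: "y \<in> S"
  have "(\<integral>\<^sup>+x. ennreal (cmod (kern (radial (\<lambda>k. real k + e)) r x y)) \<partial>\<sigma>)
     \<le> (\<integral>\<^sup>+x. ennreal ((real DIM('a) + 2 + e) / (1 - r)) * ennreal (poisson_fun y (r *\<^sub>R x) / area) \<partial>\<sigma>)"
  proof (rule nn_integral_mono)
    fix x assume "x \<in> space \<sigma>"
    then have x: "x \<in> S" by simp
    show "ennreal (cmod (kern (radial (\<lambda>k. real k + e)) r x y)) \<le> ennreal ((real DIM('a) + 2 + e) / (1 - r)) * ennreal (poisson_fun y (r *\<^sub>R x) / area)"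
      using kern_linear_bound[OF y x _ _ e, of r] r e by (subst ennreal_mult'[symmetric]) (auto intro!: ennreal_leI)
  qed
  also have "\<dots> = ennreal ((real DIM('a) + 2 + e) / (1 - r)) * (\<integral>\<^sup>+x. ennreal (poisson_fun y (r *\<^sub>R x) / area) \<partial>\<sigma>)"
    using area_pos r
    by (intro nn_integral_cmult measurable_compose[OF continuous_on_sphere_measurable measurable_ennreal] continuous_intros
        continuous_on_poisson_sphere y) auto
  also have "\<dots> = ennreal ((real DIM('a) + 2 + e) * (1 - r) powr (- 1))"
    using poisson_nn_mass[OF y, of r] r by (simp add: powr_minus_divide)
  finally show "(\<integral>\<^sup>+x. ennreal (cmod (kern (radial (\<lambda>k. real k + e)) r x y)) \<partial>\<sigma>) \<le> ennreal ((real DIM('a) + 2 + e) * (1 - r) powr (- 1))" .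
qed (use e in auto)

lemma L1_order_1: "L1_order (\<lambda>_. 1) 0"
  unfolding L1_order_def
proof (intro conjI exI[of _ 1] ballI)
  show "growth (radial (\<lambda>_. 1))" by (rule growth_const)
  fix r :: real and y assume r: "r \<in> {0..<1}" and y: "y \<in> S"
  have "(\<integral>\<^sup>+x. ennreal (cmod (kern (radial (\<lambda>_. 1)) r x y)) \<partial>\<sigma>) = (\<integral>\<^sup>+x. ennreal (poisson_fun y (r *\<^sub>R x) / area) \<partial>\<sigma>)"
  proof (rule nn_integral_cong)
    fix x assume "x \<in> space \<sigma>"
    then have x: "x \<in> S" by simp
    have "poisson_fun y (r *\<^sub>R x) / area \<ge> 0" using x r area_pos by (intro divide_nonneg_pos poisson_fun_nonneg) auto
    then show "ennreal (cmod (kern (radial (\<lambda>_. 1)) r x y)) = ennreal (poisson_fun y (r *\<^sub>R x) / area)"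
    proof -
      have "kern (radial (\<lambda>_. 1)) r x y = of_real (poisson_fun y (r *\<^sub>R x) / area)"
        using poisson_expansion[OF y x, of r] r by (simp add: kern_def)
      then show ?thesis using \<open>poisson_fun y (r *\<^sub>R x) / area \<ge> 0\<close> by (simp only: norm_of_real abs_of_nonneg)
    qed
  qed
  then show "(\<integral>\<^sup>+x. ennreal (cmod (kern (radial (\<lambda>_. 1)) r x y)) \<partial>\<sigma>) \<le> ennreal (1 * (1 - r) powr - 0)"
    using poisson_nn_mass[OF y, of r] r by simp
qed simp

text \<open>The product kernel at r is the composition of the two kernels at sqrt r, and
  \<open>minkowski_integral\<close> with exponent 1 multiplies the L1 bounds. Returning from 1 -
  sqrt r to 1 - r costs the factor \<open>2 powr (t + u)\<close>.\<close>

lemma L1_order_mult: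
  assumes "L1_order \<mu> t" "L1_order \<nu> u" "t \<ge> 0" "u \<ge> 0"
  shows "L1_order (\<lambda>k. \<mu> k * \<nu> k) (t + u)"
proof -
  obtain A where A: "A > 0" "\<And>r y. r \<in> {0..<1} \<Longrightarrow> y \<in> S \<Longrightarrow> (\<integral>\<^sup>+x. ennreal (cmod (kern (radial \<mu>) r x y)) \<partial>\<sigma>) \<le> ennreal (A * (1 - r) powr (- t))"
    and gm: "growth (radial \<mu>)" using assms(1) unfolding L1_order_def by blast
  obtain B where B: "B > 0" "\<And>r y. r \<in> {0..<1} \<Longrightarrow> y \<in> S \<Longrightarrow> (\<integral>\<^sup>+x. ennreal (cmod (kern (radial \<nu>) r x y)) \<partial>\<sigma>) \<le> ennreal (B * (1 - r) powr (- u))"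
    and gn: "growth (radial \<nu>)" using assms(2) unfolding L1_order_def by blast
  have rad: "radial (\<lambda>k. \<mu> k * \<nu> k) = (\<lambda>k j. complex_of_real (\<mu> k) * complex_of_real (\<nu> k))" by simp
  show ?thesis
    unfolding L1_order_def
  proof (intro conjI exI[of _ "A * B * 2 powr (t + u)"] ballI)
    show "growth (radial (\<lambda>k. \<mu> k * \<nu> k))" unfolding rad by (rule growth_mult[OF gm gn])
    show "A * B * 2 powr (t + u) > 0" using A B by simp
    fix r :: real and y assume r: "r \<in> {0..<1}" and y: "y \<in> S"
    define s where "s = sqrt r"
    have s: "s \<in> {0..<1}" "s * s = r" using r by (auto simp: s_def)
    define I where "I = A * (1 - s) powr (- t) * (B * (1 - s) powr (- u))"
    have I0: "I > 0" using A B s by (simp add: I_def)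
    have "(\<integral>\<^sup>+x. ennreal (cmod (kern (radial (\<lambda>k. \<mu> k * \<nu> k)) r x y) powr 1) \<partial>\<sigma>) \<le> ennreal (I powr 1)"
    proof (rule minkowski_integral[where M = \<sigma> and l = "\<lambda>z x. cmod (kern (radial \<mu>) s x z)" and A = "\<lambda>_. A * (1 - s) powr (- t)"
          and w = "\<lambda>z. cmod (kern (radial \<nu>) s z y)"])
      have "(\<lambda>p. kern (radial \<mu>) s (fst (snd p, fst p)) (snd (snd p, fst p))) \<in> borel_measurable (\<sigma> \<Otimes>\<^sub>M \<sigma>)"
        by (rule measurable_compose[OF _ measurable_kern[of "radial \<mu>" s]]) measurable
      then show "(\<lambda>(z, x). cmod (kern (radial \<mu>) s x z)) \<in> borel_measurable (\<sigma> \<Otimes>\<^sub>M \<sigma>)"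
        by (simp add: case_prod_beta')
      have kn: "(\<lambda>z. kern (radial \<nu>) s z y) \<in> borel_measurable \<sigma>"
        using s by (intro continuous_on_sphere_measurable continuous_on_kern gn y) auto
      then show "(\<lambda>z. cmod (kern (radial \<nu>) s z y)) \<in> borel_measurable \<sigma>" by measurable
      show "(\<integral>\<^sup>+x. ennreal (cmod (kern (radial \<mu>) s x z) powr 1) \<partial>\<sigma>) \<le> ennreal ((A * (1 - s) powr (- t)) powr 1)"
        if "z \<in> space \<sigma>" for z
        using A(2)[OF s(1), of z] that A(1) by simp
      have "(\<integral>\<^sup>+z. ennreal (A * (1 - s) powr (- t) * cmod (kern (radial \<nu>) s z y)) \<partial>\<sigma>)
         = ennreal (A * (1 - s) powr (- t)) * (\<integral>\<^sup>+z. ennreal (cmod (kern (radial \<nu>) s z y)) \<partial>\<sigma>)"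
        using A(1) kn by (subst nn_integral_cmult[symmetric]) (auto simp: ennreal_mult')
      also have "\<dots> \<le> ennreal (A * (1 - s) powr (- t)) * ennreal (B * (1 - s) powr (- u))"
        by (intro mult_left_mono B s y) auto
      also have "\<dots> = ennreal I" using A(1) by (simp add: I_def ennreal_mult'[symmetric])
      finally show "(\<integral>\<^sup>+z. ennreal (A * (1 - s) powr (- t) * cmod (kern (radial \<nu>) s z y)) \<partial>\<sigma>) \<le> ennreal I" .
      fix x assume "x \<in> space \<sigma>"
      then have x: "x \<in> S" by simp
      have "kern (radial (\<lambda>k. \<mu> k * \<nu> k)) r x y = (\<integral>z. kern (radial \<mu>) s x z * kern (radial \<nu>) s z y \<partial>\<sigma>)"
        using kern_composition[OF gm _ _ gn _ _ x y, of s s] s by simp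
      also have "ennreal (cmod \<dots>) \<le> (\<integral>\<^sup>+z. ennreal (norm (kern (radial \<mu>) s x z * kern (radial \<nu>) s z y)) \<partial>\<sigma>)"
        using s by (intro integral_norm_bound_ennreal continuous_on_sphere_integrable continuous_intros continuous_on_kern gm gn x y) auto
      finally show "ennreal (cmod (kern (radial (\<lambda>k. \<mu> k * \<nu> k)) r x y)) \<le> (\<integral>\<^sup>+z. ennreal (cmod (kern (radial \<mu>) s x z) * cmod (kern (radial \<nu>) s z y)) \<partial>\<sigma>)"
        by (simp only: norm_mult)
    qed (use A I0 s in \<open>auto intro: sigma_finite_measure_axioms\<close>)
    then have "(\<integral>\<^sup>+x. ennreal (cmod (kern (radial (\<lambda>k. \<mu> k * \<nu> k)) r x y)) \<partial>\<sigma>) \<le> ennreal I"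
      using I0 by simp
    also have "I \<le> A * B * 2 powr (t + u) * (1 - r) powr (- (t + u))"
    proof -
      have "1 - r = (1 - s) * (1 + s)" by (simp add: s(2)[symmetric] algebra_simps)
      also have "\<dots> \<le> (1 - s) * 2" using s by (intro mult_left_mono) auto
      finally have "((1 - s) * 2) powr (- (t + u)) \<le> (1 - r) powr (- (t + u))"
        using r assms by (intro powr_mono2') auto
      moreover have "((1 - s) * 2) powr (- (t + u)) = (1 - s) powr (- (t + u)) * 2 powr (- (t + u))"
        by (subst powr_mult) (use s in auto)
      ultimately have "(1 - s) powr (- (t + u)) * 2 powr (- (t + u)) * 2 powr (t + u) \<le> (1 - r) powr (- (t + u)) * 2 powr (t + u)"
        by (intro mult_right_mono) auto
      moreover have "2 powr (- (t + u)) * 2 powr (t + u) = (1::real)" by (subst powr_add[symmetric]) simp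
      ultimately have "(1 - s) powr (- (t + u)) \<le> 2 powr (t + u) * (1 - r) powr (- (t + u))"
        by (simp only: mult.assoc mult_1_right mult.commute[of "(1 - r) powr (- (t + u))"])
      then have "A * B * (1 - s) powr (- (t + u)) \<le> A * B * (2 powr (t + u) * (1 - r) powr (- (t + u)))"
        using A B by (intro mult_left_mono) auto
      moreover have "I = A * B * (1 - s) powr (- (t + u))"
        by (simp add: I_def powr_add[symmetric] mult_ac)
      ultimately show ?thesis by (simp add: mult.assoc)
    qed
    finally show "(\<integral>\<^sup>+x. ennreal (cmod (kern (radial (\<lambda>k. \<mu> k * \<nu> k)) r x y)) \<partial>\<sigma>) \<le> ennreal (A * B * 2 powr (t + u) * (1 - r) powr (- (t + u)))"
      by (simp add: ennreal_leI)
  qed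
qed

text \<open>The rising factorial is a product of N linear symbols, each of order 1.\<close>

lemma L1_order_pochhammer:
  assumes "e \<ge> 0"
  shows "L1_order (\<lambda>k. pochhammer (real k + e) N) (real N)"
proof (induction N)
  case 0
  then show ?case using L1_order_1 by simp
next
  case (Suc N)
  have "L1_order (\<lambda>k. pochhammer (real k + e) N * (real k + (e + real N))) (real N + 1)"
    using assms by (intro L1_order_mult Suc L1_order_linear) auto
  then show ?case by (simp add: pochhammer_Suc algebra_simps)
qed

definition frac_coeff :: "real \<Rightarrow> nat \<Rightarrow> real" where
  "frac_coeff t k = Gamma (real k + real DIM('a) / 2 + t) / (Gamma (real k + real DIM('a) / 2) * Gamma t)"

text \<open>
  Integer orders arise by composing kernels of order 1 at radius \<open>\<surd>r\<close>; a Beta integral then lowers an integer order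
  to a fractional one.
\<close>
theorem L1_order_frac:
  assumes t: "t > 0" and dim: "DIM('a) \<ge> 2"
  shows "L1_order (frac_coeff t) t"
proof -
  obtain N :: nat where N: "real N > t" using reals_Archimedean2 by blast
  define e where "e = real DIM('a) / 2"
  have e: "e \<ge> 1" using dim by (simp add: e_def)
  define \<mu> where "\<mu> k = pochhammer (real k + e) N" for k
  \<comment> \<open>Beta(k + e + t, N - t) replaces Gamma(k + e + N) by Gamma(k + e + t) up to a
    constant, which \<gamma> corrects; so it lowers the order from N to t.\<close>
  define p q where "p = e + t" and "q = real N - t"
  have pq: "p > 0" "q > 0" "p \<ge> 1" using e t N by (auto simp: p_def q_def)
  define \<gamma> where "\<gamma> = 1 / (Gamma t * Gamma q)"
  have \<gamma>: "\<gamma> > 0" using t pq by (simp add: \<gamma>_def)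
  have fc: "frac_coeff t k = \<gamma> * (Beta (real k + p) q * \<mu> k)" for k
  proof -
    have "real k + e \<notin> \<int>\<^sub>\<le>\<^sub>0" using e by (auto elim!: nonpos_Ints_cases)
    then have "\<mu> k = Gamma (real k + e + real N) / Gamma (real k + e)"
      unfolding \<mu>_def by (rule pochhammer_Gamma)
    moreover have "Gamma (real k + e + real N) > 0" "Gamma q > 0" using e pq by auto
    ultimately show ?thesis
      by (simp add: frac_coeff_def \<gamma>_def Beta_def p_def q_def e_def[symmetric] add.assoc)
  qed
  obtain A where A: "A > 0" "\<And>r y. r \<in> {0..<1} \<Longrightarrow> y \<in> S \<Longrightarrow> (\<integral>\<^sup>+x. ennreal (cmod (kern (radial \<mu>) r x y)) \<partial>\<sigma>) \<le> ennreal (A * (1 - r) powr (- real N))"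
    and gm: "growth (radial \<mu>)" using L1_order_pochhammer[of e N] e unfolding L1_order_def \<mu>_def by force
  obtain C where C: "C > 0"
    "\<And>\<rho>. 0 \<le> \<rho> \<Longrightarrow> \<rho> < 1 \<Longrightarrow> (\<integral>\<^sup>+R. ennreal (indicator {0<..<1} R * ((1 - \<rho> * R) powr (- real N) * (1 - R) powr (q - 1))) \<partial>lborel)
        \<le> ennreal (C * (1 - \<rho>) powr (q - real N))"
    using nn_integral_power_weight_le[of q "real N"] pq t by (auto simp: q_def)
  have gB: "growth (\<lambda>k j. of_real (Beta (real k + p) q) * radial \<mu> k j)"
    by (rule growth_beta[OF gm pq(1,2)])
  show ?thesis
    unfolding L1_order_def
  proof (intro conjI exI[of _ "\<gamma> * (A * C)"] ballI)
    have "growth (\<lambda>k j. of_real \<gamma> * (of_real (Beta (real k + p) q) * radial \<mu> k j))"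
      by (rule growth_mult[OF growth_const gB])
    then show gf: "growth (radial (frac_coeff t))" by (simp add: fc)
    show "0 < \<gamma> * (A * C)" using \<gamma> A C by simp
    fix r :: real and y assume r: "r \<in> {0..<1}" and y: "y \<in> S"
    define I where "I = A * (C * (1 - r) powr (- t))"
    have I0: "I > 0" using A C r by (simp add: I_def)
    have rt: "r * \<tau> \<in> {0..<1}" if "0 < \<tau>" "\<tau> < 1" for \<tau>
      using r that mult_left_mono[of \<tau> 1 r] by auto
    have gy: "growth (\<lambda>k j. radial \<mu> k j * of_real (Y k j y))" by (rule growth_kern[OF gm y])
    have "(\<integral>\<^sup>+x. ennreal (cmod (F (\<lambda>k j. of_real (Beta (real k + p) q) * (radial \<mu> k j * of_real (Y k j y))) (r *\<^sub>R x)) powr 1) \<partial>\<sigma>) \<le> ennreal (I powr 1)"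
    proof (rule minkowski_integral[where M = lborel and l = "\<lambda>\<tau> x. cmod (kern (radial \<mu>) (r * \<tau>) x y)"
          and A = "\<lambda>\<tau>. A * (1 - r * \<tau>) powr (- real N)" and w = "beta_weight p q"])
      have "(\<lambda>z. F (\<lambda>k j. radial \<mu> k j * of_real (Y k j y)) (fst (r * fst z, snd z) *\<^sub>R snd (r * fst z, snd z))) \<in> borel_measurable (borel \<Otimes>\<^sub>M \<sigma>)"
        by (rule measurable_compose[OF _ measurable_F]) measurable
      then have "(\<lambda>z. cmod (kern (radial \<mu>) (r * fst z) (snd z) y)) \<in> borel_measurable (borel \<Otimes>\<^sub>M \<sigma>)"
        unfolding kern_def by simp
      moreover have "borel_measurable (lborel \<Otimes>\<^sub>M \<sigma>) = borel_measurable (borel \<Otimes>\<^sub>M \<sigma>)"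
        by (intro measurable_cong_sets sets_pair_measure_cong) auto
      ultimately show "(\<lambda>(\<tau>, x). cmod (kern (radial \<mu>) (r * \<tau>) x y)) \<in> borel_measurable (lborel \<Otimes>\<^sub>M \<sigma>)"
        by (simp add: case_prod_beta')
      have tau: "0 < \<tau> \<and> \<tau> < 1" if "beta_weight p q \<tau> > 0" for \<tau>
        by (rule ccontr) (use that in \<open>auto simp: beta_weight_def\<close>)
      show "0 < A * (1 - r * \<tau>) powr (- real N)" if "beta_weight p q \<tau> > 0" for \<tau>
      proof -
        have "r * \<tau> < 1" using rt[of \<tau>] tau[OF that] by simp
        then show ?thesis using A(1) by simp
      qed
      show "(\<integral>\<^sup>+x. ennreal (cmod (kern (radial \<mu>) (r * \<tau>) x y) powr 1) \<partial>\<sigma>) \<le> ennreal ((A * (1 - r * \<tau>) powr (- real N)) powr 1)"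
        if "beta_weight p q \<tau> > 0" for \<tau>
        using A(2)[OF rt y, of \<tau>] A(1) tau[OF that] by simp
      have "(\<integral>\<^sup>+\<tau>. ennreal (A * (1 - r * \<tau>) powr (- real N) * beta_weight p q \<tau>) \<partial>lborel)
        \<le> (\<integral>\<^sup>+\<tau>. ennreal A * ennreal (indicator {0<..<1} \<tau> * ((1 - r * \<tau>) powr (- real N) * (1 - \<tau>) powr (q - 1))) \<partial>lborel)"
      proof (rule nn_integral_mono)
        fix \<tau> :: real
        have "(1 - r * \<tau>) powr (- real N) * beta_weight p q \<tau> \<le> indicator {0<..<1} \<tau> * ((1 - r * \<tau>) powr (- real N) * (1 - \<tau>) powr (q - 1))"
        proof (cases "\<tau> \<in> {0<..<1}")
          case True
          \<comment> \<open>Here p \<ge> 1 enters: the dimension is at least 2, so half of it is at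
            least 1. The remaining integrand is the one of
            \<open>nn_integral_power_weight_le\<close>.\<close>
          then have "\<tau> powr (p - 1) \<le> 1" using pq by (intro powr_le1) auto
          then have "\<tau> powr (p - 1) * (1 - \<tau>) powr (q - 1) \<le> 1 * (1 - \<tau>) powr (q - 1)"
            by (intro mult_right_mono) auto
          then show ?thesis using True by (simp add: beta_weight_def mult_left_mono)
        qed (simp add: beta_weight_def)
        then have "A * ((1 - r * \<tau>) powr (- real N) * beta_weight p q \<tau>) \<le> A * (indicator {0<..<1} \<tau> * ((1 - r * \<tau>) powr (- real N) * (1 - \<tau>) powr (q - 1)))"
          using A(1) by (intro mult_left_mono) auto
        then show "ennreal (A * (1 - r * \<tau>) powr (- real N) * beta_weight p q \<tau>)
           \<le> ennreal A * ennreal (indicator {0<..<1} \<tau> * ((1 - r * \<tau>) powr (- real N) * (1 - \<tau>) powr (q - 1)))"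
          using A(1) by (subst ennreal_mult'[symmetric]) (auto intro!: ennreal_leI simp: mult.assoc)
      qed
      also have "\<dots> = ennreal A * (\<integral>\<^sup>+\<tau>. ennreal (indicator {0<..<1} \<tau> * ((1 - r * \<tau>) powr (- real N) * (1 - \<tau>) powr (q - 1))) \<partial>lborel)"
        by (rule nn_integral_cmult) measurable
      also have "\<dots> \<le> ennreal A * ennreal (C * (1 - r) powr (q - real N))"
        using r by (intro mult_left_mono C) auto
      also have "\<dots> = ennreal I" using A(1) by (simp add: I_def q_def ennreal_mult'[symmetric])
      finally show "(\<integral>\<^sup>+\<tau>. ennreal (A * (1 - r * \<tau>) powr (- real N) * beta_weight p q \<tau>) \<partial>lborel) \<le> ennreal I" .
      fix x assume "x \<in> space \<sigma>"
      then have x: "x \<in> S" by simp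
      show "ennreal (cmod (F (\<lambda>k j. of_real (Beta (real k + p) q) * (radial \<mu> k j * of_real (Y k j y))) (r *\<^sub>R x)))
         \<le> (\<integral>\<^sup>+\<tau>. ennreal (cmod (kern (radial \<mu>) (r * \<tau>) x y) * beta_weight p q \<tau>) \<partial>lborel)"
        unfolding kern_def using r by (intro beta_integral gy pq x) auto
    qed (use A I0 in \<open>auto intro: sigma_finite_measure_axioms lborel.sigma_finite_measure_axioms simp: beta_weight_nonneg\<close>)
    moreover have "cmod (kern (radial (frac_coeff t)) r x y) = \<gamma> * cmod (F (\<lambda>k j. of_real (Beta (real k + p) q) * (radial \<mu> k j * of_real (Y k j y))) (r *\<^sub>R x))"
      if "x \<in> S" for x
    proof -
      have g1: "growth (\<lambda>k j. of_real (Beta (real k + p) q) * (radial \<mu> k j * of_real (Y k j y)))"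
        by (rule growth_beta[OF gy pq(1,2)])
      have 1: "(\<lambda>k. of_real \<gamma> * (of_real (r ^ k) * T (\<lambda>k j. of_real (Beta (real k + p) q) * (radial \<mu> k j * of_real (Y k j y))) k x))
          sums (of_real \<gamma> * F (\<lambda>k j. of_real (Beta (real k + p) q) * (radial \<mu> k j * of_real (Y k j y))) (r *\<^sub>R x))"
        using r by (intro sums_mult F_sums g1 that) auto
      have eq: "(\<lambda>k. of_real \<gamma> * (of_real (r ^ k) * T (\<lambda>k j. of_real (Beta (real k + p) q) * (radial \<mu> k j * of_real (Y k j y))) k x))
         = (\<lambda>k. of_real (r ^ k) * T (\<lambda>k j. radial (frac_coeff t) k j * of_real (Y k j y)) k x)"
        by (rule ext) (simp add: T_def fc sum_distrib_left mult_ac)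
      have "kern (radial (frac_coeff t)) r x y = of_real \<gamma> * F (\<lambda>k j. of_real (Beta (real k + p) q) * (radial \<mu> k j * of_real (Y k j y))) (r *\<^sub>R x)"
        unfolding kern_def F_eq_suminf[OF that, of "\<lambda>k j. radial (frac_coeff t) k j * of_real (Y k j y)"]
        by (rule sums_unique[OF 1[unfolded eq], symmetric])
      then show ?thesis using \<gamma> by (simp add: norm_mult)
    qed
    ultimately have "(\<integral>\<^sup>+x. ennreal (cmod (kern (radial (frac_coeff t)) r x y)) \<partial>\<sigma>) \<le> ennreal \<gamma> * ennreal I"
    proof -
      assume 1: "(\<integral>\<^sup>+x. ennreal (cmod (F (\<lambda>k j. of_real (Beta (real k + p) q) * (radial \<mu> k j * of_real (Y k j y))) (r *\<^sub>R x)) powr 1) \<partial>\<sigma>) \<le> ennreal (I powr 1)"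
        and 2: "\<And>x. x \<in> S \<Longrightarrow> cmod (kern (radial (frac_coeff t)) r x y) = \<gamma> * cmod (F (\<lambda>k j. of_real (Beta (real k + p) q) * (radial \<mu> k j * of_real (Y k j y))) (r *\<^sub>R x))"
      have "(\<integral>\<^sup>+x. ennreal (cmod (kern (radial (frac_coeff t)) r x y)) \<partial>\<sigma>)
         = (\<integral>\<^sup>+x. ennreal \<gamma> * ennreal (cmod (F (\<lambda>k j. of_real (Beta (real k + p) q) * (radial \<mu> k j * of_real (Y k j y))) (r *\<^sub>R x))) \<partial>\<sigma>)"
        using \<gamma> 2 by (intro nn_integral_cong) (simp add: ennreal_mult')
      also have "\<dots> = ennreal \<gamma> * (\<integral>\<^sup>+x. ennreal (cmod (F (\<lambda>k j. of_real (Beta (real k + p) q) * (radial \<mu> k j * of_real (Y k j y))) (r *\<^sub>R x))) \<partial>\<sigma>)"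
        using r by (intro nn_integral_cmult measurable_compose[OF continuous_on_sphere_measurable measurable_ennreal] continuous_intros
            continuous_on_F_scaled growth_beta gy pq) auto
      also have "\<dots> \<le> ennreal \<gamma> * ennreal I" using 1 I0 by (intro mult_left_mono) auto
      finally show ?thesis .
    qed
    also have "\<dots> = ennreal (\<gamma> * (A * C) * (1 - r) powr (- t))"
      using \<gamma> by (simp add: I_def ennreal_mult'[symmetric] mult_ac)
    finally show "(\<integral>\<^sup>+x. ennreal (cmod (kern (radial (frac_coeff t)) r x y)) \<partial>\<sigma>) \<le> ennreal (\<gamma> * (A * C) * (1 - r) powr (- t))" .
  qed
qed

end

section \<open>Integral means and the convolution estimate\<close>

text \<open>The quotient is (1 + R)^e, which lies between 1 and 2^e; minimum and maximum cover both
  signs of e.\<close>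

lemma one_minus_square_powr:
  fixes R e :: real
  assumes "0 \<le> R" "R < 1"
  shows "min 1 (2 powr e) * (1 - R) powr e \<le> (1 - R\<^sup>2) powr e"
    "(1 - R\<^sup>2) powr e \<le> max 1 (2 powr e) * (1 - R) powr e"
proof -
  have "1 - R\<^sup>2 = (1 - R) * (1 + R)" by (simp add: power2_eq_square algebra_simps)
  then have eq: "(1 - R\<^sup>2) powr e = (1 - R) powr e * (1 + R) powr e"
    using assms by (simp add: powr_mult)
  have "min 1 (2 powr e) \<le> (1 + R) powr e \<and> (1 + R) powr e \<le> max 1 (2 powr e)"
  proof (cases "e \<ge> 0")
    case True
    then have "1 powr e \<le> (1 + R) powr e" "(1 + R) powr e \<le> 2 powr e"
      using assms by (intro powr_mono2; simp)+
    then show ?thesis by (simp add: min_le_iff_disj le_max_iff_disj)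
  next
    case False
    then have "2 powr e \<le> (1 + R) powr e" "(1 + R) powr e \<le> 1 powr e"
      using assms by (intro powr_mono2'; simp)+
    then show ?thesis by (simp add: min_le_iff_disj le_max_iff_disj)
  qed
  then show "min 1 (2 powr e) * (1 - R) powr e \<le> (1 - R\<^sup>2) powr e"
    "(1 - R\<^sup>2) powr e \<le> max 1 (2 powr e) * (1 - R) powr e"
    unfolding eq by (simp_all add: mult.commute[of "(1 - R) powr e"] mult_right_mono)
qed

lemma nn_integral_powr_to_1:
  assumes "b > 0" "c \<ge> (0::real)"
  shows "(\<integral>\<^sup>+x. ennreal (indicator {0..c} (1 - x) * (1 - x) powr (b - 1)) \<partial>lborel) = ennreal (c powr b / b)"
proof -
  have "(\<integral>\<^sup>+x. ennreal (indicator {0..c} x * x powr (b - 1)) \<partial>lborel)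
     = (\<integral>\<^sup>+x. ennreal (indicator {0..c} (1 - x) * (1 - x) powr (b - 1)) \<partial>lborel)"
    by (subst nn_integral_real_affine[where c = "-1" and t = 1]) auto
  then show ?thesis using nn_integral_powr_from_0[OF assms] by simp
qed

section \<open>L1 means, weighted norms of coefficient families and the sufficiency estimate\<close>

context sph_basis
begin

definition M1 :: "(nat \<Rightarrow> nat \<Rightarrow> complex) \<Rightarrow> real \<Rightarrow> real" where
  "M1 a r = (\<integral>x. cmod (F a (r *\<^sub>R x)) \<partial>\<sigma>)"

lemma M1_nonneg: "M1 a r \<ge> 0"
  by (simp add: M1_def)

lemma M1_measurable [measurable]: "M1 a \<in> borel_measurable borel"
  unfolding M1_def[abs_def]
  using borel_measurable_lebesgue_integral[of "\<lambda>r x. cmod (F a (r *\<^sub>R x))" borel] measurable_F[of a]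
  by (simp add: case_prod_beta')

lemma integrable_F:
  assumes "growth a" "0 \<le> r" "r < 1"
  shows "integrable \<sigma> (\<lambda>x. cmod (F a (r *\<^sub>R x)))"
  by (intro continuous_on_sphere_integrable continuous_intros continuous_on_F_scaled assms)

lemma nn_M1:
  assumes "growth a" "0 \<le> r" "r < 1"
  shows "(\<integral>\<^sup>+x. ennreal (cmod (F a (r *\<^sub>R x))) \<partial>\<sigma>) = ennreal (M1 a r)"
  unfolding M1_def by (rule nn_integral_eq_integral[OF integrable_F[OF assms]]) simp

lemma F_dilation: "x \<in> S \<Longrightarrow> F (\<lambda>k j. of_real (\<rho> ^ k) * a k j) (r *\<^sub>R x) = F a ((r * \<rho>) *\<^sub>R x)"
  by (simp add: F_eq_suminf T_def power_mult_distrib sum_distrib_left mult_ac)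

lemma growth_dilation:
  assumes "growth a" "0 \<le> \<rho>" "\<rho> \<le> 1"
  shows "growth (\<lambda>k j. of_real (\<rho> ^ k) * a k j)"
proof (rule growth_mono[OF assms(1)])
  fix k j
  have "\<rho> ^ k * cmod (a k j) \<le> 1 * cmod (a k j)" using assms by (intro mult_right_mono power_le_one) auto
  then show "cmod (of_real (\<rho> ^ k) * a k j) \<le> cmod (a k j)" using assms by (simp add: norm_mult norm_power)
qed

text \<open>The function at radius r is the Poisson integral, of ratio r / R, of the function at
  radius R, and the kernel is nonnegative with mass one.\<close>

lemma M1_mono:
  assumes a: "growth a" and r: "0 \<le> r" "r \<le> R" "R < 1"
  shows "M1 a r \<le> M1 a R"
proof (cases "r = R")
  case False
  define \<rho> where "\<rho> = r / R"
  have \<rho>: "0 \<le> \<rho>" "\<rho> < 1" "\<rho> * R = r" and R: "0 < R" using r False by (auto simp: \<rho>_def)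
  \<comment> \<open>\<open>minkowski_integral\<close> asks for a strictly positive bound, but
    \<open>M1 a R\<close> may be zero.\<close>
  have "M1 a r \<le> M1 a R + \<epsilon>" if e: "\<epsilon> > 0" for \<epsilon>
  proof -
    have I0: "M1 a R + \<epsilon> > 0" using M1_nonneg[of a R] e by simp
    have ne: "\<rho> *\<^sub>R x \<noteq> y" if "x \<in> S" "y \<in> S" for x y
    proof
      assume "\<rho> *\<^sub>R x = y"
      then have "norm (\<rho> *\<^sub>R x) = norm y" by simp
      then show False using that \<rho> by simp
    qed
    have "(\<integral>\<^sup>+x. ennreal (cmod (F a (r *\<^sub>R x)) powr 1) \<partial>\<sigma>) \<le> ennreal ((M1 a R + \<epsilon>) powr 1)"
    proof (rule minkowski_integral[where M = \<sigma> and l = "\<lambda>y x. \<bar>poisson_fun y (\<rho> *\<^sub>R x) / area\<bar>" and A = "\<lambda>_. 1"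
          and w = "\<lambda>y. cmod (F a (R *\<^sub>R y))"])
      show "(\<lambda>(y, x). \<bar>poisson_fun y (\<rho> *\<^sub>R x) / area\<bar>) \<in> borel_measurable (\<sigma> \<Otimes>\<^sub>M \<sigma>)"
        unfolding case_prod_beta'
        by (rule measurable_joint) (use ne area_pos in \<open>auto intro!: continuous_intros\<close>)
      show "(\<lambda>y. cmod (F a (R *\<^sub>R y))) \<in> borel_measurable \<sigma>"
        by (intro continuous_on_sphere_measurable continuous_intros continuous_on_F_scaled) (use a R r in auto)
      show "(\<integral>\<^sup>+x. ennreal (\<bar>poisson_fun y (\<rho> *\<^sub>R x) / area\<bar> powr 1) \<partial>\<sigma>) \<le> ennreal (1 powr 1)" if "y \<in> space \<sigma>" for y
      proof -
        have y: "y \<in> S" using that by simp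
        have "(\<integral>\<^sup>+x. ennreal (\<bar>poisson_fun y (\<rho> *\<^sub>R x) / area\<bar> powr 1) \<partial>\<sigma>) = (\<integral>\<^sup>+x. ennreal (poisson_fun y (\<rho> *\<^sub>R x) / area) \<partial>\<sigma>)"
        proof (rule nn_integral_cong)
          fix x assume "x \<in> space \<sigma>"
          then have "poisson_fun y (\<rho> *\<^sub>R x) / area \<ge> 0" using \<rho> area_pos by (intro divide_nonneg_pos poisson_fun_nonneg) auto
          then show "ennreal (\<bar>poisson_fun y (\<rho> *\<^sub>R x) / area\<bar> powr 1) = ennreal (poisson_fun y (\<rho> *\<^sub>R x) / area)"
            by (simp only: abs_of_nonneg powr_one)
        qed
        then show ?thesis using poisson_nn_mass[OF y \<rho>(1,2)] by simp
      qed
      show "(\<integral>\<^sup>+y. ennreal (1 * cmod (F a (R *\<^sub>R y))) \<partial>\<sigma>) \<le> ennreal (M1 a R + \<epsilon>)"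
        using nn_M1[OF a, of R] R r e by (simp add: ennreal_leI)
      fix x assume "x \<in> space \<sigma>"
      then have x: "x \<in> S" by simp
      have i: "integrable \<sigma> (\<lambda>y. (poisson_fun y (\<rho> *\<^sub>R x) / area) *\<^sub>R F a (R *\<^sub>R y))"
        using ne[OF x] area_pos R r by (intro continuous_on_sphere_integrable continuous_intros continuous_on_F_scaled a) auto
      have "F a (r *\<^sub>R x) = (1 / area) *\<^sub>R (\<integral>y. poisson_fun y (\<rho> *\<^sub>R x) *\<^sub>R F a (R *\<^sub>R y) \<partial>\<sigma>)"
        using F_poisson[OF a \<rho>(1,2) _ _ x, of R] R r area_pos by (simp add: \<rho>(3))
      also have "\<dots> = (\<integral>y. (1 / area) *\<^sub>R (poisson_fun y (\<rho> *\<^sub>R x) *\<^sub>R F a (R *\<^sub>R y)) \<partial>\<sigma>)"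
        by (rule Bochner_Integration.integral_scaleR_right[symmetric])
      also have "\<dots> = (\<integral>y. (poisson_fun y (\<rho> *\<^sub>R x) / area) *\<^sub>R F a (R *\<^sub>R y) \<partial>\<sigma>)" by simp
      also have "ennreal (cmod \<dots>) \<le> (\<integral>\<^sup>+y. ennreal (norm ((poisson_fun y (\<rho> *\<^sub>R x) / area) *\<^sub>R F a (R *\<^sub>R y))) \<partial>\<sigma>)"
        by (rule integral_norm_bound_ennreal[OF i])
      finally show "ennreal (cmod (F a (r *\<^sub>R x))) \<le> (\<integral>\<^sup>+y. ennreal (\<bar>poisson_fun y (\<rho> *\<^sub>R x) / area\<bar> * cmod (F a (R *\<^sub>R y))) \<partial>\<sigma>)"
        by (simp only: norm_scaleR)
    qed (use I0 in \<open>auto intro: sigma_finite_measure_axioms\<close>)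
    then have "ennreal (M1 a r) \<le> ennreal (M1 a R + \<epsilon>)"
      using nn_M1[OF a, of r] r I0 by simp
    then show ?thesis using I0 by (simp add: ennreal_le_iff)
  qed
  then show ?thesis by (rule field_le_epsilon)
qed simp

definition wt :: "real \<Rightarrow> real \<Rightarrow> real" where
  "wt e R = (1 - R\<^sup>2) powr (e - 1) * R ^ (DIM('a) - 1)"

lemma wt_measurable [measurable]: "wt e \<in> borel_measurable borel"
  unfolding wt_def[abs_def] by measurable

lemma wt_nonneg: "R \<ge> 0 \<Longrightarrow> wt e R \<ge> 0"
  by (simp add: wt_def)

text \<open>The p-th power of the quasi-norm, without the outer root: in this form it is subadditive
  for p \<le> 1, and it is finite exactly when the quasi-norm is.\<close>

definition Bnorm :: "real \<Rightarrow> real \<Rightarrow> (nat \<Rightarrow> nat \<Rightarrow> complex) \<Rightarrow> ennreal" where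
  "Bnorm p \<alpha> a = (\<integral>\<^sup>+R. ennreal (M1 a R powr p * wt (\<alpha> * p) R) * indicator {0<..<1} R \<partial>lborel)"

text \<open>The means increase with the radius, so the integral over radii beyond r is at least the
  mean at r times the mass of the weight there, which is of order (1 - r)^(\<alpha> p).\<close>

lemma M1_le_Bnorm:
  assumes p: "0 < p" and \<alpha>: "0 < \<alpha>"
  obtains C where "C > 0" "\<And>a r. growth a \<Longrightarrow> 0 \<le> r \<Longrightarrow> r < 1 \<Longrightarrow>
    ennreal (M1 a r powr p * (1 - r) powr (\<alpha> * p)) \<le> ennreal C * Bnorm p \<alpha> a"
proof -
  define b where "b = \<alpha> * p"
  have b: "b > 0" using p \<alpha> by (simp add: b_def)
  define c0 where "c0 = min 1 (2 powr (b - 1)) * (1 / 2) ^ (DIM('a) - 1)"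
  have c0: "c0 > 0" by (simp add: c0_def)
  show ?thesis
  proof (rule that[of "2 powr b * b / c0"])
    show "2 powr b * b / c0 > 0" using b c0 by simp
    fix a r assume a: "growth a" and r: "0 \<le> r" "r < (1::real)"
    \<comment> \<open>Beyond 1/2 the factor R^(n-1) is bounded below, and 1 - r' is at least half of
      1 - r, which costs only the factor 2^b.\<close>
    define r' where "r' = max r (1 / 2)"
    have r': "r \<le> r'" "1 / 2 \<le> r'" "r' < 1" "(1 - r) / 2 \<le> 1 - r'" using r by (auto simp: r'_def max_def)
    define m where "m = M1 a r powr p"
    have m: "m \<ge> 0" by (simp add: m_def)
    have "ennreal (m * c0) * ennreal ((1 - r') powr b / b)
       = (\<integral>\<^sup>+R. ennreal (m * c0) * ennreal (indicator {0..1 - r'} (1 - R) * (1 - R) powr (b - 1)) \<partial>lborel)"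
      using nn_integral_powr_to_1[OF b, of "1 - r'"] r' by (subst nn_integral_cmult) auto
    also have "\<dots> \<le> Bnorm p \<alpha> a"
      unfolding Bnorm_def b_def[symmetric]
    proof (rule nn_integral_mono)
      fix R :: real
      show "ennreal (m * c0) * ennreal (indicator {0..1 - r'} (1 - R) * (1 - R) powr (b - 1))
         \<le> ennreal (M1 a R powr p * wt b R) * indicator {0<..<1} R"
      proof (cases "r' \<le> R \<and> R < 1")
        case True
        then have R: "0 < R" "R < 1" "1 / 2 \<le> R" "r \<le> R" using r' by auto
        have "m \<le> M1 a R powr p"
          unfolding m_def using p R r by (intro powr_mono2 M1_mono a M1_nonneg) auto
        moreover have "c0 * (1 - R) powr (b - 1) \<le> wt b R"
        proof -
          have "(1 / 2) ^ (DIM('a) - 1) \<le> R ^ (DIM('a) - 1)" using R by (intro power_mono) auto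
          moreover have "min 1 (2 powr (b - 1)) * (1 - R) powr (b - 1) \<le> (1 - R\<^sup>2) powr (b - 1)"
            using R by (intro one_minus_square_powr) auto
          ultimately have "(min 1 (2 powr (b - 1)) * (1 - R) powr (b - 1)) * (1 / 2) ^ (DIM('a) - 1) \<le> (1 - R\<^sup>2) powr (b - 1) * R ^ (DIM('a) - 1)"
            by (intro mult_mono) auto
          then show ?thesis by (simp add: c0_def wt_def mult_ac)
        qed
        ultimately have "m * (c0 * (1 - R) powr (b - 1)) \<le> M1 a R powr p * wt b R"
          using m c0 by (intro mult_mono) auto
        moreover have "ennreal (m * c0) * ennreal (indicator {0..1 - r'} (1 - R) * (1 - R) powr (b - 1)) = ennreal (m * (c0 * (1 - R) powr (b - 1)))"
          using True m c0 by (subst ennreal_mult'[symmetric]) (auto simp: mult.assoc)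
        ultimately show ?thesis using R by (simp add: ennreal_leI)
      next
        case False
        then have "indicator {0..1 - r'} (1 - R) * (1 - R) powr (b - 1) = 0"
          by (auto simp: indicator_def)
        then show ?thesis by (simp only: ennreal_0 mult_zero_right zero_le)
      qed
    qed
    finally have low: "ennreal (m * c0 * ((1 - r') powr b / b)) \<le> Bnorm p \<alpha> a"
      using m c0 by (subst (asm) ennreal_mult'[symmetric]) auto
    have "((1 - r) / 2) powr b \<le> (1 - r') powr b" using r r' b by (intro powr_mono2) auto
    then have "(1 - r) powr b \<le> 2 powr b * (1 - r') powr b" using r by (simp add: powr_divide pos_divide_le_eq mult.commute)
    then have "m * (1 - r) powr b \<le> m * (2 powr b * (1 - r') powr b)" using m by (intro mult_left_mono)
    also have "\<dots> = 2 powr b * b / c0 * (m * c0 * ((1 - r') powr b / b))" using b c0 by simp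
    finally have "ennreal (m * (1 - r) powr b) \<le> ennreal (2 powr b * b / c0 * (m * c0 * ((1 - r') powr b / b)))" by (rule ennreal_leI)
    also have "\<dots> = ennreal (2 powr b * b / c0) * ennreal (m * c0 * ((1 - r') powr b / b))"
      using b c0 by (intro ennreal_mult') auto
    also have "\<dots> \<le> ennreal (2 powr b * b / c0) * Bnorm p \<alpha> a" by (intro mult_left_mono low) auto
    finally show "ennreal (M1 a r powr p * (1 - r) powr (\<alpha> * p)) \<le> ennreal (2 powr b * b / c0) * Bnorm p \<alpha> a"
      by (simp add: m_def b_def)
  qed
qed

text \<open>Split M1 = M1^p M1^(1-p) and bound the second factor by \<open>M1_le_Bnorm\<close>: the
  power (1 - R^2)^(-\<alpha> (1 - p)) so obtained turns the weight exponent \<alpha> - 1 into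
  \<alpha> p - 1. The summand 1 is carried along because slice bounds in
  \<open>minkowski_integral\<close> must be positive.\<close>

lemma Bnorm_finite_imp:
  assumes p: "0 < p" "p \<le> 1" and \<alpha>: "0 < \<alpha>" and a: "growth a" and fin: "Bnorm p \<alpha> a < \<infinity>"
  shows "(\<integral>\<^sup>+R. ennreal ((M1 a R + 1) * wt \<alpha> R) * indicator {0<..<1} R \<partial>lborel) < \<infinity>"
proof -
  obtain C where C: "C > 0" "\<And>r. 0 \<le> r \<Longrightarrow> r < 1 \<Longrightarrow>
    ennreal (M1 a r powr p * (1 - r) powr (\<alpha> * p)) \<le> ennreal C * Bnorm p \<alpha> a"
    using M1_le_Bnorm[OF p(1) \<alpha>] a by metis
  obtain Q where Q: "Bnorm p \<alpha> a = ennreal Q" "Q \<ge> 0" using fin by (cases "Bnorm p \<alpha> a") auto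
  define K where "K = C * Q"
  have K0: "K \<ge> 0" using C Q by (simp add: K_def)
  have MK: "M1 a r powr p \<le> K * (1 - r) powr (- (\<alpha> * p))" if r: "0 \<le> r" "r < 1" for r
  proof -
    have "ennreal (M1 a r powr p * (1 - r) powr (\<alpha> * p)) \<le> ennreal K"
      using C(2)[OF r] C(1) Q by (simp add: K_def ennreal_mult')
    then have "M1 a r powr p * (1 - r) powr (\<alpha> * p) \<le> K" using K0 by (simp add: ennreal_le_iff)
    then show ?thesis using r by (simp add: powr_minus pos_le_divide_eq divide_inverse[symmetric])
  qed
  define e where "e = \<alpha> * (1 - p)"
  have e: "e \<ge> 0" using p \<alpha> by (simp add: e_def)
  define K' where "K' = K powr ((1 - p) / p) * 2 powr e"
  have K'0: "K' \<ge> 0" by (simp add: K'_def)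
  define L where "L = max 1 (2 powr (\<alpha> - 1))"
  have L0: "L \<ge> 0" by (simp add: L_def)
  have bound: "(M1 a R + 1) * wt \<alpha> R \<le> K' * (M1 a R powr p * wt (\<alpha> * p) R) + L * (1 - R) powr (\<alpha> - 1)"
    if R: "0 < R" "R < 1" for R
  proof -
    have q0: "1 - R\<^sup>2 > 0" using R by (simp add: power_less_one_iff)
    have "M1 a R * (1 - R\<^sup>2) powr (\<alpha> - 1) \<le> K' * (M1 a R powr p * (1 - R\<^sup>2) powr (\<alpha> * p - 1))"
    proof (cases "M1 a R = 0")
      case False
      then have m: "M1 a R > 0" using M1_nonneg[of a R] by simp
      have "(M1 a R powr p) powr ((1 - p) / p) \<le> (K * (1 - R) powr (- (\<alpha> * p))) powr ((1 - p) / p)"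
        using MK[of R] R p by (intro powr_mono2) auto
      also have "\<dots> = K powr ((1 - p) / p) * (1 - R) powr (- e)"
        using K0 p by (simp add: powr_mult powr_powr e_def)
      also have "(1 - R) powr (- e) \<le> 2 powr e * (1 - R\<^sup>2) powr (- e)"
      proof -
        have "(1 - R\<^sup>2) powr e \<le> max 1 (2 powr e) * (1 - R) powr e" using R by (intro one_minus_square_powr) auto
        also have "max 1 (2 powr e) = 2 powr e" using e by (simp add: ge_one_powr_ge_zero)
        finally show ?thesis using R q0 by (simp add: powr_minus field_simps)
      qed
      finally have "M1 a R powr (1 - p) \<le> K' * (1 - R\<^sup>2) powr (- e)"
        using p by (simp add: powr_powr K'_def mult_left_mono mult.assoc)
      then have "M1 a R powr p * M1 a R powr (1 - p) * (1 - R\<^sup>2) powr (\<alpha> - 1)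
          \<le> M1 a R powr p * (K' * (1 - R\<^sup>2) powr (- e)) * (1 - R\<^sup>2) powr (\<alpha> - 1)"
        by (intro mult_right_mono mult_left_mono) auto
      moreover have "M1 a R powr p * M1 a R powr (1 - p) = M1 a R" using m by (simp add: powr_add[symmetric])
      moreover have "(1 - R\<^sup>2) powr (- e) * (1 - R\<^sup>2) powr (\<alpha> - 1) = (1 - R\<^sup>2) powr (\<alpha> * p - 1)"
        by (simp add: powr_add[symmetric] e_def algebra_simps)
      ultimately show ?thesis by (simp add: mult_ac)
    qed (use p in simp)
    then have 1: "M1 a R * wt \<alpha> R \<le> K' * (M1 a R powr p * wt (\<alpha> * p) R)"
      unfolding wt_def using R by (simp add: mult.assoc[symmetric] mult_right_mono)
    have "wt \<alpha> R \<le> (L * (1 - R) powr (\<alpha> - 1)) * 1"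
      unfolding wt_def L_def using R by (intro mult_mono one_minus_square_powr power_le_one) auto
    then show ?thesis using 1 by (simp add: distrib_right)
  qed
  have "(\<integral>\<^sup>+R. ennreal ((M1 a R + 1) * wt \<alpha> R) * indicator {0<..<1} R \<partial>lborel)
    \<le> (\<integral>\<^sup>+R. ennreal K' * (ennreal (M1 a R powr p * wt (\<alpha> * p) R) * indicator {0<..<1} R)
        + ennreal L * ennreal (indicator {0..1} (1 - R) * (1 - R) powr (\<alpha> - 1)) \<partial>lborel)"
  proof (rule nn_integral_mono)
    fix R :: real
    show "ennreal ((M1 a R + 1) * wt \<alpha> R) * indicator {0<..<1} R
       \<le> ennreal K' * (ennreal (M1 a R powr p * wt (\<alpha> * p) R) * indicator {0<..<1} R)
        + ennreal L * ennreal (indicator {0..1} (1 - R) * (1 - R) powr (\<alpha> - 1))"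
    proof (cases "R \<in> {0<..<1}")
      case True
      then have w0: "M1 a R powr p * wt (\<alpha> * p) R \<ge> 0" by (simp add: wt_nonneg)
      have "ennreal ((M1 a R + 1) * wt \<alpha> R) \<le> ennreal (K' * (M1 a R powr p * wt (\<alpha> * p) R) + L * (1 - R) powr (\<alpha> - 1))"
        using bound[of R] True by (intro ennreal_leI) auto
      also have "\<dots> = ennreal K' * ennreal (M1 a R powr p * wt (\<alpha> * p) R) + ennreal L * ennreal ((1 - R) powr (\<alpha> - 1))"
        using K'0 L0 w0 by (subst ennreal_plus) (simp_all add: ennreal_mult)
      finally show ?thesis using True by simp
    qed simp
  qed
  also have "\<dots> = ennreal K' * Bnorm p \<alpha> a + ennreal L * (\<integral>\<^sup>+R. ennreal (indicator {0..1} (1 - R) * (1 - R) powr (\<alpha> - 1)) \<partial>lborel)"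
    unfolding Bnorm_def by (subst nn_integral_add; (subst nn_integral_cmult)?; measurable?) (simp add: nn_integral_cmult)
  also have "\<dots> < \<infinity>"
    unfolding nn_integral_powr_to_1[OF \<alpha> zero_le_one] Q by (simp add: ennreal_mult_less_top)
  finally show ?thesis .
qed

lemma frac_coeff_Beta: "t > 0 \<Longrightarrow> Beta (real k + real DIM('a) / 2) t * frac_coeff t k = 1"
proof -
  assume t: "t > 0"
  have "Gamma (real k + real DIM('a) / 2) > 0" "Gamma (real k + real DIM('a) / 2 + t) > 0" "Gamma t > 0"
    using t by (auto intro!: Gamma_real_pos simp: add_nonneg_pos)
  then show ?thesis by (simp add: frac_coeff_def Beta_def)
qed

definition frac_mult :: "real \<Rightarrow> (nat \<Rightarrow> nat \<Rightarrow> complex) \<Rightarrow> nat \<Rightarrow> nat \<Rightarrow> complex" where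
  "frac_mult t c = (\<lambda>k j. radial (frac_coeff t) k j * c k j)"

text \<open>\<open>h\<close> is the family of the derivative of order t of c * f, and the Beta
  integral undoes the derivative. Minkowski's inequality is used twice: over the sphere at the
  common radius u = sqrt (\<rho> \<tau>), then over \<tau>. What is left is the finiteness of the
  integral in \<open>fin\<close>.\<close>

theorem convolution_estimate:
  assumes dim: "DIM('a) \<ge> 2" and \<alpha>: "0 < \<alpha>" and \<beta>: "0 \<le> \<beta>" and t: "\<alpha> < t" and s: "1 \<le> s"
    and c: "growth c" and b: "growth b" and N: "N > 0"
    and kb: "\<And>u y. u \<in> {0..<1} \<Longrightarrow> y \<in> S \<Longrightarrow>
      (\<integral>\<^sup>+x. ennreal (cmod (kern (frac_mult t c) u x y) powr s) \<partial>\<sigma>) \<le> ennreal ((N * (1 - u) powr (- (t - \<alpha> + \<beta>))) powr s)"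
    and fin: "(\<integral>\<^sup>+R. ennreal ((M1 b R + 1) * wt \<alpha> R) * indicator {0<..<1} R \<partial>lborel) < \<infinity>"
  shows "\<exists>K>0. \<forall>\<rho>\<in>{0..<1}. (\<integral>\<^sup>+x. ennreal (cmod (F (\<lambda>k j. c k j * b k j) (\<rho> *\<^sub>R x)) powr s) \<partial>\<sigma>) \<le> ennreal ((K * (1 - \<rho>) powr (- \<beta>)) powr s)"
proof -
  have t0: "t > 0" using t \<alpha> by simp
  define \<delta> where "\<delta> = t - \<alpha> + \<beta>"
  have \<delta>: "\<delta> > 0" using t \<beta> by (simp add: \<delta>_def)
  have gf: "growth (radial (frac_coeff t))" using L1_order_frac[OF t0 dim] by (simp add: L1_order_def)
  have gfc: "growth (frac_mult t c)" unfolding frac_mult_def by (rule growth_mult[OF gf c])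
  define h where "h = (\<lambda>k j. frac_mult t c k j * b k j)"
  have gh: "growth h" unfolding h_def by (rule growth_mult[OF gfc b])
  define m where "m u = M1 b u + 1" for u
  have m: "m u > 0" for u using M1_nonneg[of b u] by (simp add: m_def)
  have step1: "(\<integral>\<^sup>+x. ennreal (cmod (F h ((u * u) *\<^sub>R x)) powr s) \<partial>\<sigma>) \<le> ennreal ((N * (1 - u) powr (- \<delta>) * m u) powr s)"
    \<comment> \<open>Kernel and function sit at the same radius u, so the result lives at radius
      u^2.\<close>
    if u: "u \<in> {0..<1}" for u
  proof (rule minkowski_integral[where M = \<sigma> and l = "\<lambda>y x. cmod (kern (frac_mult t c) u x y)" and A = "\<lambda>_. N * (1 - u) powr (- \<delta>)"
        and w = "\<lambda>y. cmod (F b (u *\<^sub>R y))"])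
    have "(\<lambda>p. kern (frac_mult t c) u (fst (snd p, fst p)) (snd (snd p, fst p))) \<in> borel_measurable (\<sigma> \<Otimes>\<^sub>M \<sigma>)"
      by (rule measurable_compose[OF _ measurable_kern[of "frac_mult t c" u]]) measurable
    then show "(\<lambda>(y, x). cmod (kern (frac_mult t c) u x y)) \<in> borel_measurable (\<sigma> \<Otimes>\<^sub>M \<sigma>)"
      by (simp add: case_prod_beta')
    have Fm: "(\<lambda>y. F b (u *\<^sub>R y)) \<in> borel_measurable \<sigma>"
      using u by (intro continuous_on_sphere_measurable continuous_on_F_scaled b) auto
    then show "(\<lambda>y. cmod (F b (u *\<^sub>R y))) \<in> borel_measurable \<sigma>" by measurable
    show "(\<integral>\<^sup>+x. ennreal (cmod (kern (frac_mult t c) u x y) powr s) \<partial>\<sigma>) \<le> ennreal ((N * (1 - u) powr (- \<delta>)) powr s)" if "y \<in> space \<sigma>" for y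
      using kb[OF u, of y] that by (simp add: \<delta>_def)
    have "(\<integral>\<^sup>+y. ennreal (N * (1 - u) powr (- \<delta>) * cmod (F b (u *\<^sub>R y))) \<partial>\<sigma>)
       = ennreal (N * (1 - u) powr (- \<delta>)) * (\<integral>\<^sup>+y. ennreal (cmod (F b (u *\<^sub>R y))) \<partial>\<sigma>)"
      using N Fm by (subst nn_integral_cmult[symmetric]) (auto simp: ennreal_mult')
    also have "\<dots> \<le> ennreal (N * (1 - u) powr (- \<delta>)) * ennreal (m u)"
      using nn_M1[OF b, of u] u by (intro mult_left_mono) (auto simp: m_def intro!: ennreal_leI)
    also have "\<dots> = ennreal (N * (1 - u) powr (- \<delta>) * m u)"
      using N m[of u] by (simp add: ennreal_mult'[symmetric])
    finally show "(\<integral>\<^sup>+y. ennreal (N * (1 - u) powr (- \<delta>) * cmod (F b (u *\<^sub>R y))) \<partial>\<sigma>) \<le> ennreal (N * (1 - u) powr (- \<delta>) * m u)" .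
    fix x assume "x \<in> space \<sigma>"
    then have x: "x \<in> S" by simp
    have "F h ((u * u) *\<^sub>R x) = (\<integral>y. kern (frac_mult t c) u x y * F b (u *\<^sub>R y) \<partial>\<sigma>)"
      using kern_action[OF gfc _ _ b _ _ x, of u u] u by (simp add: h_def)
    also have "ennreal (cmod \<dots>) \<le> (\<integral>\<^sup>+y. ennreal (norm (kern (frac_mult t c) u x y * F b (u *\<^sub>R y))) \<partial>\<sigma>)"
      using u by (intro integral_norm_bound_ennreal continuous_on_sphere_integrable continuous_intros continuous_on_kern gfc continuous_on_F_scaled b x) auto
    finally show "ennreal (cmod (F h ((u * u) *\<^sub>R x))) \<le> (\<integral>\<^sup>+y. ennreal (cmod (kern (frac_mult t c) u x y) * cmod (F b (u *\<^sub>R y))) \<partial>\<sigma>)"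
      by (simp only: norm_mult)
  qed (use N m u s in \<open>auto intro: sigma_finite_measure_axioms\<close>)
  \<comment> \<open>Under \<tau> = R^2 the power of exponent n/2 - 1, together with the Jacobian 2
    R, becomes 2 R^(n-1), and 1 - \<tau> becomes 1 - R^2: \<open>g\<close> is the pull-back of the
    integrand in \<open>fin\<close>.\<close>
  define g where "g \<tau> = m (sqrt \<tau>) * (\<tau> powr (real DIM('a) / 2 - 1) * (1 - \<tau>) powr (\<alpha> - 1))" for \<tau>
  have gm [measurable]: "g \<in> borel_measurable borel" unfolding g_def[abs_def] m_def by measurable
  have g0: "g \<tau> \<ge> 0" for \<tau> using m[of "sqrt \<tau>"] by (simp add: g_def)
  have "(\<integral>\<^sup>+\<tau>. ennreal (g \<tau>) * indicator {0<..<1} \<tau> \<partial>lborel) < \<infinity>"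
  proof -
    have "(\<integral>\<^sup>+\<tau>. ennreal (g \<tau>) * indicator {0<..<1} \<tau> \<partial>lborel) \<le> (\<integral>\<^sup>+\<tau>. ennreal (g \<tau>) * indicator {0\<^sup>2..1\<^sup>2} \<tau> \<partial>lborel)"
      by (intro nn_integral_mono) (auto simp: indicator_def)
    also have "\<dots> = (\<integral>\<^sup>+R. ennreal (g (R\<^sup>2) * (2 * R)) * indicator {0..1} R \<partial>lborel)"
    proof -
      have "(\<integral>\<^sup>+\<tau>. ennreal (g \<tau> * indicator {0\<^sup>2..1\<^sup>2} \<tau>) \<partial>lborel) = (\<integral>\<^sup>+R. ennreal (g (R\<^sup>2) * (2 * R) * indicator {0..1} R) \<partial>lborel)"
        by (rule nn_integral_substitution[where g = "\<lambda>R. R\<^sup>2" and g' = "\<lambda>R. 2 * R"])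
           (auto intro!: derivative_eq_intros continuous_intros simp: set_borel_measurable_def)
      then show ?thesis by (simp add: ennreal_mult' ennreal_indicator g0 mult.commute[of "ennreal (indicator _ _)"] ennreal_mult'')
    qed
    also have "\<dots> = (\<integral>\<^sup>+R. ennreal 2 * (ennreal (m R * wt \<alpha> R) * indicator {0<..<1} R) \<partial>lborel)"
    proof (rule nn_integral_cong_AE)
      show "AE R in lborel. ennreal (g (R\<^sup>2) * (2 * R)) * indicator {0..1} R = ennreal 2 * (ennreal (m R * wt \<alpha> R) * indicator {0<..<1} R)"
        using AE_lborel_singleton[of 0] AE_lborel_singleton[of 1]
      proof eventually_elim
        case (elim R)
        show ?case
        proof (cases "R \<in> {0<..<1}")
          case True
          have "(R\<^sup>2) powr (real DIM('a) / 2 - 1) * R = R ^ (DIM('a) - 1)"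
          proof -
            have "R\<^sup>2 = R powr 2" using True by (simp add: powr_numeral)
            then have "(R\<^sup>2) powr (real DIM('a) / 2 - 1) = R powr (2 * (real DIM('a) / 2 - 1))"
              by (simp only: powr_powr)
            moreover have "R = R powr 1" using True by simp
            ultimately have "(R\<^sup>2) powr (real DIM('a) / 2 - 1) * R = R powr (2 * (real DIM('a) / 2 - 1)) * R powr 1"
              by metis
            also have "\<dots> = R powr real (DIM('a) - 1)"
              unfolding powr_add[symmetric] by (rule arg_cong[of _ _ "(powr) R"]) (use dim in \<open>simp add: of_nat_diff\<close>)
            also have "\<dots> = R ^ (DIM('a) - 1)" using True by (intro powr_realpow) simp
            finally show ?thesis .
          qed
          then have eq: "g (R\<^sup>2) * (2 * R) = 2 * (m R * wt \<alpha> R)"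
            using True by (simp add: g_def wt_def mult_ac)
          have "ennreal (g (R\<^sup>2) * (2 * R)) = ennreal 2 * ennreal (m R * wt \<alpha> R)"
            unfolding eq by (rule ennreal_mult') simp
          then show ?thesis using True by (simp only: indicator_simps atLeastAtMost_iff greaterThanLessThan_iff less_imp_le mult_1_right)
        next
          case False
          then show ?thesis using elim by (auto simp: indicator_def)
        qed
      qed
    qed
    also have "\<dots> = ennreal 2 * (\<integral>\<^sup>+R. ennreal (m R * wt \<alpha> R) * indicator {0<..<1} R \<partial>lborel)"
      unfolding m_def by (rule nn_integral_cmult) measurable
    also have "\<dots> < \<infinity>" using fin by (simp add: m_def ennreal_mult_less_top)
    finally show ?thesis .
  qed
  then obtain G where G: "(\<integral>\<^sup>+\<tau>. ennreal (g \<tau>) * indicator {0<..<1} \<tau> \<partial>lborel) = ennreal G" "G \<ge> 0"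
    by (cases "\<integral>\<^sup>+\<tau>. ennreal (g \<tau>) * indicator {0<..<1} \<tau> \<partial>lborel") auto
  define K where "K = N * 2 powr \<delta> * (G + 1)"
  have K: "K > 0" using N G by (simp add: K_def)
  show ?thesis
  proof (intro exI[of _ K] conjI K ballI)
    fix \<rho> :: real assume \<rho>: "\<rho> \<in> {0..<1}"
    have I0: "K * (1 - \<rho>) powr (- \<beta>) > 0" using K \<rho> by simp
    have rt: "0 \<le> \<rho> * \<tau>" "\<rho> * \<tau> \<le> \<tau>" "\<rho> * \<tau> \<le> \<rho>" "\<rho> * \<tau> < 1" if "0 < \<tau>" "\<tau> < 1" for \<tau>
      using \<rho> that mult_left_mono[of \<tau> 1 \<rho>] mult_right_mono[of \<rho> 1 \<tau>] by auto
    have tau: "0 < \<tau> \<and> \<tau> < 1" if "beta_weight (real DIM('a) / 2) t \<tau> > 0" for \<tau>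
      by (rule ccontr) (use that in \<open>auto simp: beta_weight_def\<close>)
    show "(\<integral>\<^sup>+x. ennreal (cmod (F (\<lambda>k j. c k j * b k j) (\<rho> *\<^sub>R x)) powr s) \<partial>\<sigma>) \<le> ennreal ((K * (1 - \<rho>) powr (- \<beta>)) powr s)"
    proof (rule minkowski_integral[where M = lborel and l = "\<lambda>\<tau> x. cmod (F h ((\<rho> * \<tau>) *\<^sub>R x))"
          and A = "\<lambda>\<tau>. N * (1 - sqrt (\<rho> * \<tau>)) powr (- \<delta>) * m (sqrt (\<rho> * \<tau>))" and w = "beta_weight (real DIM('a) / 2) t"])
      have "(\<lambda>z. F h (fst (\<rho> * fst z, snd z) *\<^sub>R snd (\<rho> * fst z, snd z))) \<in> borel_measurable (borel \<Otimes>\<^sub>M \<sigma>)"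
        by (rule measurable_compose[OF _ measurable_F]) measurable
      moreover have "borel_measurable (lborel \<Otimes>\<^sub>M \<sigma>) = borel_measurable (borel \<Otimes>\<^sub>M \<sigma>)"
        by (intro measurable_cong_sets sets_pair_measure_cong) auto
      ultimately show "(\<lambda>(\<tau>, x). cmod (F h ((\<rho> * \<tau>) *\<^sub>R x))) \<in> borel_measurable (lborel \<Otimes>\<^sub>M \<sigma>)"
        by (simp add: case_prod_beta')
      show "(\<lambda>\<tau>. N * (1 - sqrt (\<rho> * \<tau>)) powr (- \<delta>) * m (sqrt (\<rho> * \<tau>))) \<in> borel_measurable lborel"
        unfolding m_def by measurable
      show "0 < N * (1 - sqrt (\<rho> * \<tau>)) powr (- \<delta>) * m (sqrt (\<rho> * \<tau>))" if "beta_weight (real DIM('a) / 2) t \<tau> > 0" for \<tau>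
      proof -
        have "sqrt (\<rho> * \<tau>) < 1" using rt[of \<tau>] tau[OF that] by simp
        then show ?thesis using N m[of "sqrt (\<rho> * \<tau>)"] by simp
      qed
      show "(\<integral>\<^sup>+x. ennreal (cmod (F h ((\<rho> * \<tau>) *\<^sub>R x)) powr s) \<partial>\<sigma>) \<le> ennreal ((N * (1 - sqrt (\<rho> * \<tau>)) powr (- \<delta>) * m (sqrt (\<rho> * \<tau>))) powr s)"
        if "beta_weight (real DIM('a) / 2) t \<tau> > 0" for \<tau>
        using step1[of "sqrt (\<rho> * \<tau>)"] rt[of \<tau>] tau[OF that] by simp
      have "(\<integral>\<^sup>+\<tau>. ennreal (N * (1 - sqrt (\<rho> * \<tau>)) powr (- \<delta>) * m (sqrt (\<rho> * \<tau>)) * beta_weight (real DIM('a) / 2) t \<tau>) \<partial>lborel)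
        \<le> (\<integral>\<^sup>+\<tau>. ennreal (N * 2 powr \<delta> * (1 - \<rho>) powr (- \<beta>)) * (ennreal (g \<tau>) * indicator {0<..<1} \<tau>) \<partial>lborel)"
      proof (rule nn_integral_mono)
        fix \<tau> :: real
        show "ennreal (N * (1 - sqrt (\<rho> * \<tau>)) powr (- \<delta>) * m (sqrt (\<rho> * \<tau>)) * beta_weight (real DIM('a) / 2) t \<tau>)
           \<le> ennreal (N * 2 powr \<delta> * (1 - \<rho>) powr (- \<beta>)) * (ennreal (g \<tau>) * indicator {0<..<1} \<tau>)"
        proof (cases "\<tau> \<in> {0<..<1}")
          case True
          then have \<tau>: "0 < \<tau>" "\<tau> < 1" by auto
          define v where "v = sqrt (\<rho> * \<tau>)"
          have v: "0 \<le> v" "v < 1" "v \<le> sqrt \<tau>" "v * v = \<rho> * \<tau>" using rt[OF \<tau>] by (auto simp: v_def)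
          have "1 - \<rho> * \<tau> = (1 - v) * (1 + v)" by (simp add: v(4)[symmetric] algebra_simps)
          also have "\<dots> \<le> (1 - v) * 2" using v by (intro mult_left_mono) auto
          finally have "((1 - v) * 2) powr (- \<delta>) \<le> (1 - \<rho> * \<tau>) powr (- \<delta>)"
            using rt[OF \<tau>] \<delta> by (intro powr_mono2') auto
          moreover have "((1 - v) * 2) powr (- \<delta>) = (1 - v) powr (- \<delta>) * 2 powr (- \<delta>)"
            by (subst powr_mult) (use v in auto)
          ultimately have "(1 - v) powr (- \<delta>) * 2 powr (- \<delta>) * 2 powr \<delta> \<le> (1 - \<rho> * \<tau>) powr (- \<delta>) * 2 powr \<delta>"
            by (intro mult_right_mono) auto
          moreover have "2 powr (- \<delta>) * 2 powr \<delta> = (1::real)" by (subst powr_add[symmetric]) simp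
          ultimately have 1: "(1 - v) powr (- \<delta>) \<le> 2 powr \<delta> * (1 - \<rho> * \<tau>) powr (- \<delta>)"
            by (simp only: mult.assoc mult_1_right mult.commute[of "(1 - \<rho> * \<tau>) powr (- \<delta>)"])
          \<comment> \<open>The singularity is shared out: exponent \<beta> goes to 1 - \<rho> and
            gives the growth of the target space, exponent t - \<alpha> goes to 1 - \<tau> and
            lowers the Beta weight from t - 1 to \<alpha> - 1.\<close>
          have "(1 - \<rho> * \<tau>) powr (- \<delta>) = (1 - \<rho> * \<tau>) powr (- \<beta>) * (1 - \<rho> * \<tau>) powr (- (t - \<alpha>))"
            by (simp add: \<delta>_def powr_add[symmetric] algebra_simps)
          also have "\<dots> \<le> (1 - \<rho>) powr (- \<beta>) * (1 - \<tau>) powr (- (t - \<alpha>))"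
            using rt[OF \<tau>] \<rho> \<tau> \<beta> t by (intro mult_mono powr_mono2') auto
          finally have "2 powr \<delta> * (1 - \<rho> * \<tau>) powr (- \<delta>) \<le> 2 powr \<delta> * ((1 - \<rho>) powr (- \<beta>) * (1 - \<tau>) powr (- (t - \<alpha>)))"
            by (intro mult_left_mono) auto
          with 1 have 2: "(1 - v) powr (- \<delta>) \<le> 2 powr \<delta> * ((1 - \<rho>) powr (- \<beta>) * (1 - \<tau>) powr (- (t - \<alpha>)))" by linarith
          \<comment> \<open>Since \<rho> < 1, the radius v is at most sqrt \<tau>; monotonicity of
            the means removes \<rho> from the integrand.\<close>
          have 3: "m v \<le> m (sqrt \<tau>)" unfolding m_def using M1_mono[OF b, of v "sqrt \<tau>"] v \<tau> by simp
          have "N * (1 - v) powr (- \<delta>) * m v * (\<tau> powr (real DIM('a) / 2 - 1) * (1 - \<tau>) powr (t - 1))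
             \<le> N * (2 powr \<delta> * ((1 - \<rho>) powr (- \<beta>) * (1 - \<tau>) powr (- (t - \<alpha>)))) * m (sqrt \<tau>) * (\<tau> powr (real DIM('a) / 2 - 1) * (1 - \<tau>) powr (t - 1))"
            using N m[of v] m[of "sqrt \<tau>"] by (intro mult_right_mono mult_mono 2 3 mult_left_mono) auto
          also have "\<dots> = N * 2 powr \<delta> * (1 - \<rho>) powr (- \<beta>) * g \<tau>"
          proof -
            have "(1 - \<tau>) powr (- (t - \<alpha>)) * (1 - \<tau>) powr (t - 1) = (1 - \<tau>) powr (\<alpha> - 1)"
              by (simp add: powr_add[symmetric])
            then have "(1 - \<tau>) powr (- (t - \<alpha>)) * m (sqrt \<tau>) * (\<tau> powr (real DIM('a) / 2 - 1) * (1 - \<tau>) powr (t - 1)) = g \<tau>"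
            proof -
              have "(1 - \<tau>) powr (- (t - \<alpha>)) * m (sqrt \<tau>) * (\<tau> powr (real DIM('a) / 2 - 1) * (1 - \<tau>) powr (t - 1))
                = m (sqrt \<tau>) * (\<tau> powr (real DIM('a) / 2 - 1) * ((1 - \<tau>) powr (- (t - \<alpha>)) * (1 - \<tau>) powr (t - 1)))"
                by (simp only: ac_simps)
              then show ?thesis
                unfolding g_def \<open>(1 - \<tau>) powr (- (t - \<alpha>)) * (1 - \<tau>) powr (t - 1) = (1 - \<tau>) powr (\<alpha> - 1)\<close> .
            qed
            then show ?thesis by (simp only: mult.assoc)
          qed
          finally have "N * (1 - v) powr (- \<delta>) * m v * beta_weight (real DIM('a) / 2) t \<tau> \<le> N * 2 powr \<delta> * (1 - \<rho>) powr (- \<beta>) * g \<tau>"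
            using True by (simp add: beta_weight_def)
          then show ?thesis
            using True N g0[of \<tau>] by (simp add: v_def ennreal_mult'[symmetric] ennreal_leI)
        qed (simp add: beta_weight_def)
      qed
      also have "\<dots> = ennreal (N * 2 powr \<delta> * (1 - \<rho>) powr (- \<beta>)) * ennreal G"
        unfolding G(1)[symmetric] by (rule nn_integral_cmult) measurable
      also have "\<dots> = ennreal (N * 2 powr \<delta> * (1 - \<rho>) powr (- \<beta>) * G)"
        using N G by (simp add: ennreal_mult'[symmetric])
      also have "\<dots> \<le> ennreal (K * (1 - \<rho>) powr (- \<beta>))"
      proof (rule ennreal_leI)
        have "N * 2 powr \<delta> * (1 - \<rho>) powr (- \<beta>) * G \<le> N * 2 powr \<delta> * (1 - \<rho>) powr (- \<beta>) * (G + 1)"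
          using N by (intro mult_left_mono) auto
        then show "N * 2 powr \<delta> * (1 - \<rho>) powr (- \<beta>) * G \<le> K * (1 - \<rho>) powr (- \<beta>)" by (simp add: K_def mult_ac)
      qed
      finally show "(\<integral>\<^sup>+\<tau>. ennreal (N * (1 - sqrt (\<rho> * \<tau>)) powr (- \<delta>) * m (sqrt (\<rho> * \<tau>)) * beta_weight (real DIM('a) / 2) t \<tau>) \<partial>lborel)
        \<le> ennreal (K * (1 - \<rho>) powr (- \<beta>))" .
      fix x assume "x \<in> space \<sigma>"
      then have x: "x \<in> S" by simp
      have "of_real (Beta (real k + real DIM('a) / 2) t) * h k j = c k j * b k j" for k j
      proof -
        have "of_real (Beta (real k + real DIM('a) / 2) t) * h k j = of_real (Beta (real k + real DIM('a) / 2) t * frac_coeff t k) * (c k j * b k j)"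
          by (simp add: h_def frac_mult_def mult_ac)
        then show ?thesis by (simp add: frac_coeff_Beta[OF t0])
      qed
      then have "(\<lambda>k j. of_real (Beta (real k + real DIM('a) / 2) t) * h k j) = (\<lambda>k j. c k j * b k j)" by simp
      moreover have "ennreal (cmod (F (\<lambda>k j. of_real (Beta (real k + real DIM('a) / 2) t) * h k j) (\<rho> *\<^sub>R x)))
         \<le> (\<integral>\<^sup>+\<tau>. ennreal (cmod (F h ((\<rho> * \<tau>) *\<^sub>R x)) * beta_weight (real DIM('a) / 2) t \<tau>) \<partial>lborel)"
        using \<rho> t0 by (intro beta_integral gh x) auto
      ultimately show "ennreal (cmod (F (\<lambda>k j. c k j * b k j) (\<rho> *\<^sub>R x)))
         \<le> (\<integral>\<^sup>+\<tau>. ennreal (cmod (F h ((\<rho> * \<tau>) *\<^sub>R x)) * beta_weight (real DIM('a) / 2) t \<tau>) \<partial>lborel)" by simp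
    qed (use s I0 in \<open>auto intro: sigma_finite_measure_axioms lborel.sigma_finite_measure_axioms simp: beta_weight_nonneg\<close>)
  qed
qed

text \<open>The family belongs to the fractional derivative of the Poisson kernel, dilated by
  \<rho>. Its L1 mean at R is at most A (1 - \<rho> R)^(-t), and integration against the weight of
  exponent \<alpha> p - 1 leaves (1 - \<rho>)^((\<alpha> - t) p), because t > \<alpha>.\<close>

lemma Bnorm_test:
  assumes dim: "DIM('a) \<ge> 2" and p: "0 < p" and \<alpha>: "0 < \<alpha>" and t: "\<alpha> < t"
  shows "\<exists>C>0. \<forall>\<rho>\<in>{0..<1}. \<forall>y\<in>S.
     Bnorm p \<alpha> (\<lambda>k j. of_real (\<rho> ^ k) * (radial (frac_coeff t) k j * of_real (Y k j y))) \<le> ennreal (C * (1 - \<rho>) powr ((\<alpha> - t) * p))"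
proof -
  have t0: "t > 0" using t \<alpha> by simp
  obtain A where A: "A > 0" "\<And>r y. r \<in> {0..<1} \<Longrightarrow> y \<in> S \<Longrightarrow> (\<integral>\<^sup>+x. ennreal (cmod (kern (radial (frac_coeff t)) r x y)) \<partial>\<sigma>) \<le> ennreal (A * (1 - r) powr (- t))"
    and gf: "growth (radial (frac_coeff t))" using L1_order_frac[OF t0 dim] unfolding L1_order_def by blast
  obtain C where C: "C > 0"
    "\<And>\<rho>. 0 \<le> \<rho> \<Longrightarrow> \<rho> < 1 \<Longrightarrow> (\<integral>\<^sup>+R. ennreal (indicator {0<..<1} R * ((1 - \<rho> * R) powr (- (t * p)) * (1 - R) powr (\<alpha> * p - 1))) \<partial>lborel)
        \<le> ennreal (C * (1 - \<rho>) powr (\<alpha> * p - t * p))"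
    using nn_integral_power_weight_le[of "\<alpha> * p" "t * p"] p \<alpha> t by auto
  define L where "L = max 1 (2 powr (\<alpha> * p - 1))"
  have L: "L > 0" by (simp add: L_def less_max_iff_disj)
  show ?thesis
  proof (intro exI[of _ "A powr p * L * C"] conjI ballI)
    show "A powr p * L * C > 0" using A L C by simp
    fix \<rho> :: real and y assume \<rho>: "\<rho> \<in> {0..<1}" and y: "y \<in> S"
    define a where "a = (\<lambda>k j. complex_of_real (\<rho> ^ k) * (radial (frac_coeff t) k j * of_real (Y k j y)))"
    have ga: "growth a" unfolding a_def using \<rho> by (intro growth_dilation growth_kern[OF gf y]) auto
    have rt: "0 \<le> R * \<rho>" "R * \<rho> < 1" if "0 < R" "R < 1" for R
      using \<rho> that mult_right_mono[of R 1 \<rho>] by auto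
    have M: "M1 a R \<le> A * (1 - \<rho> * R) powr (- t)" if R: "0 < R" "R < 1" for R
    proof -
      have "ennreal (M1 a R) = (\<integral>\<^sup>+x. ennreal (cmod (kern (radial (frac_coeff t)) (R * \<rho>) x y)) \<partial>\<sigma>)"
        unfolding nn_M1[OF ga less_imp_le[OF R(1)] R(2), symmetric]
      proof (rule nn_integral_cong)
        fix x assume "x \<in> space \<sigma>"
        then have "x \<in> S" by simp
        then show "ennreal (cmod (F a (R *\<^sub>R x))) = ennreal (cmod (kern (radial (frac_coeff t)) (R * \<rho>) x y))"
          by (simp only: a_def kern_def F_dilation)
      qed
      also have "\<dots> \<le> ennreal (A * (1 - R * \<rho>) powr (- t))" using rt[OF R] by (intro A y) auto
      finally show ?thesis using A(1) by (simp add: mult.commute)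
    qed
    have "Bnorm p \<alpha> a \<le> (\<integral>\<^sup>+R. ennreal (A powr p * L) * ennreal (indicator {0<..<1} R * ((1 - \<rho> * R) powr (- (t * p)) * (1 - R) powr (\<alpha> * p - 1))) \<partial>lborel)"
      unfolding Bnorm_def
    proof (rule nn_integral_mono)
      fix R :: real
      show "ennreal (M1 a R powr p * wt (\<alpha> * p) R) * indicator {0<..<1} R
         \<le> ennreal (A powr p * L) * ennreal (indicator {0<..<1} R * ((1 - \<rho> * R) powr (- (t * p)) * (1 - R) powr (\<alpha> * p - 1)))"
      proof (cases "R \<in> {0<..<1}")
        case True
        then have R: "0 < R" "R < 1" by auto
        have "M1 a R powr p \<le> (A * (1 - \<rho> * R) powr (- t)) powr p"
          using M[OF R] p M1_nonneg by (intro powr_mono2) auto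
        also have "\<dots> = A powr p * (1 - \<rho> * R) powr (- (t * p))"
          using A(1) by (simp add: powr_mult powr_powr)
        finally have 1: "M1 a R powr p \<le> A powr p * (1 - \<rho> * R) powr (- (t * p))" .
        have 2: "wt (\<alpha> * p) R \<le> (L * (1 - R) powr (\<alpha> * p - 1)) * 1"
          unfolding wt_def L_def using R by (intro mult_mono one_minus_square_powr power_le_one) auto
        have "M1 a R powr p * wt (\<alpha> * p) R \<le> (A powr p * (1 - \<rho> * R) powr (- (t * p))) * ((L * (1 - R) powr (\<alpha> * p - 1)) * 1)"
          using R by (intro mult_mono 1 2) (auto simp: wt_nonneg)
        also have "\<dots> = (A powr p * L) * ((1 - \<rho> * R) powr (- (t * p)) * (1 - R) powr (\<alpha> * p - 1))" by simp
        finally show ?thesis using True L by (simp add: ennreal_mult'[symmetric] ennreal_leI)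
      qed simp
    qed
    also have "\<dots> = ennreal (A powr p * L) * (\<integral>\<^sup>+R. ennreal (indicator {0<..<1} R * ((1 - \<rho> * R) powr (- (t * p)) * (1 - R) powr (\<alpha> * p - 1))) \<partial>lborel)"
      by (rule nn_integral_cmult) measurable
    also have "\<dots> \<le> ennreal (A powr p * L) * ennreal (C * (1 - \<rho>) powr (\<alpha> * p - t * p))"
      using \<rho> by (intro mult_left_mono C) auto
    also have "\<dots> = ennreal (A powr p * L * C * (1 - \<rho>) powr ((\<alpha> - t) * p))"
      using L by (simp add: ennreal_mult'[symmetric] left_diff_distrib mult.assoc)
    finally show "Bnorm p \<alpha> (\<lambda>k j. of_real (\<rho> ^ k) * (radial (frac_coeff t) k j * of_real (Y k j y))) \<le> ennreal (A powr p * L * C * (1 - \<rho>) powr ((\<alpha> - t) * p))"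
      by (simp add: a_def)
  qed
qed

end

section \<open>Uniform boundedness of multipliers\<close>

text \<open>After division by a + b both summands lie in [0, 1], where raising to a power p \<le> 1
  does not decrease.\<close>

lemma powr_add_le_add_powr:
  fixes a b p :: real
  assumes "0 \<le> a" "0 \<le> b" "0 < p" "p \<le> 1"
  shows "(a + b) powr p \<le> a powr p + b powr p"
proof (cases "a + b = 0")
  case True
  then show ?thesis using assms by simp
next
  case False
  then have pos: "a + b > 0" using assms by simp
  have le: "u / (a + b) \<le> (u / (a + b)) powr p" if "0 \<le> u" "u \<le> a + b" for u
  proof -
    have "0 \<le> u / (a + b)" "u / (a + b) \<le> 1" using that pos by (auto simp: divide_simps)
    then show ?thesis using powr_mono'[of p 1 "u / (a + b)"] assms that pos by simp
  qed
  have "1 = a / (a + b) + b / (a + b)" using pos by (simp add: add_divide_distrib[symmetric])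
  also have "\<dots> \<le> (a / (a + b)) powr p + (b / (a + b)) powr p"
    using assms by (intro add_mono le) auto
  also have "\<dots> = (a powr p + b powr p) / (a + b) powr p"
    using assms by (simp add: powr_divide add_divide_distrib)
  finally show ?thesis using pos by (simp add: pos_le_divide_eq)
qed

lemma powr_le_suminf_powr:
  fixes f :: "nat \<Rightarrow> real"
  assumes f0: "\<And>n. f n \<ge> 0" and sm: "summable f" and u: "0 \<le> u" "u \<le> suminf f" and p: "0 < p" "p \<le> 1"
  shows "ennreal (u powr p) \<le> (\<Sum>n. ennreal (f n powr p))"
proof -
  have fin: "(\<Sum>n<N. f n) powr p \<le> (\<Sum>n<N. f n powr p)" for N
  proof (induction N)
    case (Suc N)
    have "(\<Sum>n<Suc N. f n) powr p \<le> (\<Sum>n<N. f n) powr p + f N powr p"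
      using powr_add_le_add_powr[of "\<Sum>n<N. f n" "f N" p] f0 p by (simp add: sum_nonneg)
    then show ?case using Suc by simp
  qed simp
  have le: "ennreal ((\<Sum>n<N. f n) powr p) \<le> (\<Sum>n. ennreal (f n powr p))" for N
  proof -
    have "ennreal ((\<Sum>n<N. f n) powr p) \<le> ennreal (\<Sum>n<N. f n powr p)" by (rule ennreal_leI[OF fin])
    also have "\<dots> = (\<Sum>n<N. ennreal (f n powr p))" by simp
    also have "\<dots> \<le> (\<Sum>n. ennreal (f n powr p))" by (rule sum_le_suminf) auto
    finally show ?thesis .
  qed
  have "(\<lambda>N. (\<Sum>n<N. f n) powr p) \<longlonglongrightarrow> suminf f powr p"
    using p f0 by (intro tendsto_powr' summable_LIMSEQ sm tendsto_const) (auto simp: sum_nonneg)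
  then have "(\<lambda>N. ennreal ((\<Sum>n<N. f n) powr p)) \<longlonglongrightarrow> ennreal (suminf f powr p)" by (rule tendsto_ennrealI)
  then have "ennreal (suminf f powr p) \<le> (\<Sum>n. ennreal (f n powr p))"
    by (rule LIMSEQ_le_const2) (use le in blast)
  moreover have "ennreal (u powr p) \<le> ennreal (suminf f powr p)"
    using u p by (intro ennreal_leI powr_mono2) auto
  ultimately show ?thesis by (rule order_trans[rotated])
qed

section \<open>Series of unit ball elements in the quasi-normed space\<close>

context sph_basis
begin

lemma F_cong: "(\<And>k j. j \<in> {1..sph_dim TYPE('a) k} \<Longrightarrow> a k j = b k j) \<Longrightarrow> F a z = F b z"
  unfolding sph_series_def sph_term_def by (intro suminf_cong arg_cong2[where f = "(*)"] refl sum.cong) auto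

lemma growth_scale: "growth a \<Longrightarrow> growth (\<lambda>k j. e * a k j)"
  by (rule growth_mult[OF growth_const])

lemma growth_add:
  assumes "growth a" "growth b"
  shows "growth (\<lambda>k j. a k j + b k j)"
  unfolding growth_def
proof (intro allI impI)
  fix r :: real assume r: "0 < r" "r < 1"
  obtain C where C: "\<And>k j. j \<in> {1..sph_dim TYPE('a) k} \<Longrightarrow> cmod (a k j) * r ^ k \<le> C"
    using growthD[OF assms(1) r] by metis
  obtain D where D: "\<And>k j. j \<in> {1..sph_dim TYPE('a) k} \<Longrightarrow> cmod (b k j) * r ^ k \<le> D"
    using growthD[OF assms(2) r] by metis
  have "cmod (a k j + b k j) * r ^ k \<le> C + D" if j: "j \<in> {1..sph_dim TYPE('a) k}" for k j
  proof -
    have "cmod (a k j + b k j) * r ^ k \<le> (cmod (a k j) + cmod (b k j)) * r ^ k"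
      using r by (intro mult_right_mono norm_triangle_ineq) auto
    then show ?thesis using C[OF j] D[OF j] by (simp add: distrib_right)
  qed
  then show "\<exists>C. \<forall>k. \<forall>j\<in>{1..sph_dim TYPE('a) k}. cmod (a k j + b k j) * r ^ k \<le> C" by blast
qed

lemma F_scale:
  assumes "growth a" "0 \<le> r" "r < 1" "x \<in> S"
  shows "F (\<lambda>k j. e * a k j) (r *\<^sub>R x) = e * F a (r *\<^sub>R x)"
proof -
  have "(\<lambda>k. e * (of_real (r ^ k) * T a k x)) sums (e * F a (r *\<^sub>R x))"
    by (intro sums_mult F_sums assms)
  then have "(\<lambda>k. of_real (r ^ k) * T (\<lambda>k j. e * a k j) k x) sums (e * F a (r *\<^sub>R x))"
    by (simp add: T_def sum_distrib_left mult_ac)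
  then show ?thesis using sums_unique[symmetric] by (subst F_eq_suminf[OF assms(4)]) blast
qed

lemma F_add:
  assumes "growth a" "growth b" "0 \<le> r" "r < 1" "x \<in> S"
  shows "F (\<lambda>k j. a k j + b k j) (r *\<^sub>R x) = F a (r *\<^sub>R x) + F b (r *\<^sub>R x)"
proof -
  have "(\<lambda>k. of_real (r ^ k) * T a k x + of_real (r ^ k) * T b k x) sums (F a (r *\<^sub>R x) + F b (r *\<^sub>R x))"
    by (intro sums_add F_sums assms)
  then have "(\<lambda>k. of_real (r ^ k) * T (\<lambda>k j. a k j + b k j) k x) sums (F a (r *\<^sub>R x) + F b (r *\<^sub>R x))"
    by (simp add: T_def sum.distrib distrib_left distrib_right)
  then show ?thesis using sums_unique[symmetric] by (subst F_eq_suminf[OF assms(5)]) blast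
qed

lemma F_0: "F (\<lambda>k j. 0) z = 0"
  by (simp add: sph_series_def sph_term_def)

lemma growth_lincomb:
  fixes N :: nat
  assumes "\<And>n. growth (x n)"
  shows "growth (\<lambda>k j. \<Sum>n<N. e n * x n k j)"
proof (induction N)
  case 0
  show ?case using growth_const[of 0] by simp
next
  case (Suc N)
  show ?case unfolding sum.lessThan_Suc by (intro growth_add growth_scale Suc assms)
qed

lemma F_lincomb:
  fixes N :: nat
  assumes x: "\<And>n. growth (x n)" and r: "0 \<le> r" "r < 1" and y: "y \<in> S"
  shows "F (\<lambda>k j. \<Sum>n<N. e n * x n k j) (r *\<^sub>R y) = (\<Sum>n<N. e n * F (x n) (r *\<^sub>R y))"
proof (induction N)
  case 0
  show ?case by (simp add: F_0)
next
  case (Suc N)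
  show ?case
    unfolding sum.lessThan_Suc using F_add[OF growth_lincomb[OF x] growth_scale[OF x] r y] F_scale[OF x r y] Suc by simp
qed

lemma coeff_le_M1:
  assumes a: "growth a" and r: "0 \<le> r" "r < 1" and j: "j \<in> {1..sph_dim TYPE('a) k}"
  shows "cmod (a k j) * r ^ k \<le> Ysup k j * M1 a r"
proof -
  have cont: "continuous_on S (\<lambda>x. of_real (Y k j x) * F a (r *\<^sub>R x))"
    by (intro continuous_intros continuous_on_Y[OF j] continuous_on_F_scaled a r)
  have "cmod (a k j) * r ^ k = cmod (\<integral>x. of_real (Y k j x) * F a (r *\<^sub>R x) \<partial>\<sigma>)"
    unfolding F_coeff[OF a r j] using r by (simp add: norm_mult norm_power)
  also have "\<dots> \<le> (\<integral>x. cmod (of_real (Y k j x) * F a (r *\<^sub>R x)) \<partial>\<sigma>)"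
    by (rule integral_norm_bound)
  also have "\<dots> \<le> (\<integral>x. Ysup k j * cmod (F a (r *\<^sub>R x)) \<partial>\<sigma>)"
    using continuous_on_sphere_integrable[OF cont] Y_le_Ysup[OF j]
    by (intro integral_mono integrable_mult_right integrable_F a r integrable_norm) (auto simp: norm_mult intro!: mult_right_mono)
  also have "\<dots> = Ysup k j * M1 a r" by (simp add: M1_def)
  finally show ?thesis .
qed

text \<open>With \<rho> = (1 + r) / 2 one has r \<le> \<rho>^2, so one factor \<rho>^k pays for the
  coefficients of \<open>a\<close> and the other one for the sum over degrees of \<open>c\<close>
  and the sup norms. The constant does not depend on \<open>a\<close>, which gives continuity of the
  multiplier at a fixed radius.\<close>

lemma F_mult_bound:
  assumes c: "growth c" and r: "0 \<le> r" "r < 1"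
  obtains K where "K \<ge> 0"
    "\<And>a \<epsilon> x. \<epsilon> \<ge> 0 \<Longrightarrow> (\<And>k j. j \<in> {1..sph_dim TYPE('a) k} \<Longrightarrow> cmod (a k j) * ((1 + r) / 2) ^ k \<le> \<epsilon> * Ysup k j) \<Longrightarrow> x \<in> S
       \<Longrightarrow> cmod (F (\<lambda>k j. c k j * a k j) (r *\<^sub>R x)) \<le> \<epsilon> * K"
proof -
  define \<rho> where "\<rho> = (1 + r) / 2"
  have \<rho>: "0 < \<rho>" "\<rho> < 1" using r by (auto simp: \<rho>_def)
  have "0 \<le> (1 - r)\<^sup>2" by simp
  then have r\<rho>: "r \<le> \<rho> * \<rho>" by (simp add: \<rho>_def power2_eq_square field_simps)
  define G where "G k j = c k j * (of_real (Ysup k j) * of_real (Ysup k j))" for k j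
  have "growth G" unfolding G_def[abs_def] by (intro growth_mult c growth_Ysup)
  then obtain C q where Cq: "C \<ge> 0" "0 < q" "q < 1"
    and "\<And>k s. 0 \<le> s \<Longrightarrow> s \<le> \<rho> \<Longrightarrow> s ^ k * (\<Sum>j\<in>{1..sph_dim TYPE('a) k}. cmod (G k j)) \<le> C * q ^ k"
    using growth_sum[OF _ less_imp_le[OF \<rho>(1)] \<rho>(2), of G] by blast
  then have "\<rho> ^ k * (\<Sum>j\<in>{1..sph_dim TYPE('a) k}. cmod (G k j)) \<le> C * q ^ k" for k
    using \<rho>(1) by simp
  note C = Cq this[unfolded G_def]
  have "cmod (F (\<lambda>k j. c k j * a k j) (r *\<^sub>R x)) \<le> \<epsilon> * (C / (1 - q))"
    if \<epsilon>: "\<epsilon> \<ge> 0" and a: "\<And>k j. j \<in> {1..sph_dim TYPE('a) k} \<Longrightarrow> cmod (a k j) * \<rho> ^ k \<le> \<epsilon> * Ysup k j" and x: "x \<in> S"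
    for a \<epsilon> x
  proof -
    have term_le: "cmod (of_real (r ^ k) * T (\<lambda>k j. c k j * a k j) k x) \<le> \<epsilon> * C * q ^ k" for k
    proof -
      have "cmod (of_real (r ^ k) * T (\<lambda>k j. c k j * a k j) k x)
          \<le> r ^ k * (\<Sum>j\<in>{1..sph_dim TYPE('a) k}. cmod (c k j * a k j * of_real (Y k j x)))"
        unfolding T_def norm_mult[of "of_real (r ^ k)"] using r by (intro mult_mono norm_sum) (auto simp: norm_power)
      also have "\<dots> \<le> (\<rho> * \<rho>) ^ k * (\<Sum>j\<in>{1..sph_dim TYPE('a) k}. cmod (c k j * a k j * of_real (Y k j x)))"
        using r r\<rho> by (intro mult_right_mono power_mono sum_nonneg) auto
      also have "\<dots> = \<rho> ^ k * (\<Sum>j\<in>{1..sph_dim TYPE('a) k}. cmod (c k j) * ((cmod (a k j) * \<rho> ^ k) * \<bar>Y k j x\<bar>))"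
        by (simp add: power_mult_distrib sum_distrib_left norm_mult mult_ac)
      also have "\<dots> \<le> \<rho> ^ k * (\<Sum>j\<in>{1..sph_dim TYPE('a) k}. cmod (c k j) * ((\<epsilon> * Ysup k j) * Ysup k j))"
        using \<rho> \<epsilon> Ysup_nonneg by (intro mult_left_mono sum_mono mult_mono a Y_le_Ysup x) auto
      also have "\<dots> = \<rho> ^ k * (\<Sum>j\<in>{1..sph_dim TYPE('a) k}. \<epsilon> * cmod (c k j * (of_real (Ysup k j) * of_real (Ysup k j))))"
        by (rule arg_cong2[where f = "(*)", OF refl sum.cong[OF refl]]) (use Ysup_nonneg in \<open>auto simp: norm_mult mult_ac\<close>)
      also have "\<dots> = \<epsilon> * (\<rho> ^ k * (\<Sum>j\<in>{1..sph_dim TYPE('a) k}. cmod (c k j * (of_real (Ysup k j) * of_real (Ysup k j)))))"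
        by (simp add: sum_distrib_left mult_ac)
      also have "\<dots> \<le> \<epsilon> * (C * q ^ k)" by (intro mult_left_mono C \<epsilon>)
      finally show ?thesis by (simp add: mult_ac)
    qed
    have geo: "(\<lambda>k. \<epsilon> * C * q ^ k) sums (\<epsilon> * C * (1 / (1 - q)))"
      using C by (intro sums_mult geometric_sums) auto
    have "cmod (F (\<lambda>k j. c k j * a k j) (r *\<^sub>R x)) \<le> (\<Sum>k. \<epsilon> * C * q ^ k)"
      unfolding F_eq_suminf[OF x] by (rule norm_suminf_le[OF term_le sums_summable[OF geo]])
    then show ?thesis using sums_unique[OF geo] by simp
  qed
  then show ?thesis using C by (intro that[of "C / (1 - q)"]) (auto simp: \<rho>_def)
qed

lemma M1_bounded_on_unit_ball:
  assumes p: "0 < p" and \<alpha>: "0 < \<alpha>" and r: "0 \<le> r" "r < 1"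
  obtains D where "D \<ge> 0" "\<And>a. growth a \<Longrightarrow> Bnorm p \<alpha> a \<le> 1 \<Longrightarrow> M1 a r \<le> D"
proof -
  obtain C where C: "C > 0" "\<And>a. growth a \<Longrightarrow> ennreal (M1 a r powr p * (1 - r) powr (\<alpha> * p)) \<le> ennreal C * Bnorm p \<alpha> a"
    using M1_le_Bnorm[OF p \<alpha>] r by metis
  have "M1 a r \<le> (C / (1 - r) powr (\<alpha> * p)) powr (1 / p)" if a: "growth a" "Bnorm p \<alpha> a \<le> 1" for a
  proof -
    have "ennreal (M1 a r powr p * (1 - r) powr (\<alpha> * p)) \<le> ennreal C * 1"
      using C(2)[OF a(1)] mult_left_mono[OF a(2), of "ennreal C"] by (meson order_trans zero_le)
    then have "M1 a r powr p * (1 - r) powr (\<alpha> * p) \<le> C"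
      using C(1) by (simp add: ennreal_le_iff)
    then have "M1 a r powr p \<le> C / (1 - r) powr (\<alpha> * p)" using r by (simp add: pos_le_divide_eq)
    then have "(M1 a r powr p) powr (1 / p) \<le> (C / (1 - r) powr (\<alpha> * p)) powr (1 / p)"
      using p by (intro powr_mono2) auto
    then show ?thesis using p M1_nonneg[of a r] by (simp add: powr_powr)
  qed
  then show ?thesis using that by (metis powr_ge_zero)
qed

lemma growth_from_Ysup:
  assumes "\<And>\<rho>. 0 < \<rho> \<Longrightarrow> \<rho> < 1 \<Longrightarrow> \<exists>A\<ge>0. \<forall>k. \<forall>j\<in>{1..sph_dim TYPE('a) k}. cmod (a k j) * \<rho> ^ k \<le> A * Ysup k j"
  shows "growth a"
  unfolding growth_def
proof (intro allI impI)
  fix r :: real assume r: "0 < r" "r < 1"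
  define \<rho> where "\<rho> = sqrt r"
  have \<rho>: "0 < \<rho>" "\<rho> < 1" "\<rho> * \<rho> = r" using r by (auto simp: \<rho>_def)
  obtain A where A: "A \<ge> 0" "\<And>k j. j \<in> {1..sph_dim TYPE('a) k} \<Longrightarrow> cmod (a k j) * \<rho> ^ k \<le> A * Ysup k j"
    using assms[OF \<rho>(1,2)] by blast
  obtain C where C: "\<And>k j. j \<in> {1..sph_dim TYPE('a) k} \<Longrightarrow> cmod (of_real (Ysup k j)) * \<rho> ^ k \<le> C"
    using growthD[OF growth_Ysup \<rho>(1,2)] by metis
  have "cmod (a k j) * r ^ k \<le> A * C" if j: "j \<in> {1..sph_dim TYPE('a) k}" for k j
  proof -
    have "cmod (a k j) * r ^ k = (cmod (a k j) * \<rho> ^ k) * \<rho> ^ k"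
      unfolding \<rho>(3)[symmetric] by (simp add: power_mult_distrib)
    also have "\<dots> \<le> (A * Ysup k j) * \<rho> ^ k" using \<rho> by (intro mult_right_mono A j) auto
    also have "\<dots> = A * (cmod (of_real (Ysup k j)) * \<rho> ^ k)" using Ysup_nonneg[OF j] by simp
    also have "\<dots> \<le> A * C" by (intro mult_left_mono C j A)
    finally show ?thesis .
  qed
  then show "\<exists>C. \<forall>k. \<forall>j\<in>{1..sph_dim TYPE('a) k}. cmod (a k j) * r ^ k \<le> C" by blast
qed

text \<open>This is the form in which completeness of the quasi-normed space enters: p-summable
  combinations of unit ball elements stay in the unit ball. The sum is taken coefficientwise;
  uniform tail bounds give the pointwise domination of \<open>F Z\<close> by the sum of the moduli,
  and subadditivity of the p-th power is then integrated.\<close>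

lemma Bnorm_series:
  fixes e :: "nat \<Rightarrow> real" and x :: "nat \<Rightarrow> nat \<Rightarrow> nat \<Rightarrow> complex"
  assumes p: "0 < p" "p \<le> 1" and \<alpha>: "0 < \<alpha>" and x: "\<And>n. growth (x n)" "\<And>n. Bnorm p \<alpha> (x n) \<le> 1"
    and e: "summable (\<lambda>n. \<bar>e n\<bar> powr p)" "(\<Sum>n. \<bar>e n\<bar> powr p) \<le> 1"
  defines "Z \<equiv> \<lambda>k j. \<Sum>n. of_real (e n) * x n k j"
  shows "growth Z" "Bnorm p \<alpha> Z \<le> 1"
    "\<And>k j. j \<in> {1..sph_dim TYPE('a) k} \<Longrightarrow> summable (\<lambda>n. of_real (e n) * x n k j)"
proof -
  \<comment> \<open>Every |e n| is at most 1, so for p \<le> 1 summability of the p-th powers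
    implies summability.\<close>
  have e_le: "\<bar>e n\<bar> \<le> \<bar>e n\<bar> powr p" for n
  proof -
    have "\<bar>e n\<bar> powr p \<le> (\<Sum>n. \<bar>e n\<bar> powr p)" using sum_le_suminf[OF e(1), of "{n}"] by simp
    then have "\<bar>e n\<bar> powr p \<le> 1" using e(2) by simp
    then have "\<bar>e n\<bar> \<le> 1" using p gr_one_powr[of "\<bar>e n\<bar>" p] by (meson leD linorder_le_less_linear)
    then show ?thesis using powr_mono'[of p 1 "\<bar>e n\<bar>"] p by simp
  qed
  have se: "summable (\<lambda>n. \<bar>e n\<bar>)" by (rule summable_comparison_test[OF _ e(1)]) (use e_le in auto)
  have M: "\<exists>D\<ge>0. \<forall>n. M1 (x n) r \<le> D" if "0 \<le> r" "r < 1" for r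
    using M1_bounded_on_unit_ball[OF p(1) \<alpha> that] x by metis
  have bnd: "\<exists>D\<ge>0. \<forall>n k. \<forall>j\<in>{1..sph_dim TYPE('a) k}. cmod (x n k j) * r ^ k \<le> D * Ysup k j" if r: "0 \<le> r" "r < 1" for r
  proof -
    obtain D where D: "D \<ge> 0" "\<And>n. M1 (x n) r \<le> D" using M[OF r] by blast
    have "cmod (x n k j) * r ^ k \<le> D * Ysup k j" if j: "j \<in> {1..sph_dim TYPE('a) k}" for n k j
      using coeff_le_M1[OF x(1) r j, of n] mult_left_mono[OF D(2)[of n] Ysup_nonneg[OF j]] by (simp add: mult_ac)
    then show ?thesis using D(1) by blast
  qed
  show summ: "summable (\<lambda>n. of_real (e n) * x n k j)" if j: "j \<in> {1..sph_dim TYPE('a) k}" for k j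
  proof -
    obtain D where "\<forall>n k. \<forall>j\<in>{1..sph_dim TYPE('a) k}. cmod (x n k j) * (1 / 2) ^ k \<le> D * Ysup k j"
      using bnd[of "1 / 2"] by auto
    then have D: "cmod (x n k j) * (1 / 2) ^ k \<le> D * Ysup k j" for n using j by blast
    have "norm (of_real (e n) * x n k j) \<le> \<bar>e n\<bar> * (D * Ysup k j * 2 ^ k)" for n
      using D[of n] by (simp add: norm_mult power_divide pos_divide_le_eq mult_left_mono)
    then show ?thesis
      by (intro summable_comparison_test[OF _ summable_mult2[OF se]]) auto
  qed
  \<comment> \<open>Tails are measured against \<open>Ysup\<close>, the scale that
    \<open>F_mult_bound\<close> accepts; one factor \<epsilon> N serves all degrees.\<close>
  define tail where "tail N = (\<lambda>k j. \<Sum>n. of_real (e (n + N)) * x (n + N) k j)" for N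
  define \<epsilon> where "\<epsilon> N = (\<Sum>n. \<bar>e (n + N)\<bar>)" for N
  have \<epsilon>0: "\<epsilon> N \<ge> 0" for N
    unfolding \<epsilon>_def by (intro suminf_nonneg summable_ignore_initial_segment se) auto
  have tail_le: "\<exists>D\<ge>0. \<forall>N k. \<forall>j\<in>{1..sph_dim TYPE('a) k}. cmod (tail N k j) * r ^ k \<le> (\<epsilon> N * D) * Ysup k j" if r: "0 < r" "r < 1" for r
  proof -
    obtain D where D: "D \<ge> 0" "\<And>n k j. j \<in> {1..sph_dim TYPE('a) k} \<Longrightarrow> cmod (x n k j) * r ^ k \<le> D * Ysup k j"
      using bnd[of r] r by auto
    have "cmod (tail N k j) * r ^ k \<le> (\<epsilon> N * D) * Ysup k j" if j: "j \<in> {1..sph_dim TYPE('a) k}" for N k j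
    proof -
      have "norm (of_real (e (n + N)) * x (n + N) k j) \<le> \<bar>e (n + N)\<bar> * (D * Ysup k j / r ^ k)" for n
        unfolding norm_mult norm_of_real
        using D(2)[OF j, of "n + N"] r by (intro mult_left_mono) (auto simp: pos_le_divide_eq)
      then have "cmod (tail N k j) \<le> (\<Sum>n. \<bar>e (n + N)\<bar> * (D * Ysup k j / r ^ k))"
        unfolding tail_def
        by (intro norm_suminf_le summable_mult2 summable_ignore_initial_segment se) auto
      also have "\<dots> = \<epsilon> N * (D * Ysup k j / r ^ k)"
        unfolding \<epsilon>_def by (intro suminf_mult2[symmetric] summable_ignore_initial_segment se)
      finally show ?thesis using r by (simp add: pos_le_divide_eq mult_ac)
    qed
    then show ?thesis using D(1) by blast
  qed
  have Z_tail: "Z = tail 0" by (simp add: Z_def tail_def)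
  have g_tail: "growth (tail N)" for N
  proof (rule growth_from_Ysup)
    fix \<rho> :: real assume "0 < \<rho>" "\<rho> < 1"
    then obtain D where "D \<ge> 0" "\<And>k j. j \<in> {1..sph_dim TYPE('a) k} \<Longrightarrow> cmod (tail N k j) * \<rho> ^ k \<le> (\<epsilon> N * D) * Ysup k j"
      using tail_le[of \<rho>] by metis
    then show "\<exists>A\<ge>0. \<forall>k. \<forall>j\<in>{1..sph_dim TYPE('a) k}. cmod (tail N k j) * \<rho> ^ k \<le> A * Ysup k j"
      using \<epsilon>0[of N] by (intro exI[of _ "\<epsilon> N * D"]) auto
  qed
  show gZ: "growth Z" unfolding Z_tail by (rule g_tail)
  have "\<epsilon> \<longlonglongrightarrow> 0" unfolding \<epsilon>_def by (rule suminf_exist_split2[OF se])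
  have F_le: "ennreal (cmod (F Z (r *\<^sub>R y))) \<le> (\<Sum>n. ennreal (\<bar>e n\<bar> * cmod (F (x n) (r *\<^sub>R y))))"
    if r: "0 \<le> r" "r < 1" and y: "y \<in> S" for r y
  proof -
    obtain K where K: "K \<ge> 0" "\<And>a \<epsilon> x. \<epsilon> \<ge> 0 \<Longrightarrow> (\<And>k j. j \<in> {1..sph_dim TYPE('a) k} \<Longrightarrow> cmod (a k j) * ((1 + r) / 2) ^ k \<le> \<epsilon> * Ysup k j) \<Longrightarrow> x \<in> S
       \<Longrightarrow> cmod (F (\<lambda>k j. 1 * a k j) (r *\<^sub>R x)) \<le> \<epsilon> * K"
      using F_mult_bound[OF growth_const[of 1] r] by metis
    obtain D where D: "D \<ge> 0" "\<And>N k j. j \<in> {1..sph_dim TYPE('a) k} \<Longrightarrow> cmod (tail N k j) * ((1 + r) / 2) ^ k \<le> (\<epsilon> N * D) * Ysup k j"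
      using tail_le[of "(1 + r) / 2"] r by auto
    \<comment> \<open>The tail contributes a constant times \<epsilon> N, which tends to zero, so
      the estimate passes to the full series.\<close>
    have split: "cmod (F Z (r *\<^sub>R y)) \<le> (\<Sum>n<N. \<bar>e n\<bar> * cmod (F (x n) (r *\<^sub>R y))) + \<epsilon> N * (D * K)" for N
    proof -
      have "F Z (r *\<^sub>R y) = F (\<lambda>k j. (\<Sum>n<N. of_real (e n) * x n k j) + tail N k j) (r *\<^sub>R y)"
        unfolding Z_def tail_def
        by (rule F_cong) (subst suminf_split_initial_segment[OF summ, of _ _ N], auto)
      also have "\<dots> = (\<Sum>n<N. of_real (e n) * F (x n) (r *\<^sub>R y)) + F (tail N) (r *\<^sub>R y)"
        by (subst F_add[OF growth_lincomb[OF x(1)] g_tail r y]) (simp only: F_lincomb[OF x(1) r y])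
      also have "cmod \<dots> \<le> cmod (\<Sum>n<N. of_real (e n) * F (x n) (r *\<^sub>R y)) + cmod (F (tail N) (r *\<^sub>R y))"
        by (rule norm_triangle_ineq)
      also have "\<dots> \<le> (\<Sum>n<N. \<bar>e n\<bar> * cmod (F (x n) (r *\<^sub>R y))) + (\<epsilon> N * D) * K"
      proof (rule add_mono)
        show "cmod (\<Sum>n<N. of_real (e n) * F (x n) (r *\<^sub>R y)) \<le> (\<Sum>n<N. \<bar>e n\<bar> * cmod (F (x n) (r *\<^sub>R y)))"
          by (rule order_trans[OF norm_sum]) (simp add: norm_mult)
        have "cmod (F (\<lambda>k j. 1 * tail N k j) (r *\<^sub>R y)) \<le> (\<epsilon> N * D) * K"
          by (rule K(2)[OF _ D(2) y]) (use \<epsilon>0 D(1) in auto)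
        then show "cmod (F (tail N) (r *\<^sub>R y)) \<le> (\<epsilon> N * D) * K" by simp
      qed
      finally show ?thesis by (simp add: mult_ac)
    qed
    have le: "ennreal (cmod (F Z (r *\<^sub>R y))) \<le> (\<Sum>n. ennreal (\<bar>e n\<bar> * cmod (F (x n) (r *\<^sub>R y)))) + ennreal (\<epsilon> N * (D * K))" for N
    proof -
      have "ennreal (cmod (F Z (r *\<^sub>R y))) \<le> ennreal ((\<Sum>n<N. \<bar>e n\<bar> * cmod (F (x n) (r *\<^sub>R y))) + \<epsilon> N * (D * K))"
        by (rule ennreal_leI[OF split])
      also have "\<dots> = (\<Sum>n<N. ennreal (\<bar>e n\<bar> * cmod (F (x n) (r *\<^sub>R y)))) + ennreal (\<epsilon> N * (D * K))"
        using \<epsilon>0 D(1) K(1) by (subst ennreal_plus) (auto intro!: sum_nonneg)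
      also have "\<dots> \<le> (\<Sum>n. ennreal (\<bar>e n\<bar> * cmod (F (x n) (r *\<^sub>R y)))) + ennreal (\<epsilon> N * (D * K))"
        by (intro add_right_mono sum_le_suminf) auto
      finally show ?thesis .
    qed
    have "(\<lambda>N. (\<Sum>n. ennreal (\<bar>e n\<bar> * cmod (F (x n) (r *\<^sub>R y)))) + ennreal (\<epsilon> N * (D * K)))
        \<longlonglongrightarrow> (\<Sum>n. ennreal (\<bar>e n\<bar> * cmod (F (x n) (r *\<^sub>R y)))) + ennreal (0 * (D * K))"
      by (intro tendsto_add tendsto_const tendsto_ennrealI tendsto_mult \<open>\<epsilon> \<longlonglongrightarrow> 0\<close>)
    then have "ennreal (cmod (F Z (r *\<^sub>R y))) \<le> (\<Sum>n. ennreal (\<bar>e n\<bar> * cmod (F (x n) (r *\<^sub>R y)))) + ennreal (0 * (D * K))"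
      by (rule LIMSEQ_le_const) (use le in blast)
    then show ?thesis by simp
  qed
  have M1_le: "summable (\<lambda>n. \<bar>e n\<bar> * M1 (x n) r)" "M1 Z r \<le> (\<Sum>n. \<bar>e n\<bar> * M1 (x n) r)" if r: "0 \<le> r" "r < 1" for r
  proof -
    obtain D where D: "\<And>n. M1 (x n) r \<le> D" using M[OF r] by blast
    show sm: "summable (\<lambda>n. \<bar>e n\<bar> * M1 (x n) r)"
      by (rule summable_comparison_test[OF _ summable_mult2[OF se, of D]])
        (use D M1_nonneg in \<open>auto simp: abs_mult intro!: mult_left_mono\<close>)
    have meas: "(\<lambda>y. cmod (F (x n) (r *\<^sub>R y))) \<in> borel_measurable \<sigma>" for n
      using integrable_F[OF x(1) r] by (rule borel_measurable_integrable)
    have "ennreal (M1 Z r) = (\<integral>\<^sup>+y. ennreal (cmod (F Z (r *\<^sub>R y))) \<partial>\<sigma>)"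
      by (rule nn_M1[OF gZ r, symmetric])
    also have "\<dots> \<le> (\<integral>\<^sup>+y. (\<Sum>n. ennreal (\<bar>e n\<bar> * cmod (F (x n) (r *\<^sub>R y)))) \<partial>\<sigma>)"
      by (intro nn_integral_mono F_le r) simp
    also have "\<dots> = (\<Sum>n. \<integral>\<^sup>+y. ennreal (\<bar>e n\<bar> * cmod (F (x n) (r *\<^sub>R y))) \<partial>\<sigma>)"
      by (intro nn_integral_suminf measurable_compose[OF _ measurable_ennreal] borel_measurable_times borel_measurable_const meas)
    also have "\<dots> = (\<Sum>n. ennreal (\<bar>e n\<bar> * M1 (x n) r))"
      using meas by (intro suminf_cong) (simp add: ennreal_mult' nn_integral_cmult nn_M1[OF x(1) r])
    also have "\<dots> = ennreal (\<Sum>n. \<bar>e n\<bar> * M1 (x n) r)"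
      using sm M1_nonneg by (intro suminf_ennreal2) auto
    finally show "M1 Z r \<le> (\<Sum>n. \<bar>e n\<bar> * M1 (x n) r)"
      using M1_nonneg by (subst (asm) ennreal_le_iff) (auto intro!: suminf_nonneg sm)
  qed
  have "Bnorm p \<alpha> Z \<le> (\<integral>\<^sup>+R. (\<Sum>n. ennreal (\<bar>e n\<bar> powr p) * (ennreal (M1 (x n) R powr p * wt (\<alpha> * p) R) * indicator {0<..<1} R)) \<partial>lborel)"
    unfolding Bnorm_def
  proof (rule nn_integral_mono)
    fix R :: real
    show "ennreal (M1 Z R powr p * wt (\<alpha> * p) R) * indicator {0<..<1} R
      \<le> (\<Sum>n. ennreal (\<bar>e n\<bar> powr p) * (ennreal (M1 (x n) R powr p * wt (\<alpha> * p) R) * indicator {0<..<1} R))"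
    proof (cases "R \<in> {0<..<1}")
      case True
      then have R: "0 \<le> R" "R < 1" by auto
      have "ennreal (M1 Z R powr p) \<le> (\<Sum>n. ennreal ((\<bar>e n\<bar> * M1 (x n) R) powr p))"
        using M1_nonneg by (intro powr_le_suminf_powr M1_le[OF R] p) auto
      then have "ennreal (M1 Z R powr p) * ennreal (wt (\<alpha> * p) R) \<le> (\<Sum>n. ennreal ((\<bar>e n\<bar> * M1 (x n) R) powr p)) * ennreal (wt (\<alpha> * p) R)"
        by (rule mult_right_mono) simp
      also have "\<dots> = (\<Sum>n. ennreal ((\<bar>e n\<bar> * M1 (x n) R) powr p) * ennreal (wt (\<alpha> * p) R))"
        by simp
      also have "\<dots> = (\<Sum>n. ennreal (\<bar>e n\<bar> powr p) * (ennreal (M1 (x n) R powr p * wt (\<alpha> * p) R)))"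
        using M1_nonneg by (intro suminf_cong) (simp add: powr_mult ennreal_mult' mult.assoc)
      finally show ?thesis using True by (simp add: ennreal_mult')
    qed simp
  qed
  also have "\<dots> = (\<Sum>n. ennreal (\<bar>e n\<bar> powr p) * Bnorm p \<alpha> (x n))"
    unfolding Bnorm_def by (subst nn_integral_suminf) (auto intro!: suminf_cong nn_integral_cmult)
  also have "\<dots> \<le> (\<Sum>n. ennreal (\<bar>e n\<bar> powr p))"
    using mult_left_mono[OF x(2)] by (intro suminf_le) auto
  also have "\<dots> = ennreal (\<Sum>n. \<bar>e n\<bar> powr p)" by (intro suminf_ennreal2 e) auto
  also have "\<dots> \<le> 1" using e(2) by simp
  finally show "Bnorm p \<alpha> Z \<le> 1" .
qed

section \<open>Weighted means at one radius and their uniform boundedness\<close>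

text \<open>The \<open>H_space\<close> quantity of c * a at a single radius, as a real function of
  the family \<open>a\<close>. The uniform boundedness argument runs over this collection of
  functions indexed by the radius.\<close>

definition wmean :: "real \<Rightarrow> real \<Rightarrow> (nat \<Rightarrow> nat \<Rightarrow> complex) \<Rightarrow> real \<Rightarrow> (nat \<Rightarrow> nat \<Rightarrow> complex) \<Rightarrow> real" where
  "wmean s \<beta> c r a = (\<integral>x. cmod (F (\<lambda>k j. c k j * a k j) (r *\<^sub>R x)) powr s \<partial>\<sigma>) powr (1 / s) * (1 - r) powr \<beta>"

lemma wmean_nonneg: "wmean s \<beta> c r a \<ge> 0"
  by (simp add: wmean_def)

lemma wmean_cong:
  "(\<And>k j. j \<in> {1..sph_dim TYPE('a) k} \<Longrightarrow> a k j = b k j) \<Longrightarrow> wmean s \<beta> c r a = wmean s \<beta> c r b"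
  unfolding wmean_def
  by (intro arg_cong2[where f = "(*)"] arg_cong2[where f = "(powr)"] refl Bochner_Integration.integral_cong arg_cong[where f = cmod] F_cong) simp

lemma integrable_F_powr:
  assumes "growth a" "0 \<le> r" "r < 1" "s \<ge> 1"
  shows "integrable \<sigma> (\<lambda>x. cmod (F a (r *\<^sub>R x)) powr s)"
  using assms
  by (intro continuous_on_sphere_integrable continuous_on_powr' continuous_intros continuous_on_F_scaled) auto

lemma wmean_scale:
  assumes c: "growth c" and a: "growth a" and r: "0 \<le> r" "r < 1" and s: "s \<ge> 1"
  shows "wmean s \<beta> c r (\<lambda>k j. e * a k j) = cmod e * wmean s \<beta> c r a"
proof -
  have eq: "(\<lambda>k j. c k j * (e * a k j)) = (\<lambda>k j. e * (c k j * a k j))" by (simp add: fun_eq_iff)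
  have "(\<integral>x. cmod (F (\<lambda>k j. c k j * (e * a k j)) (r *\<^sub>R x)) powr s \<partial>\<sigma>)
      = (\<integral>x. cmod e powr s * cmod (F (\<lambda>k j. c k j * a k j) (r *\<^sub>R x)) powr s \<partial>\<sigma>)"
    unfolding eq
    by (rule Bochner_Integration.integral_cong[OF refl])
      (simp add: F_scale[OF growth_mult[OF c a] r] norm_mult powr_mult)
  also have "\<dots> = cmod e powr s * (\<integral>x. cmod (F (\<lambda>k j. c k j * a k j) (r *\<^sub>R x)) powr s \<partial>\<sigma>)" by simp
  finally show ?thesis using s by (simp add: wmean_def powr_mult powr_powr)
qed

text \<open>The factor 2 comes from the elementary (u + v)^s \<le> 2^s (u^s + v^s), followed by
  subadditivity of the s-th root; the constants of the gliding hump are adapted to it.\<close>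

lemma wmean_add:
  assumes c: "growth c" and a: "growth a" and b: "growth b" and r: "0 \<le> r" "r < 1" and s: "s \<ge> 1"
  shows "wmean s \<beta> c r (\<lambda>k j. a k j + b k j) \<le> 2 * (wmean s \<beta> c r a + wmean s \<beta> c r b)"
proof -
  have powr_add: "(u + v) powr s \<le> 2 powr s * (u powr s + v powr s)" if "u \<ge> 0" "v \<ge> 0" for u v :: real
  proof -
    have "(u + v) powr s \<le> (2 * max u v) powr s" using that s by (intro powr_mono2) auto
    also have "\<dots> = 2 powr s * (max u v) powr s" using that by (simp add: powr_mult)
    also have "\<dots> \<le> 2 powr s * (u powr s + v powr s)" by (intro mult_left_mono) (auto simp: max_def)
    finally show ?thesis .
  qed
  define A where "A x = cmod (F (\<lambda>k j. c k j * a k j) (r *\<^sub>R x))" for x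
  define B where "B x = cmod (F (\<lambda>k j. c k j * b k j) (r *\<^sub>R x))" for x
  have int: "integrable \<sigma> (\<lambda>x. A x powr s)" "integrable \<sigma> (\<lambda>x. B x powr s)"
    unfolding A_def B_def by (intro integrable_F_powr growth_mult a b c r s)+
  have "(\<integral>x. cmod (F (\<lambda>k j. c k j * (a k j + b k j)) (r *\<^sub>R x)) powr s \<partial>\<sigma>)
      \<le> (\<integral>x. 2 powr s * (A x powr s + B x powr s) \<partial>\<sigma>)"
  proof (rule integral_mono)
    show "integrable \<sigma> (\<lambda>x. cmod (F (\<lambda>k j. c k j * (a k j + b k j)) (r *\<^sub>R x)) powr s)"
      by (intro integrable_F_powr growth_mult growth_add a b c r s)
    fix x assume "x \<in> space \<sigma>"
    then have x: "x \<in> S" by simp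
    have "F (\<lambda>k j. c k j * (a k j + b k j)) (r *\<^sub>R x) = F (\<lambda>k j. c k j * a k j) (r *\<^sub>R x) + F (\<lambda>k j. c k j * b k j) (r *\<^sub>R x)"
      unfolding distrib_left by (rule F_add[OF growth_mult[OF c a] growth_mult[OF c b] r x])
    then have "cmod (F (\<lambda>k j. c k j * (a k j + b k j)) (r *\<^sub>R x)) \<le> A x + B x"
      unfolding A_def B_def by (simp add: norm_triangle_ineq)
    then have "cmod (F (\<lambda>k j. c k j * (a k j + b k j)) (r *\<^sub>R x)) powr s \<le> (A x + B x) powr s"
      using s by (intro powr_mono2) auto
    also have "\<dots> \<le> 2 powr s * (A x powr s + B x powr s)" by (rule powr_add) (auto simp: A_def B_def)
    finally show "cmod (F (\<lambda>k j. c k j * (a k j + b k j)) (r *\<^sub>R x)) powr s \<le> 2 powr s * (A x powr s + B x powr s)" .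
  qed (intro integrable_mult_right Bochner_Integration.integrable_add int)
  also have "\<dots> = 2 powr s * ((\<integral>x. A x powr s \<partial>\<sigma>) + (\<integral>x. B x powr s \<partial>\<sigma>))"
    using int by simp
  finally have "(\<integral>x. cmod (F (\<lambda>k j. c k j * (a k j + b k j)) (r *\<^sub>R x)) powr s \<partial>\<sigma>) powr (1 / s)
      \<le> (2 powr s * ((\<integral>x. A x powr s \<partial>\<sigma>) + (\<integral>x. B x powr s \<partial>\<sigma>))) powr (1 / s)"
    using s by (intro powr_mono2) auto
  also have "\<dots> = 2 * ((\<integral>x. A x powr s \<partial>\<sigma>) + (\<integral>x. B x powr s \<partial>\<sigma>)) powr (1 / s)"
    using s by (simp add: powr_mult powr_powr)
  also have "\<dots> \<le> 2 * ((\<integral>x. A x powr s \<partial>\<sigma>) powr (1 / s) + (\<integral>x. B x powr s \<partial>\<sigma>) powr (1 / s))"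
    using s by (intro mult_left_mono powr_add_le_add_powr) auto
  finally have "wmean s \<beta> c r (\<lambda>k j. a k j + b k j)
      \<le> (2 * ((\<integral>x. A x powr s \<partial>\<sigma>) powr (1 / s) + (\<integral>x. B x powr s \<partial>\<sigma>) powr (1 / s))) * (1 - r) powr \<beta>"
    unfolding wmean_def by (intro mult_right_mono) auto
  then show ?thesis by (simp add: wmean_def A_def B_def distrib_left distrib_right mult.assoc)
qed

text \<open>Elements of the unit ball have bounded L1 means at radius (1 + r) / 2, hence bounded
  coefficients there, and \<open>F_mult_bound\<close> carries this to the radius r. Only uniformity
  in r is still missing.\<close>

lemma wmean_bounded:
  assumes c: "growth c" and r: "0 \<le> r" "r < 1" and p: "0 < p" and \<alpha>: "0 < \<alpha>" and s: "s \<ge> 1"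
  shows "\<exists>K. \<forall>a. growth a \<longrightarrow> Bnorm p \<alpha> a \<le> 1 \<longrightarrow> wmean s \<beta> c r a \<le> K"
proof -
  obtain K where K: "K \<ge> 0" "\<And>a \<epsilon> x. \<epsilon> \<ge> 0 \<Longrightarrow> (\<And>k j. j \<in> {1..sph_dim TYPE('a) k} \<Longrightarrow> cmod (a k j) * ((1 + r) / 2) ^ k \<le> \<epsilon> * Ysup k j) \<Longrightarrow> x \<in> S
       \<Longrightarrow> cmod (F (\<lambda>k j. c k j * a k j) (r *\<^sub>R x)) \<le> \<epsilon> * K"
    using F_mult_bound[OF c r] by blast
  have \<rho>: "0 \<le> (1 + r) / 2" "(1 + r) / 2 < 1" using r by auto
  obtain D where D: "D \<ge> 0" "\<And>a. growth a \<Longrightarrow> Bnorm p \<alpha> a \<le> 1 \<Longrightarrow> M1 a ((1 + r) / 2) \<le> D"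
    using M1_bounded_on_unit_ball[OF p \<alpha> \<rho>] by metis
  have "wmean s \<beta> c r a \<le> ((D * K) powr s * area) powr (1 / s) * (1 - r) powr \<beta>"
    if a: "growth a" "Bnorm p \<alpha> a \<le> 1" for a
  proof -
    have coeff: "cmod (a k j) * ((1 + r) / 2) ^ k \<le> D * Ysup k j" if j: "j \<in> {1..sph_dim TYPE('a) k}" for k j
      using coeff_le_M1[OF a(1) \<rho> j] mult_left_mono[OF D(2)[OF a] Ysup_nonneg[OF j]] by (simp add: mult_ac)
    have "(\<integral>x. cmod (F (\<lambda>k j. c k j * a k j) (r *\<^sub>R x)) powr s \<partial>\<sigma>) \<le> (\<integral>x. (D * K) powr s \<partial>\<sigma>)"
      using s by (intro integral_mono integrable_F_powr growth_mult c a r s powr_mono2 K(2) D(1) coeff) auto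
    also have "\<dots> = (D * K) powr s * area" by simp
    finally show ?thesis
      unfolding wmean_def using s by (intro mult_right_mono powr_mono2) auto
  qed
  then show ?thesis by blast
qed

text \<open>
  Sokal's gliding hump: the signs of the partial sums \<open>u n\<close> are chosen so that the quasi-triangle inequality
  keeps the mean at the radius \<open>\<rho> n\<close> large; the tail after step \<open>n\<close> is a small multiple of an element of the
  unit ball. This avoids the closed graph theorem for complete quasi-normed spaces.
\<close>
theorem multiplier_bounded:
  assumes p: "0 < p" "p \<le> 1" and \<alpha>: "0 < \<alpha>" and s: "s \<ge> 1" and c: "growth c"
    and mult: "\<And>a. growth a \<Longrightarrow> Bnorm p \<alpha> a < \<infinity> \<Longrightarrow> \<exists>K. \<forall>r\<in>{0..<1}. wmean s \<beta> c r a \<le> K"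
  shows "\<exists>C. \<forall>a. growth a \<longrightarrow> Bnorm p \<alpha> a \<le> 1 \<longrightarrow> (\<forall>r\<in>{0..<1}. wmean s \<beta> c r a \<le> C)"
proof (rule ccontr)
  assume "\<not> ?thesis"
  then have unb: "\<exists>a r. growth a \<and> Bnorm p \<alpha> a \<le> 1 \<and> r \<in> {0..<1} \<and> wmean s \<beta> c r a > C" for C
    by (meson linorder_le_less_linear)
  define T where "T r a = wmean s \<beta> c r a" for r a
  define U where "U = {a. growth a \<and> Bnorm p \<alpha> a \<le> 1}"
  define nm where "nm r = (SUP a\<in>U. T r a)" for r
  have bdd: "bdd_above (T r ` U)" if "r \<in> {0..<1}" for r
    using wmean_bounded[OF c _ _ p(1) \<alpha> s, of r \<beta>] that by (auto simp: T_def U_def bdd_above_def)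
  have T_le: "T r a \<le> nm r" if "r \<in> {0..<1}" "a \<in> U" for r a
    unfolding nm_def by (rule cSUP_upper[OF that(2) bdd[OF that(1)]])
  \<comment> \<open>The p-th powers are 17^(-n-1), with sum 1/16, so every signed series with these
    weights stays in the unit ball.\<close>
  define A where "A n = ((1 / 17) ^ Suc n) powr (1 / p)" for n :: nat
  have A0: "A n > 0" for n by (simp add: A_def)
  have A_powr: "A n powr p = (1 / 17) ^ Suc n" for n using p by (simp add: A_def powr_powr del: power_Suc)
  \<comment> \<open>The radius is chosen where the supremum over the unit ball beats n / A n, and
    then an element that attains three quarters of that supremum.\<close>
  have "\<exists>r a. r \<in> {0..<1} \<and> a \<in> U \<and> real n / A n \<le> nm r \<and> 3 / 4 * nm r \<le> T r a" for n
  proof -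
    obtain a r where ar: "a \<in> U" "r \<in> {0..<1}" "T r a > real n / A n"
      using unb[of "real n / A n"] by (auto simp: U_def T_def)
    have "real n / A n \<ge> 0" using A0[of n] by simp
    then have "nm r > 0" using T_le[OF ar(2,1)] ar(3) by linarith
    then have "3 / 4 * nm r < (SUP a\<in>U. T r a)" unfolding nm_def[symmetric] by simp
    then obtain b where "b \<in> U" "3 / 4 * nm r < T r b"
      using less_cSUP_iff[OF _ bdd[OF ar(2)]] ar(1) by blast
    then show ?thesis using ar T_le[OF ar(2,1)] by (meson less_imp_le order_trans)
  qed
  then obtain \<rho> x where \<rho>: "\<And>n. \<rho> n \<in> {0..<1}" and xU: "\<And>n. x n \<in> U"
    and big: "\<And>n. real n / A n \<le> nm (\<rho> n)" and near: "\<And>n. 3 / 4 * nm (\<rho> n) \<le> T (\<rho> n) (x n)"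
    by metis
  have x: "growth (x n)" "Bnorm p \<alpha> (x n) \<le> 1" for n using xU[of n] by (auto simp: U_def)
  have \<rho>': "0 \<le> \<rho> n" "\<rho> n < 1" for n using \<rho>[of n] by auto
  define sg where "sg u n = (if A n * T (\<rho> n) (x n) / 2 \<le> T (\<rho> n) (\<lambda>k j. u k j + of_real (A n) * x n k j) then A n else - A n)" for u n
  define u where "u = rec_nat (\<lambda>(k::nat) (j::nat). 0) (\<lambda>n u. \<lambda>k j. u k j + complex_of_real (sg u n) * x n k j)"
  define e where "e n = sg (u n) n" for n
  have u_Suc: "u (Suc n) = (\<lambda>k j. u n k j + of_real (e n) * x n k j)" for n
    by (simp add: u_def e_def)
  have u_eq: "u N = (\<lambda>k j. \<Sum>n<N. of_real (e n) * x n k j)" for N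
  proof (induction N)
    case 0
    show ?case by (simp add: u_def)
  next
    case (Suc N)
    show ?case unfolding u_Suc Suc by simp
  qed
  have u_growth: "growth (u N)" for N unfolding u_eq by (rule growth_lincomb[OF x(1)])
  have e_abs: "\<bar>e n\<bar> = A n" for n using A0[of n] by (simp add: e_def sg_def)
  \<comment> \<open>Twice the new term is the difference of the two candidates u + A x and u - A x,
    so by the quasi-triangle inequality the two means cannot both be less than A T(x) / 2.\<close>
  have hump: "A n * T (\<rho> n) (x n) / 2 \<le> T (\<rho> n) (u (Suc n))" for n
  proof (cases "A n * T (\<rho> n) (x n) / 2 \<le> T (\<rho> n) (\<lambda>k j. u n k j + of_real (A n) * x n k j)")
    case True
    then show ?thesis unfolding u_Suc by (simp add: e_def sg_def)
  next
    case False
    then have e: "e n = - A n" by (simp add: e_def sg_def)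
    have "2 * A n * T (\<rho> n) (x n) = T (\<rho> n) (\<lambda>k j. of_real (2 * A n) * x n k j)"
      unfolding T_def wmean_scale[OF c x(1) \<rho>' s] using A0[of n] by simp
    also have "(\<lambda>k j. of_real (2 * A n) * x n k j) = (\<lambda>k j. (u n k j + of_real (A n) * x n k j) + (- 1) * (u n k j + of_real (e n) * x n k j))"
      by (simp add: fun_eq_iff e algebra_simps)
    also have "T (\<rho> n) \<dots> \<le> 2 * (T (\<rho> n) (\<lambda>k j. u n k j + of_real (A n) * x n k j) + T (\<rho> n) (\<lambda>k j. (- 1) * (u n k j + of_real (e n) * x n k j)))"
      unfolding T_def by (intro wmean_add c growth_add growth_scale u_growth x \<rho>' s)
    also have "T (\<rho> n) (\<lambda>k j. (- 1) * (u n k j + of_real (e n) * x n k j)) = T (\<rho> n) (u (Suc n))"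
      unfolding u_Suc T_def by (subst wmean_scale) (auto intro!: c growth_add growth_scale u_growth x \<rho>' s)
    finally have "2 * A n * T (\<rho> n) (x n) \<le> 2 * (T (\<rho> n) (\<lambda>k j. u n k j + of_real (A n) * x n k j) + T (\<rho> n) (u (Suc n)))" .
    then have "2 * (A n * T (\<rho> n) (x n)) \<le> 2 * T (\<rho> n) (\<lambda>k j. u n k j + of_real (A n) * x n k j) + 2 * T (\<rho> n) (u (Suc n))"
      by (simp only: mult.assoc distrib_left)
    then show ?thesis using False by linarith
  qed
  have geo: "(\<lambda>n. (1 / 17) ^ Suc n :: real) sums (1 / 16)"
    using sums_mult[OF geometric_sums[of "1 / 17 :: real"], of "1 / 17"] by simp
  define Z where "Z = (\<lambda>k j. \<Sum>n. of_real (e n) * x n k j)"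
  have e_sum: "summable (\<lambda>n. \<bar>e n\<bar> powr p)" "(\<Sum>n. \<bar>e n\<bar> powr p) \<le> 1"
    using sums_summable[OF geo] sums_unique[OF geo] by (simp_all add: e_abs A_powr del: power_Suc)
  note Z = Bnorm_series[where x = x, OF p \<alpha> x e_sum, folded Z_def]
  have "Bnorm p \<alpha> Z < \<infinity>" using Z(2) by (simp add: order_le_less_trans[of _ 1])
  from mult[OF Z(1) this] obtain K where K: "\<And>r. r \<in> {0..<1} \<Longrightarrow> T r Z \<le> K" unfolding T_def by blast
  have "real n / 8 \<le> K" for n
  proof -
    \<comment> \<open>The p-th powers of the weights after step n sum to 17^(-n-1) / 16, so the tail
      is l times an element of the unit ball, and p \<le> 1 gives l \<le> A n / 16. The ratio 17 is
      what produces this 16.\<close>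
    define l where "l = ((1 / 17) ^ Suc n / 16) powr (1 / p)"
    have l0: "l > 0" by (simp add: l_def)
    have l_powr: "l powr p = (1 / 17) ^ Suc n / 16" using p by (simp add: l_def powr_powr del: power_Suc)
    have "l = A n * (1 / 16) powr (1 / p)"
      unfolding l_def A_def by (subst powr_mult[symmetric]) (auto simp del: power_Suc)
    also have "\<dots> \<le> A n * (1 / 16) powr 1"
      using A0[of n] p by (intro mult_left_mono powr_mono') auto
    finally have l_le: "l \<le> A n / 16" by simp
    define f where "f i = e (i + Suc n) / l" for i
    have f_powr: "\<bar>f i\<bar> powr p = 16 * (1 / 17) ^ Suc i" for i
    proof -
      have "\<bar>f i\<bar> powr p = A (i + Suc n) powr p / l powr p"
        using l0 A0 by (simp add: f_def e_abs powr_divide less_imp_le)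
      then show ?thesis unfolding A_powr l_powr by (simp add: power_add)
    qed
    have f_sums: "(\<lambda>i. \<bar>f i\<bar> powr p) sums 1" unfolding f_powr using sums_mult[OF geo, of 16] by simp
    define V where "V = (\<lambda>k j. \<Sum>i. of_real (f i) * x (i + Suc n) k j)"
    have V: "growth V" "Bnorm p \<alpha> V \<le> 1"
      unfolding V_def
      by (rule Bnorm_series[where x = "\<lambda>i. x (i + Suc n)", OF p \<alpha> x sums_summable[OF f_sums]], use sums_unique[OF f_sums] in simp)+
    have "T (\<rho> n) (u (Suc n)) = T (\<rho> n) (\<lambda>k j. Z k j + of_real (- l) * V k j)"
      unfolding T_def
    proof (rule wmean_cong)
      fix k j assume j: "j \<in> {1..sph_dim TYPE('a) k}"
      have "of_real l * V k j = (\<Sum>i. of_real l * (of_real (f i) * x (i + Suc n) k j))"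
        unfolding V_def
        by (rule suminf_mult[symmetric], rule Bnorm_series(3)[where x = "\<lambda>i. x (i + Suc n)", OF p \<alpha> x sums_summable[OF f_sums] _ j])
          (use sums_unique[OF f_sums] in simp)
      also have "\<dots> = (\<Sum>i. of_real (e (i + Suc n)) * x (i + Suc n) k j)"
        using l0 by (simp add: f_def)
      also have "\<dots> = Z k j - u (Suc n) k j"
        unfolding Z_def u_eq by (rule suminf_minus_initial_segment[OF Z(3)[OF j]])
      finally show "u (Suc n) k j = Z k j + of_real (- l) * V k j" by simp
    qed
    also have "\<dots> \<le> 2 * (T (\<rho> n) Z + T (\<rho> n) (\<lambda>k j. of_real (- l) * V k j))"
      unfolding T_def by (intro wmean_add c growth_scale Z(1) V \<rho>' s)
    also have "T (\<rho> n) (\<lambda>k j. of_real (- l) * V k j) = l * T (\<rho> n) V"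
      unfolding T_def wmean_scale[OF c V(1) \<rho>' s] using l0 by simp
    finally have 1: "T (\<rho> n) (u (Suc n)) \<le> 2 * (T (\<rho> n) Z + l * T (\<rho> n) V)" .
    have TV: "T (\<rho> n) V \<le> nm (\<rho> n)" using V by (intro T_le \<rho>) (simp add: U_def)
    have "0 \<le> T (\<rho> n) V" by (simp add: T_def wmean_nonneg)
    then have "l * T (\<rho> n) V \<le> A n / 16 * nm (\<rho> n)"
      using l_le TV A0[of n] by (intro mult_mono) auto
    then have 2: "16 * (l * T (\<rho> n) V) \<le> A n * nm (\<rho> n)" by simp
    have "A n * (3 / 4 * nm (\<rho> n)) \<le> A n * T (\<rho> n) (x n)" using A0[of n] by (intro mult_left_mono near) auto
    then have 3: "3 * (A n * nm (\<rho> n)) \<le> 4 * (A n * T (\<rho> n) (x n))" by simp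
    have 4: "real n \<le> A n * nm (\<rho> n)" using big[of n] A0[of n] by (simp add: pos_divide_le_eq mult_ac)
    have 5: "2 * (A n * T (\<rho> n) (x n)) \<le> 4 * T (\<rho> n) (u (Suc n))" using hump[of n] by simp
    have 6: "T (\<rho> n) (u (Suc n)) \<le> 2 * T (\<rho> n) Z + 2 * (l * T (\<rho> n) V)" using 1 by simp
    have 7: "T (\<rho> n) Z \<le> K" by (rule K[OF \<rho>])
    \<comment> \<open>The hump is at least 3/8 of A nm, the tail takes away at most 2/16 of it, and
      A nm \<ge> n; hence 2 K \<ge> n / 4.\<close>
    show ?thesis using 2 3 4 5 6 7 by (simp del: mult_le_cancel_left)
  qed
  then show False using reals_Archimedean2[of "8 * K"] by (metis linorder_not_le mult.commute pos_divide_le_eq zero_less_numeral)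
qed

end

section \<open>Characterisation of multipliers\<close>

lemma ennpow_ennreal: "v \<ge> 0 \<Longrightarrow> ennpow (ennreal v) a = ennreal (v powr a)"
  by (simp add: ennpow_def)

lemma ennpow_finite_iff: "ennpow x a < \<infinity> \<longleftrightarrow> x < \<infinity>"
  by (cases "x = \<infinity>") (auto simp: ennpow_def less_top)

lemma SUP_SUP_eq_SUP_Times:
  fixes g :: "'i \<Rightarrow> 'j \<Rightarrow> 'k::complete_lattice"
  shows "(SUP i\<in>A. SUP j\<in>B. g i j) = (SUP z\<in>A \<times> B. g (fst z) (snd z))"
proof (rule antisym)
  show "(SUP i\<in>A. SUP j\<in>B. g i j) \<le> (SUP z\<in>A \<times> B. g (fst z) (snd z))"
  proof (intro SUP_least)
    fix i j assume "i \<in> A" "j \<in> B"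
    then show "g i j \<le> (SUP z\<in>A \<times> B. g (fst z) (snd z))" by (intro SUP_upper2[of "(i, j)"]) auto
  qed
  show "(SUP z\<in>A \<times> B. g (fst z) (snd z)) \<le> (SUP i\<in>A. SUP j\<in>B. g i j)"
  proof (rule SUP_least)
    fix z assume "z \<in> A \<times> B"
    then show "g (fst z) (snd z) \<le> (SUP i\<in>A. SUP j\<in>B. g i j)"
      by (intro SUP_upper2[of "fst z" A] SUP_upper2[of "snd z" B]) auto
  qed
qed

lemma ennpow_le_iff:
  assumes "q > 0" "N \<ge> 0"
  shows "ennpow x (1 / q) \<le> ennreal N \<longleftrightarrow> x \<le> ennreal (N powr q)"
proof (cases x)
  case (real v)
  have "v powr (1 / q) \<le> N \<longleftrightarrow> v \<le> N powr q"
  proof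
    assume "v powr (1 / q) \<le> N"
    then have "(v powr (1 / q)) powr q \<le> N powr q" using assms by (intro powr_mono2) auto
    then show "v \<le> N powr q" using assms real by (simp add: powr_powr)
  next
    assume "v \<le> N powr q"
    then have "v powr (1 / q) \<le> (N powr q) powr (1 / q)" using assms real by (intro powr_mono2) auto
    then show "v powr (1 / q) \<le> N" using assms by (simp add: powr_powr)
  qed
  then show ?thesis using real assms by (simp add: ennpow_ennreal ennreal_le_iff)
next
  case top
  then show ?thesis by (simp add: ennpow_def top_unique)
qed

lemma ennreal_mult_le_iff:
  assumes "a > 0" "N \<ge> 0"
  shows "ennreal a * L \<le> ennreal N \<longleftrightarrow> L \<le> ennreal (N / a)"
proof (cases L)
  case (real v)
  then show ?thesis using assms by (simp add: ennreal_mult[symmetric] ennreal_le_iff pos_le_divide_eq mult.commute)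
next
  case top
  then show ?thesis using assms by (simp add: top_unique ennreal_mult_top)
qed

lemma SUP_finite_iff:
  fixes g :: "'i \<Rightarrow> ennreal"
  shows "(SUP i\<in>A. g i) < \<infinity> \<longleftrightarrow> (\<exists>N>0. \<forall>i\<in>A. g i \<le> ennreal N)"
proof
  assume fin: "(SUP i\<in>A. g i) < \<infinity>"
  then obtain v where v: "v \<ge> 0" "(SUP i\<in>A. g i) = ennreal v" by (cases "SUP i\<in>A. g i") auto
  have "g i \<le> ennreal (v + 1)" if "i \<in> A" for i
  proof -
    have "g i \<le> ennreal v" unfolding v(2)[symmetric] using that by (rule SUP_upper)
    also have "\<dots> \<le> ennreal (v + 1)" by (rule ennreal_leI) simp
    finally show ?thesis .
  qed
  then show "\<exists>N>0. \<forall>i\<in>A. g i \<le> ennreal N" using v(1) by (intro exI[of _ "v + 1"]) auto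
next
  assume "\<exists>N>0. \<forall>i\<in>A. g i \<le> ennreal N"
  then obtain N where "\<forall>i\<in>A. g i \<le> ennreal N" by blast
  then have "(SUP i\<in>A. g i) \<le> ennreal N" by (intro SUP_least) auto
  then show "(SUP i\<in>A. g i) < \<infinity>" by (simp add: order_le_less_trans[OF _ ennreal_less_top])
qed

section \<open>Translation between function spaces and coefficient families, and the two
  implications\<close>

context sph_basis
begin

lemma integral_mean_cong:
  assumes "\<And>z. z \<in> ball 0 1 \<Longrightarrow> f z = g z" "0 \<le> r" "r < 1"
  shows "integral_mean \<sigma> q f r = integral_mean \<sigma> q g r"
  unfolding integral_mean_def lq_norm_def
  by (intro arg_cong2[where f = ennpow] refl nn_integral_cong) (use assms in simp)

lemma integral_mean_1:
  assumes "growth a" "0 \<le> r" "r < 1"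
  shows "integral_mean \<sigma> 1 (F a) r = ennreal (M1 a r)"
  unfolding integral_mean_def lq_norm_def
  using nn_M1[OF assms] M1_nonneg[of a r] by (simp add: ennpow_ennreal)

text \<open>The outer root preserves finiteness, and only values inside the ball enter, so any
  family of subexponential growth that represents \<open>f\<close> there may be used.\<close>

lemma B1_space_iff:
  assumes f: "f \<in> harmonic_ball" and a: "growth a" "\<And>z. z \<in> ball 0 1 \<Longrightarrow> f z = F a z"
  shows "f \<in> B1_space \<sigma> p \<alpha> \<longleftrightarrow> Bnorm p \<alpha> a < \<infinity>"
proof -
  have "(\<integral>\<^sup>+r\<in>{0<..<1}. ennpow (integral_mean \<sigma> 1 f r) p *
                 ennreal ((1 - r\<^sup>2) powr (\<alpha> * p - 1) * r ^ (DIM('a) - 1)) \<partial>lborel) = Bnorm p \<alpha> a"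
    unfolding Bnorm_def
  proof (rule nn_integral_cong)
    fix r :: real
    show "ennpow (integral_mean \<sigma> 1 f r) p * ennreal ((1 - r\<^sup>2) powr (\<alpha> * p - 1) * r ^ (DIM('a) - 1)) * indicator {0<..<1} r
        = ennreal (M1 a r powr p * wt (\<alpha> * p) r) * indicator {0<..<1} r"
    proof (cases "r \<in> {0<..<1}")
      case True
      then have r: "0 \<le> r" "r < 1" by auto
      have "integral_mean \<sigma> 1 f r = ennreal (M1 a r)"
        using integral_mean_cong[OF a(2) r] integral_mean_1[OF a(1) r] by simp
      then show ?thesis using M1_nonneg[of a r] by (simp add: ennpow_ennreal wt_def ennreal_mult')
    qed simp
  qed
  then show ?thesis using f by (simp only: B1_space_def mem_Collect_eq ennpow_finite_iff simp_thms)
qed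

lemma integral_mean_F:
  assumes "growth a" "0 \<le> r" "r < 1" "s \<ge> 1"
  shows "integral_mean \<sigma> s (F a) r = ennreal ((\<integral>x. cmod (F a (r *\<^sub>R x)) powr s \<partial>\<sigma>) powr (1 / s))"
  unfolding integral_mean_def lq_norm_def
  by (subst nn_integral_eq_integral[OF integrable_F_powr[OF assms]]) (auto intro: ennpow_ennreal)

lemma H_space_imp:
  assumes c: "growth c" and a: "growth a" and s: "s \<ge> 1" and H: "F (\<lambda>k j. c k j * a k j) \<in> H_space \<sigma> s \<beta>"
  shows "\<exists>K. \<forall>r\<in>{0..<1}. wmean s \<beta> c r a \<le> K"
proof -
  obtain N where N: "N > 0" "\<And>r. r \<in> {0..<1} \<Longrightarrow> integral_mean \<sigma> s (F (\<lambda>k j. c k j * a k j)) r * ennreal ((1 - r) powr \<beta>) \<le> ennreal N"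
    using H unfolding H_space_def mem_Collect_eq SUP_finite_iff by blast
  have "wmean s \<beta> c r a \<le> N" if r: "r \<in> {0..<1}" for r
  proof -
    have r': "0 \<le> r" "r < 1" using r by auto
    show ?thesis
      using N(2)[OF r] N(1) unfolding integral_mean_F[OF growth_mult[OF c a] r' s] wmean_def
      by (simp add: ennreal_mult'[symmetric])
  qed
  then show ?thesis by blast
qed

lemma H_spaceI:
  assumes a: "growth a" and s: "s \<ge> 1" and K: "K > 0" "\<And>\<rho>. \<rho> \<in> {0..<1} \<Longrightarrow>
      (\<integral>\<^sup>+x. ennreal (cmod (F a (\<rho> *\<^sub>R x)) powr s) \<partial>\<sigma>) \<le> ennreal ((K * (1 - \<rho>) powr (- \<beta>)) powr s)"
  shows "F a \<in> H_space \<sigma> s \<beta>"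
proof -
  have "integral_mean \<sigma> s (F a) r * ennreal ((1 - r) powr \<beta>) \<le> ennreal K" if r: "r \<in> {0..<1}" for r
  proof -
    have "integral_mean \<sigma> s (F a) r \<le> ennreal (K * (1 - r) powr (- \<beta>))"
      unfolding integral_mean_def lq_norm_def using K r s by (subst ennpow_le_iff) auto
    then have "ennreal ((1 - r) powr \<beta>) * integral_mean \<sigma> s (F a) r \<le> ennreal K"
      using K(1) r by (subst ennreal_mult_le_iff) (auto simp: powr_minus divide_inverse)
    then show ?thesis by (simp add: mult.commute)
  qed
  then show ?thesis using F_harmonic[OF a] K(1) by (auto simp: H_space_def SUP_finite_iff[unfolded infinity_ennreal_def])
qed

text \<open>All three operators act diagonally on coefficients, which \<open>coeff_F\<close> reads
  off. The operator acts in the variable y with x fixed; symmetry of the kernel exchanges the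
  two.\<close>

lemma frac_deriv_convolution:
  assumes c: "growth c" and x: "x \<in> S" and y: "y \<in> S"
  shows "frac_deriv Y t (harm_conv Y (F c) (poisson_kernel Y x)) (\<rho> *\<^sub>R y) = kern (frac_mult t c) \<rho> x y"
proof -
  have P: "sph_coeff Y (poisson_kernel Y x) k j = of_real (Y k j x)" if "j \<in> {1..sph_dim TYPE('a) k}" for k j
    unfolding poisson_kernel_def by (rule coeff_F[OF growth_Y[OF x] that])
  have "growth (sph_coeff Y (F c))" "growth (sph_coeff Y (poisson_kernel Y x))"
    unfolding poisson_kernel_def by (intro sph_coeff(1) F_harmonic c growth_Y x)+
  then have "growth (\<lambda>k j. sph_coeff Y (F c) k j * sph_coeff Y (poisson_kernel Y x) k j)" by (rule growth_mult)
  note conv = coeff_F[OF this]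
  have "frac_deriv Y t (harm_conv Y (F c) (poisson_kernel Y x)) (\<rho> *\<^sub>R y) = kern (frac_mult t c) \<rho> y x"
    unfolding frac_deriv_def kern_def
  proof (rule F_cong)
    fix k j assume j: "j \<in> {1..sph_dim TYPE('a) k}"
    show "of_real (Gamma (real k + real DIM('a) / 2 + t) / (Gamma (real k + real DIM('a) / 2) * Gamma t)) *
         sph_coeff Y (harm_conv Y (F c) (poisson_kernel Y x)) k j = frac_mult t c k j * of_real (Y k j x)"
      unfolding harm_conv_def conv[OF j] P[OF j] coeff_F[OF c j] frac_mult_def frac_coeff_def by (simp add: mult_ac)
  qed
  then show ?thesis using kern_sym[OF y x] by simp
qed

text \<open>Both suprema are merged into one over pairs, so that finiteness becomes a single
  constant; weight and s-th root move to the other side, giving the slice bound that Minkowski's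
  inequality takes.\<close>

lemma N_norm_finite_iff:
  assumes c: "growth c" and s: "s \<ge> 1"
  shows "N_norm \<sigma> Y \<alpha> \<beta> m s (F c) < \<infinity> \<longleftrightarrow> (\<exists>N>0. \<forall>\<rho>\<in>{0..<1}. \<forall>y\<in>S.
      (\<integral>\<^sup>+x. ennreal (cmod (kern (frac_mult (m + 1) c) \<rho> x y) powr s) \<partial>\<sigma>) \<le> ennreal ((N * (1 - \<rho>) powr (- (m + 1 - \<alpha> + \<beta>))) powr s))"
proof -
  define e where "e = m + 1 - \<alpha> + \<beta>"
  have lq: "lq_norm \<sigma> s (\<lambda>x. frac_deriv Y (m + 1) (harm_conv Y (F c) (poisson_kernel Y x)) (\<rho> *\<^sub>R y))
      = ennpow (\<integral>\<^sup>+x. ennreal (cmod (kern (frac_mult (m + 1) c) \<rho> x y) powr s) \<partial>\<sigma>) (1 / s)" if "y \<in> S" for \<rho> y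
    unfolding lq_norm_def
    by (intro arg_cong2[where f = ennpow] refl nn_integral_cong) (simp add: frac_deriv_convolution[OF c _ that])
  have iff: "ennreal ((1 - \<rho>) powr e) * ennpow (\<integral>\<^sup>+x. ennreal (cmod (kern (frac_mult (m + 1) c) \<rho> x y) powr s) \<partial>\<sigma>) (1 / s) \<le> ennreal N
      \<longleftrightarrow> (\<integral>\<^sup>+x. ennreal (cmod (kern (frac_mult (m + 1) c) \<rho> x y) powr s) \<partial>\<sigma>) \<le> ennreal ((N * (1 - \<rho>) powr (- e)) powr s)"
    if "\<rho> \<in> {0..<1}" "N > 0" for \<rho> y N
  proof -
    have pos: "(1 - \<rho>) powr e > 0" and eq: "N / (1 - \<rho>) powr e = N * (1 - \<rho>) powr (- e)"
      using that by (auto simp: powr_minus divide_inverse)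
    show ?thesis
      unfolding ennreal_mult_le_iff[OF pos less_imp_le[OF that(2)]] eq using that s by (intro ennpow_le_iff) auto
  qed
  define G where "G z = ennreal ((1 - fst z) powr e) *
        ennpow (\<integral>\<^sup>+x. ennreal (cmod (kern (frac_mult (m + 1) c) (fst z) x (snd z)) powr s) \<partial>\<sigma>) (1 / s)" for z
  have G_le: "G (\<rho>, y) \<le> ennreal N \<longleftrightarrow>
      (\<integral>\<^sup>+x. ennreal (cmod (kern (frac_mult (m + 1) c) \<rho> x y) powr s) \<partial>\<sigma>) \<le> ennreal ((N * (1 - \<rho>) powr (- e)) powr s)"
    if "\<rho> \<in> {0..<1}" "N > 0" for \<rho> y N
    unfolding G_def fst_conv snd_conv by (rule iff[OF that])
  have "N_norm \<sigma> Y \<alpha> \<beta> m s (F c) = (SUP z\<in>{0..<1} \<times> S. G z)"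
    unfolding N_norm_def e_def[symmetric] SUP_SUP_eq_SUP_Times
    by (rule SUP_cong[OF refl]) (auto simp: lq G_def)
  then have "N_norm \<sigma> Y \<alpha> \<beta> m s (F c) < \<infinity> \<longleftrightarrow> (\<exists>N>0. \<forall>z\<in>{0..<1} \<times> S. G z \<le> ennreal N)"
    by (simp only: SUP_finite_iff)
  also have "\<dots> \<longleftrightarrow> (\<exists>N>0. \<forall>\<rho>\<in>{0..<1}. \<forall>y\<in>S. G (\<rho>, y) \<le> ennreal N)"
    by blast
  also have "\<dots> \<longleftrightarrow> (\<exists>N>0. \<forall>\<rho>\<in>{0..<1}. \<forall>y\<in>S.
      (\<integral>\<^sup>+x. ennreal (cmod (kern (frac_mult (m + 1) c) \<rho> x y) powr s) \<partial>\<sigma>) \<le> ennreal ((N * (1 - \<rho>) powr (- e)) powr s))"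
    by (simp only: G_le cong: conj_cong ball_cong)
  finally show ?thesis unfolding e_def .
qed

text \<open>The weight exponent \<alpha> p - 1 exceeds -1, so the weight is integrable up to the
  boundary.\<close>

lemma Bnorm_bounded:
  assumes p: "0 < p" and \<alpha>: "0 < \<alpha>" and D: "\<And>R. 0 < R \<Longrightarrow> R < 1 \<Longrightarrow> M1 a R \<le> D"
  shows "Bnorm p \<alpha> a < \<infinity>"
proof -
  define C where "C = D powr p * max 1 (2 powr (\<alpha> * p - 1))"
  have C0: "C \<ge> 0" by (simp add: C_def)
  have "Bnorm p \<alpha> a \<le> (\<integral>\<^sup>+R. ennreal C * ennreal (indicator {0..1} (1 - R) * (1 - R) powr (\<alpha> * p - 1)) \<partial>lborel)"
    unfolding Bnorm_def
  proof (rule nn_integral_mono)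
    fix R :: real
    show "ennreal (M1 a R powr p * wt (\<alpha> * p) R) * indicator {0<..<1} R \<le> ennreal C * ennreal (indicator {0..1} (1 - R) * (1 - R) powr (\<alpha> * p - 1))"
    proof (cases "R \<in> {0<..<1}")
      case True
      then have R: "0 < R" "R < 1" by auto
      have "wt (\<alpha> * p) R \<le> (max 1 (2 powr (\<alpha> * p - 1)) * (1 - R) powr (\<alpha> * p - 1)) * 1"
        unfolding wt_def using R by (intro mult_mono one_minus_square_powr power_le_one) auto
      moreover have "M1 a R powr p \<le> D powr p" using R p M1_nonneg by (intro powr_mono2 D) auto
      ultimately have "M1 a R powr p * wt (\<alpha> * p) R \<le> D powr p * ((max 1 (2 powr (\<alpha> * p - 1)) * (1 - R) powr (\<alpha> * p - 1)) * 1)"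
        using R by (intro mult_mono wt_nonneg) auto
      then have "ennreal (M1 a R powr p * wt (\<alpha> * p) R) \<le> ennreal (C * (1 - R) powr (\<alpha> * p - 1))"
        by (intro ennreal_leI) (simp add: C_def mult_ac)
      then show ?thesis using True C0 by (simp add: ennreal_mult')
    qed simp
  qed
  also have "\<dots> = ennreal C * ennreal (1 powr (\<alpha> * p) / (\<alpha> * p))"
    using nn_integral_powr_to_1[of "\<alpha> * p" 1] p \<alpha> by (subst nn_integral_cmult) auto
  also have "\<dots> < \<infinity>" using ennreal_mult_less_top by simp
  finally show ?thesis .
qed

lemma Bnorm_scale:
  assumes a: "growth a" and p: "0 < p"
  shows "Bnorm p \<alpha> (\<lambda>k j. e * a k j) = ennreal (cmod e powr p) * Bnorm p \<alpha> a"
proof -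
  have M: "M1 (\<lambda>k j. e * a k j) R = cmod e * M1 a R" if "0 \<le> R" "R < 1" for R
  proof -
    have "M1 (\<lambda>k j. e * a k j) R = (\<integral>x. cmod e * cmod (F a (R *\<^sub>R x)) \<partial>\<sigma>)"
      unfolding M1_def by (rule Bochner_Integration.integral_cong[OF refl]) (simp add: F_scale[OF a that] norm_mult)
    then show ?thesis by (simp add: M1_def)
  qed
  have "Bnorm p \<alpha> (\<lambda>k j. e * a k j) = (\<integral>\<^sup>+R. ennreal (cmod e powr p) * (ennreal (M1 a R powr p * wt (\<alpha> * p) R) * indicator {0<..<1} R) \<partial>lborel)"
    unfolding Bnorm_def
  proof (rule nn_integral_cong)
    fix R :: real
    show "ennreal (M1 (\<lambda>k j. e * a k j) R powr p * wt (\<alpha> * p) R) * indicator {0<..<1} R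
        = ennreal (cmod e powr p) * (ennreal (M1 a R powr p * wt (\<alpha> * p) R) * indicator {0<..<1} R)"
      by (cases "R \<in> {0<..<1}") (auto simp: M powr_mult M1_nonneg ennreal_mult' mult.assoc)
  qed
  also have "\<dots> = ennreal (cmod e powr p) * Bnorm p \<alpha> a"
    unfolding Bnorm_def by (intro nn_integral_cmult) auto
  finally show ?thesis .
qed

text \<open>
  The test function has coefficients that decay so slowly that their reciprocals have subexponential growth,
  yet its expansion converges uniformly on the closed ball.
\<close>
lemma growth_of_multiplier:
  assumes p: "0 < p" and \<alpha>: "0 < \<alpha>" and mult: "c \<in> multipliers Y (B1_space \<sigma> p \<alpha>) (H_space \<sigma> s \<beta>)"
  shows "growth c"
proof -
  define v where "v k = (\<Sum>j\<in>{1..sph_dim TYPE('a) k}. Ysup k j)" for k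
  \<comment> \<open>The factor (k + 1)^2 provides a convergent majorant, and 1 + v k absorbs the sup
    norms of the whole degree k.\<close>
  define W where "W k = (real k + 1) * (real k + 1) * (1 + v k)" for k
  have v0: "v k \<ge> 0" for k unfolding v_def by (intro sum_nonneg Ysup_nonneg)
  have W0: "W k > 0" for k using v0[of k] by (simp add: W_def add_pos_nonneg)
  have "growth (radial v)"
    unfolding growth_def
  proof (intro allI impI)
    fix r :: real assume r: "0 < r" "r < 1"
    obtain C \<rho> where C: "C \<ge> 0" "0 < \<rho>" "\<rho> < 1"
      and le: "\<And>k s. 0 \<le> s \<Longrightarrow> s \<le> r \<Longrightarrow> s ^ k * (\<Sum>j\<in>{1..sph_dim TYPE('a) k}. cmod (of_real (Ysup k j))) \<le> C * \<rho> ^ k"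
      using growth_sum[OF growth_Ysup less_imp_le[OF r(1)] r(2)] by blast
    have "cmod (radial v k j) * r ^ k \<le> C" for k and j :: nat
    proof -
      have "(\<Sum>j\<in>{1..sph_dim TYPE('a) k}. cmod (of_real (Ysup k j))) = v k"
        unfolding v_def by (intro sum.cong) (use Ysup_nonneg in auto)
      then have "r ^ k * v k \<le> C * \<rho> ^ k" using le[of r k] r by simp
      also have "\<dots> \<le> C * 1" using C by (intro mult_left_mono power_le_one) auto
      finally show ?thesis using v0[of k] by (simp add: mult.commute)
    qed
    then show "\<exists>C. \<forall>k. \<forall>j\<in>{1..sph_dim TYPE('a) k}. cmod (radial v k j) * r ^ k \<le> C" by blast
  qed
  then have "growth (\<lambda>k j. radial (\<lambda>k. real k + 1) k j * radial (\<lambda>k. real k + 1) k j * (1 + radial v k j))"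
    by (intro growth_mult growth_add growth_linear growth_const)
  then have gW: "growth (radial W)" by (simp add: W_def)
  define b where "b = radial (\<lambda>k. inverse (W k))"
  have gb: "growth b"
  proof (rule growth_mono[OF growth_const[of 1]])
    fix k j
    have "1 * 1 * 1 \<le> W k" unfolding W_def using v0[of k] by (intro mult_mono) auto
    then show "cmod (b k j) \<le> cmod 1" using W0[of k] by (simp add: b_def inverse_le_1_iff norm_inverse)
  qed
  have sq: "summable (\<lambda>k. 1 / real ((k + 1)\<^sup>2))"
  proof -
    have "summable (\<lambda>k. inverse (real k ^ 2))" by (rule inverse_power_summable) simp
    then have "summable (\<lambda>k. inverse (real (Suc k) ^ 2))" by (subst summable_Suc_iff)
    then show ?thesis by (simp only: inverse_eq_divide of_nat_power Suc_eq_plus1)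
  qed
  define A where "A = (\<Sum>k. 1 / real ((k + 1)\<^sup>2))"
  have Fb: "cmod (F b (R *\<^sub>R x)) \<le> A" if R: "0 < R" "R < 1" and x: "x \<in> S" for R x
    unfolding F_eq_suminf[OF x] A_def
  proof (rule norm_suminf_le[OF _ sq])
    fix k
    have "cmod (of_real (R ^ k) * T b k x) \<le> 1 * (\<Sum>j\<in>{1..sph_dim TYPE('a) k}. cmod (b k j * of_real (Y k j x)))"
      unfolding T_def norm_mult[of "of_real (R ^ k)"] using R
      by (intro mult_mono norm_sum) (auto simp: norm_power power_le_one)
    also have "\<dots> \<le> (\<Sum>j\<in>{1..sph_dim TYPE('a) k}. inverse (W k) * Ysup k j)"
      unfolding mult_1_left using Y_le_Ysup[OF _ x] W0[of k]
      by (intro sum_mono) (auto simp: b_def norm_mult norm_inverse intro!: mult_left_mono)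
    also have "\<dots> = v k / W k" by (simp add: v_def sum_distrib_left[symmetric] divide_inverse mult.commute)
    also have "\<dots> \<le> 1 / real ((k + 1)\<^sup>2)"
    proof -
      have "v k / W k = 1 / real ((k + 1)\<^sup>2) * (v k / (1 + v k))" by (simp add: W_def power2_eq_square algebra_simps)
      also have "\<dots> \<le> 1 / real ((k + 1)\<^sup>2) * 1" using v0[of k] by (intro mult_left_mono) auto
      finally show ?thesis by simp
    qed
    finally show "cmod (of_real (R ^ k) * T b k x) \<le> 1 / real ((k + 1)\<^sup>2)" .
  qed
  have "M1 b R \<le> A * area" if R: "0 < R" "R < 1" for R
  proof -
    have "M1 b R \<le> (\<integral>x. A \<partial>\<sigma>)"
      unfolding M1_def using R by (intro integral_mono integrable_F gb Fb) auto
    then show ?thesis by (simp add: mult.commute)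
  qed
  then have "Bnorm p \<alpha> b < \<infinity>" by (rule Bnorm_bounded[OF p \<alpha>])
  then have "F b \<in> B1_space \<sigma> p \<alpha>" using B1_space_iff[OF F_harmonic[OF gb] gb] by simp
  then have "growth (\<lambda>k j. c k j * sph_coeff Y (F b) k j)"
    using mult by (intro growth_of_harmonic) (auto simp: multipliers_def H_space_def)
  \<comment> \<open>The product of c with the test coefficients 1 / W has growth by the multiplier
    property; multiplication by W, itself of subexponential growth, recovers c.\<close>
  from growth_mult[OF gW this] show ?thesis
  proof (rule growth_mono)
    fix k j assume j: "j \<in> {1..sph_dim TYPE('a) k}"
    show "cmod (c k j) \<le> cmod (radial W k j * (c k j * sph_coeff Y (F b) k j))"
      unfolding coeff_F[OF gb j] using W0[of k]
      by (simp add: b_def norm_mult norm_inverse mult.left_commute[of "W k"])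
  qed
qed

text \<open>With \<rho> = sqrt R, the multiplier applied to the test family dilated by \<rho> and
  evaluated at radius \<rho> is the kernel at radius R. The uniform bound of
  \<open>multiplier_bounded\<close>, rescaled by the size of the test family, is therefore the
  kernel bound.\<close>

lemma kernel_bound_of_multiplier:
  assumes dim: "DIM('a) \<ge> 2" and p: "0 < p" "p \<le> 1" and \<alpha>: "0 < \<alpha>" and t: "\<alpha> < t" and s: "1 \<le> s" and \<beta>: "0 \<le> \<beta>"
    and mult: "c \<in> multipliers Y (B1_space \<sigma> p \<alpha>) (H_space \<sigma> s \<beta>)"
  shows "\<exists>N>0. \<forall>\<rho>\<in>{0..<1}. \<forall>y\<in>S.
      (\<integral>\<^sup>+x. ennreal (cmod (kern (frac_mult t c) \<rho> x y) powr s) \<partial>\<sigma>) \<le> ennreal ((N * (1 - \<rho>) powr (- (t - \<alpha> + \<beta>))) powr s)"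
proof -
  have c: "growth c" by (rule growth_of_multiplier[OF p(1) \<alpha> mult])
  have means: "\<exists>K. \<forall>r\<in>{0..<1}. wmean s \<beta> c r a \<le> K" if a: "growth a" "Bnorm p \<alpha> a < \<infinity>" for a
  proof (rule H_space_imp[OF c a(1) s])
    have "F a \<in> B1_space \<sigma> p \<alpha>" using B1_space_iff[OF F_harmonic[OF a(1)] a(1)] a(2) by simp
    then have "F (\<lambda>k j. c k j * sph_coeff Y (F a) k j) \<in> H_space \<sigma> s \<beta>" using mult by (auto simp: multipliers_def)
    moreover have "F (\<lambda>k j. c k j * sph_coeff Y (F a) k j) = F (\<lambda>k j. c k j * a k j)"
      by (intro ext F_cong) (simp add: coeff_F[OF a(1)])
    ultimately show "F (\<lambda>k j. c k j * a k j) \<in> H_space \<sigma> s \<beta>" by simp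
  qed
  have "\<exists>C. \<forall>a. growth a \<longrightarrow> Bnorm p \<alpha> a \<le> 1 \<longrightarrow> (\<forall>r\<in>{0..<1}. wmean s \<beta> c r a \<le> C)"
    by (rule multiplier_bounded[OF p \<alpha> s c means])
  then obtain C where C: "\<And>a r. growth a \<Longrightarrow> Bnorm p \<alpha> a \<le> 1 \<Longrightarrow> r \<in> {0..<1} \<Longrightarrow> wmean s \<beta> c r a \<le> C"
    by blast
  obtain B where B: "B > 0" "\<And>\<rho> y. \<rho> \<in> {0..<1} \<Longrightarrow> y \<in> S \<Longrightarrow>
     Bnorm p \<alpha> (\<lambda>k j. of_real (\<rho> ^ k) * (radial (frac_coeff t) k j * of_real (Y k j y))) \<le> ennreal (B * (1 - \<rho>) powr ((\<alpha> - t) * p))"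
    using Bnorm_test[OF dim p(1) \<alpha> t] by blast
  define N where "N = max C 1 * B powr (1 / p) * 2 powr (t - \<alpha> + \<beta>)"
  have N0: "N > 0" using B(1) by (simp add: N_def)
  have "(\<integral>\<^sup>+x. ennreal (cmod (kern (frac_mult t c) R x y) powr s) \<partial>\<sigma>) \<le> ennreal ((N * (1 - R) powr (- (t - \<alpha> + \<beta>))) powr s)"
    if R: "R \<in> {0..<1}" and y: "y \<in> S" for R y
  proof -
    define \<rho> where "\<rho> = sqrt R"
    have \<rho>: "0 \<le> \<rho>" "\<rho> < 1" "\<rho> * \<rho> = R" using R by (auto simp: \<rho>_def)
    define a where "a = (\<lambda>k j. of_real (\<rho> ^ k) * (radial (frac_coeff t) k j * of_real (Y k j y)))"
    have "growth (radial (frac_coeff t))" using L1_order_frac[of t] dim t \<alpha> by (simp add: L1_order_def)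
    note gfrac = this
    have ga: "growth a" unfolding a_def using \<rho> by (intro growth_dilation growth_mult gfrac growth_Y y) auto
    \<comment> \<open>\<open>l powr p\<close> equals the bound of \<open>Bnorm_test\<close>, so
      division by l moves the test family into the unit ball.\<close>
    define l where "l = B powr (1 / p) * (1 - \<rho>) powr (\<alpha> - t)"
    have l0: "l > 0" using B(1) \<rho> by (simp add: l_def)
    have l_powr: "l powr p = B * (1 - \<rho>) powr ((\<alpha> - t) * p)"
      using B(1) p \<rho> by (simp add: l_def powr_mult powr_powr)
    have "Bnorm p \<alpha> (\<lambda>k j. of_real (inverse l) * a k j) \<le> ennreal ((inverse l) powr p) * ennreal (l powr p)"
      unfolding Bnorm_scale[OF ga p(1)] l_powr using B(2)[of \<rho> y] \<rho> y l0
      by (intro mult_mono) (auto simp: a_def norm_inverse)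
    also have "\<dots> = ennreal ((inverse l * l) powr p)"
      using l0 by (subst powr_mult) (auto simp: ennreal_mult)
    also have "\<dots> = 1" using l0 by simp
    finally have "wmean s \<beta> c \<rho> (\<lambda>k j. of_real (inverse l) * a k j) \<le> C"
      using \<rho> by (intro C growth_scale ga) auto
    then have "wmean s \<beta> c \<rho> a \<le> C * l"
      unfolding wmean_scale[OF c ga \<rho>(1,2) s] using l0 by (simp add: norm_inverse divide_inverse[symmetric] pos_divide_le_eq mult.commute[of "inverse l"])
    also have "\<dots> \<le> max C 1 * l" using l0 by (intro mult_right_mono) auto
    finally have w: "wmean s \<beta> c \<rho> a \<le> max C 1 * l" .
    have F_eq: "F (\<lambda>k j. c k j * a k j) (\<rho> *\<^sub>R x) = kern (frac_mult t c) R x y" if x: "x \<in> S" for x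
    proof -
      have "(\<lambda>k j. c k j * a k j) = (\<lambda>k j. of_real (\<rho> ^ k) * (frac_mult t c k j * of_real (Y k j y)))"
        by (simp add: a_def frac_mult_def fun_eq_iff mult_ac)
      then show ?thesis unfolding kern_def \<rho>(3)[symmetric] by (simp only: F_dilation[OF x])
    qed
    define I where "I = (\<integral>x. cmod (F (\<lambda>k j. c k j * a k j) (\<rho> *\<^sub>R x)) powr s \<partial>\<sigma>)"
    have I0: "I \<ge> 0" by (simp add: I_def)
    have "I powr (1 / s) * (1 - \<rho>) powr \<beta> \<le> max C 1 * l"
      using w by (simp add: wmean_def I_def)
    then have "I powr (1 / s) \<le> max C 1 * l / (1 - \<rho>) powr \<beta>" using \<rho> by (simp add: pos_le_divide_eq)
    also have "\<dots> = max C 1 * B powr (1 / p) * (1 - \<rho>) powr (- (t - \<alpha> + \<beta>))"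
    proof -
      have "- (t - \<alpha> + \<beta>) = (\<alpha> - t) - \<beta>" by simp
      then show ?thesis by (simp only: l_def powr_diff mult.assoc times_divide_eq_right)
    qed
    also have "\<dots> \<le> max C 1 * B powr (1 / p) * ((1 - R) / 2) powr (- (t - \<alpha> + \<beta>))"
    proof -
      \<comment> \<open>Back from the radius \<rho> to R: 1 - R \<le> 2 (1 - \<rho>), and the
        exponent is negative.\<close>
      have "(1 - \<rho>) * (1 + \<rho>) \<le> (1 - \<rho>) * 2" using \<rho> by (intro mult_left_mono) auto
      then have "1 - \<rho> * \<rho> \<le> (1 - \<rho>) * 2" by (simp add: algebra_simps)
      then have "(1 - R) / 2 \<le> 1 - \<rho>" unfolding \<rho>(3) by simp
      moreover have "- (t - \<alpha> + \<beta>) \<le> 0" "0 < (1 - R) / 2" using t \<beta> R by auto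
      ultimately have "(1 - \<rho>) powr (- (t - \<alpha> + \<beta>)) \<le> ((1 - R) / 2) powr (- (t - \<alpha> + \<beta>))"
        by (intro powr_mono2')
      moreover have "0 \<le> max C 1 * B powr (1 / p)" by (intro mult_nonneg_nonneg) auto
      ultimately show ?thesis by (rule mult_left_mono)
    qed
    also have "\<dots> = N * (1 - R) powr (- (t - \<alpha> + \<beta>))"
    proof -
      have "((1 - R) / 2) powr (- (t - \<alpha> + \<beta>)) = 2 powr (t - \<alpha> + \<beta>) * (1 - R) powr (- (t - \<alpha> + \<beta>))"
        using R unfolding powr_minus by (simp add: powr_divide, simp add: divide_inverse)
      then show ?thesis by (simp only: N_def mult.assoc)
    qed
    finally have "(I powr (1 / s)) powr s \<le> (N * (1 - R) powr (- (t - \<alpha> + \<beta>))) powr s"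
      using s by (intro powr_mono2) auto
    then have "I \<le> (N * (1 - R) powr (- (t - \<alpha> + \<beta>))) powr s" using s I0 by (simp add: powr_powr)
    moreover have "(\<integral>\<^sup>+x. ennreal (cmod (kern (frac_mult t c) R x y) powr s) \<partial>\<sigma>) = ennreal I"
    proof -
      have "(\<integral>\<^sup>+x. ennreal (cmod (kern (frac_mult t c) R x y) powr s) \<partial>\<sigma>)
          = (\<integral>\<^sup>+x. ennreal (cmod (F (\<lambda>k j. c k j * a k j) (\<rho> *\<^sub>R x)) powr s) \<partial>\<sigma>)"
        by (rule nn_integral_cong) (simp add: F_eq)
      also have "\<dots> = ennreal I"
        unfolding I_def by (intro nn_integral_eq_integral integrable_F_powr growth_mult c ga \<rho> s) simp
      finally show ?thesis .
    qed
    ultimately show ?thesis by (simp add: ennreal_leI)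
  qed
  note bound = this
  show ?thesis
  proof (rule exI[of _ N], rule conjI[OF N0], rule ballI, rule ballI)
    fix R y assume "R \<in> {0..<1::real}" "y \<in> S"
    then show "(\<integral>\<^sup>+x. ennreal (cmod (kern (frac_mult t c) R x y) powr s) \<partial>\<sigma>) \<le> ennreal ((N * (1 - R) powr (- (t - \<alpha> + \<beta>))) powr s)"
      by (rule bound)
  qed
qed

text \<open>A member of the domain enters through its coefficients only:
  \<open>Bnorm_finite_imp\<close> reduces p to 1, and \<open>convolution_estimate\<close> bounds the
  image.\<close>

lemma multiplier_of_kernel_bound:
  assumes dim: "DIM('a) \<ge> 2" and p: "0 < p" "p \<le> 1" and \<alpha>: "0 < \<alpha>" and t: "\<alpha> < t" and s: "1 \<le> s" and \<beta>: "0 \<le> \<beta>"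
    and c: "growth c" and N: "N > 0" and kb: "\<And>\<rho> y. \<rho> \<in> {0..<1} \<Longrightarrow> y \<in> S \<Longrightarrow>
      (\<integral>\<^sup>+x. ennreal (cmod (kern (frac_mult t c) \<rho> x y) powr s) \<partial>\<sigma>) \<le> ennreal ((N * (1 - \<rho>) powr (- (t - \<alpha> + \<beta>))) powr s)"
  shows "c \<in> multipliers Y (B1_space \<sigma> p \<alpha>) (H_space \<sigma> s \<beta>)"
  unfolding multipliers_def mem_Collect_eq
proof
  fix f assume f: "f \<in> B1_space \<sigma> p \<alpha>"
  then have fh: "f \<in> harmonic_ball" by (simp add: B1_space_def)
  note b = sph_coeff[OF fh]
  have cb: "growth (\<lambda>k j. c k j * sph_coeff Y f k j)" by (rule growth_mult[OF c b(1)])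
  have "Bnorm p \<alpha> (sph_coeff Y f) < \<infinity>"
    using f B1_space_iff[OF fh b(1) b(3)[symmetric]] by simp
  from convolution_estimate[OF dim \<alpha> \<beta> t s c b(1) N kb Bnorm_finite_imp[OF p \<alpha> b(1) this]]
  obtain K where "K > 0" "\<And>\<rho>. \<rho> \<in> {0..<1} \<Longrightarrow>
      (\<integral>\<^sup>+x. ennreal (cmod (F (\<lambda>k j. c k j * sph_coeff Y f k j) (\<rho> *\<^sub>R x)) powr s) \<partial>\<sigma>) \<le> ennreal ((K * (1 - \<rho>) powr (- \<beta>)) powr s)"
    by blast
  then have "F (\<lambda>k j. c k j * sph_coeff Y f k j) \<in> H_space \<sigma> s \<beta>" by (rule H_spaceI[OF cb s])
  then show "sph_convergent Y (\<lambda>k j. c k j * sph_coeff Y f k j) \<and> F (\<lambda>k j. c k j * sph_coeff Y f k j) \<in> H_space \<sigma> s \<beta>"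
    using growth_convergent[OF cb] by blast
qed

end

theorem theorem4:
  fixes \<sigma> :: "'a::euclidean_space measure"
    and Y :: "nat \<Rightarrow> nat \<Rightarrow> 'a \<Rightarrow> real"
    and c :: "nat \<Rightarrow> nat \<Rightarrow> complex"
    and \<kappa> \<alpha> \<beta> p s m :: real
  assumes "DIM('a) \<ge> 2"
    and "\<kappa> > 0" and "\<sigma> = scale_measure (ennreal \<kappa>) surface_measure"
    and "spherical_harmonic_basis \<sigma> Y"
    and "\<alpha> > 0" and "\<beta> \<ge> 0" and "0 < p" and "p \<le> 1" and "1 \<le> s" and "m > \<alpha> - 1"
  shows "c \<in> multipliers Y (B1_space \<sigma> p \<alpha>) (H_space \<sigma> s \<beta>) \<longleftrightarrow>
         (sph_convergent Y c \<and> sph_series Y c \<in> harmonic_ball \<and>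
          N_norm \<sigma> Y \<alpha> \<beta> m s (sph_series Y c) < \<infinity>)"
proof -
  interpret sph_basis \<sigma> \<kappa> Y
    using assms(2,3,4) by unfold_locales
  have t: "\<alpha> < m + 1" using assms(10) by simp
  show ?thesis
  proof
    assume mult: "c \<in> multipliers Y (B1_space \<sigma> p \<alpha>) (H_space \<sigma> s \<beta>)"
    have c: "growth c" by (rule growth_of_multiplier[OF assms(7,5) mult])
    show "sph_convergent Y c \<and> sph_series Y c \<in> harmonic_ball \<and> N_norm \<sigma> Y \<alpha> \<beta> m s (sph_series Y c) < \<infinity>"
      using growth_convergent[OF c] F_harmonic[OF c] N_norm_finite_iff[OF c assms(9)]
        kernel_bound_of_multiplier[OF assms(1,7,8,5) t assms(9,6) mult] by blast
  next
    assume *: "sph_convergent Y c \<and> sph_series Y c \<in> harmonic_ball \<and> N_norm \<sigma> Y \<alpha> \<beta> m s (sph_series Y c) < \<infinity>"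
    \<comment> \<open>Convergence to a harmonic sum already controls the coefficients, so
      \<open>frac_mult (m + 1) c\<close> defines a convergent kernel and the norm condition can be
      read as a kernel bound.\<close>
    then have c: "growth c" by (intro growth_of_harmonic) auto
    then obtain N where "N > 0" "\<And>\<rho> y. \<rho> \<in> {0..<1} \<Longrightarrow> y \<in> sphere 0 1 \<Longrightarrow>
      (\<integral>\<^sup>+x. ennreal (cmod (kern (frac_mult (m + 1) c) \<rho> x y) powr s) \<partial>\<sigma>) \<le> ennreal ((N * (1 - \<rho>) powr (- (m + 1 - \<alpha> + \<beta>))) powr s)"
      using * N_norm_finite_iff[OF c assms(9)] by blast
    then show "c \<in> multipliers Y (B1_space \<sigma> p \<alpha>) (H_space \<sigma> s \<beta>)"
      by (rule multiplier_of_kernel_bound[OF assms(1,7,8,5) t assms(9,6) c])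
  qed
qed

end
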